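(* Let $w_0>0$, $\ell>1$, $(\phi_0,a_0)\in\mathcal{H}_{w_0}^{\ell+3}\times\mathcal{H}_{w_0}^{\ell+2}$, $(\phi_{10},a_{10})\in\mathcal{H}_{w_0}^{\ell+2}\times\mathcal{H}_{w_0}^{\ell+1}$, and let $(\phi_0^\varepsilon,a_0^\varepsilon)_{\varepsilon\in(0,1]}$ be bounded in $\mathcal{H}_{w_0}^{\ell+1}\times\mathcal{H}_{w_0}^{\ell}$, with $\phi_0,\phi_{10},\phi_0^\varepsilon$ real-valued and $a_0,a_{10},a_0^\varepsilon$ complex-valued, such that $$r_1^\varepsilon:=\|\phi_0^\varepsilon-\phi_0-\varepsilon\phi_{10}\|_{\mathcal{H}_{w_0}^{\ell+1}}+\|a_0^\varepsilon-a_0-\varepsilon a_{10}\|_{\mathcal{H}_{w_0}^{\ell}}=o(\varepsilon)\quad\text{as }\varepsilon\to0.$$ Let $M=M(\ell+2)>0$ be sufficiently large (i.e. $M\ge M_0$ for some $M_0>0$ independent of $\varepsilon$), $w(t)=w_0-Mt$ and $0<T<w_0/M$. Let $(\phi^\varepsilon,a^\varepsilon)\in X_{w,T}^\ell$ be the solution, for $\varepsilon\in(0,1]$, of $$ (\mathrm{S}_\varepsilon)\quad\begin{cases} \partial_t \phi^\varepsilon + \frac12(\partial_x\phi^\varepsilon)^2+\frac12 g(|a^\varepsilon|^2)\partial_x\phi^\varepsilon+f(|a^\varepsilon|^2)=0, & \phi^\varepsilon_{|t=0}=\phi_0^\varepsilon,\\ \partial_t a^\varepsilon+\partial_x\phi^\varepsilon\,\partial_x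 a^\varepsilon+\frac12 a^\varepsilon\partial_x^2\phi^\varepsilon+\frac12\partial_x\big(g(|a^\varepsilon|^2)a^\varepsilon\big)=\frac{i\varepsilon}{2}\partial_x^2a^\varepsilon, & a^\varepsilon_{|t=0}=a_0^\varepsilon, \end{cases} $$ let $(\phi,a)\in X_{w,T}^{\ell+2}$ be the solution of $$ (\mathrm{S}_0)\quad\begin{cases} \partial_t \phi + \frac12(\partial_x\phi)^2+\frac12 g(|a|^2)\partial_x\phi+f(|a|^2)=0, & \phi_{|t=0}=\phi_0,\\ \partial_t a+\partial_x\phi\,\partial_x a+\frac12 a\,\partial_x^2\phi+\frac12\partial_x\big(g(|a|^2)a\big)=0, & a_{|t=0}=a_0, \end{cases} $$ and let $(\phi_1,a_1)\in X_{w,T}^{\ell+1}$ be the solution of the linearized system $$ \begin{cases} \partial_t\phi_1+\Big(\partial_x\phi+\frac12g(|a|^2)\Big)\partial_x\phi_1+\Big(g'(|a|^2)\partial_x\phi+2f'(|a|^2)\Big)\operatorname{Re}(\overline a\,a_1)=0, & \phi_{1|t=0}=\phi_{10},\\ \partial_ta_1+\partial_x\phi\,\partial_xa_1+\frac12a_1\partial_x^2\phi+\partial_xa\,\partial_x\phi_1+\frac12a\,\partial_x^2\phi_1+\frac12\partial_x\big(g(|a|^2)a_1\big)\\ \qquad+\frac12\partial_x\big(2a\,g'(|a|^2)\operatorname{Re}(\overline a\,a_1)\big)=\frac i2\partial_x^2a, & a_{1|t=0}=a_{10}. \end{cases} $$ Then there is an $\varepsilon$-independent $C>0$ such that for all $\varepsilon\in(0,1]$,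 $$|||\phi^\varepsilon-\phi-\varepsilon\phi_1|||_{\ell+1,T}+|||a^\varepsilon-a-\varepsilon a_1|||_{\ell,T}\le C\,(r_1^\varepsilon+\varepsilon^2).$$ In particular, with $u^\varepsilon=a^\varepsilon e^{i\phi^\varepsilon/\varepsilon}$, $$\big\|u^\varepsilon-a\,e^{i\phi_1}e^{i\phi/\varepsilon}\big\|_{L^\infty([0,T];L^2\cap L^\infty(\mathbb{R}))}=\mathcal{O}\Big(\frac{r_1^\varepsilon}{\varepsilon}+\varepsilon\Big)\longrightarrow0\quad\text{as }\varepsilon\to0.$$
   Context: Nonlinearities: $g(s)=\alpha s^\gamma$ and $f(s)=\lambda s^\sigma$, where $\alpha,\lambda\in\mathbb{R}$ and $\gamma,\sigma$ are positive integers, fixed throughout. All systems are posed for $(t,x)\in[0,T]\times\mathbb{R}$. The function $u^\varepsilon=a^\varepsilon e^{i\phi^\varepsilon/\varepsilon}$ solves $i\varepsilon\partial_tu^\varepsilon+\frac{\varepsilon^2}{2}\partial_x^2u^\varepsilon+\frac{i\varepsilon}{2}\partial_x\big(g(|u^\varepsilon|^2)u^\varepsilon\big)-f(|u^\varepsilon|^2)u^\varepsilon=0$ with $u^\varepsilon(0,x)=a_0^\varepsilon(x)e^{i\phi_0^\varepsilon(x)/\varepsilon}$. Fourier transform: $\hat\psi(\xi)=\mathcal{F}\psi(\xi)=\frac{1}{\sqrt{2\pi}}\int_{\mathbb{R}}e^{-ix\xi}\psi(x)\,dx$, and $\langle\xi\rangle=\sqrt{1+\xi^2}$. For $w\ge0$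 and $\ell\ge0$, $\mathcal{H}_w^\ell=\{\psi\in L^2(\mathbb{R}):\|\psi\|_{\mathcal{H}_w^\ell}<\infty\}$ with $\|\psi\|_{\mathcal{H}_w^\ell}^2=\int_{\mathbb{R}}\langle\xi\rangle^{2\ell}e^{2w\langle\xi\rangle}|\hat\psi(\xi)|^2\,d\xi$. For a time-dependent weight $w(t)=w_0-Mt$ with $w_0,M>0$ and $0<T<w_0/M$: $C([0,T],\mathcal{H}_w^\ell)$ is the set of $\psi$ such that $\mathcal{F}^{-1}\big(e^{w(t)\langle\xi\rangle}\hat\psi\big)\in C([0,T],H^\ell(\mathbb{R}))$ (Fourier transform in $x$); $L^2_T\mathcal{H}_w^\ell$ is the set of $\psi$ such that $\int_0^T\|\psi(t)\|_{\mathcal{H}_{w(t)}^\ell}^2dt<\infty$. Set $Y_{w,T}^\ell=C([0,T],\mathcal{H}_w^\ell)\cap L^2_T\mathcal{H}_w^{\ell+1/2}$ and $X_{w,T}^\ell=Y_{w,T}^{\ell+1}\times Y_{w,T}^\ell$. For $0\le t\le T$, $$|||\psi|||_{\ell,t}^2=\max\Big(\sup_{0\le s\le t}\|\psi(s)\|_{\mathcal{H}_{w(s)}^\ell}^2,\ 2M\int_0^t\|\psi(s)\|_{\mathcal{H}_{w(s)}^{\ell+1/2}}^2ds\Big).$$ The constant $M(\ell+2)$ is the (sufficiently large) constant furnished by the local well-posedness theory at regularity $\ell+2$: for $k>1$ and a family of initial data bounded in $\mathcal{H}_{w_0}^{k+1}\times\mathcal{H}_{w_0}^{k}$, the systems $(\mathrm{S}_\varepsilon)$,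 $\varepsilon\in[0,1]$, have unique solutions in $X_{w,T}^k$ when $w(t)=w_0-Mt$, $M=M(k)$ is sufficiently large and $T=T(k)<w_0/M$; $k\mapsto M(k)$ is taken to be increasing. For $M$ sufficiently large the solutions $(\phi^\varepsilon,a^\varepsilon)\in X_{w,T}^\ell$, $(\phi,a)\in X_{w,T}^{\ell+2}$ and $(\phi_1,a_1)\in X_{w,T}^{\ell+1}$ of the claim exist and are unique. *)

theory Defs
  imports "HOL-Analysis.Analysis" "HOL-Library.Landau_Symbols"
    "HOL-Probability.Essential_Supremum"
begin

section \<open>The Fourier transform on \<open>L\<^sup>2(\<real>)\<close>\<close>

definition square_integrable :: "(real \<Rightarrow> complex) \<Rightarrow> bool" where
  "square_integrable \<psi> \<longleftrightarrow>
     \<psi> \<in> borel_measurable lborel \<and> (\<integral>\<^sup>+ x. ennreal ((cmod (\<psi> x))\<^sup>2) \<partial>lborel) < \<infinity>"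

text \<open>
  The Plancherel transform of an \<open>L\<^sup>2\<close> function is the limit in \<open>L\<^sup>2\<close>, as \<open>R\<close> tends to infinity,
  of the absolutely convergent integrals of \<open>exp (- i x \<xi>) \<psi>(x) / sqrt (2 pi)\<close> over \<open>[-R, R]\<close>.
  The sign \<open>s = -1\<close> gives the transform, \<open>s = 1\<close> its inverse.
  The limit is determined only up to null sets; \<open>fourier\<close> and \<open>inv_fourier\<close> choose a
  representative, and are meaningful only on square-integrable arguments.
\<close>

definition is_plancherel_limit :: "real \<Rightarrow> (real \<Rightarrow> complex) \<Rightarrow> (real \<Rightarrow> complex) \<Rightarrow> bool" where
  "is_plancherel_limit s \<psi> h \<longleftrightarrow>
     square_integrable h \<and>
     ((\<lambda>R. \<integral>\<^sup>+ \<xi>. ennreal ((cmod (complex_of_real (1 / sqrt (2 * pi)) *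
              (LINT x:{-R..R}|lborel. exp (\<i> * complex_of_real (s * x * \<xi>)) * \<psi> x) - h \<xi>))\<^sup>2)
            \<partial>lborel) \<longlongrightarrow> 0) at_top"

definition fourier :: "(real \<Rightarrow> complex) \<Rightarrow> real \<Rightarrow> complex" where
  "fourier \<psi> = (SOME h. is_plancherel_limit (-1) \<psi> h)"

definition inv_fourier :: "(real \<Rightarrow> complex) \<Rightarrow> real \<Rightarrow> complex" where
  "inv_fourier \<psi> = (SOME h. is_plancherel_limit 1 \<psi> h)"

section \<open>Analytic function spaces\<close>

definition japanese :: "real \<Rightarrow> real" where
  "japanese \<xi> = sqrt (1 + \<xi>\<^sup>2)"

definition ennsqrt :: "ennreal \<Rightarrow> ennreal" where
  "ennsqrt x = (if x = \<infinity> then \<infinity> else ennreal (sqrt (enn2real x)))"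

definition Hnorm_sq :: "real \<Rightarrow> real \<Rightarrow> (real \<Rightarrow> complex) \<Rightarrow> ennreal" where
  "Hnorm_sq w l \<psi> =
     (\<integral>\<^sup>+ \<xi>. ennreal (japanese \<xi> powr (2 * l) * exp (2 * w * japanese \<xi>) *
                      (cmod (fourier \<psi> \<xi>))\<^sup>2) \<partial>lborel)"

definition Hnorm :: "real \<Rightarrow> real \<Rightarrow> (real \<Rightarrow> complex) \<Rightarrow> ennreal" where
  "Hnorm w l \<psi> = ennsqrt (Hnorm_sq w l \<psi>)"

definition Hspace :: "real \<Rightarrow> real \<Rightarrow> (real \<Rightarrow> complex) set" where
  "Hspace w l = {\<psi>. square_integrable \<psi> \<and> Hnorm w l \<psi> < \<infinity>}"

text \<open>The Sobolev space \<open>H\<^sup>l\<close> is \<open>Hspace 0 l\<close>, with the same norm.\<close>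

definition C_Sobolev :: "real \<Rightarrow> real \<Rightarrow> (real \<Rightarrow> real \<Rightarrow> complex) set" where
  "C_Sobolev T l =
     {v. (\<forall>t\<in>{0..T}. v t \<in> Hspace 0 l) \<and>
         (\<forall>t\<in>{0..T}. ((\<lambda>s. Hnorm 0 l (\<lambda>x. v s x - v t x)) \<longlongrightarrow> 0) (at t within {0..T}))}"

text \<open>
  Membership of \<open>\<psi> t\<close> in \<open>Hspace (w t) l\<close> makes the argument of the inverse transform
  square-integrable.
\<close>

definition C_H :: "(real \<Rightarrow> real) \<Rightarrow> real \<Rightarrow> real \<Rightarrow> (real \<Rightarrow> real \<Rightarrow> complex) set" where
  "C_H w T l =
     {\<psi>. (\<forall>t\<in>{0..T}. \<psi> t \<in> Hspace (w t) l) \<and>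
         (\<lambda>t. inv_fourier (\<lambda>\<xi>. complex_of_real (exp (w t * japanese \<xi>)) * fourier (\<psi> t) \<xi>))
           \<in> C_Sobolev T l}"

definition L2_H :: "(real \<Rightarrow> real) \<Rightarrow> real \<Rightarrow> real \<Rightarrow> (real \<Rightarrow> real \<Rightarrow> complex) set" where
  "L2_H w T l =
     {\<psi>. (AE t in lborel. t \<in> {0..T} \<longrightarrow> square_integrable (\<psi> t)) \<and>
         (\<integral>\<^sup>+ t\<in>{0..T}. Hnorm_sq (w t) l (\<psi> t) \<partial>lborel) < \<infinity>}"

definition Y_space :: "(real \<Rightarrow> real) \<Rightarrow> real \<Rightarrow> real \<Rightarrow> (real \<Rightarrow> real \<Rightarrow> complex) set" where
  "Y_space w T l = C_H w T l \<inter> L2_H w T (l + 1/2)"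

definition X_space ::
  "(real \<Rightarrow> real) \<Rightarrow> real \<Rightarrow> real \<Rightarrow> ((real \<Rightarrow> real \<Rightarrow> complex) \<times> (real \<Rightarrow> real \<Rightarrow> complex)) set" where
  "X_space w T l = Y_space w T (l + 1) \<times> Y_space w T l"

definition triple_norm ::
  "(real \<Rightarrow> real) \<Rightarrow> real \<Rightarrow> real \<Rightarrow> real \<Rightarrow> (real \<Rightarrow> real \<Rightarrow> complex) \<Rightarrow> ennreal" where
  "triple_norm w M l t \<psi> =
     ennsqrt (max (SUP s\<in>{0..t}. Hnorm_sq (w s) l (\<psi> s))
                  (ennreal (2 * M) * (\<integral>\<^sup>+ s\<in>{0..t}. Hnorm_sq (w s) (l + 1/2) (\<psi> s) \<partial>lborel)))"

section \<open>The systems\<close>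

definition Dx :: "(real \<Rightarrow> real \<Rightarrow> 'a::real_normed_vector) \<Rightarrow> real \<Rightarrow> real \<Rightarrow> 'a" where
  "Dx \<psi> t x = vector_derivative (\<psi> t) (at x)"

definition twice_x_differentiable ::
  "real \<Rightarrow> (real \<Rightarrow> real \<Rightarrow> 'a::real_normed_vector) \<Rightarrow> bool" where
  "twice_x_differentiable T \<psi> \<longleftrightarrow>
     (\<forall>t\<in>{0..T}. \<forall>x. \<psi> t differentiable (at x) \<and> Dx \<psi> t differentiable (at x))"

text \<open>
  Elements of the spaces above are defined up to null sets. Since the weights are positive on
  \<open>[0, T]\<close>, they have representatives that are analytic in \<open>x\<close>, and the equations then hold
  pointwise, with one-sided time derivatives at the end points of \<open>[0, T]\<close>. The predicates
  below select these representatives. Only the initial data, which are arbitrary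
  representatives, are attained almost everywhere. The case \<open>\<epsilon> = 0\<close> of \<open>solves_S\<close> is the
  limit system.
\<close>

definition solves_S ::
  "(real \<Rightarrow> real) \<Rightarrow> (real \<Rightarrow> real) \<Rightarrow> real \<Rightarrow> real \<Rightarrow> (real \<Rightarrow> real) \<Rightarrow> (real \<Rightarrow> complex) \<Rightarrow>
   (real \<Rightarrow> real \<Rightarrow> real) \<Rightarrow> (real \<Rightarrow> real \<Rightarrow> complex) \<Rightarrow> bool" where
  "solves_S g f \<epsilon> T \<phi>0 a0 \<phi> a \<longleftrightarrow>
     twice_x_differentiable T \<phi> \<and> twice_x_differentiable T a \<and>
     (AE x in lborel. \<phi> 0 x = \<phi>0 x) \<and> (AE x in lborel. a 0 x = a0 x) \<and>
     (\<forall>t\<in>{0..T}. \<forall>x.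
        ((\<lambda>s. \<phi> s x) has_vector_derivative
           - (1/2 * (Dx \<phi> t x)\<^sup>2 + 1/2 * g ((cmod (a t x))\<^sup>2) * Dx \<phi> t x + f ((cmod (a t x))\<^sup>2)))
          (at t within {0..T}) \<and>
        ((\<lambda>s. a s x) has_vector_derivative
           (\<i> * complex_of_real \<epsilon> / 2 * Dx (Dx a) t x
            - (complex_of_real (Dx \<phi> t x) * Dx a t x
               + 1/2 * a t x * complex_of_real (Dx (Dx \<phi>) t x)
               + 1/2 * Dx (\<lambda>t x. complex_of_real (g ((cmod (a t x))\<^sup>2)) * a t x) t x)))
          (at t within {0..T}))"

definition solves_linearized ::
  "(real \<Rightarrow> real) \<Rightarrow> (real \<Rightarrow> real) \<Rightarrow> real \<Rightarrow> (real \<Rightarrow> real \<Rightarrow> real) \<Rightarrow> (real \<Rightarrow> real \<Rightarrow> complex) \<Rightarrow>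
   (real \<Rightarrow> real) \<Rightarrow> (real \<Rightarrow> complex) \<Rightarrow>
   (real \<Rightarrow> real \<Rightarrow> real) \<Rightarrow> (real \<Rightarrow> real \<Rightarrow> complex) \<Rightarrow> bool" where
  "solves_linearized g f T \<phi> a \<phi>10 a10 \<phi>1 a1 \<longleftrightarrow>
     twice_x_differentiable T \<phi>1 \<and> twice_x_differentiable T a1 \<and>
     (AE x in lborel. \<phi>1 0 x = \<phi>10 x) \<and> (AE x in lborel. a1 0 x = a10 x) \<and>
     (\<forall>t\<in>{0..T}. \<forall>x.
        ((\<lambda>s. \<phi>1 s x) has_vector_derivative
           - ((Dx \<phi> t x + 1/2 * g ((cmod (a t x))\<^sup>2)) * Dx \<phi>1 t x
              + (deriv g ((cmod (a t x))\<^sup>2) * Dx \<phi> t x + 2 * deriv f ((cmod (a t x))\<^sup>2))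
                * Re (cnj (a t x) * a1 t x)))
          (at t within {0..T}) \<and>
        ((\<lambda>s. a1 s x) has_vector_derivative
           (\<i> / 2 * Dx (Dx a) t x
            - (complex_of_real (Dx \<phi> t x) * Dx a1 t x
               + 1/2 * a1 t x * complex_of_real (Dx (Dx \<phi>) t x)
               + Dx a t x * complex_of_real (Dx \<phi>1 t x)
               + 1/2 * a t x * complex_of_real (Dx (Dx \<phi>1) t x)
               + 1/2 * Dx (\<lambda>t x. complex_of_real (g ((cmod (a t x))\<^sup>2)) * a1 t x) t x
               + 1/2 * Dx (\<lambda>t x. 2 * a t x * complex_of_real (deriv g ((cmod (a t x))\<^sup>2)
                                  * Re (cnj (a t x) * a1 t x))) t x)))
          (at t within {0..T}))"

section \<open>The norm of \<open>L\<^sup>\<infinity>([0,T]; L\<^sup>2 \<inter> L\<^sup>\<infinity>)\<close>\<close>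

definition L2_Linf_norm :: "(real \<Rightarrow> complex) \<Rightarrow> ennreal" where
  "L2_Linf_norm v =
     ennsqrt (\<integral>\<^sup>+ x. ennreal ((cmod (v x))\<^sup>2) \<partial>lborel) + esssup lborel (\<lambda>x. ennreal (cmod (v x)))"

definition Linf_L2_Linf_norm :: "real \<Rightarrow> (real \<Rightarrow> real \<Rightarrow> complex) \<Rightarrow> ennreal" where
  "Linf_L2_Linf_norm T v = esssup (restrict_space lborel {0..T}) (\<lambda>t. L2_Linf_norm (v t))"

end

theory Submission
  imports Defs "HOL-Probability.Probability"
begin

text \<open>
  Measured with the weight \<open>exp (w(t) \<langle>\<xi>\<rangle>)\<close>, a solution of \<open>\<partial>\<^sub>t u = i q \<partial>\<^sub>x\<^sup>2 u + P\<close> gains half a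
  derivative in \<open>L\<^sup>2\<close> in time, with factor \<open>2 M\<close>, from the decay of \<open>w\<close>. This gain pays for the
  derivative lost in the transport terms: the triple norm of the solution is at most twice the initial
  norm plus \<open>D / M\<close>, where \<open>D\<close> measures \<open>P\<close> half a derivative lower. Products obey tame
  estimates with constants independent of \<open>w\<close> and \<open>M\<close>. A continuity argument hence bounds \<open>\<phi>\<^sup>\<epsilon>\<close> and
  \<open>a\<^sup>\<epsilon>\<close> uniformly in \<open>\<epsilon>\<close> for large \<open>M\<close>. The first difference, with the bounded source \<open>i \<epsilon> \<partial>\<^sub>x\<^sup>2 a / 2\<close>, is of
  order \<open>r\<^sub>1 + \<epsilon>\<close>; the second difference solves the linearised equations up to a term
  quadratic in the first one and the source \<open>i \<epsilon>\<^sup>2 \<partial>\<^sub>x\<^sup>2 a\<^sub>1 / 2\<close>, and is of order \<open>r\<^sub>1 + \<epsilon>\<^sup>2\<close>. The WKB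
  approximation follows since a phase error \<open>\<delta>\<close> changes \<open>exp (i \<phi> / \<epsilon>)\<close> by at most \<open>\<delta> / \<epsilon>\<close>.
\<close>

section \<open>Fourier integrals and Plancherel's theorem\<close>

text \<open>The order in which constants are chosen shapes the argument. The data bound
  \<open>B\<close> fixes the size \<open>4 * B + 3\<close> allowed to the solutions, this size fixes
  the constants of the nonlinear terms, and these fix the threshold for \<open>M\<close>. Hence
  \<open>M\<close> depends neither on \<epsilon> nor on the solutions, whereas the final
  \<open>C\<close> may depend on \<open>M\<close> and on the solutions of the limit and linearised
  systems. Products are estimated at order \<open>l - 1/2\<close>, where the space is an algebra
  because \<open>l > 1\<close>. The source
  \<open>\<i> \<epsilon> \<partial>\<^sub>x\<^sup>2 a / 2\<close> costs two derivatives, of which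
  the energy estimate returns one; so \<open>a\<close> and \<open>a1\<close> are controlled at order
  \<open>l + 1\<close>, one above the order of the conclusion. Norms are kept squared and
  extended-real. Their triangle inequality carries a factor 2; the resulting factors are absorbed by
  a large \<open>M\<close> or enter \<open>C\<close>. The term quadratic in the first difference is
  harmless only while \<open>r1\<close> is small. As \<epsilon> ranges over all of (0, 1], large
  \<open>r1\<close> is treated separately, by the uniform bounds alone.\<close>

text \<open>For a non-integrable function the Bochner integral is 0 by convention, so the bound is
  then trivial; this spares integrability checks in chains of estimates.\<close>

lemma integral_norm_bound_ennreal':
  fixes f :: "'a \<Rightarrow> complex"
  assumes [measurable]: "f \<in> borel_measurable M"
  shows "ennreal (cmod (integral\<^sup>L M f)) \<le> (\<integral>\<^sup>+ x. ennreal (cmod (f x)) \<partial>M)"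
  by (cases "integrable M f") (auto simp: integral_norm_bound_ennreal not_integrable_integral_eq)

lemma borel_measurable_cnj [measurable (raw)]:
  "f \<in> borel_measurable M \<Longrightarrow> (\<lambda>x. cnj (f x)) \<in> borel_measurable M"
  by (rule measurable_compose[OF _ borel_measurable_continuous_onI]) (auto intro: continuous_intros)

section \<open>Square-integrable functions and the Cauchy-Schwarz inequality\<close>

text \<open>Extended-real, so that it makes sense for every measurable function and finiteness can
  be a conclusion of an estimate.\<close>

definition L2sq :: "(real \<Rightarrow> complex) \<Rightarrow> ennreal" where
  "L2sq f = (\<integral>\<^sup>+ x. ennreal ((cmod (f x))\<^sup>2) \<partial>lborel)"

text \<open>The sign \<open>s\<close> is a parameter: \<open>-1\<close> gives the transform and
  \<open>1\<close> its inverse, so a statement that assumes just \<open>s\<^sup>2 = 1\<close> serves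
  both.\<close>

definition fourier_int :: "real \<Rightarrow> (real \<Rightarrow> complex) \<Rightarrow> real \<Rightarrow> complex" where
  "fourier_int s f \<xi> = complex_of_real (1 / sqrt (2 * pi)) * (LINT x|lborel. iexp (s * x * \<xi>) * f x)"

lemma sqi_iff: "square_integrable f \<longleftrightarrow> f \<in> borel_measurable borel \<and> L2sq f < \<infinity>"
  by (simp add: square_integrable_def L2sq_def)

lemma sqiD [dest]: "square_integrable f \<Longrightarrow> f \<in> borel_measurable borel" "square_integrable f \<Longrightarrow> L2sq f < \<infinity>"
  by (auto simp: sqi_iff)

lemma cmod_add_sq: "(cmod (a + b))\<^sup>2 \<le> 2 * (cmod a)\<^sup>2 + 2 * (cmod b)\<^sup>2"
proof -
  have "(cmod (a + b))\<^sup>2 \<le> (cmod a + cmod b)\<^sup>2"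
    by (intro power_mono norm_triangle_ineq) auto
  also have "\<dots> \<le> 2 * (cmod a)\<^sup>2 + 2 * (cmod b)\<^sup>2"
    using zero_le_power2[of "cmod a - cmod b"] by (simp add: power2_eq_square algebra_simps)
  finally show ?thesis .
qed

lemma L2sq_add:
  assumes [measurable]: "f \<in> borel_measurable borel" "g \<in> borel_measurable borel"
  shows "L2sq (\<lambda>x. f x + g x) \<le> 2 * L2sq f + 2 * L2sq g"
proof -
  have "L2sq (\<lambda>x. f x + g x) \<le> (\<integral>\<^sup>+ x. 2 * ennreal ((cmod (f x))\<^sup>2) + 2 * ennreal ((cmod (g x))\<^sup>2) \<partial>lborel)"
    unfolding L2sq_def
  proof (rule nn_integral_mono)
    fix x
    have "ennreal ((cmod (f x + g x))\<^sup>2) \<le> ennreal (2 * (cmod (f x))\<^sup>2 + 2 * (cmod (g x))\<^sup>2)"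
      by (intro ennreal_leI cmod_add_sq)
    also have "\<dots> = 2 * ennreal ((cmod (f x))\<^sup>2) + 2 * ennreal ((cmod (g x))\<^sup>2)"
      by (simp add: ennreal_plus ennreal_mult)
    finally show "ennreal ((cmod (f x + g x))\<^sup>2) \<le> 2 * ennreal ((cmod (f x))\<^sup>2) + 2 * ennreal ((cmod (g x))\<^sup>2)" .
  qed
  also have "\<dots> = 2 * L2sq f + 2 * L2sq g"
    unfolding L2sq_def by (subst nn_integral_add) (auto simp: nn_integral_cmult)
  finally show ?thesis .
qed

lemma L2sq_cmult:
  assumes [measurable]: "f \<in> borel_measurable borel"
  shows "L2sq (\<lambda>x. c * f x) = ennreal ((cmod c)\<^sup>2) * L2sq f"
  unfolding L2sq_def by (simp add: norm_mult power_mult_distrib ennreal_mult nn_integral_cmult)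

lemma L2sq_uminus: "L2sq (\<lambda>x. - f x) = L2sq f"
  by (simp add: L2sq_def)

lemma L2sq_diff_commute: "L2sq (\<lambda>x. f x - g x) = L2sq (\<lambda>x. g x - f x)"
  by (simp add: L2sq_def norm_minus_commute)

lemma L2sq_diff:
  assumes [measurable]: "f \<in> borel_measurable borel" "g \<in> borel_measurable borel"
  shows "L2sq (\<lambda>x. f x - g x) \<le> 2 * L2sq f + 2 * L2sq g"
  using L2sq_add[of f "\<lambda>x. - g x"] by (simp add: L2sq_uminus)

lemma sqi_cmult: "square_integrable f \<Longrightarrow> square_integrable (\<lambda>x. c * f x)"
  by (auto simp: sqi_iff ennreal_mult_less_top L2sq_cmult)

lemma sqi_diff: "square_integrable f \<Longrightarrow> square_integrable g \<Longrightarrow> square_integrable (\<lambda>x. f x - g x)"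
  using L2sq_diff[of f g] by (auto simp: sqi_iff ennreal_mult_less_top elim!: order.strict_trans1)

lemma L2sq_cong_AE: "AE x in lborel. f x = g x \<Longrightarrow> L2sq f = L2sq g"
  unfolding L2sq_def by (rule nn_integral_cong_AE) auto

lemma L2sq_mono: "(\<And>x. cmod (f x) \<le> cmod (g x)) \<Longrightarrow> L2sq f \<le> L2sq g"
  unfolding L2sq_def by (intro nn_integral_mono ennreal_leI power_mono) auto

lemma sqi_mult_integrable:
  assumes f: "square_integrable f" and g: "square_integrable g"
  shows "integrable lborel (\<lambda>x. f x * g x)"
proof -
  have [measurable]: "f \<in> borel_measurable borel" "g \<in> borel_measurable borel" using f g by auto
  have "(\<integral>\<^sup>+x. ennreal (cmod (f x)) * ennreal (cmod (g x)) \<partial>lborel)\<^sup>2 \<le> L2sq f * L2sq g"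
    using Cauchy_Schwarz_nn_integral[of "\<lambda>x. ennreal (cmod (f x))" lborel "\<lambda>x. ennreal (cmod (g x))"]
    by (simp add: L2sq_def ennreal_power)
  also have "\<dots> < \<infinity>" using f g by (auto simp: sqi_iff ennreal_mult_less_top)
  finally have "(\<integral>\<^sup>+x. ennreal (cmod (f x)) * ennreal (cmod (g x)) \<partial>lborel) < \<infinity>"
    by (auto simp: power_less_top_ennreal)
  then show ?thesis
    by (intro integrableI_bounded) (auto simp: norm_mult ennreal_mult)
qed

lemma sqi_Cauchy_Schwarz:
  assumes f: "square_integrable f" and g: "square_integrable g"
  shows "ennreal ((cmod (LINT x|lborel. f x * g x))\<^sup>2) \<le> L2sq f * L2sq g"
proof -
  have [measurable]: "f \<in> borel_measurable borel" "g \<in> borel_measurable borel" using f g by auto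
  have "ennreal (cmod (LINT x|lborel. f x * g x)) \<le> (\<integral>\<^sup>+x. ennreal (cmod (f x * g x)) \<partial>lborel)"
    by (rule integral_norm_bound_ennreal[OF sqi_mult_integrable[OF f g]])
  then have "ennreal (cmod (LINT x|lborel. f x * g x))^2 \<le> (\<integral>\<^sup>+x. ennreal (cmod (f x)) * ennreal (cmod (g x)) \<partial>lborel)^2"
    by (intro power_mono) (auto simp: norm_mult ennreal_mult)
  also have "\<dots> \<le> L2sq f * L2sq g"
    using Cauchy_Schwarz_nn_integral[of "\<lambda>x. ennreal (cmod (f x))" lborel "\<lambda>x. ennreal (cmod (g x))"]
    by (simp add: L2sq_def ennreal_power)
  finally show ?thesis by (simp add: ennreal_power)
qed

section \<open>Fourier integrals of integrable functions\<close>

lemma fourier_int_measurable [measurable]: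
  assumes [measurable]: "f \<in> borel_measurable borel"
  shows "fourier_int s f \<in> borel_measurable borel"
  unfolding fourier_int_def by measurable

lemma iexp_integrable [simp]:
  assumes "integrable lborel f" and [measurable]: "p \<in> borel_measurable borel"
  shows "integrable lborel (\<lambda>x. iexp (p x) * f x)"
proof -
  have [measurable]: "f \<in> borel_measurable borel" using assms by auto
  show ?thesis
    by (rule Bochner_Integration.integrable_bound[OF assms(1)]) (auto simp: norm_mult)
qed

lemma fourier_int_bound:
  assumes "integrable lborel f"
  shows "cmod (fourier_int s f \<xi>) \<le> 1 / sqrt (2 * pi) * (LINT x|lborel. cmod (f x))"
proof -
  have "cmod (LINT x|lborel. iexp (s * x * \<xi>) * f x) \<le> (LINT x|lborel. cmod (iexp (s * x * \<xi>) * f x))"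
    by (rule integral_norm_bound)
  also have "\<dots> = (LINT x|lborel. cmod (f x))" by (simp add: norm_mult)
  finally show ?thesis by (simp add: fourier_int_def norm_mult norm_divide divide_right_mono del: of_real_mult)
qed

lemma fourier_int_add:
  assumes "integrable lborel f" "integrable lborel g"
  shows "fourier_int s (\<lambda>x. f x + g x) \<xi> = fourier_int s f \<xi> + fourier_int s g \<xi>"
  using assms by (simp add: fourier_int_def ring_distribs add_divide_distrib del: of_real_mult)

lemma fourier_int_diff:
  assumes "integrable lborel f" "integrable lborel g"
  shows "fourier_int s (\<lambda>x. f x - g x) \<xi> = fourier_int s f \<xi> - fourier_int s g \<xi>"
  using assms by (simp add: fourier_int_def ring_distribs diff_divide_distrib del: of_real_mult)

lemma fourier_int_cmult: "fourier_int s (\<lambda>x. c * f x) \<xi> = c * fourier_int s f \<xi>"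
  by (simp add: fourier_int_def mult.left_commute[of _ c])

lemma fourier_int_cong_AE:
  assumes "AE x in lborel. f x = g x" and [measurable]: "f \<in> borel_measurable borel" "g \<in> borel_measurable borel"
  shows "fourier_int s f = fourier_int s g"
  unfolding fourier_int_def by (intro ext arg_cong2[where f="(*)"] refl integral_cong_AE) (use assms(1) in auto)

text \<open>The kernel \<open>iexp (s * x * \<xi>)\<close> is symmetric in its two variables, so
  both sides are the same double integral and Fubini applies.\<close>

lemma fourier_int_duality:
  assumes f: "integrable lborel f" and k: "integrable lborel k"
  shows "(LINT \<xi>|lborel. fourier_int s f \<xi> * k \<xi>) = (LINT x|lborel. f x * fourier_int s k x)"
proof -
  have [measurable]: "f \<in> borel_measurable borel" "k \<in> borel_measurable borel" using f k by auto
  have fk: "integrable (lborel \<Otimes>\<^sub>M lborel) (\<lambda>(x, y). f x * k y)"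
  proof (rule integrableI_bounded)
    have "(\<integral>\<^sup>+ z. ennreal (norm (case z of (x, y) \<Rightarrow> f x * k y)) \<partial>(lborel \<Otimes>\<^sub>M lborel)) =
        (\<integral>\<^sup>+ x. ennreal (norm (f x)) * (\<integral>\<^sup>+ y. ennreal (norm (k y)) \<partial>lborel) \<partial>lborel)"
      by (subst lborel.nn_integral_fst[symmetric]) (auto simp: norm_mult ennreal_mult nn_integral_cmult)
    also have "\<dots> < \<infinity>"
      using f k by (auto simp: nn_integral_multc integrable_iff_bounded ennreal_mult_less_top)
    finally show "(\<integral>\<^sup>+ z. ennreal (norm (case z of (x, y) \<Rightarrow> f x * k y)) \<partial>(lborel \<Otimes>\<^sub>M lborel)) < \<infinity>" .
  qed measurable
  have I: "integrable (lborel \<Otimes>\<^sub>M lborel) (\<lambda>(x, y). iexp (s * x * y) * f x * k y)"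
    by (rule Bochner_Integration.integrable_bound[OF fk]) (auto simp: norm_mult split_beta')
  have F: "(LINT y|lborel. (LINT x|lborel. iexp (s * x * y) * f x * k y)) = (LINT x|lborel. (LINT y|lborel. iexp (s * x * y) * f x * k y))"
    by (rule lborel_pair.Fubini_integral[OF I])
  let ?c = "complex_of_real (1 / sqrt (2 * pi))"
  have "(LINT y|lborel. fourier_int s f y * k y) = (LINT y|lborel. ?c * (LINT x|lborel. iexp (s * x * y) * f x * k y))"
    unfolding fourier_int_def integral_mult_left_zero by (simp only: mult.assoc)
  also have "\<dots> = ?c * (LINT x|lborel. (LINT y|lborel. iexp (s * x * y) * f x * k y))"
    by (simp only: integral_mult_right_zero F)
  also have "\<dots> = (LINT x|lborel. f x * (?c * (LINT y|lborel. iexp (s * y * x) * k y)))"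
    unfolding integral_mult_right_zero[symmetric]
    by (intro Bochner_Integration.integral_cong refl) (simp add: mult_ac del: integral_mult_right_zero integral_mult_left_zero)
  finally show ?thesis by (simp only: fourier_int_def)
qed

section \<open>Gaussian wave packets and Bessel's inequality\<close>

text \<open>A Gaussian centred at \<open>q\<close> and modulated with frequency \<open>p\<close>. Up
  to a constant phase the family is mapped to itself by the Fourier transform, and it is rich enough
  to test equality of square-integrable functions.\<close>

definition wave_packet :: "real \<Rightarrow> real \<Rightarrow> real \<Rightarrow> complex" where
  "wave_packet p q x = iexp (p * x) * complex_of_real (exp (- ((x - q)\<^sup>2 / 2)))"

lemma gauss_nn: "(\<integral>\<^sup>+ x. ennreal (exp (- (x\<^sup>2 / 2))) \<partial>lborel) = ennreal (sqrt (2 * pi))"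
proof -
  have "(\<integral>\<^sup>+ x. ennreal (std_normal_density x) \<partial>lborel) = 1"
    using nn_integral_eq_integral[OF integrable_normal_density[of 1 0]]
    by (simp add: normal_density_nonneg integral_normal_density)
  moreover have "ennreal (exp (- (x\<^sup>2 / 2))) = ennreal (sqrt (2 * pi)) * ennreal (std_normal_density x)" for x
    by (subst ennreal_mult[symmetric]) (auto simp: std_normal_density_def)
  ultimately show ?thesis by (simp add: nn_integral_cmult)
qed

text \<open>Read off from the characteristic function of the standard normal distribution.\<close>

lemma gauss_integral:
  "(LINT x|lborel. iexp (t * x) * complex_of_real (exp (- (x\<^sup>2 / 2)))) = complex_of_real (sqrt (2 * pi) * exp (- (t\<^sup>2 / 2)))"
proof -
  have "complex_of_real (exp (- (t\<^sup>2 / 2))) = char std_normal_distribution t"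
    by (simp add: char_std_normal_distribution)
  also have "\<dots> = (LINT x|lborel. std_normal_density x *\<^sub>R iexp (t * x))"
    unfolding char_def by (subst integral_density) (auto simp: normal_density_nonneg)
  also have "\<dots> = (LINT x|lborel. complex_of_real (1 / sqrt (2 * pi)) * (iexp (t * x) * complex_of_real (exp (- (x\<^sup>2 / 2)))))"
    by (intro Bochner_Integration.integral_cong) (auto simp: std_normal_density_def scaleR_conv_of_real)
  finally have "complex_of_real (sqrt (2 * pi) * exp (- (t\<^sup>2 / 2))) = complex_of_real (sqrt (2 * pi)) *
     (complex_of_real (1 / sqrt (2 * pi)) * (LINT x|lborel. iexp (t * x) * complex_of_real (exp (- (x\<^sup>2 / 2)))))"
    by simp
  then show ?thesis by (simp add: mult.assoc[symmetric] of_real_mult[symmetric] del: of_real_mult)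
qed

lemma wave_packet_measurable [measurable]: "wave_packet p q \<in> borel_measurable borel"
  unfolding wave_packet_def by measurable

lemma cmod_wave_packet: "cmod (wave_packet p q x) = exp (- ((x - q)\<^sup>2 / 2))"
  by (simp add: wave_packet_def norm_mult)

lemma wave_packet_integrable: "integrable lborel (wave_packet p q)"
proof (rule integrableI_bounded)
  have "(\<integral>\<^sup>+ x. ennreal (norm (wave_packet p q x)) \<partial>lborel) = (\<integral>\<^sup>+ x. ennreal (exp (- ((x - q)\<^sup>2 / 2))) \<partial>lborel)"
    by (simp add: cmod_wave_packet)
  also have "\<dots> = ennreal (sqrt (2 * pi))"
    by (subst nn_integral_real_affine[where c=1 and t=q]) (auto simp: gauss_nn)
  finally show "(\<integral>\<^sup>+ x. ennreal (norm (wave_packet p q x)) \<partial>lborel) < \<infinity>" by simp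
qed measurable

lemma wave_packet_sqi: "square_integrable (wave_packet p q)"
proof -
  have "L2sq (wave_packet p q) \<le> (\<integral>\<^sup>+ x. ennreal (norm (wave_packet p q x)) \<partial>lborel)"
    unfolding L2sq_def
    by (intro nn_integral_mono ennreal_leI) (auto simp: cmod_wave_packet power2_eq_square intro!: mult_left_le)
  also have "\<dots> < \<infinity>" using wave_packet_integrable[of p q] by (auto simp: integrable_iff_bounded)
  finally show ?thesis by (simp add: sqi_iff)
qed

lemma fourier_int_wave_packet: "fourier_int s (wave_packet p q) \<xi> = iexp ((s * \<xi> + p) * q) * complex_of_real (exp (- ((s * \<xi> + p)\<^sup>2 / 2)))"
proof -
  have "(LINT x|lborel. iexp (s * x * \<xi>) * wave_packet p q x) =
      (LINT x|lborel. iexp ((s * \<xi> + p) * x) * complex_of_real (exp (- ((x - q)\<^sup>2 / 2))))"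
    unfolding wave_packet_def by (intro Bochner_Integration.integral_cong) (auto simp: exp_add[symmetric] algebra_simps)
  also have "\<dots> = (LINT x|lborel. iexp ((s * \<xi> + p) * q) * (iexp ((s * \<xi> + p) * x) * complex_of_real (exp (- (x\<^sup>2 / 2)))))"
    by (subst lborel_integral_real_affine[where c=1 and t=q])
       (auto intro!: Bochner_Integration.integral_cong simp: exp_add[symmetric] algebra_simps)
  also have "\<dots> = iexp ((s * \<xi> + p) * q) * complex_of_real (sqrt (2 * pi) * exp (- ((s * \<xi> + p)\<^sup>2 / 2)))"
    by (simp only: integral_mult_right_zero gauss_integral)
  finally show ?thesis by (simp add: fourier_int_def of_real_mult)
qed

lemma fourier_int_cnj: "cnj (fourier_int s f \<xi>) = fourier_int (-s) (\<lambda>x. cnj (f x)) \<xi>"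
proof -
  have "cnj (LINT x|lborel. iexp (s * x * \<xi>) * f x) = (LINT x|lborel. cnj (iexp (s * x * \<xi>) * f x))"
    by (rule Bochner_Integration.integral_cnj[symmetric])
  also have "\<dots> = (LINT x|lborel. iexp (- s * x * \<xi>) * cnj (f x))"
    by (simp add: exp_cnj)
  finally show ?thesis by (simp add: fourier_int_def)
qed

lemma gauss_kernel_nn:
  assumes "\<delta> > 0"
  shows "(\<integral>\<^sup>+ y. ennreal (1 / \<delta> * exp (- (((x - y) / \<delta>)\<^sup>2 / 2))) \<partial>lborel) = ennreal (sqrt (2 * pi))"
proof -
  have "(\<integral>\<^sup>+ y. ennreal (1 / \<delta> * exp (- (((x - y) / \<delta>)\<^sup>2 / 2))) \<partial>lborel)
      = \<bar>\<delta>\<bar> * (\<integral>\<^sup>+ z. ennreal (1 / \<delta> * exp (- (((x - (x + \<delta> * z)) / \<delta>)\<^sup>2 / 2))) \<partial>lborel)"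
    by (rule nn_integral_real_affine) (use assms in auto)
  also have "(\<lambda>z. ennreal (1 / \<delta> * exp (- (((x - (x + \<delta> * z)) / \<delta>)\<^sup>2 / 2)))) = (\<lambda>z. ennreal (1 / \<delta>) * ennreal (exp (- (z\<^sup>2 / 2))))"
    using assms by (intro ext, subst ennreal_mult[symmetric]) auto
  also have "\<bar>\<delta>\<bar> * (\<integral>\<^sup>+ z. ennreal (1 / \<delta>) * ennreal (exp (- (z\<^sup>2 / 2))) \<partial>lborel) = ennreal (sqrt (2 * pi))"
    using assms by (subst nn_integral_cmult) (auto simp: gauss_nn mult.assoc[symmetric] ennreal_mult[symmetric])
  finally show ?thesis .
qed

text \<open>Rescaling reduces this to \<open>gauss_integral\<close>. The outcome is the kernel
  \<open>K\<close> of the quadratic form in \<open>Bessel_gauss\<close>, an approximate identity of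
  width \<delta>.\<close>

lemma gauss_kernel_fourier_int:
  assumes d: "\<delta> > 0" and s: "s\<^sup>2 = 1"
  shows "fourier_int (-s) (\<lambda>\<xi>. iexp (s * x * \<xi>) * complex_of_real (exp (- ((\<delta> * \<xi>)\<^sup>2 / 2)))) y =
    complex_of_real (1 / \<delta> * exp (- (((x - y) / \<delta>)\<^sup>2 / 2)))"
proof -
  have "(LINT \<xi>|lborel. iexp (- s * \<xi> * y) * (iexp (s * x * \<xi>) * complex_of_real (exp (- ((\<delta> * \<xi>)\<^sup>2 / 2)))))
    = \<bar>1/\<delta>\<bar> *\<^sub>R (LINT \<xi>|lborel. iexp (- s * (0 + 1/\<delta> * \<xi>) * y) * (iexp (s * x * (0 + 1/\<delta> * \<xi>)) * complex_of_real (exp (- ((\<delta> * (0 + 1/\<delta> * \<xi>))\<^sup>2 / 2)))))"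
    by (rule lborel_integral_real_affine) (use d in auto)
  also have "\<dots> = \<bar>1/\<delta>\<bar> *\<^sub>R (LINT \<xi>|lborel. iexp ((s * (x - y) / \<delta>) * \<xi>) * complex_of_real (exp (- (\<xi>\<^sup>2 / 2))))"
  proof (intro arg_cong2[where f="(*\<^sub>R)"] refl Bochner_Integration.integral_cong)
    fix \<xi>
    have "iexp (- s * (0 + 1/\<delta> * \<xi>) * y) * iexp (s * x * (0 + 1/\<delta> * \<xi>)) = iexp ((s * (x - y) / \<delta>) * \<xi>)"
      by (simp add: exp_add[symmetric] algebra_simps diff_divide_distrib)
    then show "iexp (- s * (0 + 1/\<delta> * \<xi>) * y) * (iexp (s * x * (0 + 1/\<delta> * \<xi>)) * complex_of_real (exp (- ((\<delta> * (0 + 1/\<delta> * \<xi>))\<^sup>2 / 2))))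
       = iexp ((s * (x - y) / \<delta>) * \<xi>) * complex_of_real (exp (- (\<xi>\<^sup>2 / 2)))"
      using d by (simp add: mult.assoc[symmetric])
  qed
  also have "\<dots> = complex_of_real (1/\<delta> * (sqrt (2 * pi) * exp (- ((s * (x - y) / \<delta>)\<^sup>2 / 2))))"
    unfolding gauss_integral using d by (simp add: scaleR_conv_of_real)
  also have "(s * (x - y) / \<delta>)\<^sup>2 = ((x - y) / \<delta>)\<^sup>2"
    using s by (simp add: power_mult_distrib power_divide)
  finally show ?thesis
    unfolding fourier_int_def by simp
qed

lemma gauss_integrable:
  assumes "\<delta> > 0"
  shows "integrable lborel (\<lambda>\<xi>. complex_of_real (exp (- ((\<delta> * \<xi>)\<^sup>2 / 2))))"
proof -
  have "integrable lborel (\<lambda>\<xi>. wave_packet 0 0 (0 + \<delta> * \<xi>))"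
    by (rule lborel_integrable_real_affine[OF wave_packet_integrable]) (use assms in auto)
  then show ?thesis by (simp add: wave_packet_def)
qed

text \<open>
  Fubini turns the damped energy into a quadratic form with Gaussian kernel \<open>K\<close>; then
  \<open>2 \<bar>f x f y\<bar> \<le> \<bar>f x\<bar>\<^sup>2 + \<bar>f y\<bar>\<^sup>2\<close> and \<open>\<integral> K x y dy = sqrt (2 pi)\<close> finish the estimate.
\<close>

lemma Bessel_gauss:
  assumes f: "integrable lborel f" and d: "\<delta> > 0" and s: "s\<^sup>2 = 1"
  shows "(\<integral>\<^sup>+ \<xi>. ennreal ((cmod (fourier_int s f \<xi>))\<^sup>2 * exp (- ((\<delta> * \<xi>)\<^sup>2 / 2))) \<partial>lborel) \<le> L2sq f"
proof -
  have [measurable]: "f \<in> borel_measurable borel" using f by auto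
  define G where "G \<xi> = complex_of_real (exp (- ((\<delta> * \<xi>)\<^sup>2 / 2)))" for \<xi>
  have [measurable]: "G \<in> borel_measurable borel" unfolding G_def by measurable
  have G: "integrable lborel G" unfolding G_def by (rule gauss_integrable[OF d])
  define K where "K x y = 1 / \<delta> * exp (- (((x - y) / \<delta>)\<^sup>2 / 2))" for x y
  have [measurable]: "case_prod K \<in> borel_measurable (borel \<Otimes>\<^sub>M borel)" unfolding K_def by measurable
  have K0: "K x y \<ge> 0" for x y using d by (simp add: K_def)
  \<comment> \<open>With this \<open>k\<close>, the product \<open>fourier_int s f * k\<close> is
    the damped energy density, while by duality the transform of \<open>k\<close> is an integral of
    \<open>cnj f\<close> against a Gaussian.\<close>
  define k where "k \<xi> = G \<xi> * cnj (fourier_int s f \<xi>)" for \<xi>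
  have k: "integrable lborel k"
  proof (rule Bochner_Integration.integrable_bound)
    show "integrable lborel (\<lambda>\<xi>. complex_of_real (1 / sqrt (2 * pi) * (LINT x|lborel. cmod (f x))) * G \<xi>)"
      using G by simp
    show "AE \<xi> in lborel. norm (k \<xi>) \<le> norm (complex_of_real (1 / sqrt (2 * pi) * (LINT x|lborel. cmod (f x))) * G \<xi>)"
    proof (intro AE_I2)
      fix \<xi>
      have "cmod (fourier_int s f \<xi>) \<le> \<bar>1 / sqrt (2 * pi) * (LINT x|lborel. cmod (f x))\<bar>"
        using fourier_int_bound[OF f, of s \<xi>] by linarith
      then have "cmod (G \<xi>) * cmod (fourier_int s f \<xi>) \<le> cmod (G \<xi>) * \<bar>1 / sqrt (2 * pi) * (LINT x|lborel. cmod (f x))\<bar>"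
        by (rule mult_left_mono) simp
      then show "norm (k \<xi>) \<le> norm (complex_of_real (1 / sqrt (2 * pi) * (LINT x|lborel. cmod (f x))) * G \<xi>)"
        by (simp only: k_def norm_mult norm_of_real complex_mod_cnj mult.commute)
    qed
  qed (unfold k_def, measurable)
  have FIk: "fourier_int s k x = complex_of_real (1 / sqrt (2 * pi)) * (LINT y|lborel. cnj (f y) * complex_of_real (K x y))" for x
  proof -
    have i: "integrable lborel (\<lambda>\<xi>. iexp (s * x * \<xi>) * G \<xi>)" using G by (intro iexp_integrable) auto
    have "(LINT \<xi>|lborel. iexp (s * \<xi> * x) * k \<xi>) = (LINT \<xi>|lborel. fourier_int (-s) (\<lambda>x. cnj (f x)) \<xi> * (iexp (s * x * \<xi>) * G \<xi>))"
      by (intro Bochner_Integration.integral_cong) (auto simp: k_def fourier_int_cnj mult_ac)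
    also have "\<dots> = (LINT y|lborel. cnj (f y) * fourier_int (-s) (\<lambda>\<xi>. iexp (s * x * \<xi>) * G \<xi>) y)"
      by (rule fourier_int_duality[OF _ i]) (use f in auto)
    also have "\<dots> = (LINT y|lborel. cnj (f y) * complex_of_real (K x y))"
      unfolding G_def gauss_kernel_fourier_int[OF d s] K_def ..
    finally show ?thesis by (simp only: fourier_int_def)
  qed
  have Fk: "fourier_int s f \<xi> * k \<xi> = complex_of_real ((cmod (fourier_int s f \<xi>))\<^sup>2 * exp (- ((\<delta> * \<xi>)\<^sup>2 / 2)))" for \<xi>
    unfolding k_def G_def of_real_mult complex_norm_square by (simp only: mult_ac)
  have Fki: "integrable lborel (\<lambda>\<xi>. fourier_int s f \<xi> * k \<xi>)"
  proof (rule Bochner_Integration.integrable_bound)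
    show "integrable lborel (\<lambda>\<xi>. complex_of_real (1 / sqrt (2 * pi) * (LINT x|lborel. cmod (f x))) * k \<xi>)"
      using k by simp
    show "AE \<xi> in lborel. norm (fourier_int s f \<xi> * k \<xi>) \<le> norm (complex_of_real (1 / sqrt (2 * pi) * (LINT x|lborel. cmod (f x))) * k \<xi>)"
    proof (intro AE_I2)
      fix \<xi>
      have "cmod (fourier_int s f \<xi>) \<le> \<bar>1 / sqrt (2 * pi) * (LINT x|lborel. cmod (f x))\<bar>"
        using fourier_int_bound[OF f, of s \<xi>] by linarith
      then show "norm (fourier_int s f \<xi> * k \<xi>) \<le> norm (complex_of_real (1 / sqrt (2 * pi) * (LINT x|lborel. cmod (f x))) * k \<xi>)"
        by (simp only: norm_mult norm_of_real mult_right_mono norm_ge_zero)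
    qed
  qed (auto simp: k_def)
  have Fki': "integrable lborel (\<lambda>\<xi>. (cmod (fourier_int s f \<xi>))\<^sup>2 * exp (- ((\<delta> * \<xi>)\<^sup>2 / 2)))"
    using Fki[unfolded Fk] by (simp only: complex_of_real_integrable_eq)
  have fm: "(\<integral>\<^sup>+ x. (\<integral>\<^sup>+ y. ennreal ((cmod (f x))\<^sup>2 / 2) * ennreal (K x y) \<partial>lborel) \<partial>lborel) = ennreal (sqrt (2 * pi)) * (ennreal (1/2) * L2sq f)"
  proof -
    have "(\<integral>\<^sup>+ x. (\<integral>\<^sup>+ y. ennreal ((cmod (f x))\<^sup>2 / 2) * ennreal (K x y) \<partial>lborel) \<partial>lborel) =
       (\<integral>\<^sup>+ x. ennreal ((cmod (f x))\<^sup>2 / 2) * ennreal (sqrt (2 * pi)) \<partial>lborel)"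
      by (subst nn_integral_cmult) (auto simp: K_def gauss_kernel_nn[OF d, simplified])
    also have "\<dots> = ennreal (sqrt (2 * pi)) * (ennreal (1/2) * L2sq f)"
    proof -
      have "ennreal ((cmod (f x))\<^sup>2 / 2) * ennreal (sqrt (2 * pi)) = ennreal (sqrt (2 * pi)) * (ennreal (1/2) * ennreal ((cmod (f x))\<^sup>2))" for x
      proof -
        have "ennreal (sqrt (2 * pi)) * (ennreal (1/2) * ennreal ((cmod (f x))\<^sup>2)) = ennreal (sqrt (2 * pi) * (1/2 * (cmod (f x))\<^sup>2))"
          using ennreal_mult[of "sqrt (2 * pi)" "1/2 * (cmod (f x))\<^sup>2"] ennreal_mult[of "1/2" "(cmod (f x))\<^sup>2"] by simp
        moreover have "ennreal ((cmod (f x))\<^sup>2 / 2) * ennreal (sqrt (2 * pi)) = ennreal ((cmod (f x))\<^sup>2 / 2 * sqrt (2 * pi))"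
          by (rule ennreal_mult[symmetric]) auto
        ultimately show ?thesis by (simp add: mult_ac)
      qed
      then show ?thesis by (simp only: L2sq_def) (simp add: nn_integral_cmult)
    qed
    finally show ?thesis .
  qed
  have Ksym: "K x y = K y x" for x y unfolding K_def by (simp add: power2_commute power_divide)
  have fm2: "(\<integral>\<^sup>+ x. (\<integral>\<^sup>+ y. ennreal ((cmod (f y))\<^sup>2 / 2) * ennreal (K x y) \<partial>lborel) \<partial>lborel) = ennreal (sqrt (2 * pi)) * (ennreal (1/2) * L2sq f)"
    by (subst lborel_pair.Fubini') (auto simp: Ksym fm)
  have "ennreal (LINT \<xi>|lborel. (cmod (fourier_int s f \<xi>))\<^sup>2 * exp (- ((\<delta> * \<xi>)\<^sup>2 / 2))) = ennreal (cmod (LINT \<xi>|lborel. fourier_int s f \<xi> * k \<xi>))"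
    unfolding Fk by (subst integral_complex_of_real) (simp add: abs_of_nonneg integral_nonneg_AE)
  also have "(LINT \<xi>|lborel. fourier_int s f \<xi> * k \<xi>) = (LINT x|lborel. f x * (complex_of_real (1 / sqrt (2 * pi)) * (LINT y|lborel. cnj (f y) * complex_of_real (K x y))))"
    unfolding fourier_int_duality[OF f k] FIk ..
  also have "ennreal (cmod \<dots>) \<le> (\<integral>\<^sup>+ x. ennreal (cmod (f x * (complex_of_real (1 / sqrt (2 * pi)) * (LINT y|lborel. cnj (f y) * complex_of_real (K x y))))) \<partial>lborel)"
    by (rule integral_norm_bound_ennreal') auto
  also have "\<dots> \<le> (\<integral>\<^sup>+ x. ennreal (1 / sqrt (2 * pi)) * (\<integral>\<^sup>+ y. ennreal ((cmod (f x))\<^sup>2 / 2) * ennreal (K x y) + ennreal ((cmod (f y))\<^sup>2 / 2) * ennreal (K x y) \<partial>lborel) \<partial>lborel)"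
  proof (rule nn_integral_mono)
    fix x
    have "ennreal (cmod (LINT y|lborel. cnj (f y) * complex_of_real (K x y))) \<le> (\<integral>\<^sup>+ y. ennreal (cmod (cnj (f y) * complex_of_real (K x y))) \<partial>lborel)"
      by (rule integral_norm_bound_ennreal') auto
    then have "ennreal (cmod (f x * (complex_of_real (1 / sqrt (2 * pi)) * (LINT y|lborel. cnj (f y) * complex_of_real (K x y)))))
      \<le> ennreal (cmod (f x)) * (ennreal (1 / sqrt (2 * pi)) * (\<integral>\<^sup>+ y. ennreal (cmod (f y) * K x y) \<partial>lborel))"
    proof -
      assume *: "ennreal (cmod (LINT y|lborel. cnj (f y) * complex_of_real (K x y))) \<le> (\<integral>\<^sup>+ y. ennreal (cmod (cnj (f y) * complex_of_real (K x y))) \<partial>lborel)"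
      have "ennreal (cmod (f x * (complex_of_real (1 / sqrt (2 * pi)) * Z))) = ennreal (cmod (f x)) * (ennreal (1 / sqrt (2 * pi)) * ennreal (cmod Z))" for Z
      proof -
        have "cmod (complex_of_real (1 / sqrt (2 * pi))) = 1 / sqrt (2 * pi)"
          by (simp only: norm_of_real) simp
        then show ?thesis
          unfolding norm_mult by (subst ennreal_mult, simp, simp, subst ennreal_mult) simp_all
      qed
      then show ?thesis
        using * by (simp only:) (auto intro!: mult_left_mono simp: norm_mult K0 abs_of_nonneg)
    qed
    also have "\<dots> = ennreal (1 / sqrt (2 * pi)) * (\<integral>\<^sup>+ y. ennreal (cmod (f x)) * ennreal (cmod (f y) * K x y) \<partial>lborel)"
      by (subst nn_integral_cmult) (auto simp: mult_ac)
    also have "\<dots> \<le> ennreal (1 / sqrt (2 * pi)) * (\<integral>\<^sup>+ y. ennreal ((cmod (f x))\<^sup>2 / 2) * ennreal (K x y) + ennreal ((cmod (f y))\<^sup>2 / 2) * ennreal (K x y) \<partial>lborel)"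
    proof (intro mult_left_mono nn_integral_mono)
      fix y
      have "cmod (f x) * cmod (f y) \<le> (cmod (f x))\<^sup>2 / 2 + (cmod (f y))\<^sup>2 / 2"
        using zero_le_power2[of "cmod (f x) - cmod (f y)"] by (simp add: power2_eq_square algebra_simps)
      then have "cmod (f x) * (cmod (f y) * K x y) \<le> (cmod (f x))\<^sup>2 / 2 * K x y + (cmod (f y))\<^sup>2 / 2 * K x y"
        using mult_right_mono[OF _ K0[of x y]] unfolding distrib_right[symmetric] mult.assoc[symmetric] by blast
      then have "ennreal (cmod (f x) * (cmod (f y) * K x y)) \<le> ennreal ((cmod (f x))\<^sup>2 / 2 * K x y + (cmod (f y))\<^sup>2 / 2 * K x y)"
        by (rule ennreal_leI)
      moreover have "ennreal (cmod (f x) * (cmod (f y) * K x y)) = ennreal (cmod (f x)) * ennreal (cmod (f y) * K x y)"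
        by (rule ennreal_mult) (auto simp: K0)
      moreover have "ennreal ((cmod (f x))\<^sup>2 / 2 * K x y + (cmod (f y))\<^sup>2 / 2 * K x y) = ennreal ((cmod (f x))\<^sup>2 / 2) * ennreal (K x y) + ennreal ((cmod (f y))\<^sup>2 / 2) * ennreal (K x y)"
        by (subst ennreal_plus, simp add: K0, simp add: K0, subst ennreal_mult, simp, simp add: K0, subst ennreal_mult) (auto simp: K0)
      ultimately show "ennreal (cmod (f x)) * ennreal (cmod (f y) * K x y) \<le> ennreal ((cmod (f x))\<^sup>2 / 2) * ennreal (K x y) + ennreal ((cmod (f y))\<^sup>2 / 2) * ennreal (K x y)"
        by simp
    qed simp
    finally show "ennreal (cmod (f x * (complex_of_real (1 / sqrt (2 * pi)) * (LINT y|lborel. cnj (f y) * complex_of_real (K x y)))))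
      \<le> ennreal (1 / sqrt (2 * pi)) * (\<integral>\<^sup>+ y. ennreal ((cmod (f x))\<^sup>2 / 2) * ennreal (K x y) + ennreal ((cmod (f y))\<^sup>2 / 2) * ennreal (K x y) \<partial>lborel)" .
  qed
  also have "\<dots> = ennreal (1 / sqrt (2 * pi)) * ((\<integral>\<^sup>+ x. (\<integral>\<^sup>+ y. ennreal ((cmod (f x))\<^sup>2 / 2) * ennreal (K x y) \<partial>lborel) \<partial>lborel)
       + (\<integral>\<^sup>+ x. (\<integral>\<^sup>+ y. ennreal ((cmod (f y))\<^sup>2 / 2) * ennreal (K x y) \<partial>lborel) \<partial>lborel))"
    by (subst nn_integral_cmult) (auto simp: nn_integral_add)
  also have "\<dots> = L2sq f"
  proof -
    have "ennreal (sqrt (2 * pi)) * (ennreal (1/2) * L2sq f) + ennreal (sqrt (2 * pi)) * (ennreal (1/2) * L2sq f) = ennreal (sqrt (2 * pi)) * L2sq f"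
    proof -
      have "ennreal (1/2) * L2sq f + ennreal (1/2) * L2sq f = L2sq f"
        unfolding distrib_right[symmetric] by (subst ennreal_plus[symmetric]) auto
      then show ?thesis by (simp only: distrib_left[symmetric])
    qed
    then show ?thesis unfolding fm fm2 by (simp add: mult.assoc[symmetric] ennreal_mult[symmetric])
  qed
  finally show ?thesis
    by (subst nn_integral_eq_integral[OF Fki']) auto
qed

text \<open>Fatou's lemma removes the Gaussian damping along
  \<open>\<delta> = 1 / Suc n\<close>.\<close>

lemma Bessel:
  assumes f: "integrable lborel f" and s: "s\<^sup>2 = 1"
  shows "L2sq (fourier_int s f) \<le> L2sq f"
proof -
  have [measurable]: "f \<in> borel_measurable borel" using f by auto
  let ?g = "\<lambda>n \<xi>. ennreal ((cmod (fourier_int s f \<xi>))\<^sup>2 * exp (- ((1 / real (Suc n) * \<xi>)\<^sup>2 / 2)))"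
  have "L2sq (fourier_int s f) = (\<integral>\<^sup>+ \<xi>. liminf (\<lambda>n. ?g n \<xi>) \<partial>lborel)"
    unfolding L2sq_def
  proof (rule nn_integral_cong)
    fix \<xi>
    have "(\<lambda>n. 1 / real (Suc n) * \<xi>) \<longlonglongrightarrow> 0 * \<xi>"
      by (intro tendsto_mult tendsto_const LIMSEQ_Suc[OF lim_1_over_n])
    then have "(\<lambda>n. (cmod (fourier_int s f \<xi>))\<^sup>2 * exp (- ((1 / real (Suc n) * \<xi>)\<^sup>2 / 2))) \<longlonglongrightarrow> (cmod (fourier_int s f \<xi>))\<^sup>2 * exp (- ((0 * \<xi>)\<^sup>2 / 2))"
      by (rule tendsto_mult[OF tendsto_const tendsto_exp[OF tendsto_minus[OF tendsto_divide[OF tendsto_power tendsto_const]]]]) auto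
    then have "(\<lambda>n. ?g n \<xi>) \<longlonglongrightarrow> ennreal ((cmod (fourier_int s f \<xi>))\<^sup>2)"
      by (intro tendsto_ennrealI) simp
    from lim_imp_Liminf[OF _ this]
    show "ennreal ((cmod (fourier_int s f \<xi>))\<^sup>2) = liminf (\<lambda>n. ?g n \<xi>)" by simp
  qed
  also have "\<dots> \<le> liminf (\<lambda>n. \<integral>\<^sup>+ \<xi>. ?g n \<xi> \<partial>lborel)"
    by (rule nn_integral_liminf) measurable
  also have "\<dots> \<le> L2sq f"
    by (rule Liminf_le, simp, intro always_eventually allI Bessel_gauss[OF f _ s]) simp
  finally show ?thesis .
qed

text \<open>
  The positive and negative parts of \<open>h\<close> have the same mass and, once normalised, are probability
  densities with the same characteristic function, so Levy's uniqueness theorem applies.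
\<close>

lemma FT_inj_real:
  fixes h :: "real \<Rightarrow> real"
  assumes h: "integrable lborel h" and z: "\<And>t. (LINT x|lborel. iexp (t * x) * complex_of_real (h x)) = 0"
  shows "AE x in lborel. h x = 0"
proof -
  have [measurable]: "h \<in> borel_measurable borel" using h by auto
  define p where "p x = max 0 (h x)" for x
  define q where "q x = max 0 (- h x)" for x
  have [measurable]: "p \<in> borel_measurable borel" "q \<in> borel_measurable borel"
    unfolding p_def q_def by measurable
  have pq: "integrable lborel p" "integrable lborel q"
    unfolding p_def q_def using h by auto
  have p0: "p x \<ge> 0" and q0: "q x \<ge> 0" and hpq: "h x = p x - q x" for x by (auto simp: p_def q_def)
  have eq: "(LINT x|lborel. iexp (t * x) * complex_of_real (p x)) = (LINT x|lborel. iexp (t * x) * complex_of_real (q x))" for t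
  proof -
    have "integrable lborel (\<lambda>x. iexp (t * x) * complex_of_real (p x))" "integrable lborel (\<lambda>x. iexp (t * x) * complex_of_real (q x))"
      by (intro iexp_integrable; use pq in simp)+
    from Bochner_Integration.integral_diff[OF this] z[of t] show ?thesis
      by (simp add: hpq ring_distribs)
  qed
  define c where "c = (LINT x|lborel. p x)"
  \<comment> \<open>Equality at frequency 0 compares the total masses.\<close>
  have cq: "c = (LINT x|lborel. q x)"
    using eq[of 0] by (simp add: c_def)
  have "c \<ge> 0" unfolding c_def by (intro integral_nonneg_AE) (simp add: p0)
  show ?thesis
  proof (cases "c = 0")
    case True
    have "AE x in lborel. p x = 0" "AE x in lborel. q x = 0"
      using integral_nonneg_eq_0_iff_AE[OF pq(1)] integral_nonneg_eq_0_iff_AE[OF pq(2)] True cq c_def p0 q0 by auto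
    then show ?thesis by eventually_elim (simp add: hpq)
  next
    case False
    with \<open>c \<ge> 0\<close> have c: "c > 0" by simp
    have P: "real_distribution (density lborel (\<lambda>x. ennreal (r x / c))) \<and>
       char (density lborel (\<lambda>x. ennreal (r x / c))) t = (LINT x|lborel. iexp (t * x) * complex_of_real (r x)) / complex_of_real c"
      if r: "integrable lborel r" "\<And>x. r x \<ge> 0" "c = (LINT x|lborel. r x)" for r t
    proof -
      have [measurable]: "r \<in> borel_measurable borel" using r by auto
      have "(\<integral>\<^sup>+ x. ennreal (r x / c) \<partial>lborel) = ennreal (LINT x|lborel. r x / c)"
        by (rule nn_integral_eq_integral) (use r c in auto)
      also have "\<dots> = 1" using r(3) c by simp
      finally have "prob_space (density lborel (\<lambda>x. ennreal (r x / c)))"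
        by (intro prob_spaceI) (simp add: emeasure_density)
      then have "real_distribution (density lborel (\<lambda>x. ennreal (r x / c)))"
        by (simp add: real_distribution_def real_distribution_axioms_def)
      moreover have "char (density lborel (\<lambda>x. ennreal (r x / c))) t = (LINT x|lborel. (r x / c) *\<^sub>R iexp (t * x))"
        unfolding char_def by (subst integral_density) (use r c in auto)
      moreover have "\<dots> = (LINT x|lborel. iexp (t * x) * complex_of_real (r x) / complex_of_real c)"
        by (intro Bochner_Integration.integral_cong) (auto simp: scaleR_conv_of_real)
      ultimately show ?thesis by (simp add: integral_divide_zero)
    qed
    have "char (density lborel (\<lambda>x. ennreal (p x / c))) = char (density lborel (\<lambda>x. ennreal (q x / c)))"
      using P[OF pq(1) p0 c_def] P[OF pq(2) q0 cq] eq by (intro ext) simp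
    then have "density lborel (\<lambda>x. ennreal (p x / c)) = density lborel (\<lambda>x. ennreal (q x / c))"
      using P[OF pq(1) p0 c_def] P[OF pq(2) q0 cq] by (intro Levy_uniqueness) auto
    then have "AE x in lborel. ennreal (p x / c) = ennreal (q x / c)"
      by (subst (asm) sigma_finite_measure.density_unique_iff[OF sigma_finite_lborel]) auto
    then show ?thesis
      by eventually_elim (use p0 q0 c in \<open>simp add: hpq\<close>)
  qed
qed

text \<open>Replacing \<open>t\<close> by \<open>- t\<close> shows that the transform of
  \<open>cnj h\<close> vanishes too, hence also those of the real and imaginary parts of
  \<open>h\<close>, to which the real case applies.\<close>

lemma FT_inj:
  fixes h :: "real \<Rightarrow> complex"
  assumes h: "integrable lborel h" and z: "\<And>t. (LINT x|lborel. iexp (t * x) * h x) = 0"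
  shows "AE x in lborel. h x = 0"
proof -
  have zc: "(LINT x|lborel. iexp (t * x) * cnj (h x)) = 0" for t
  proof -
    have "(LINT x|lborel. iexp (t * x) * cnj (h x)) = cnj (LINT x|lborel. iexp (- t * x) * h x)"
      by (subst Bochner_Integration.integral_cnj[symmetric]) (simp add: exp_cnj)
    then show ?thesis using z[of "- t"] by simp
  qed
  have i: "integrable lborel (\<lambda>x. iexp (t * x) * h x)" "integrable lborel (\<lambda>x. iexp (t * x) * cnj (h x))" for t
    by (intro iexp_integrable; use h in simp)+
  have "AE x in lborel. Re (h x) = 0"
  proof (rule FT_inj_real)
    fix t
    have "(LINT x|lborel. iexp (t * x) * complex_of_real (Re (h x))) = (LINT x|lborel. (iexp (t * x) * h x + iexp (t * x) * cnj (h x)) / 2)"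
      by (intro Bochner_Integration.integral_cong refl) (simp add: complex_add_cnj ring_distribs[symmetric])
    then show "(LINT x|lborel. iexp (t * x) * complex_of_real (Re (h x))) = 0"
      using i[of t] z[of t] zc[of t] by simp
  qed (use h in auto)
  moreover have "AE x in lborel. Im (h x) = 0"
  proof (rule FT_inj_real)
    fix t
    have "(LINT x|lborel. iexp (t * x) * complex_of_real (Im (h x))) = (LINT x|lborel. (iexp (t * x) * h x - iexp (t * x) * cnj (h x)) / (2 * \<i>))"
    proof (intro Bochner_Integration.integral_cong refl)
      fix x
      have "h x - cnj (h x) = complex_of_real (Im (h x)) * (2 * \<i>)" by (simp add: complex_diff_cnj mult_ac)
      then show "iexp (t * x) * complex_of_real (Im (h x)) = (iexp (t * x) * h x - iexp (t * x) * cnj (h x)) / (2 * \<i>)"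
        unfolding right_diff_distrib[symmetric] by (simp only:) (simp add: field_simps)
    qed
    then show "(LINT x|lborel. iexp (t * x) * complex_of_real (Im (h x))) = 0"
      using i[of t] z[of t] zc[of t] by simp
  qed (use h in auto)
  ultimately show ?thesis by eventually_elim (simp add: complex_eq_iff)
qed

section \<open>Existence of the Plancherel transform\<close>

definition trunc :: "real \<Rightarrow> (real \<Rightarrow> complex) \<Rightarrow> real \<Rightarrow> complex" where
  "trunc R f x = indicator {-R..R} x *\<^sub>R f x"

lemma trunc_measurable [measurable]: "f \<in> borel_measurable borel \<Longrightarrow> trunc R f \<in> borel_measurable borel"
  unfolding trunc_def by measurable

lemma cmod_trunc: "cmod (trunc R f x) \<le> cmod (f x)"
  by (simp add: trunc_def indicator_def)

lemma trunc_sqi: "square_integrable f \<Longrightarrow> square_integrable (trunc R f)"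
  using L2sq_mono[of "trunc R f" f, OF cmod_trunc] by (auto simp: sqi_iff)

lemma trunc_integrable:
  assumes f: "square_integrable f" shows "integrable lborel (trunc R f)"
proof -
  have "square_integrable (\<lambda>x. indicator {-R..R} x)"
  proof -
    have "L2sq (\<lambda>x. indicator {-R..R} x) = (\<integral>\<^sup>+ x. indicator {-R..R} x \<partial>lborel)"
      unfolding L2sq_def by (rule nn_integral_cong) (simp split: split_indicator)
    also have "\<dots> < \<infinity>" by (cases "- R \<le> R") (auto simp: emeasure_lborel_Icc_eq)
    finally show ?thesis by (simp add: sqi_iff)
  qed
  from sqi_mult_integrable[OF this f] show ?thesis
    by (rule Bochner_Integration.integrable_cong[THEN iffD1, rotated -1]) (auto simp: trunc_def indicator_def)
qed

lemma plancherel_limit_iff: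
  "is_plancherel_limit s \<psi> h \<longleftrightarrow> square_integrable h \<and> ((\<lambda>R. L2sq (\<lambda>\<xi>. fourier_int s (trunc R \<psi>) \<xi> - h \<xi>)) \<longlongrightarrow> 0) at_top"
proof -
  have "complex_of_real (1 / sqrt (2 * pi)) * (LINT x:{-R..R}|lborel. exp (\<i> * complex_of_real (s * x * \<xi>)) * \<psi> x) = fourier_int s (trunc R \<psi>) \<xi>" for R \<xi>
    unfolding fourier_int_def set_lebesgue_integral_def trunc_def
    by (intro arg_cong2[where f="(*)"] refl Bochner_Integration.integral_cong) (simp add: scaleR_conv_of_real mult_ac)
  then show ?thesis unfolding is_plancherel_limit_def L2sq_def by presburger
qed

lemma plancherel_limit_cong_AE:
  assumes "AE x in lborel. \<psi> x = \<psi>' x" and [measurable]: "\<psi> \<in> borel_measurable borel" "\<psi>' \<in> borel_measurable borel"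
  shows "is_plancherel_limit s \<psi> = is_plancherel_limit s \<psi>'"
proof -
  have "fourier_int s (trunc R \<psi>) = fourier_int s (trunc R \<psi>')" for R
    by (rule fourier_int_cong_AE) (use assms(1) in \<open>auto simp: trunc_def\<close>)
  then show ?thesis by (simp add: fun_eq_iff plancherel_limit_iff)
qed

lemma fourier_cong_AE:
  assumes "AE x in lborel. \<psi> x = \<psi>' x" "\<psi> \<in> borel_measurable borel" "\<psi>' \<in> borel_measurable borel"
  shows "fourier \<psi> = fourier \<psi>'" "inv_fourier \<psi> = inv_fourier \<psi>'"
  unfolding fourier_def inv_fourier_def plancherel_limit_cong_AE[OF assms] by auto

lemma L2sq_tail:
  assumes f: "square_integrable f"
  shows "((\<lambda>R. L2sq (\<lambda>x. f x - trunc R f x)) \<longlongrightarrow> 0) at_top"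
proof -
  have [measurable]: "f \<in> borel_measurable borel" using f by auto
  have i: "integrable lborel (\<lambda>x. (cmod (f x))\<^sup>2)"
    using f by (intro integrableI_bounded) (auto simp: sqi_iff L2sq_def)
  have "((\<lambda>R. LINT x|lborel. (cmod (f x - trunc R f x))\<^sup>2) \<longlongrightarrow> (LINT x::real|lborel. 0)) at_top"
  proof (rule integral_dominated_convergence_at_top[where w="\<lambda>x. (cmod (f x))\<^sup>2"])
    show "\<forall>\<^sub>F R in at_top. AE x in lborel. norm ((cmod (f x - trunc R f x))\<^sup>2) \<le> (cmod (f x))\<^sup>2"
      by (intro always_eventually allI AE_I2) (auto simp: trunc_def indicator_def)
    show "AE x in lborel. ((\<lambda>R. (cmod (f x - trunc R f x))\<^sup>2) \<longlongrightarrow> 0) at_top"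
    proof (intro AE_I2 tendsto_eventually)
      fix x show "\<forall>\<^sub>F R in at_top. (cmod (f x - trunc R f x))\<^sup>2 = 0"
        using eventually_ge_at_top[of "\<bar>x\<bar>"] by eventually_elim (auto simp: trunc_def indicator_def)
    qed
  qed (use i in auto)
  moreover have "L2sq (\<lambda>x. f x - trunc R f x) = ennreal (LINT x|lborel. (cmod (f x - trunc R f x))\<^sup>2)" for R
    unfolding L2sq_def
    by (rule nn_integral_eq_integral[OF Bochner_Integration.integrable_bound[OF i]])
       (auto simp: trunc_def indicator_def)
  ultimately show ?thesis using tendsto_ennrealI by fastforce
qed

lemma L2sq_tail_mono:
  assumes [measurable]: "f \<in> borel_measurable borel" and "R \<le> S"
  shows "L2sq (\<lambda>x. trunc R f x - trunc S f x) \<le> L2sq (\<lambda>x. f x - trunc R f x)"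
  by (rule L2sq_mono) (use assms in \<open>auto simp: trunc_def indicator_def\<close>)

lemma L2sq_Fatou:
  assumes [measurable]: "\<And>k. F k \<in> borel_measurable borel" "h \<in> borel_measurable borel"
    and "AE \<xi> in lborel. (\<lambda>k::nat. F k \<xi>) \<longlonglongrightarrow> h \<xi>"
  shows "L2sq h \<le> liminf (\<lambda>k. L2sq (F k))"
proof -
  have "L2sq h = (\<integral>\<^sup>+ \<xi>. liminf (\<lambda>k. ennreal ((cmod (F k \<xi>))\<^sup>2)) \<partial>lborel)"
    unfolding L2sq_def
  proof (rule nn_integral_cong_AE)
    from assms(3) show "AE \<xi> in lborel. ennreal ((cmod (h \<xi>))\<^sup>2) = liminf (\<lambda>k. ennreal ((cmod (F k \<xi>))\<^sup>2))"
    proof eventually_elim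
      case (elim \<xi>)
      then have "(\<lambda>k. ennreal ((cmod (F k \<xi>))\<^sup>2)) \<longlonglongrightarrow> ennreal ((cmod (h \<xi>))\<^sup>2)"
        by (intro tendsto_ennrealI tendsto_intros)
      from lim_imp_Liminf[OF _ this] show ?case by simp
    qed
  qed
  also have "\<dots> \<le> liminf (\<lambda>k. L2sq (F k))"
    unfolding L2sq_def by (rule nn_integral_liminf) measurable
  finally show ?thesis .
qed

text \<open>The increments are at most \<open>sqrt C\<close> times powers of
  \<open>1 / sqrt 2\<close>, hence summable. The weight \<open>2 ^ k\<close> is what squared norms
  of size \<open>(1/4) ^ k\<close> leave room for.\<close>

lemma geometric_steps_convergent:
  fixes F :: "nat \<Rightarrow> complex"
  assumes "\<And>k. 2 ^ k * (cmod (F (Suc k) - F k))\<^sup>2 \<le> C"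
  shows "convergent F"
proof -
  have C: "C \<ge> 0" using order_trans[OF _ assms[of 0]] by simp
  have "summable (\<lambda>k. F (Suc k) - F k)"
  proof (rule summable_comparison_test')
    show "summable (\<lambda>k. sqrt C * (1 / sqrt 2) ^ k)"
      by (intro summable_mult summable_geometric) simp
    fix k :: nat
    have "(cmod (F (Suc k) - F k))\<^sup>2 \<le> (sqrt C * (1 / sqrt 2) ^ k)\<^sup>2"
    proof -
      have "((1 / sqrt 2) ^ k)\<^sup>2 = ((1 / sqrt 2)\<^sup>2) ^ k" by (simp only: power_mult[symmetric] mult.commute)
      also have "\<dots> = (1 / 2) ^ k" by (simp add: power_divide)
      finally show ?thesis using assms[of k] C by (simp add: power_mult_distrib power_divide field_simps)
    qed
    then show "norm (F (Suc k) - F k) \<le> sqrt C * (1 / sqrt 2) ^ k"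
      by (rule power2_le_imp_le) (use C in simp)
  qed
  then have "convergent (\<lambda>n. \<Sum>k<n. F (Suc k) - F k)"
    by (simp add: summable_iff_convergent)
  then have "convergent (\<lambda>n. F n - F 0)"
    by (simp add: sum_lessThan_telescope)
  then have "convergent (\<lambda>n. (F n - F 0) + F 0)" by (intro convergent_add convergent_const)
  then show ?thesis by simp
qed

lemma fourier_int_sqi:
  assumes "integrable lborel f" "square_integrable f" "s\<^sup>2 = 1"
  shows "square_integrable (fourier_int s f)"
  using Bessel[OF assms(1,3)] assms(2) by (auto simp: sqi_iff elim!: order.strict_trans1)

text \<open>Riesz-Fischer: by Bessel the transforms of the truncations form a Cauchy family, a fast
  subsequence converges almost everywhere, and Fatou's lemma shows that the pointwise limit is the
  limit in the mean.\<close>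

lemma plancherel_exists:
  assumes \<psi>: "square_integrable \<psi>" and s: "s\<^sup>2 = 1"
  shows "\<exists>h. is_plancherel_limit s \<psi> h"
proof -
  have [measurable]: "\<psi> \<in> borel_measurable borel" using \<psi> by auto
  define D where "D R = fourier_int s (trunc R \<psi>)" for R
  define tail where "tail R = L2sq (\<lambda>x. \<psi> x - trunc R \<psi> x)" for R
  have [measurable]: "D R \<in> borel_measurable borel" for R unfolding D_def by measurable
  have DD: "L2sq (\<lambda>\<xi>. D R \<xi> - D S \<xi>) \<le> tail R" if "R \<le> S" for R S
  proof -
    have i: "integrable lborel (trunc R \<psi>)" "integrable lborel (trunc S \<psi>)" using trunc_integrable[OF \<psi>] by auto
    have "(\<lambda>\<xi>. D R \<xi> - D S \<xi>) = fourier_int s (\<lambda>x. trunc R \<psi> x - trunc S \<psi> x)"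
      unfolding D_def by (intro ext fourier_int_diff[symmetric] i)
    then have "L2sq (\<lambda>\<xi>. D R \<xi> - D S \<xi>) \<le> L2sq (\<lambda>x. trunc R \<psi> x - trunc S \<psi> x)"
      using i by (auto intro!: Bessel s)
    also have "\<dots> \<le> tail R" unfolding tail_def by (rule L2sq_tail_mono) (use that in auto)
    finally show ?thesis .
  qed
  have tail0: "(tail \<longlongrightarrow> 0) at_top" unfolding tail_def by (rule L2sq_tail[OF \<psi>])
  have "\<exists>R0. \<forall>R\<ge>R0. tail R \<le> ennreal ((1/4)^k)" for k
  proof -
    have "eventually (\<lambda>R. tail R < ennreal ((1/4)^k)) at_top"
      by (rule order_tendstoD[OF tail0]) simp
    then show ?thesis unfolding eventually_at_top_linorder by (meson less_imp_le)
  qed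
  then obtain R0 where R0: "\<And>k R. R \<ge> R0 k \<Longrightarrow> tail R \<le> ennreal ((1/4)^k)" by metis
  \<comment> \<open>The radii must dominate \<open>R0 k\<close>, increase, and tend to infinity. The
    sum of absolute values ensures the first two, the summand \<open>real k\<close> the
    third.\<close>
  define r where "r k = real k + (\<Sum>j\<le>k. \<bar>R0 j\<bar>)" for k
  have rk: "r k \<ge> real k" for k unfolding r_def by (simp add: sum_nonneg)
  have rR0: "r k \<ge> R0 k" for k
    using member_le_sum[of k "{..k}" "\<lambda>j. \<bar>R0 j\<bar>"] unfolding r_def by auto
  have rS: "r k \<le> r (Suc k)" for k unfolding r_def by simp
  define F where "F k = D (r k)" for k
  have [measurable]: "F k \<in> borel_measurable borel" for k unfolding F_def by measurable
  have FF: "L2sq (\<lambda>\<xi>. F (Suc k) \<xi> - F k \<xi>) \<le> ennreal ((1/4)^k)" for k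
    using order_trans[OF DD[OF rS] R0[OF rR0]] unfolding F_def by (subst L2sq_diff_commute)
  \<comment> \<open>Since \<open>2 ^ k * (1/4) ^ k\<close> is summable, \<open>G\<close> has finite
    integral and is finite almost everywhere; there the weighted increments are bounded.\<close>
  define G where "G \<xi> = (\<Sum>k. ennreal (2 ^ k) * ennreal ((cmod (F (Suc k) \<xi> - F k \<xi>))\<^sup>2))" for \<xi>
  have "(\<integral>\<^sup>+ \<xi>. G \<xi> \<partial>lborel) = (\<Sum>k. ennreal (2 ^ k) * L2sq (\<lambda>\<xi>. F (Suc k) \<xi> - F k \<xi>))"
    unfolding G_def L2sq_def by (subst nn_integral_suminf) (auto simp: nn_integral_cmult)
  also have "\<dots> \<le> (\<Sum>k. ennreal ((1/2) ^ k))"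
  proof (rule suminf_le)
    fix k
    have "ennreal (2 ^ k) * L2sq (\<lambda>\<xi>. F (Suc k) \<xi> - F k \<xi>) \<le> ennreal (2 ^ k) * ennreal ((1/4)^k)"
      by (intro mult_left_mono FF) simp
    also have "\<dots> = ennreal ((1/2) ^ k)"
      by (subst ennreal_mult[symmetric]) (auto simp: power_mult_distrib[symmetric])
    finally show "ennreal (2 ^ k) * L2sq (\<lambda>\<xi>. F (Suc k) \<xi> - F k \<xi>) \<le> ennreal ((1/2) ^ k)" .
  qed auto
  also have "\<dots> < \<infinity>"
    by (subst suminf_ennreal2) (auto intro: summable_geometric)
  finally have "AE \<xi> in lborel. G \<xi> \<noteq> \<infinity>"
    by (intro nn_integral_noteq_infinite) (auto simp: G_def)
  then have conv: "AE \<xi> in lborel. convergent (\<lambda>k. F k \<xi>)"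
  proof eventually_elim
    case (elim \<xi>)
    have "2 ^ k * (cmod (F (Suc k) \<xi> - F k \<xi>))\<^sup>2 \<le> enn2real (G \<xi>)" for k
    proof -
      have "ennreal (2 ^ k) * ennreal ((cmod (F (Suc k) \<xi> - F k \<xi>))\<^sup>2) \<le> G \<xi>"
        unfolding G_def using sum_le_suminf[of "\<lambda>k. ennreal (2 ^ k) * ennreal ((cmod (F (Suc k) \<xi> - F k \<xi>))\<^sup>2)" "{k}"] by simp
      then have "ennreal (2 ^ k * (cmod (F (Suc k) \<xi> - F k \<xi>))\<^sup>2) \<le> ennreal (enn2real (G \<xi>))"
        using elim by (subst ennreal_mult) (auto simp: ennreal_enn2real less_top)
      then show ?thesis by (simp add: ennreal_le_iff)
    qed
    then show ?case by (rule geometric_steps_convergent)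
  qed
  define h where "h \<xi> = lim (\<lambda>k. F k \<xi>)" for \<xi>
  have [measurable]: "h \<in> borel_measurable borel" unfolding h_def by measurable
  \<comment> \<open>Bounding by \<open>tail R\<close> for every \<open>R\<close>, and not just for
    the radii \<open>r k\<close>, gives convergence along the whole filter.\<close>
  have hb: "L2sq (\<lambda>\<xi>. D R \<xi> - h \<xi>) \<le> tail R" for R
  proof -
    have "L2sq (\<lambda>\<xi>. D R \<xi> - h \<xi>) \<le> liminf (\<lambda>k. L2sq (\<lambda>\<xi>. D R \<xi> - F k \<xi>))"
    proof (rule L2sq_Fatou)
      from conv show "AE \<xi> in lborel. (\<lambda>k. D R \<xi> - F k \<xi>) \<longlonglongrightarrow> D R \<xi> - h \<xi>"
        by eventually_elim (auto simp: h_def convergent_LIMSEQ_iff intro!: tendsto_intros)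
    qed measurable
    also have "\<dots> \<le> tail R"
    proof (rule Liminf_le)
      show "\<forall>\<^sub>F k in sequentially. L2sq (\<lambda>\<xi>. D R \<xi> - F k \<xi>) \<le> tail R"
        using eventually_ge_at_top[of "nat \<lceil>R\<rceil>"]
      proof eventually_elim
        case (elim k)
        then have "R \<le> r k" using rk[of k] by linarith
        then show ?case unfolding F_def by (rule DD)
      qed
    qed simp
    finally show ?thesis .
  qed
  have lim: "((\<lambda>R. L2sq (\<lambda>\<xi>. D R \<xi> - h \<xi>)) \<longlongrightarrow> 0) at_top"
    by (rule tendsto_sandwich[OF _ _ tendsto_const tail0]) (simp_all add: hb)
  have "square_integrable (D R)" for R
    unfolding D_def by (rule fourier_int_sqi[OF trunc_integrable[OF \<psi>] trunc_sqi[OF \<psi>] s])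
  moreover have "square_integrable (\<lambda>\<xi>. D (r 0) \<xi> - h \<xi>)"
    using order_trans[OF hb[of "r 0"] R0[OF rR0[of 0]]] by (auto simp: sqi_iff elim!: order.strict_trans1)
  ultimately have "square_integrable h"
    using sqi_diff[of "D (r 0)" "\<lambda>\<xi>. D (r 0) \<xi> - h \<xi>"] by simp
  with lim show ?thesis unfolding plancherel_limit_iff D_def by blast
qed

lemma fourier_spec: "square_integrable \<psi> \<Longrightarrow> is_plancherel_limit (-1) \<psi> (fourier \<psi>)"
  unfolding fourier_def by (rule someI_ex[OF plancherel_exists]) auto

lemma inv_fourier_spec: "square_integrable \<psi> \<Longrightarrow> is_plancherel_limit 1 \<psi> (inv_fourier \<psi>)"
  unfolding inv_fourier_def by (rule someI_ex[OF plancherel_exists]) auto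

text \<open>Bessel's inequality for the truncations passes to the limit; the factor 2 comes from the
  squared triangle inequality.\<close>

lemma plancherel_limit_L2sq_le:
  assumes \<psi>: "square_integrable \<psi>" and s: "s\<^sup>2 = 1" and h: "is_plancherel_limit s \<psi> h"
  shows "L2sq h \<le> 2 * L2sq \<psi>"
proof -
  have [measurable]: "\<psi> \<in> borel_measurable borel" "h \<in> borel_measurable borel"
    using \<psi> h by (auto simp: plancherel_limit_iff)
  have "L2sq h \<le> 2 * L2sq \<psi> + 2 * L2sq (\<lambda>\<xi>. fourier_int s (trunc R \<psi>) \<xi> - h \<xi>)" for R
  proof -
    have "L2sq h = L2sq (\<lambda>\<xi>. fourier_int s (trunc R \<psi>) \<xi> - (fourier_int s (trunc R \<psi>) \<xi> - h \<xi>))" by simp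
    also have "\<dots> \<le> 2 * L2sq (fourier_int s (trunc R \<psi>)) + 2 * L2sq (\<lambda>\<xi>. fourier_int s (trunc R \<psi>) \<xi> - h \<xi>)"
      by (rule L2sq_diff) auto
    also have "L2sq (fourier_int s (trunc R \<psi>)) \<le> L2sq \<psi>"
      using Bessel[OF trunc_integrable[OF \<psi>] s] L2sq_mono[OF cmod_trunc] by (rule order_trans)
    finally show ?thesis by (simp add: add_mono mult_left_mono)
  qed
  moreover have "((\<lambda>R. 2 * L2sq \<psi> + 2 * L2sq (\<lambda>\<xi>. fourier_int s (trunc R \<psi>) \<xi> - h \<xi>)) \<longlongrightarrow> 2 * L2sq \<psi> + 2 * 0) at_top"
    using h by (intro tendsto_add tendsto_const ennreal_tendsto_cmult) (auto simp: plancherel_limit_iff)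
  ultimately have "L2sq h \<le> 2 * L2sq \<psi> + 2 * 0"
    by (intro tendsto_lowerbound[of _ _ at_top]) auto
  then show ?thesis by simp
qed

section \<open>Duality, inversion and identification of transforms\<close>

text \<open>Holds for truncations by Fubini. In the limit the left side converges by Cauchy-Schwarz
  and the right side by dominated convergence. Inversion is later obtained by inserting wave packets
  for \<open>k\<close>.\<close>

lemma weak_duality:
  assumes \<psi>: "square_integrable \<psi>" and s: "s\<^sup>2 = 1" and h: "is_plancherel_limit s \<psi> h"
    and k: "integrable lborel k" "square_integrable k"
  shows "(LINT \<xi>|lborel. h \<xi> * k \<xi>) = (LINT x|lborel. \<psi> x * fourier_int s k x)"
proof -
  have hs: "square_integrable h" and hl: "((\<lambda>R. L2sq (\<lambda>\<xi>. fourier_int s (trunc R \<psi>) \<xi> - h \<xi>)) \<longlongrightarrow> 0) at_top"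
    using h by (auto simp: plancherel_limit_iff)
  have [measurable]: "\<psi> \<in> borel_measurable borel" "h \<in> borel_measurable borel" "k \<in> borel_measurable borel"
    using \<psi> hs k by auto
  have Fs: "square_integrable (fourier_int s (trunc R \<psi>))" for R
    by (rule fourier_int_sqi[OF trunc_integrable[OF \<psi>] trunc_sqi[OF \<psi>] s])
  have Fk: "square_integrable (fourier_int s k)"
    using Bessel[OF k(1) s] k(2) by (auto simp: sqi_iff elim!: order.strict_trans1)
  define a where "a n = (LINT \<xi>|lborel. fourier_int s (trunc (real n) \<psi>) \<xi> * k \<xi>)" for n :: nat
  have "a \<longlonglongrightarrow> (LINT \<xi>|lborel. h \<xi> * k \<xi>)"
  proof -
    have hl': "(\<lambda>n. L2sq (\<lambda>\<xi>. fourier_int s (trunc (real n) \<psi>) \<xi> - h \<xi>)) \<longlonglongrightarrow> 0"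
      by (rule filterlim_compose[OF hl filterlim_real_sequentially])
    have L: "(\<lambda>n. L2sq k * L2sq (\<lambda>\<xi>. fourier_int s (trunc (real n) \<psi>) \<xi> - h \<xi>)) \<longlonglongrightarrow> L2sq k * 0"
      by (intro ennreal_tendsto_cmult hl') (use k in \<open>auto simp: sqi_iff\<close>)
    have B: "ennreal ((cmod (a n - (LINT \<xi>|lborel. h \<xi> * k \<xi>)))\<^sup>2) \<le> L2sq k * L2sq (\<lambda>\<xi>. fourier_int s (trunc (real n) \<psi>) \<xi> - h \<xi>)" for n
    proof -
      have "a n - (LINT \<xi>|lborel. h \<xi> * k \<xi>) = (LINT \<xi>|lborel. (fourier_int s (trunc (real n) \<psi>) \<xi> - h \<xi>) * k \<xi>)"
        unfolding a_def left_diff_distrib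
      by (rule Bochner_Integration.integral_diff[symmetric]) (rule sqi_mult_integrable[OF Fs k(2)] sqi_mult_integrable[OF hs k(2)])+
      then show ?thesis using sqi_Cauchy_Schwarz[OF sqi_diff[OF Fs hs] k(2)] by (simp only: mult.commute[of "L2sq k"])
    qed
    have "(\<lambda>n. ennreal ((cmod (a n - (LINT \<xi>|lborel. h \<xi> * k \<xi>)))\<^sup>2)) \<longlonglongrightarrow> 0"
    proof (rule tendsto_sandwich[OF _ _ tendsto_const L[unfolded mult_zero_right]])
      show "\<forall>\<^sub>F n in sequentially. 0 \<le> ennreal ((cmod (a n - (LINT \<xi>|lborel. h \<xi> * k \<xi>)))\<^sup>2)" by simp
    qed (intro always_eventually allI B)
    then have "(\<lambda>n. (cmod (a n - (LINT \<xi>|lborel. h \<xi> * k \<xi>)))\<^sup>2) \<longlonglongrightarrow> 0"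
      by (subst (asm) ennreal_tendsto_0_iff) auto
    then have "(\<lambda>n. a n - (LINT \<xi>|lborel. h \<xi> * k \<xi>)) \<longlonglongrightarrow> 0"
      by (simp add: tendsto_norm_zero_iff)
    then show ?thesis by (simp add: LIM_zero_iff)
  qed
  moreover have "a \<longlonglongrightarrow> (LINT x|lborel. \<psi> x * fourier_int s k x)"
  proof -
    have "a n = (LINT x|lborel. trunc (real n) \<psi> x * fourier_int s k x)" for n
      unfolding a_def by (rule fourier_int_duality[OF trunc_integrable[OF \<psi>] k(1)])
    moreover have "(\<lambda>n. LINT x|lborel. trunc (real n) \<psi> x * fourier_int s k x) \<longlonglongrightarrow> (LINT x|lborel. \<psi> x * fourier_int s k x)"
    proof (rule integral_dominated_convergence[where w="\<lambda>x. norm (\<psi> x * fourier_int s k x)"])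
      show "integrable lborel (\<lambda>x. norm (\<psi> x * fourier_int s k x))"
        using sqi_mult_integrable[OF \<psi> Fk] by simp
      show "AE x in lborel. norm (trunc (real n) \<psi> x * fourier_int s k x) \<le> norm (\<psi> x * fourier_int s k x)" for n
        by (intro AE_I2) (auto simp: norm_mult intro!: mult_right_mono cmod_trunc)
      show "AE x in lborel. (\<lambda>n. trunc (real n) \<psi> x * fourier_int s k x) \<longlonglongrightarrow> \<psi> x * fourier_int s k x"
      proof (intro AE_I2 tendsto_eventually)
        fix x show "\<forall>\<^sub>F n in sequentially. trunc (real n) \<psi> x * fourier_int s k x = \<psi> x * fourier_int s k x"
          using eventually_ge_at_top[of "nat \<lceil>\<bar>x\<bar>\<rceil>"]
        proof eventually_elim
          case (elim n)
          then have "\<bar>x\<bar> \<le> real n" by linarith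
          then show ?case by (auto simp: trunc_def indicator_def abs_le_iff)
        qed
      qed
    qed measurable
    ultimately show ?thesis by presburger
  qed
  ultimately show ?thesis by (rule LIMSEQ_unique)
qed

text \<open>Multiplication by a Gaussian makes \<phi> integrable and loses nothing, as the Gaussian
  has no zero. Testing against all modulations is then testing all frequencies of the
  product.\<close>

lemma gaussian_test:
  assumes \<phi>: "square_integrable \<phi>" and z: "\<And>p. (LINT x|lborel. \<phi> x * wave_packet p 0 x) = 0"
  shows "AE x in lborel. \<phi> x = 0"
proof -
  have "AE x in lborel. \<phi> x * wave_packet 0 0 x = 0"
  proof (rule FT_inj)
    show "integrable lborel (\<lambda>x. \<phi> x * wave_packet 0 0 x)" by (rule sqi_mult_integrable[OF \<phi> wave_packet_sqi])
    fix p
    have "(LINT x|lborel. iexp (p * x) * (\<phi> x * wave_packet 0 0 x)) = (LINT x|lborel. \<phi> x * wave_packet p 0 x)"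
      by (intro Bochner_Integration.integral_cong) (auto simp: wave_packet_def mult_ac)
    then show "(LINT x|lborel. iexp (p * x) * (\<phi> x * wave_packet 0 0 x)) = 0" using z by simp
  qed
  moreover have "wave_packet 0 0 x \<noteq> 0" for x by (simp add: wave_packet_def)
  ultimately show ?thesis by simp
qed

lemma fourier_int_wave_packet_p0: "s\<^sup>2 = 1 \<Longrightarrow> fourier_int s (wave_packet p 0) = wave_packet 0 (- s * p)"
proof (intro ext)
  fix \<xi> assume s: "s\<^sup>2 = 1"
  have "(s * \<xi> + p)\<^sup>2 = s\<^sup>2 * (\<xi> + s * p)\<^sup>2"
    using s by (simp add: power2_eq_square algebra_simps)
  then show "fourier_int s (wave_packet p 0) \<xi> = wave_packet 0 (- s * p) \<xi>" using s by (simp add: fourier_int_wave_packet wave_packet_def)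
qed

lemma fourier_int_wave_packet_0q: "s\<^sup>2 = 1 \<Longrightarrow> fourier_int s (wave_packet 0 q) = wave_packet (s * q) 0"
  by (intro ext) (simp add: fourier_int_wave_packet wave_packet_def power_mult_distrib mult_ac)

text \<open>Duality moves both transforms onto the wave packet, where they are explicit and inverse
  to each other.\<close>

lemma plancherel_limit_fourier_int:
  assumes h: "integrable lborel h" "square_integrable h" and s: "s\<^sup>2 = 1" and H: "is_plancherel_limit s (fourier_int (-s) h) H"
  shows "AE \<xi> in lborel. H \<xi> = h \<xi>"
proof -
  have s': "(-s)\<^sup>2 = 1" using s by simp
  have [measurable]: "h \<in> borel_measurable borel" using h by auto
  have u: "square_integrable (fourier_int (-s) h)"
    using Bessel[OF h(1) s'] h(2) by (auto simp: sqi_iff elim!: order.strict_trans1)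
  have Hs: "square_integrable H" using H by (simp add: plancherel_limit_iff)
  have "AE \<xi> in lborel. H \<xi> - h \<xi> = 0"
  proof (rule gaussian_test[OF sqi_diff[OF Hs h(2)]])
    fix p
    have "(LINT \<xi>|lborel. H \<xi> * wave_packet p 0 \<xi>) = (LINT x|lborel. fourier_int (-s) h x * fourier_int s (wave_packet p 0) x)"
      by (rule weak_duality[OF u s H wave_packet_integrable wave_packet_sqi])
    also have "\<dots> = (LINT \<xi>|lborel. h \<xi> * fourier_int (-s) (fourier_int s (wave_packet p 0)) \<xi>)"
      by (rule fourier_int_duality[OF h(1)]) (simp add: fourier_int_wave_packet_p0[OF s] wave_packet_integrable)
    also have "fourier_int (-s) (fourier_int s (wave_packet p 0)) = wave_packet p 0"
      using s by (simp add: fourier_int_wave_packet_p0[OF s] fourier_int_wave_packet_0q[OF s'] power2_eq_square flip: mult.assoc)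
    finally show "(LINT \<xi>|lborel. (H \<xi> - h \<xi>) * wave_packet p 0 \<xi>) = 0"
      by (simp add: left_diff_distrib sqi_mult_integrable[OF Hs wave_packet_sqi] sqi_mult_integrable[OF h(2) wave_packet_sqi])
  qed
  then show ?thesis by simp
qed

text \<open>The test function \<open>wave_packet p 0\<close> is itself the transform of
  \<open>wave_packet 0 (s * p)\<close>, so \<open>weak_duality\<close> expresses its pairing with
  \<psi> through \<open>H\<close>. Integrability of \<open>H\<close> lets the second duality return
  to a genuine integral.\<close>

lemma plancherel_limit_inversion:
  assumes \<psi>: "square_integrable \<psi>" and s: "s\<^sup>2 = 1" and H: "is_plancherel_limit s \<psi> H" and Hi: "integrable lborel H"
  shows "AE x in lborel. \<psi> x = fourier_int (-s) H x"
proof -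
  have s': "(-s)\<^sup>2 = 1" using s by simp
  have Hs: "square_integrable H" using H by (simp add: plancherel_limit_iff)
  have [measurable]: "H \<in> borel_measurable borel" using Hs by auto
  have u: "square_integrable (fourier_int (-s) H)"
    using Bessel[OF Hi s'] Hs by (auto simp: sqi_iff elim!: order.strict_trans1)
  have "AE x in lborel. \<psi> x - fourier_int (-s) H x = 0"
  proof (rule gaussian_test[OF sqi_diff[OF \<psi> u]])
    fix p
    have g: "fourier_int s (wave_packet 0 (s * p)) = wave_packet p 0"
      using s by (simp add: fourier_int_wave_packet_0q[OF s] power2_eq_square flip: mult.assoc)
    have "(LINT x|lborel. \<psi> x * wave_packet p 0 x) = (LINT \<xi>|lborel. H \<xi> * wave_packet 0 (s * p) \<xi>)"
      using weak_duality[OF \<psi> s H wave_packet_integrable wave_packet_sqi, of 0 "s * p"] by (simp add: g)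
    also have "wave_packet 0 (s * p) = fourier_int (-s) (wave_packet p 0)" using fourier_int_wave_packet_p0[OF s', of p] by simp
    also have "(LINT \<xi>|lborel. H \<xi> * fourier_int (-s) (wave_packet p 0) \<xi>) = (LINT x|lborel. fourier_int (-s) H x * wave_packet p 0 x)"
      by (rule fourier_int_duality[symmetric, OF Hi wave_packet_integrable])
    finally show "(LINT x|lborel. (\<psi> x - fourier_int (-s) H x) * wave_packet p 0 x) = 0"
      by (simp add: left_diff_distrib sqi_mult_integrable[OF \<psi> wave_packet_sqi] sqi_mult_integrable[OF u wave_packet_sqi])
  qed
  then show ?thesis by simp
qed

text \<open>\<open>fourier\<close> is chosen by \<open>SOME\<close>; knowing any integrable and
  square-integrable spectral density pins the choice down up to a null set.\<close>

lemma fourier_fourier_int: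
  assumes "integrable lborel h" "square_integrable h" and "AE x in lborel. u x = fourier_int 1 h x" "u \<in> borel_measurable borel"
  shows "AE \<xi> in lborel. fourier u \<xi> = h \<xi>" and "square_integrable u"
proof -
  have "square_integrable (fourier_int 1 h)"
    using Bessel[OF assms(1), of 1] assms(2) by (auto simp: sqi_iff elim!: order.strict_trans1)
  then show "square_integrable u"
    using assms(3,4) L2sq_cong_AE[OF assms(3)] by (simp add: sqi_iff)
  have "AE \<xi> in lborel. fourier (fourier_int 1 h) \<xi> = h \<xi>"
    using plancherel_limit_fourier_int[of h "-1" "fourier (fourier_int 1 h)"] assms(1,2) fourier_spec[OF \<open>square_integrable (fourier_int 1 h)\<close>] by simp
  moreover have "fourier u = fourier (fourier_int 1 h)"
    by (rule fourier_cong_AE[OF assms(3,4)]) (use \<open>square_integrable (fourier_int 1 h)\<close> in auto)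
  ultimately show "AE \<xi> in lborel. fourier u \<xi> = h \<xi>" by simp
qed

lemma inv_fourier_fourier_int:
  assumes "integrable lborel h" "square_integrable h"
  shows "AE x in lborel. inv_fourier h x = fourier_int 1 h x" and "inv_fourier h \<in> borel_measurable borel"
proof -
  have P: "is_plancherel_limit 1 h (inv_fourier h)" by (rule inv_fourier_spec[OF assms(2)])
  have I: "square_integrable (inv_fourier h)" using P by (simp add: plancherel_limit_iff)
  then show "inv_fourier h \<in> borel_measurable borel" by auto
  have [measurable]: "h \<in> borel_measurable borel" using assms by auto
  have u: "square_integrable (fourier_int 1 h)"
    using Bessel[OF assms(1), of 1] assms(2) by (auto simp: sqi_iff elim!: order.strict_trans1)
  have "AE x in lborel. inv_fourier h x - fourier_int 1 h x = 0"
  proof (rule gaussian_test[OF sqi_diff[OF I u]])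
    fix p
    have "(LINT x|lborel. inv_fourier h x * wave_packet p 0 x) = (LINT x|lborel. h x * fourier_int 1 (wave_packet p 0) x)"
      by (rule weak_duality[OF assms(2) _ P wave_packet_integrable wave_packet_sqi]) simp
    also have "\<dots> = (LINT x|lborel. fourier_int 1 h x * wave_packet p 0 x)"
      by (rule fourier_int_duality[symmetric, OF assms(1) wave_packet_integrable])
    finally show "(LINT x|lborel. (inv_fourier h x - fourier_int 1 h x) * wave_packet p 0 x) = 0"
      by (simp add: left_diff_distrib sqi_mult_integrable[OF I wave_packet_sqi] sqi_mult_integrable[OF u wave_packet_sqi])
  qed
  then show "AE x in lborel. inv_fourier h x = fourier_int 1 h x" by simp
qed

text \<open>The set where the functions differ is open and negligible, hence empty. This selects the
  continuous representative of an almost everywhere class.\<close>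

lemma continuous_AE_eq:
  fixes f g :: "real \<Rightarrow> complex"
  assumes "continuous_on UNIV f" "continuous_on UNIV g" "AE x in lborel. f x = g x"
  shows "f = g"
proof -
  have "open {x. f x \<noteq> g x}" using assms(1,2) by (rule open_Collect_neq)
  moreover have "negligible {x. f x \<noteq> g x}"
  proof -
    have "{x. f x \<noteq> g x} \<in> sets borel" using \<open>open {x. f x \<noteq> g x}\<close> by auto
    then have "{x \<in> space lborel. \<not> f x = g x} \<in> null_sets lborel"
      using assms(3) by (simp add: AE_iff_null_sets)
    then show ?thesis by (simp add: negligible_iff_null_sets null_sets_completionI)
  qed
  ultimately have "{x. f x \<noteq> g x} = {}" using open_not_negligible by blast
  then show ?thesis by auto
qed

section \<open>Weighted norms and convolution\<close>

lemma japanese_ge_1 [simp]: "1 \<le> japanese \<xi>"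
  by (simp add: japanese_def)

lemma japanese_pos [simp]: "0 < japanese \<xi>" "japanese \<xi> \<noteq> 0" "0 \<le> japanese \<xi>"
  using japanese_ge_1[of \<xi>] by linarith+

lemma japanese_minus [simp]: "japanese (- \<xi>) = japanese \<xi>"
  by (simp add: japanese_def)

lemma japanese_measurable [measurable]: "japanese \<in> borel_measurable borel"
  unfolding japanese_def by measurable

lemma abs_le_japanese: "\<bar>\<xi>\<bar> \<le> japanese \<xi>"
  unfolding japanese_def by (rule real_le_rsqrt) simp

lemma japanese_le: "japanese \<xi> \<le> 1 + \<bar>\<xi>\<bar>"
  unfolding japanese_def by (rule real_le_lsqrt) (auto simp: power2_eq_square algebra_simps)

lemma japanese_ge_half: "(1 + \<bar>\<xi>\<bar>) / 2 \<le> japanese \<xi>"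
  using add_mono[OF japanese_ge_1[of \<xi>] abs_le_japanese[of \<xi>]] by (simp del: japanese_ge_1)

lemma japanese_triangle: "japanese (a + b) \<le> japanese a + japanese b"
proof -
  have "japanese (a + b) = cmod (Complex 1 (a + b))" by (simp add: japanese_def cmod_def)
  also have "\<dots> \<le> cmod (Complex 1 a) + cmod (Complex 0 b)"
    by (rule order_trans[OF _ norm_triangle_ineq]) (simp add: complex_add)
  also have "cmod (Complex 0 b) \<le> japanese b" by (simp add: cmod_def abs_le_japanese)
  finally show ?thesis by (simp add: japanese_def cmod_def)
qed

section \<open>Weighted norms and the Sobolev embedding\<close>

definition weight :: "real \<Rightarrow> real \<Rightarrow> real \<Rightarrow> real" where
  "weight w m \<xi> = japanese \<xi> powr m * exp (w * japanese \<xi>)"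

text \<open>The squared analytic norm, read on a spectral density and not on the function itself; so
  it does not involve the choice made in \<open>fourier\<close>.\<close>

definition wnorm :: "real \<Rightarrow> real \<Rightarrow> (real \<Rightarrow> complex) \<Rightarrow> ennreal" where
  "wnorm w m h = L2sq (\<lambda>\<xi>. complex_of_real (weight w m \<xi>) * h \<xi>)"

lemma weight_pos [simp]: "0 < weight w m \<xi>" "0 \<le> weight w m \<xi>" "weight w m \<xi> \<noteq> 0"
  using japanese_pos[of \<xi>] by (auto simp: weight_def)

lemma weight_measurable [measurable]: "weight w m \<in> borel_measurable borel"
  unfolding weight_def by measurable

lemma weight_minus [simp]: "weight w m (- \<xi>) = weight w m \<xi>"
  by (simp add: weight_def)

lemma wnorm_alt: "wnorm w m h = (\<integral>\<^sup>+ \<xi>. ennreal ((weight w m \<xi> * cmod (h \<xi>))\<^sup>2) \<partial>lborel)"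
  by (simp add: wnorm_def L2sq_def norm_mult abs_of_nonneg)

lemma Hnorm_sq_eq_wnorm: "Hnorm_sq w m \<psi> = wnorm w m (fourier \<psi>)"
proof -
  have "(weight w m \<xi>)\<^sup>2 = japanese \<xi> powr (2 * m) * exp (2 * w * japanese \<xi>)" for \<xi>
  proof -
    have "(japanese \<xi> powr m)\<^sup>2 = japanese \<xi> powr (2 * m)"
      by (simp add: power2_eq_square powr_add[symmetric])
    moreover have "(exp (w * japanese \<xi>))\<^sup>2 = exp (2 * w * japanese \<xi>)"
      by (simp add: exp_double[symmetric] mult.assoc)
    ultimately show ?thesis by (simp add: weight_def power_mult_distrib)
  qed
  then show ?thesis unfolding Hnorm_sq_def wnorm_alt by (simp add: power_mult_distrib)
qed

lemma wnorm_cong_AE: "AE \<xi> in lborel. h \<xi> = k \<xi> \<Longrightarrow> wnorm w m h = wnorm w m k"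
  unfolding wnorm_def by (rule L2sq_cong_AE) auto

lemma wnorm_00: "wnorm 0 0 h = L2sq h"
  by (simp add: wnorm_def weight_def)

lemma wnorm_add:
  assumes [measurable]: "h \<in> borel_measurable borel" "k \<in> borel_measurable borel"
  shows "wnorm w m (\<lambda>\<xi>. h \<xi> + k \<xi>) \<le> 2 * wnorm w m h + 2 * wnorm w m k"
  unfolding wnorm_def distrib_left by (rule L2sq_add) measurable

lemma wnorm_diff:
  assumes [measurable]: "h \<in> borel_measurable borel" "k \<in> borel_measurable borel"
  shows "wnorm w m (\<lambda>\<xi>. h \<xi> - k \<xi>) \<le> 2 * wnorm w m h + 2 * wnorm w m k"
  unfolding wnorm_def right_diff_distrib by (rule L2sq_diff) measurable

lemma wnorm_cmult:
  assumes [measurable]: "h \<in> borel_measurable borel"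
  shows "wnorm w m (\<lambda>\<xi>. c * h \<xi>) = ennreal ((cmod c)\<^sup>2) * wnorm w m h"
  unfolding wnorm_def by (subst L2sq_cmult[symmetric]) (auto simp: mult_ac)

lemma wnorm_mono_pw:
  assumes "\<And>\<xi>. weight w m \<xi> * cmod (h \<xi>) \<le> weight w' m' \<xi> * cmod (k \<xi>)"
  shows "wnorm w m h \<le> wnorm w' m' k"
  unfolding wnorm_def by (rule L2sq_mono) (simp add: norm_mult abs_of_nonneg assms)

lemma weight_mono: "w \<le> w' \<Longrightarrow> m \<le> m' \<Longrightarrow> weight w m \<xi> \<le> weight w' m' \<xi>"
  unfolding weight_def by (intro mult_mono powr_mono) (auto intro: mult_right_mono)

lemma wnorm_mono: "w \<le> w' \<Longrightarrow> m \<le> m' \<Longrightarrow> wnorm w m h \<le> wnorm w' m' h"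
  by (rule wnorm_mono_pw) (auto intro!: mult_right_mono weight_mono)

text \<open>Take \<open>y \<le> exp y\<close> at \<open>y = d * x / n\<close> and raise it to a
  power \<open>n\<close> that is at least \<open>m\<close>.\<close>

lemma powr_exp_bound:
  fixes m d :: real
  assumes d: "d > 0"
  shows "\<exists>C>0. \<forall>x\<ge>1. x powr m \<le> C * exp (d * x)"
proof -
  define n where "n = Suc (nat \<lceil>\<bar>m\<bar>\<rceil>)"
  have n: "real n \<ge> m" "n > 0" unfolding n_def by linarith+
  have "x powr m \<le> (real n / d) ^ n * exp (d * x)" if x: "x \<ge> 1" for x
  proof -
    have "x powr m \<le> x powr real n" using x n by (intro powr_mono) auto
    also have "\<dots> = (real n / d) ^ n * (d * x / real n) ^ n"
      using x n d by (simp add: powr_realpow power_mult_distrib[symmetric])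
    also have "\<dots> \<le> (real n / d) ^ n * exp (d * x / real n) ^ n"
      using x n d by (intro mult_left_mono power_mono order_trans[OF _ exp_ge_add_one_self]) auto
    also have "exp (d * x / real n) ^ n = exp (d * x)"
      using n by (simp add: exp_of_nat_mult[symmetric])
    finally show ?thesis .
  qed
  moreover have "(real n / d) ^ n > 0" using n d by simp
  ultimately show ?thesis by blast
qed

text \<open>The exponential gap \<open>c' - c\<close> beats every power, so \<open>m\<close> and
  \<open>m'\<close> are arbitrary: a slightly larger radius pays for any number of
  derivatives.\<close>

lemma wnorm_absorb:
  assumes "c < c'"
  shows "\<exists>C>0. \<forall>h. h \<in> borel_measurable borel \<longrightarrow> wnorm c m h \<le> ennreal C * wnorm c' m' h"
proof -
  obtain C where C: "C > 0" "\<And>x. x \<ge> 1 \<Longrightarrow> x powr (m - m') \<le> C * exp ((c' - c) * x)"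
    using powr_exp_bound[of "c' - c" "m - m'"] assms by auto
  have W: "weight c m \<xi> \<le> C * weight c' m' \<xi>" for \<xi>
  proof -
    have "weight c m \<xi> = japanese \<xi> powr (m - m') * (japanese \<xi> powr m' * exp (c * japanese \<xi>))"
      by (simp add: weight_def powr_diff)
    also have "\<dots> \<le> (C * exp ((c' - c) * japanese \<xi>)) * (japanese \<xi> powr m' * exp (c * japanese \<xi>))"
      by (intro mult_right_mono C) auto
    also have "\<dots> = C * weight c' m' \<xi>"
      by (simp add: weight_def left_diff_distrib exp_diff)
    finally show ?thesis .
  qed
  have "wnorm c m h \<le> ennreal (C\<^sup>2) * wnorm c' m' h" if [measurable]: "h \<in> borel_measurable borel" for h
  proof -
    have "wnorm c m h \<le> wnorm c' m' (\<lambda>\<xi>. complex_of_real C * h \<xi>)"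
    proof (rule wnorm_mono_pw)
      fix \<xi>
      have "weight c m \<xi> * cmod (h \<xi>) \<le> (C * weight c' m' \<xi>) * cmod (h \<xi>)"
        by (rule mult_right_mono[OF W]) simp
      then show "weight c m \<xi> * cmod (h \<xi>) \<le> weight c' m' \<xi> * cmod (complex_of_real C * h \<xi>)"
        using C by (simp add: norm_mult mult_ac)
    qed
    also have "\<dots> = ennreal (C\<^sup>2) * wnorm c' m' h" by (subst wnorm_cmult) auto
    finally show ?thesis .
  qed
  moreover have "C\<^sup>2 > 0" using C by simp
  ultimately show ?thesis by blast
qed

text \<open>The constant of the Sobolev embedding of order \<open>s\<close> into bounded functions.
  It is meaningful for \<open>s > 1/2\<close>; \<open>enn2real\<close> turns an infinite integral
  into 0.\<close>

definition japanese_int :: "real \<Rightarrow> real" where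
  "japanese_int s = enn2real (\<integral>\<^sup>+ \<xi>. ennreal (japanese \<xi> powr (- (2 * s))) \<partial>lborel)"

lemma japanese_int_finite:
  assumes "s > 1/2"
  shows "(\<integral>\<^sup>+ \<xi>. ennreal (japanese \<xi> powr (- (2 * s))) \<partial>lborel) = ennreal (japanese_int s)"
proof -
  have hi: "((\<lambda>x. x powr (- (2 * s))) has_integral - (1 powr (- (2 * s) + 1)) / (- (2 * s) + 1)) {1..}"
    by (rule has_integral_powr_to_inf) (use assms in auto)
  have I: "(\<integral>\<^sup>+ x. ennreal (x powr (- (2 * s))) * indicator {1..} x \<partial>lborel) < \<infinity>"
    by (subst nn_integral_has_integral_lebesgue'[OF _ hi]) auto
  \<comment> \<open>The slopes 1 and -1 cover the two half-lines, on which
    \<open>1 + \<bar>x\<bar>\<close> is an affine function.\<close>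
  have I2: "(\<integral>\<^sup>+ x. ennreal ((1 + r * x) powr (- (2 * s))) * indicator {1..} (1 + r * x) \<partial>lborel) < \<infinity>" if "\<bar>r\<bar> = 1" for r
  proof -
    have "r \<noteq> 0" using that by auto
    from nn_integral_real_affine[OF _ this, of "\<lambda>x. ennreal (x powr (- (2 * s))) * indicator {1..} x" 1] I that
    show ?thesis by simp
  qed
  have "(\<integral>\<^sup>+ \<xi>. ennreal (japanese \<xi> powr (- (2 * s))) \<partial>lborel) \<le>
    (\<integral>\<^sup>+ x. ennreal (2 powr (2 * s)) * (ennreal ((1 + 1 * x) powr (- (2 * s))) * indicator {1..} (1 + 1 * x) +
       ennreal ((1 + (-1) * x) powr (- (2 * s))) * indicator {1..} (1 + (-1) * x)) \<partial>lborel)"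
  proof (rule nn_integral_mono)
    fix x :: real
    have "japanese x powr (- (2 * s)) \<le> ((1 + \<bar>x\<bar>) / 2) powr (- (2 * s))"
      using assms by (intro powr_mono2' japanese_ge_half) auto
    also have "\<dots> = 2 powr (2 * s) * (1 + \<bar>x\<bar>) powr (- (2 * s))"
      by (simp add: powr_divide powr_minus field_simps)
    finally have "ennreal (japanese x powr (- (2 * s))) \<le> ennreal (2 powr (2 * s)) * ennreal ((1 + \<bar>x\<bar>) powr (- (2 * s)))"
      by (subst ennreal_mult[symmetric]) (auto intro: ennreal_leI)
    also have "\<dots> \<le> ennreal (2 powr (2 * s)) * (ennreal ((1 + 1 * x) powr (- (2 * s))) * indicator {1..} (1 + 1 * x) +
       ennreal ((1 + (-1) * x) powr (- (2 * s))) * indicator {1..} (1 + (-1) * x))"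
      by (intro mult_left_mono) (auto simp: abs_if indicator_def)
    finally show "ennreal (japanese x powr (- (2 * s))) \<le> ennreal (2 powr (2 * s)) * (ennreal ((1 + 1 * x) powr (- (2 * s))) * indicator {1..} (1 + 1 * x) +
       ennreal ((1 + (-1) * x) powr (- (2 * s))) * indicator {1..} (1 + (-1) * x))" .
  qed
  also have "\<dots> < \<infinity>"
    using I2[of 1] I2[of "-1"] by (subst nn_integral_cmult, simp, subst nn_integral_add) (auto simp: ennreal_mult_less_top)
  finally show ?thesis unfolding japanese_int_def by (simp add: less_top)
qed

lemma japanese_int_nonneg [simp]: "japanese_int s \<ge> 0" by (simp add: japanese_int_def)

text \<open>Cauchy-Schwarz after inserting \<open>japanese \<xi> powr (- s)\<close> and its inverse.
  The exponential radius is the same on both sides, so only polynomial order is paid.\<close>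

lemma L1_bound:
  assumes s: "s > 1/2" and [measurable]: "h \<in> borel_measurable borel"
  shows "(\<integral>\<^sup>+ \<xi>. ennreal (weight w 0 \<xi> * cmod (h \<xi>)) \<partial>lborel)\<^sup>2 \<le> ennreal (japanese_int s) * wnorm w s h"
proof -
  have "ennreal (weight w 0 \<xi> * cmod (h \<xi>)) = ennreal (japanese \<xi> powr (- s)) * ennreal (weight w s \<xi> * cmod (h \<xi>))" for \<xi>
    by (subst ennreal_mult[symmetric]) (auto simp: weight_def powr_minus)
  then have "(\<integral>\<^sup>+ \<xi>. ennreal (weight w 0 \<xi> * cmod (h \<xi>)) \<partial>lborel)\<^sup>2 \<le>
     (\<integral>\<^sup>+ \<xi>. (ennreal (japanese \<xi> powr (- s)))\<^sup>2 \<partial>lborel) * (\<integral>\<^sup>+ \<xi>. (ennreal (weight w s \<xi> * cmod (h \<xi>)))\<^sup>2 \<partial>lborel)"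
    by (simp only:) (rule Cauchy_Schwarz_nn_integral, auto)
  also have "(\<lambda>\<xi>. (ennreal (japanese \<xi> powr (- s)))\<^sup>2) = (\<lambda>\<xi>. ennreal (japanese \<xi> powr (- (2 * s))))"
  proof
    fix \<xi>
    have "(ennreal (japanese \<xi> powr (- s)))\<^sup>2 = ennreal ((japanese \<xi> powr (- s))\<^sup>2)" by (simp add: ennreal_power)
    also have "(japanese \<xi> powr (- s))\<^sup>2 = japanese \<xi> powr (- (2 * s))" unfolding power2_eq_square powr_add[symmetric] by simp
    finally show "(ennreal (japanese \<xi> powr (- s)))\<^sup>2 = ennreal (japanese \<xi> powr (- (2 * s)))" .
  qed
  also have "(\<integral>\<^sup>+ \<xi>. (ennreal (weight w s \<xi> * cmod (h \<xi>)))\<^sup>2 \<partial>lborel) = wnorm w s h"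
    by (simp add: wnorm_alt ennreal_power)
  finally show ?thesis by (simp only: japanese_int_finite[OF s])
qed

lemma integrable_of_wnorm:
  assumes s: "s > 1/2" and w: "w \<ge> 0" and [measurable]: "h \<in> borel_measurable borel" and f: "wnorm w s h < \<infinity>"
  shows "integrable lborel h"
proof (rule integrableI_bounded)
  have "(\<integral>\<^sup>+ \<xi>. ennreal (norm (h \<xi>)) \<partial>lborel) \<le> (\<integral>\<^sup>+ \<xi>. ennreal (weight w 0 \<xi> * cmod (h \<xi>)) \<partial>lborel)"
  proof (intro nn_integral_mono ennreal_leI)
    fix \<xi>
    have "1 * cmod (h \<xi>) \<le> weight w 0 \<xi> * cmod (h \<xi>)"
      using w by (intro mult_right_mono) (auto simp: weight_def)
    then show "norm (h \<xi>) \<le> weight w 0 \<xi> * cmod (h \<xi>)" by simp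
  qed
  moreover have "(\<integral>\<^sup>+ \<xi>. ennreal (weight w 0 \<xi> * cmod (h \<xi>)) \<partial>lborel)\<^sup>2 < \<infinity>"
    by (rule order.strict_trans1[OF L1_bound[OF s]]) (use f in \<open>auto simp: ennreal_mult_less_top\<close>)
  ultimately show "(\<integral>\<^sup>+ \<xi>. ennreal (norm (h \<xi>)) \<partial>lborel) < \<infinity>"
    by (auto simp: power_less_top_ennreal elim: order.strict_trans1)
qed measurable

lemma sqi_of_wnorm:
  assumes "w \<ge> 0" "m \<ge> 0" "h \<in> borel_measurable borel" "wnorm w m h < \<infinity>"
  shows "square_integrable h"
  using assms wnorm_mono[of 0 w 0 m h] by (auto simp: sqi_iff wnorm_00 elim: order.strict_trans1)

text \<open>Sobolev embedding: the transform is bounded by the integral of the modulus of the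
  density, the normalising factor \<open>1 / sqrt (2 * pi)\<close> being at most 1.\<close>

lemma fourier_int_sup_bound:
  assumes s: "s > 1/2" and [measurable]: "h \<in> borel_measurable borel"
  shows "ennreal ((cmod (fourier_int r h x))\<^sup>2) \<le> ennreal (japanese_int s) * wnorm 0 s h"
proof -
  have "cmod (complex_of_real (1 / sqrt (2 * pi))) \<le> 1"
    using pi_gt3 by (simp only: norm_of_real) (simp add: real_le_rsqrt)
  then have "cmod (fourier_int r h x) \<le> cmod (LINT \<xi>|lborel. iexp (r * \<xi> * x) * h \<xi>)"
    unfolding fourier_int_def norm_mult by (rule mult_left_le_one_le[OF norm_ge_zero norm_ge_zero])
  then have "ennreal (cmod (fourier_int r h x)) \<le> ennreal (cmod (LINT \<xi>|lborel. iexp (r * \<xi> * x) * h \<xi>))"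
    by (rule ennreal_leI)
  also have "\<dots> \<le> (\<integral>\<^sup>+ \<xi>. ennreal (cmod (iexp (r * \<xi> * x) * h \<xi>)) \<partial>lborel)"
    by (rule integral_norm_bound_ennreal') measurable
  also have "\<dots> = (\<integral>\<^sup>+ \<xi>. ennreal (weight 0 0 \<xi> * cmod (h \<xi>)) \<partial>lborel)"
    by (simp add: norm_mult weight_def)
  finally have "ennreal (cmod (fourier_int r h x)) ^ 2 \<le> (\<integral>\<^sup>+ \<xi>. ennreal (weight 0 0 \<xi> * cmod (h \<xi>)) \<partial>lborel)\<^sup>2"
    by (rule power_mono) simp
  also have "\<dots> \<le> ennreal (japanese_int s) * wnorm 0 s h" by (rule L1_bound[OF s]) measurable
  finally show ?thesis by (simp add: ennreal_power)
qed

section \<open>Young's inequality and tame convolution estimates\<close>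

text \<open>Write \<open>B\<close> as a product of two square roots, apply Cauchy-Schwarz for fixed
  \<xi>, and exchange the order of integration.\<close>

lemma Young_nn:
  fixes A B :: "real \<Rightarrow> real"
  assumes [measurable]: "A \<in> borel_measurable borel" "B \<in> borel_measurable borel"
    and A0: "\<And>x. A x \<ge> 0" and B0: "\<And>x. B x \<ge> 0"
  shows "(\<integral>\<^sup>+ \<xi>. (\<integral>\<^sup>+ \<eta>. ennreal (A \<eta> * B (\<xi> - \<eta>)) \<partial>lborel)\<^sup>2 \<partial>lborel) \<le>
    (\<integral>\<^sup>+ \<eta>. ennreal ((A \<eta>)\<^sup>2) \<partial>lborel) * (\<integral>\<^sup>+ \<eta>. ennreal (B \<eta>) \<partial>lborel)\<^sup>2"
proof -
  let ?b = "\<integral>\<^sup>+ \<eta>. ennreal (B \<eta>) \<partial>lborel"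
  have refl: "(\<integral>\<^sup>+ \<eta>. ennreal (B (\<xi> - \<eta>)) \<partial>lborel) = ?b" for \<xi>
    by (subst nn_integral_real_affine[where c="-1" and t=\<xi>]) auto
  have shift: "(\<integral>\<^sup>+ \<xi>. ennreal (B (\<xi> - \<eta>)) \<partial>lborel) = ?b" for \<eta>
    by (subst nn_integral_real_affine[where c=1 and t=\<eta>]) auto
  have "(\<integral>\<^sup>+ \<eta>. ennreal (A \<eta> * B (\<xi> - \<eta>)) \<partial>lborel)\<^sup>2 \<le> (\<integral>\<^sup>+ \<eta>. ennreal ((A \<eta>)\<^sup>2) * ennreal (B (\<xi> - \<eta>)) \<partial>lborel) * ?b" for \<xi>
  proof -
    have "ennreal (A \<eta> * B (\<xi> - \<eta>)) = ennreal (A \<eta> * sqrt (B (\<xi> - \<eta>))) * ennreal (sqrt (B (\<xi> - \<eta>)))" for \<eta>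
      using A0 B0 by (subst ennreal_mult[symmetric]) auto
    then have "(\<integral>\<^sup>+ \<eta>. ennreal (A \<eta> * B (\<xi> - \<eta>)) \<partial>lborel)\<^sup>2 \<le>
       (\<integral>\<^sup>+ \<eta>. (ennreal (A \<eta> * sqrt (B (\<xi> - \<eta>))))\<^sup>2 \<partial>lborel) * (\<integral>\<^sup>+ \<eta>. (ennreal (sqrt (B (\<xi> - \<eta>))))\<^sup>2 \<partial>lborel)"
      by (simp only:) (rule Cauchy_Schwarz_nn_integral, auto)
    also have "(\<lambda>\<eta>. (ennreal (A \<eta> * sqrt (B (\<xi> - \<eta>))))\<^sup>2) = (\<lambda>\<eta>. ennreal ((A \<eta>)\<^sup>2) * ennreal (B (\<xi> - \<eta>)))"
      using A0 B0 by (auto simp: ennreal_power power_mult_distrib ennreal_mult fun_eq_iff)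
    also have "(\<lambda>\<eta>. (ennreal (sqrt (B (\<xi> - \<eta>))))\<^sup>2) = (\<lambda>\<eta>. ennreal (B (\<xi> - \<eta>)))"
      using B0 by (auto simp: ennreal_power)
    finally show ?thesis by (simp only: refl)
  qed
  then have "(\<integral>\<^sup>+ \<xi>. (\<integral>\<^sup>+ \<eta>. ennreal (A \<eta> * B (\<xi> - \<eta>)) \<partial>lborel)\<^sup>2 \<partial>lborel) \<le>
     (\<integral>\<^sup>+ \<xi>. (\<integral>\<^sup>+ \<eta>. ennreal ((A \<eta>)\<^sup>2) * ennreal (B (\<xi> - \<eta>)) \<partial>lborel) * ?b \<partial>lborel)"
    by (rule nn_integral_mono)
  also have "\<dots> = (\<integral>\<^sup>+ \<xi>. (\<integral>\<^sup>+ \<eta>. ennreal ((A \<eta>)\<^sup>2) * ennreal (B (\<xi> - \<eta>)) \<partial>lborel) \<partial>lborel) * ?b"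
    by (rule nn_integral_multc) measurable
  also have "(\<integral>\<^sup>+ \<xi>. (\<integral>\<^sup>+ \<eta>. ennreal ((A \<eta>)\<^sup>2) * ennreal (B (\<xi> - \<eta>)) \<partial>lborel) \<partial>lborel) =
     (\<integral>\<^sup>+ \<eta>. (\<integral>\<^sup>+ \<xi>. ennreal ((A \<eta>)\<^sup>2) * ennreal (B (\<xi> - \<eta>)) \<partial>lborel) \<partial>lborel)"
    by (rule lborel_pair.Fubini') measurable
  also have "\<dots> = (\<integral>\<^sup>+ \<eta>. ennreal ((A \<eta>)\<^sup>2) \<partial>lborel) * ?b"
    by (subst nn_integral_cmult) (auto simp: shift nn_integral_multc)
  finally show ?thesis by (simp add: power2_eq_square mult_ac)
qed

text \<open>The factor makes convolution of densities correspond exactly to multiplication of the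
  functions.\<close>

definition conv :: "(real \<Rightarrow> complex) \<Rightarrow> (real \<Rightarrow> complex) \<Rightarrow> real \<Rightarrow> complex" where
  "conv h k \<xi> = complex_of_real (1 / sqrt (2 * pi)) * (LINT \<eta>|lborel. h \<eta> * k (\<xi> - \<eta>))"

lemma conv_measurable [measurable]:
  assumes [measurable]: "h \<in> borel_measurable borel" "k \<in> borel_measurable borel"
  shows "conv h k \<in> borel_measurable borel"
  unfolding conv_def by measurable

text \<open>Since \<open>japanese (\<eta> + \<zeta>)\<close> is at most twice the larger summand,
  the polynomial weight falls on one factor at the price \<open>2 powr m\<close>. Subadditivity of
  \<open>japanese\<close> and \<open>w \<ge> 0\<close> split the exponential with constant
  1.\<close>

lemma weight_submult:
  assumes "m \<ge> 0" "w \<ge> 0"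
  shows "weight w m (\<eta> + \<zeta>) \<le> 2 powr m * (weight w m \<eta> * weight w 0 \<zeta> + weight w 0 \<eta> * weight w m \<zeta>)"
proof -
  have "japanese (\<eta> + \<zeta>) powr m \<le> (2 * max (japanese \<eta>) (japanese \<zeta>)) powr m"
    using japanese_triangle[of \<eta> \<zeta>] assms by (intro powr_mono2) auto
  also have "\<dots> = 2 powr m * (max (japanese \<eta>) (japanese \<zeta>)) powr m"
    by (rule powr_mult)
  also have "(max (japanese \<eta>) (japanese \<zeta>)) powr m \<le> japanese \<eta> powr m + japanese \<zeta> powr m"
    by (auto simp: max_def)
  finally have 1: "japanese (\<eta> + \<zeta>) powr m \<le> 2 powr m * (japanese \<eta> powr m + japanese \<zeta> powr m)"
    by (simp add: mult_left_mono)
  have 2: "exp (w * japanese (\<eta> + \<zeta>)) \<le> exp (w * japanese \<eta>) * exp (w * japanese \<zeta>)"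
    using japanese_triangle[of \<eta> \<zeta>] assms by (simp add: exp_add[symmetric] distrib_left[symmetric] mult_left_mono)
  have "weight w m (\<eta> + \<zeta>) \<le> (2 powr m * (japanese \<eta> powr m + japanese \<zeta> powr m)) * (exp (w * japanese \<eta>) * exp (w * japanese \<zeta>))"
    unfolding weight_def by (intro mult_mono 1 2) auto
  also have "\<dots> = 2 powr m * (weight w m \<eta> * weight w 0 \<zeta> + weight w 0 \<eta> * weight w m \<zeta>)"
    by (simp add: weight_def algebra_simps)
  finally show ?thesis .
qed

text \<open>The square of \<open>2 powr m\<close> comes from \<open>weight_submult\<close>, the 2
  from squaring a sum of two terms, and \<open>japanese_int s\<close> from putting the low-order
  factor into L1.\<close>

definition tame_const :: "real \<Rightarrow> real \<Rightarrow> real" where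
  "tame_const m s = 2 * (2 powr m)\<^sup>2 * japanese_int s"

text \<open>
  The exponential weight is submultiplicative, so the constant does not depend on \<open>w\<close>; only the
  polynomial weight is split between the factors.
\<close>

lemma conv_tame:
  assumes m: "m \<ge> 0" and s: "s > 1/2" and w: "w \<ge> 0"
    and [measurable]: "h \<in> borel_measurable borel" "k \<in> borel_measurable borel"
  shows "wnorm w m (conv h k) \<le> ennreal (tame_const m s) * (wnorm w m h * wnorm w s k + wnorm w s h * wnorm w m k)"
proof -
  define A1 B1 A2 B2 where "A1 \<xi> = weight w m \<xi> * cmod (h \<xi>)" and "B1 \<xi> = weight w 0 \<xi> * cmod (k \<xi>)"
    and "A2 \<xi> = weight w m \<xi> * cmod (k \<xi>)" and "B2 \<xi> = weight w 0 \<xi> * cmod (h \<xi>)" for \<xi>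
  have [measurable]: "A1 \<in> borel_measurable borel" "B1 \<in> borel_measurable borel" "A2 \<in> borel_measurable borel" "B2 \<in> borel_measurable borel"
    unfolding A1_def B1_def A2_def B2_def by measurable
  have nn: "A1 x \<ge> 0" "B1 x \<ge> 0" "A2 x \<ge> 0" "B2 x \<ge> 0" for x by (auto simp: A1_def B1_def A2_def B2_def)
  define I1 I2 where "I1 \<xi> = (\<integral>\<^sup>+ \<eta>. ennreal (A1 \<eta> * B1 (\<xi> - \<eta>)) \<partial>lborel)"
    and "I2 \<xi> = (\<integral>\<^sup>+ \<eta>. ennreal (A2 \<eta> * B2 (\<xi> - \<eta>)) \<partial>lborel)" for \<xi>
  have [measurable]: "I1 \<in> borel_measurable borel" "I2 \<in> borel_measurable borel"
    unfolding I1_def I2_def by measurable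
  define p where "p = 2 powr m"
  have p: "p \<ge> 0" by (simp add: p_def)
  \<comment> \<open>The reflection of \<eta> into \<xi> - \<eta> exchanges the factors, so that
    Young's inequality can also be used with the high-order weight on \<open>k\<close>.\<close>
  have I2': "I2 \<xi> = (\<integral>\<^sup>+ \<eta>. ennreal (B2 \<eta> * A2 (\<xi> - \<eta>)) \<partial>lborel)" for \<xi>
    unfolding I2_def by (subst nn_integral_real_affine[where c="-1" and t=\<xi>]) (auto simp: mult.commute)
  have c1: "cmod (complex_of_real (1 / sqrt (2 * pi))) \<le> 1"
    using pi_gt3 by (simp only: norm_of_real) (simp add: real_le_rsqrt)
  have "ennreal (weight w m \<xi> * cmod (conv h k \<xi>)) \<le> ennreal p * (I1 \<xi> + I2 \<xi>)" for \<xi>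
  proof -
    have "cmod (conv h k \<xi>) \<le> cmod (LINT \<eta>|lborel. h \<eta> * k (\<xi> - \<eta>))"
      unfolding conv_def norm_mult by (rule mult_left_le_one_le[OF norm_ge_zero norm_ge_zero c1])
    then have "ennreal (cmod (conv h k \<xi>)) \<le> (\<integral>\<^sup>+ \<eta>. ennreal (cmod (h \<eta> * k (\<xi> - \<eta>))) \<partial>lborel)"
      by (intro order_trans[OF ennreal_leI integral_norm_bound_ennreal']) measurable
    then have "ennreal (weight w m \<xi>) * ennreal (cmod (conv h k \<xi>)) \<le> ennreal (weight w m \<xi>) * (\<integral>\<^sup>+ \<eta>. ennreal (cmod (h \<eta> * k (\<xi> - \<eta>))) \<partial>lborel)"
      by (rule mult_left_mono) simp
    also have "\<dots> = (\<integral>\<^sup>+ \<eta>. ennreal (weight w m \<xi> * (cmod (h \<eta>) * cmod (k (\<xi> - \<eta>)))) \<partial>lborel)"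
      by (subst nn_integral_cmult[symmetric]) (auto simp: norm_mult ennreal_mult)
    also have "\<dots> \<le> (\<integral>\<^sup>+ \<eta>. ennreal (p * (A1 \<eta> * B1 (\<xi> - \<eta>) + B2 \<eta> * A2 (\<xi> - \<eta>))) \<partial>lborel)"
    proof (intro nn_integral_mono ennreal_leI)
      fix \<eta>
      have "weight w m \<xi> * (cmod (h \<eta>) * cmod (k (\<xi> - \<eta>))) \<le>
         (p * (weight w m \<eta> * weight w 0 (\<xi> - \<eta>) + weight w 0 \<eta> * weight w m (\<xi> - \<eta>))) * (cmod (h \<eta>) * cmod (k (\<xi> - \<eta>)))"
        using weight_submult[OF m w, of \<eta> "\<xi> - \<eta>"] by (intro mult_right_mono) (auto simp: p_def)
      also have "\<dots> = p * (A1 \<eta> * B1 (\<xi> - \<eta>) + B2 \<eta> * A2 (\<xi> - \<eta>))"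
        by (simp add: A1_def B1_def A2_def B2_def algebra_simps)
      finally show "weight w m \<xi> * (cmod (h \<eta>) * cmod (k (\<xi> - \<eta>))) \<le> p * (A1 \<eta> * B1 (\<xi> - \<eta>) + B2 \<eta> * A2 (\<xi> - \<eta>))" .
    qed
    also have "\<dots> = ennreal p * (I1 \<xi> + I2 \<xi>)"
      unfolding I1_def I2' using nn p
      by (subst nn_integral_add[symmetric], simp, simp, subst nn_integral_cmult[symmetric]) (auto simp: ennreal_mult ennreal_plus)
    finally show ?thesis by (simp add: ennreal_mult)
  qed
  then have "ennreal (weight w m \<xi> * cmod (conv h k \<xi>)) ^ 2 \<le> (ennreal p * (I1 \<xi> + I2 \<xi>)) ^ 2" for \<xi>
    by (rule power_mono) simp
  also have "(ennreal p * (I1 \<xi> + I2 \<xi>)) ^ 2 \<le> ennreal (2 * p\<^sup>2) * ((I1 \<xi>)\<^sup>2 + (I2 \<xi>)\<^sup>2)" for \<xi>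
  proof -
    have "(a + b)\<^sup>2 \<le> 2 * (a\<^sup>2 + b\<^sup>2)" for a b :: ennreal
    proof (cases "a = \<infinity> \<or> b = \<infinity>")
      case False
      then obtain x y where "a = ennreal x" "b = ennreal y" "x \<ge> 0" "y \<ge> 0"
        by (metis ennreal_cases infinity_ennreal_def)
      moreover have "(x + y)\<^sup>2 \<le> 2 * (x\<^sup>2 + y\<^sup>2)"
        using zero_le_power2[of "x - y"] by (simp add: power2_eq_square algebra_simps)
      moreover have "(2::ennreal) = ennreal 2" by simp
      ultimately show ?thesis
        by (simp only: ennreal_plus[symmetric] ennreal_power ennreal_mult[symmetric] zero_le_power2 add_nonneg_nonneg zero_le_numeral ennreal_leI)
    qed (auto simp: ennreal_mult_top power2_eq_square ennreal_top_mult)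
    then have "(ennreal p)\<^sup>2 * (I1 \<xi> + I2 \<xi>)\<^sup>2 \<le> (ennreal p)\<^sup>2 * (2 * ((I1 \<xi>)\<^sup>2 + (I2 \<xi>)\<^sup>2))"
      by (intro mult_left_mono) auto
    also have "\<dots> = ennreal (2 * p\<^sup>2) * ((I1 \<xi>)\<^sup>2 + (I2 \<xi>)\<^sup>2)"
      using p by (simp only: ennreal_mult ennreal_power zero_le_numeral zero_le_power2 ennreal_numeral mult_ac)
    finally show ?thesis by (simp add: power_mult_distrib)
  qed
  finally have "wnorm w m (conv h k) \<le> (\<integral>\<^sup>+ \<xi>. ennreal (2 * p\<^sup>2) * ((I1 \<xi>)\<^sup>2 + (I2 \<xi>)\<^sup>2) \<partial>lborel)"
    unfolding wnorm_alt by (intro nn_integral_mono) (simp add: ennreal_power)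
  also have "\<dots> = ennreal (2 * p\<^sup>2) * ((\<integral>\<^sup>+ \<xi>. (I1 \<xi>)\<^sup>2 \<partial>lborel) + (\<integral>\<^sup>+ \<xi>. (I2 \<xi>)\<^sup>2 \<partial>lborel))"
    by (subst nn_integral_cmult) (auto simp: nn_integral_add)
  also have "\<dots> \<le> ennreal (2 * p\<^sup>2) * (wnorm w m h * (ennreal (japanese_int s) * wnorm w s k) + wnorm w m k * (ennreal (japanese_int s) * wnorm w s h))"
  proof (intro mult_left_mono add_mono)
    have "(\<integral>\<^sup>+ \<xi>. (I1 \<xi>)\<^sup>2 \<partial>lborel) \<le> (\<integral>\<^sup>+ \<eta>. ennreal ((A1 \<eta>)\<^sup>2) \<partial>lborel) * (\<integral>\<^sup>+ \<eta>. ennreal (B1 \<eta>) \<partial>lborel)\<^sup>2"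
      unfolding I1_def by (rule Young_nn) (auto simp: nn)
    also have "\<dots> \<le> wnorm w m h * (ennreal (japanese_int s) * wnorm w s k)"
      unfolding A1_def B1_def wnorm_alt[of w m, symmetric] by (intro mult_left_mono L1_bound[OF s]) auto
    finally show "(\<integral>\<^sup>+ \<xi>. (I1 \<xi>)\<^sup>2 \<partial>lborel) \<le> wnorm w m h * (ennreal (japanese_int s) * wnorm w s k)" .
    have "(\<integral>\<^sup>+ \<xi>. (I2 \<xi>)\<^sup>2 \<partial>lborel) \<le> (\<integral>\<^sup>+ \<eta>. ennreal ((A2 \<eta>)\<^sup>2) \<partial>lborel) * (\<integral>\<^sup>+ \<eta>. ennreal (B2 \<eta>) \<partial>lborel)\<^sup>2"
      unfolding I2_def by (rule Young_nn) (auto simp: nn)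
    also have "\<dots> \<le> wnorm w m k * (ennreal (japanese_int s) * wnorm w s h)"
      unfolding A2_def B2_def wnorm_alt[of w m, symmetric] by (intro mult_left_mono L1_bound[OF s]) auto
    finally show "(\<integral>\<^sup>+ \<xi>. (I2 \<xi>)\<^sup>2 \<partial>lborel) \<le> wnorm w m k * (ennreal (japanese_int s) * wnorm w s h)" .
  qed simp
  also have "\<dots> = ennreal (tame_const m s) * (wnorm w m h * wnorm w s k + wnorm w s h * wnorm w m k)"
  proof -
    have "ennreal (tame_const m s) = ennreal (2 * p\<^sup>2) * ennreal (japanese_int s)"
      unfolding tame_const_def p_def by (subst ennreal_mult) auto
    then show ?thesis by (simp add: distrib_left mult_ac)
  qed
  finally show ?thesis .
qed

lemma conv_tame_alg:
  assumes s: "s > 1/2" and w: "w \<ge> 0"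
    and "h \<in> borel_measurable borel" "k \<in> borel_measurable borel"
  shows "wnorm w s (conv h k) \<le> ennreal (2 * tame_const s s) * (wnorm w s h * wnorm w s k)"
proof -
  have "tame_const s s \<ge> 0" by (simp add: tame_const_def)
  have "wnorm w s (conv h k) \<le> ennreal (tame_const s s) * (wnorm w s h * wnorm w s k + wnorm w s h * wnorm w s k)"
    using s by (intro conv_tame assms) auto
  also have "\<dots> = ennreal (2 * tame_const s s) * (wnorm w s h * wnorm w s k)"
    using \<open>tame_const s s \<ge> 0\<close> by (simp only: mult_2[symmetric] ennreal_mult zero_le_numeral ennreal_numeral mult_ac)
  finally show ?thesis .
qed

section \<open>Products, derivatives and conjugates of Fourier integrals\<close>

lemma conv_fourier_int:
  assumes h: "integrable lborel h" and k: "integrable lborel k"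
  shows "fourier_int 1 h x * fourier_int 1 k x = fourier_int 1 (conv h k) x" and "integrable lborel (conv h k)"
proof -
  have [measurable]: "h \<in> borel_measurable borel" "k \<in> borel_measurable borel" using h k by auto
  let ?c = "complex_of_real (1 / sqrt (2 * pi))"
  have i0: "integrable (lborel \<Otimes>\<^sub>M lborel) (\<lambda>(\<eta>, \<xi>). h \<eta> * k (\<xi> - \<eta>))"
  proof (rule integrableI_bounded)
    have shift: "(\<integral>\<^sup>+ \<xi>. ennreal (cmod (k (\<xi> - \<eta>))) \<partial>lborel) = (\<integral>\<^sup>+ \<xi>. ennreal (cmod (k \<xi>)) \<partial>lborel)" for \<eta>
      by (subst nn_integral_real_affine[where c=1 and t=\<eta>]) auto
    have "(\<integral>\<^sup>+ z. ennreal (norm (case z of (\<eta>, \<xi>) \<Rightarrow> h \<eta> * k (\<xi> - \<eta>))) \<partial>(lborel \<Otimes>\<^sub>M lborel)) =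
        (\<integral>\<^sup>+ \<eta>. ennreal (norm (h \<eta>)) * (\<integral>\<^sup>+ \<xi>. ennreal (norm (k (\<xi> - \<eta>))) \<partial>lborel) \<partial>lborel)"
      by (subst lborel.nn_integral_fst[symmetric]) (auto simp: norm_mult ennreal_mult nn_integral_cmult)
    also have "\<dots> < \<infinity>"
      unfolding shift using h k by (auto simp: nn_integral_multc integrable_iff_bounded ennreal_mult_less_top)
    finally show "(\<integral>\<^sup>+ z. ennreal (norm (case z of (\<eta>, \<xi>) \<Rightarrow> h \<eta> * k (\<xi> - \<eta>))) \<partial>(lborel \<Otimes>\<^sub>M lborel)) < \<infinity>" .
  qed measurable
  have i1: "integrable (lborel \<Otimes>\<^sub>M lborel) (\<lambda>(\<eta>, \<xi>). iexp (1 * \<xi> * x) * (h \<eta> * k (\<xi> - \<eta>)))"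
    by (rule Bochner_Integration.integrable_bound[OF i0]) (auto simp: norm_mult split_beta')
  have "integrable (lborel \<Otimes>\<^sub>M lborel) (\<lambda>(\<xi>, \<eta>). h \<eta> * k (\<xi> - \<eta>))"
    using lborel_pair.integrable_product_swap[OF i0] by (simp add: split_beta')
  then have "integrable lborel (\<lambda>\<xi>. LINT \<eta>|lborel. h \<eta> * k (\<xi> - \<eta>))"
    by (rule lborel_pair.integrable_fst)
  then show "integrable lborel (conv h k)"
    unfolding conv_def by (rule integrable_mult_right)
  have "fourier_int 1 (conv h k) x = ?c * (LINT \<xi>|lborel. ?c * (LINT \<eta>|lborel. iexp (1 * \<xi> * x) * (h \<eta> * k (\<xi> - \<eta>))))"
    unfolding fourier_int_def conv_def
  proof (rule arg_cong2[where f="(*)", OF refl], rule Bochner_Integration.integral_cong[OF refl])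
    fix \<xi>
    show "iexp (1 * \<xi> * x) * (?c * (LINT \<eta>|lborel. h \<eta> * k (\<xi> - \<eta>))) = ?c * (LINT \<eta>|lborel. iexp (1 * \<xi> * x) * (h \<eta> * k (\<xi> - \<eta>)))"
      unfolding integral_mult_right_zero by (simp only: mult.left_commute)
  qed
  also have "\<dots> = ?c * (?c * (LINT \<eta>|lborel. (LINT \<xi>|lborel. iexp (1 * \<xi> * x) * (h \<eta> * k (\<xi> - \<eta>)))))"
    by (rule arg_cong2[where f="(*)", OF refl], subst lborel_pair.Fubini_integral[OF i1, symmetric], rule integral_mult_right_zero)
  also have "(\<lambda>\<eta>. LINT \<xi>|lborel. iexp (1 * \<xi> * x) * (h \<eta> * k (\<xi> - \<eta>))) = (\<lambda>\<eta>. iexp (1 * \<eta> * x) * h \<eta> * (LINT \<xi>|lborel. iexp (1 * \<xi> * x) * k \<xi>))"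
  proof
    fix \<eta>
    have "(LINT \<xi>|lborel. iexp (1 * \<xi> * x) * (h \<eta> * k (\<xi> - \<eta>))) = (LINT \<xi>|lborel. iexp (1 * (\<eta> + 1 * \<xi>) * x) * (h \<eta> * k ((\<eta> + 1 * \<xi>) - \<eta>)))"
      by (subst lborel_integral_real_affine[where c=1 and t=\<eta>]) auto
    also have "\<dots> = (LINT \<xi>|lborel. (iexp (1 * \<eta> * x) * h \<eta>) * (iexp (1 * \<xi> * x) * k \<xi>))"
      by (intro Bochner_Integration.integral_cong) (auto simp: algebra_simps exp_add)
    finally show "(LINT \<xi>|lborel. iexp (1 * \<xi> * x) * (h \<eta> * k (\<xi> - \<eta>))) = iexp (1 * \<eta> * x) * h \<eta> * (LINT \<xi>|lborel. iexp (1 * \<xi> * x) * k \<xi>)"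
      by (simp only: integral_mult_right_zero)
  qed
  also have "(LINT \<eta>|lborel. iexp (1 * \<eta> * x) * h \<eta> * (LINT \<xi>|lborel. iexp (1 * \<xi> * x) * k \<xi>)) = (LINT \<eta>|lborel. iexp (1 * \<eta> * x) * h \<eta>) * (LINT \<xi>|lborel. iexp (1 * \<xi> * x) * k \<xi>)"
    by (rule integral_mult_left_zero)
  also have "?c * (?c * ((LINT \<eta>|lborel. iexp (1 * \<eta> * x) * h \<eta>) * (LINT \<xi>|lborel. iexp (1 * \<xi> * x) * k \<xi>))) = fourier_int 1 h x * fourier_int 1 k x"
    unfolding fourier_int_def by (simp only: mult_ac)
  finally show "fourier_int 1 h x * fourier_int 1 k x = fourier_int 1 (conv h k) x" by simp
qed

text \<open>Bilinear expansion about the base point \<open>(h', k')\<close>. Every term on the right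
  contains a difference, which gives continuity of products in time.\<close>

lemma conv_diff_diff:
  assumes h: "square_integrable h" "square_integrable h'" and k: "square_integrable k" "square_integrable k'"
  shows "conv h k \<xi> - conv h' k' \<xi> = conv (\<lambda>\<eta>. h \<eta> - h' \<eta>) (\<lambda>\<eta>. k \<eta> - k' \<eta>) \<xi> + (conv h' (\<lambda>\<eta>. k \<eta> - k' \<eta>) \<xi> + conv (\<lambda>\<eta>. h \<eta> - h' \<eta>) k' \<xi>)"
proof -
  have refl: "square_integrable (\<lambda>\<eta>. k (\<xi> - \<eta>))" if "square_integrable k" for k
  proof -
    have [measurable]: "k \<in> borel_measurable borel" using that by auto
    have "L2sq (\<lambda>\<eta>. k (\<xi> - \<eta>)) = L2sq k"
      unfolding L2sq_def by (subst nn_integral_real_affine[where c="-1" and t=\<xi>]) auto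
    then show ?thesis using that by (auto simp: sqi_iff)
  qed
  have i: "integrable lborel (\<lambda>\<eta>. h \<eta> * k (\<xi> - \<eta>))" "integrable lborel (\<lambda>\<eta>. h' \<eta> * k (\<xi> - \<eta>))"
     "integrable lborel (\<lambda>\<eta>. h \<eta> * k' (\<xi> - \<eta>))" "integrable lborel (\<lambda>\<eta>. h' \<eta> * k' (\<xi> - \<eta>))"
    by (intro sqi_mult_integrable refl h k)+
  show ?thesis unfolding conv_def
    by (simp add: left_diff_distrib right_diff_distrib i diff_divide_distrib add_divide_distrib del: of_real_mult)
qed

text \<open>The second-order Taylor bound for the exponential, integrated against \<open>h\<close>,
  yields an explicit error \<open>B * (y - x)\<^sup>2\<close>; this is where the second moment of
  \<open>h\<close> enters.\<close>

lemma fourier_int_has_derivative: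
  assumes h: "integrable lborel h" "integrable lborel (\<lambda>\<xi>. complex_of_real \<xi> * h \<xi>)" "integrable lborel (\<lambda>\<xi>. complex_of_real (\<xi>\<^sup>2) * h \<xi>)"
  shows "(fourier_int 1 h has_vector_derivative fourier_int 1 (\<lambda>\<xi>. \<i> * complex_of_real \<xi> * h \<xi>) x) (at x)"
proof -
  have [measurable]: "h \<in> borel_measurable borel" using h by auto
  define B where "B = 1 / sqrt (2 * pi) * (LINT \<xi>|lborel. cmod (complex_of_real (\<xi>\<^sup>2) * h \<xi>))"
  have d: "integrable lborel (\<lambda>\<xi>. \<i> * complex_of_real \<xi> * h \<xi>)"
    using integrable_mult_right[OF h(2), of \<i>] by (simp add: mult.assoc)
  have bound: "cmod (fourier_int 1 h y - fourier_int 1 h x - (y - x) *\<^sub>R fourier_int 1 (\<lambda>\<xi>. \<i> * complex_of_real \<xi> * h \<xi>) x) \<le> B * (y - x)\<^sup>2" for y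
  proof -
    let ?k = "\<lambda>\<xi>. (iexp (\<xi> * (y - x)) - 1 - \<i> * complex_of_real (\<xi> * (y - x))) * h \<xi>"
    have kb: "cmod (?k \<xi>) \<le> (y - x)\<^sup>2 * cmod (complex_of_real (\<xi>\<^sup>2) * h \<xi>)" for \<xi>
    proof -
      have "cmod (iexp (\<xi> * (y - x)) - 1 - \<i> * complex_of_real (\<xi> * (y - x))) \<le> \<bar>\<xi> * (y - x)\<bar>\<^sup>2 / 2"
        using iexp_approx1[of "\<xi> * (y - x)" 1] by (simp add: diff_diff_eq numeral_2_eq_2)
      also have "\<dots> \<le> (y - x)\<^sup>2 * \<xi>\<^sup>2" by (simp add: power_mult_distrib)
      finally show ?thesis
        by (simp add: norm_mult mult_right_mono mult.assoc[symmetric] norm_power)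
    qed
    have ki: "integrable lborel ?k"
      by (rule Bochner_Integration.integrable_bound[OF integrable_mult_right[OF integrable_norm[OF h(3)], of "(y - x)\<^sup>2"]])
         (use kb in \<open>auto simp: abs_of_nonneg intro!: AE_I2\<close>)
    have "fourier_int 1 h y - fourier_int 1 h x - (y - x) *\<^sub>R fourier_int 1 (\<lambda>\<xi>. \<i> * complex_of_real \<xi> * h \<xi>) x = fourier_int 1 ?k x"
    proof -
      have i1: "integrable lborel (\<lambda>\<xi>. iexp (1 * \<xi> * y) * h \<xi>)" "integrable lborel (\<lambda>\<xi>. iexp (1 * \<xi> * x) * h \<xi>)"
        "integrable lborel (\<lambda>\<xi>. complex_of_real (y - x) * (iexp (1 * \<xi> * x) * (\<i> * complex_of_real \<xi> * h \<xi>)))"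
        by (intro iexp_integrable h d integrable_mult_right; measurable)+
      have "(LINT \<xi>|lborel. iexp (1 * \<xi> * x) * ?k \<xi>) = (LINT \<xi>|lborel. iexp (1 * \<xi> * y) * h \<xi> - iexp (1 * \<xi> * x) * h \<xi> - complex_of_real (y - x) * (iexp (1 * \<xi> * x) * (\<i> * complex_of_real \<xi> * h \<xi>)))"
      proof (intro Bochner_Integration.integral_cong refl)
        fix \<xi>
        have "iexp (1 * \<xi> * y) = iexp (1 * \<xi> * x) * iexp (\<xi> * (y - x))"
          by (simp add: exp_add[symmetric] algebra_simps)
        then show "iexp (1 * \<xi> * x) * ?k \<xi> = iexp (1 * \<xi> * y) * h \<xi> - iexp (1 * \<xi> * x) * h \<xi> - complex_of_real (y - x) * (iexp (1 * \<xi> * x) * (\<i> * complex_of_real \<xi> * h \<xi>))"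
          by (simp only:) (simp add: algebra_simps)
      qed
      also have "\<dots> = (LINT \<xi>|lborel. iexp (1 * \<xi> * y) * h \<xi>) - (LINT \<xi>|lborel. iexp (1 * \<xi> * x) * h \<xi>) - complex_of_real (y - x) * (LINT \<xi>|lborel. iexp (1 * \<xi> * x) * (\<i> * complex_of_real \<xi> * h \<xi>))"
        by (subst Bochner_Integration.integral_diff[OF Bochner_Integration.integrable_diff[OF i1(1,2)] i1(3)], subst Bochner_Integration.integral_diff[OF i1(1,2)]) (simp only: integral_mult_right_zero)
      finally show ?thesis unfolding fourier_int_def scaleR_conv_of_real by (simp only:) (simp only: right_diff_distrib mult_ac)
    qed
    then have "cmod (fourier_int 1 h y - fourier_int 1 h x - (y - x) *\<^sub>R fourier_int 1 (\<lambda>\<xi>. \<i> * complex_of_real \<xi> * h \<xi>) x) \<le> 1 / sqrt (2 * pi) * (LINT \<xi>|lborel. cmod (?k \<xi>))"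
      using fourier_int_bound[OF ki] by simp
    also have "\<dots> \<le> 1 / sqrt (2 * pi) * (LINT \<xi>|lborel. (y - x)\<^sup>2 * cmod (complex_of_real (\<xi>\<^sup>2) * h \<xi>))"
      by (intro mult_left_mono integral_mono integrable_norm[OF ki] integrable_mult_right integrable_norm[OF h(3)] kb) simp
    also have "\<dots> = B * (y - x)\<^sup>2" unfolding B_def by (subst integral_mult_right_zero) (simp only: mult_ac)
    finally show ?thesis .
  qed
  have B: "B \<ge> 0" unfolding B_def by (intro mult_nonneg_nonneg integral_nonneg_AE) auto
  show ?thesis
    unfolding has_vector_derivative_def has_derivative_iff_norm
  proof (intro conjI bounded_linear_scaleR_left)
    have lim: "((\<lambda>y. B * \<bar>y - x\<bar>) \<longlongrightarrow> B * \<bar>x - x\<bar>) (at x)" by (intro tendsto_intros)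
    show "((\<lambda>y. norm (fourier_int 1 h y - fourier_int 1 h x - (y - x) *\<^sub>R fourier_int 1 (\<lambda>\<xi>. \<i> * complex_of_real \<xi> * h \<xi>) x) / norm (y - x)) \<longlongrightarrow> 0) (at x)"
    proof (rule tendsto_sandwich[OF _ _ tendsto_const lim[simplified]])
      show "\<forall>\<^sub>F y in at x. norm (fourier_int 1 h y - fourier_int 1 h x - (y - x) *\<^sub>R fourier_int 1 (\<lambda>\<xi>. \<i> * complex_of_real \<xi> * h \<xi>) x) / norm (y - x) \<le> B * \<bar>y - x\<bar>"
      proof (rule eventually_at_filter[THEN iffD2], intro always_eventually allI impI)
        fix y assume "y \<noteq> x"
        have "B * (y - x)\<^sup>2 = B * \<bar>y - x\<bar> * \<bar>y - x\<bar>" by (simp add: power2_eq_square)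
        moreover have "norm (y - x) > 0" using \<open>y \<noteq> x\<close> by simp
        ultimately show "norm (fourier_int 1 h y - fourier_int 1 h x - (y - x) *\<^sub>R fourier_int 1 (\<lambda>\<xi>. \<i> * complex_of_real \<xi> * h \<xi>) x) / norm (y - x) \<le> B * \<bar>y - x\<bar>"
          using bound[of y] by (simp only: pos_divide_le_eq real_norm_def)
      qed
    qed simp
  qed
qed

lemma fourier_int_cnj_reflect: "cnj (fourier_int 1 h x) = fourier_int 1 (\<lambda>\<xi>. cnj (h (- \<xi>))) x"
proof -
  have "(LINT \<xi>|lborel. iexp (- 1 * \<xi> * x) * cnj (h \<xi>)) = (LINT \<xi>|lborel. iexp (1 * \<xi> * x) * cnj (h (- \<xi>)))"
    by (subst lborel_integral_real_affine[where c="-1" and t=0]) auto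
  then show ?thesis by (subst fourier_int_cnj) (simp only: fourier_int_def)
qed

lemma wnorm_reflect:
  assumes [measurable]: "h \<in> borel_measurable borel"
  shows "wnorm w m (\<lambda>\<xi>. cnj (h (- \<xi>))) = wnorm w m h"
  unfolding wnorm_alt by (subst nn_integral_real_affine[where c="-1" and t=0]) auto

lemma wnorm_power_le: "wnorm 0 1 (\<lambda>\<xi>. complex_of_real (\<xi> ^ n) * h \<xi>) \<le> wnorm 0 (1 + real n) h"
proof (rule wnorm_mono_pw)
  fix \<xi>
  have "weight 0 1 \<xi> * \<bar>\<xi>\<bar> ^ n \<le> weight 0 1 \<xi> * japanese \<xi> ^ n" by (intro mult_left_mono power_mono abs_le_japanese) auto
  also have "\<dots> = weight 0 (1 + real n) \<xi>" by (simp add: weight_def powr_add powr_realpow)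
  finally have "weight 0 1 \<xi> * \<bar>\<xi>\<bar> ^ n * cmod (h \<xi>) \<le> weight 0 (1 + real n) \<xi> * cmod (h \<xi>)" by (rule mult_right_mono) simp
  then show "weight 0 1 \<xi> * cmod (complex_of_real (\<xi> ^ n) * h \<xi>) \<le> weight 0 (1 + real n) \<xi> * cmod (h \<xi>)"
    by (simp add: norm_mult norm_power mult.assoc)
qed

lemma wnorm_xi:
  shows "wnorm w m (\<lambda>\<xi>. \<i> * complex_of_real \<xi> * h \<xi>) \<le> wnorm w (m + 1) h"
proof (rule wnorm_mono_pw)
  fix \<xi>
  have "weight w m \<xi> * \<bar>\<xi>\<bar> \<le> weight w m \<xi> * japanese \<xi>" by (intro mult_left_mono abs_le_japanese) simp
  also have "\<dots> = weight w (m + 1) \<xi>" by (simp add: weight_def powr_add)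
  finally have "weight w m \<xi> * \<bar>\<xi>\<bar> * cmod (h \<xi>) \<le> weight w (m + 1) \<xi> * cmod (h \<xi>)" by (rule mult_right_mono) simp
  then show "weight w m \<xi> * cmod (\<i> * complex_of_real \<xi> * h \<xi>) \<le> weight w (m + 1) \<xi> * cmod (h \<xi>)"
    by (simp add: norm_mult mult.assoc)
qed

section \<open>Limits in the extended reals and squared norms along curves\<close>

lemma ennreal_tendsto_0_le:
  fixes f g :: "'a \<Rightarrow> ennreal"
  assumes "(g \<longlongrightarrow> 0) F" "eventually (\<lambda>x. f x \<le> ennreal C * g x) F"
  shows "(f \<longlongrightarrow> 0) F"
proof -
  have "((\<lambda>x. ennreal C * g x) \<longlongrightarrow> ennreal C * 0) F"
    by (rule ennreal_tendsto_cmult[OF _ assms(1)]) simp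
  then have "((\<lambda>x. ennreal C * g x) \<longlongrightarrow> 0) F" by simp
  from tendsto_sandwich[OF _ assms(2) tendsto_const this] show ?thesis by simp
qed

lemma ennsqrt_sq: "(ennsqrt x)\<^sup>2 = x"
  by (cases x) (auto simp: ennsqrt_def ennreal_power power2_eq_square[of "\<top>"] ennreal_mult_top)

lemma ennsqrt_less_top: "ennsqrt x < \<infinity> \<longleftrightarrow> x < \<infinity>"
  by (auto simp: ennsqrt_def less_top)

lemma ennsqrt_mono: "x \<le> y \<Longrightarrow> ennsqrt x \<le> ennsqrt y"
  by (auto simp: ennsqrt_def top_unique less_top intro!: ennreal_leI enn2real_mono)

lemma ennsqrt_le: "x \<le> ennreal (a\<^sup>2) \<Longrightarrow> a \<ge> 0 \<Longrightarrow> ennsqrt x \<le> ennreal a"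
  using ennsqrt_mono[of x "ennreal (a\<^sup>2)"] by (simp add: ennsqrt_def)

lemma ennsqrt_leD: "ennsqrt x \<le> ennreal a \<Longrightarrow> a \<ge> 0 \<Longrightarrow> x \<le> ennreal (a\<^sup>2)"
  using power_mono[of "ennsqrt x" "ennreal a" 2] by (simp add: ennsqrt_sq ennreal_power)

text \<open>A real number, for use in calculus. An infinite norm would be sent to 0, so
  square-integrability accompanies the statements in which the value matters.\<close>

definition L2sqr :: "(real \<Rightarrow> complex) \<Rightarrow> real" where "L2sqr y = enn2real (L2sq y)"

lemma L2sqr_nonneg [simp]: "L2sqr y \<ge> 0" by (simp add: L2sqr_def)

lemma ennreal_L2sqr: "square_integrable y \<Longrightarrow> ennreal (L2sqr y) = L2sq y"
  by (auto simp: L2sqr_def sqi_iff less_top)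

lemma sqi_integrable: "square_integrable y \<Longrightarrow> integrable lborel (\<lambda>x. (cmod (y x))\<^sup>2)"
  by (intro integrableI_bounded) (auto simp: sqi_iff L2sq_def)

lemma L2sqr_eq: "square_integrable y \<Longrightarrow> L2sqr y = (LINT x|lborel. (cmod (y x))\<^sup>2)"
  unfolding L2sqr_def L2sq_def by (subst nn_integral_eq_integral[OF sqi_integrable]) (auto intro!: enn2real_ennreal integral_nonneg_AE)

lemma sqi_cnj: "square_integrable y \<Longrightarrow> square_integrable (\<lambda>x. cnj (y x))"
  by (auto simp: sqi_iff L2sq_def)

text \<open>Expansion of a square about \<open>b\<close> into a linear and a quadratic part; it
  yields both continuity and differentiability of norms along curves.\<close>

lemma L2sqr_diff:
  assumes a: "square_integrable a" and b: "square_integrable b"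
  shows "L2sqr a - L2sqr b = 2 * Re (LINT x|lborel. cnj (b x) * (a x - b x)) + L2sqr (\<lambda>x. a x - b x)"
proof -
  have d: "square_integrable (\<lambda>x. a x - b x)" by (rule sqi_diff[OF a b])
  have i: "integrable lborel (\<lambda>x. cnj (b x) * (a x - b x))" by (rule sqi_mult_integrable[OF sqi_cnj[OF b] d])
  have pw: "(cmod (a x))\<^sup>2 - (cmod (b x))\<^sup>2 = 2 * Re (cnj (b x) * (a x - b x)) + (cmod (a x - b x))\<^sup>2" for x
    unfolding cmod_power2 by (simp add: power2_eq_square algebra_simps)
  have "L2sqr a - L2sqr b = (LINT x|lborel. (cmod (a x))\<^sup>2 - (cmod (b x))\<^sup>2)"
    unfolding L2sqr_eq[OF a] L2sqr_eq[OF b] by (rule Bochner_Integration.integral_diff[symmetric]) (rule sqi_integrable a b)+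
  also have "\<dots> = (LINT x|lborel. 2 * Re (cnj (b x) * (a x - b x))) + (LINT x|lborel. (cmod (a x - b x))\<^sup>2)"
    unfolding pw by (rule Bochner_Integration.integral_add[OF integrable_mult_right[OF integrable_Re[OF i]] sqi_integrable[OF d]])
  also have "(LINT x|lborel. 2 * Re (cnj (b x) * (a x - b x))) = 2 * Re (LINT x|lborel. cnj (b x) * (a x - b x))"
    by (simp only: integral_mult_right_zero integral_Re[OF i])
  finally show ?thesis by (simp add: L2sqr_eq[OF d])
qed

lemma sqi_CS_real:
  assumes "square_integrable f" "square_integrable g"
  shows "cmod (LINT x|lborel. f x * g x) \<le> sqrt (L2sqr f) * sqrt (L2sqr g)"
proof -
  have "ennreal ((cmod (LINT x|lborel. f x * g x))\<^sup>2) \<le> ennreal (L2sqr f * L2sqr g)"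
    using sqi_Cauchy_Schwarz[OF assms] assms by (simp add: ennreal_L2sqr ennreal_mult)
  then have "(cmod (LINT x|lborel. f x * g x))\<^sup>2 \<le> L2sqr f * L2sqr g" by (subst (asm) ennreal_le_iff) auto
  then show ?thesis by (metis real_le_rsqrt real_sqrt_mult)
qed

lemma L2sqr_cnj: "L2sqr (\<lambda>x. cnj (y x)) = L2sqr y"
  by (simp add: L2sqr_def L2sq_def)

lemma L2sq_to_L2sqr:
  assumes "((\<lambda>s. L2sq (d s)) \<longlongrightarrow> 0) F" shows "((\<lambda>s. L2sqr (d s)) \<longlongrightarrow> 0) F"
  unfolding L2sqr_def using tendsto_enn2real[OF assms[folded ennreal_0]] by simp

lemma L2sqr_continuous:
  assumes y: "\<And>s. s \<in> S \<Longrightarrow> square_integrable (y s)"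
    and lim: "\<And>t. t \<in> S \<Longrightarrow> ((\<lambda>s. L2sq (\<lambda>x. y s x - y t x)) \<longlongrightarrow> 0) (at t within S)"
  shows "continuous_on S (\<lambda>s. L2sqr (y s))"
  unfolding continuous_on_def
proof
  fix t assume t: "t \<in> S"
  have L: "((\<lambda>s. L2sqr (\<lambda>x. y s x - y t x)) \<longlongrightarrow> 0) (at t within S)" by (rule L2sq_to_L2sqr[OF lim[OF t]])
  have L2: "((\<lambda>s. 2 * (sqrt (L2sqr (y t)) * sqrt (L2sqr (\<lambda>x. y s x - y t x))) + L2sqr (\<lambda>x. y s x - y t x)) \<longlongrightarrow> 2 * (sqrt (L2sqr (y t)) * sqrt 0) + 0) (at t within S)"
    by (intro tendsto_intros L)
  have "((\<lambda>s. L2sqr (y s) - L2sqr (y t)) \<longlongrightarrow> 0) (at t within S)"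
  proof (rule Lim_null_comparison)
    show "\<forall>\<^sub>F s in at t within S. norm (L2sqr (y s) - L2sqr (y t)) \<le> 2 * (sqrt (L2sqr (y t)) * sqrt (L2sqr (\<lambda>x. y s x - y t x))) + L2sqr (\<lambda>x. y s x - y t x)"
      unfolding eventually_at_filter
    proof (intro always_eventually allI impI)
      fix s assume s: "s \<in> S"
      have "\<bar>Re (LINT x|lborel. cnj (y t x) * (y s x - y t x))\<bar> \<le> sqrt (L2sqr (y t)) * sqrt (L2sqr (\<lambda>x. y s x - y t x))"
        using sqi_CS_real[OF sqi_cnj[OF y[OF t]] sqi_diff[OF y[OF s] y[OF t]]]
        by (intro order_trans[OF abs_Re_le_cmod]) (simp add: L2sqr_cnj)
      then show "norm (L2sqr (y s) - L2sqr (y t)) \<le> 2 * (sqrt (L2sqr (y t)) * sqrt (L2sqr (\<lambda>x. y s x - y t x))) + L2sqr (\<lambda>x. y s x - y t x)"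
        unfolding L2sqr_diff[OF y[OF s] y[OF t]] using L2sqr_nonneg[of "\<lambda>x. y s x - y t x"] unfolding real_norm_def by linarith
    qed
  qed (use L2 in simp)
  then show "((\<lambda>s. L2sqr (y s)) \<longlongrightarrow> L2sqr (y t)) (at t within S)" by (simp add: LIM_zero_iff)
qed

lemma exp_diff_bound: "\<bar>exp a - exp b\<bar> \<le> \<bar>a - b\<bar> * exp (max a b)" for a b :: real
proof -
  have *: "exp b - exp a \<le> (b - a) * exp b" if "a \<le> b" for a b :: real
  proof -
    have "1 + (a - b) \<le> exp (a - b)" by (rule exp_ge_add_one_self)
    then have "exp b * (1 + (a - b)) \<le> exp b * exp (a - b)" by simp
    also have "\<dots> = exp a" by (simp add: exp_add[symmetric])
    finally show ?thesis by (simp add: algebra_simps)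
  qed
  show ?thesis
  proof (cases "a \<le> b")
    case True then show ?thesis using *[OF True] by (simp add: abs_if max_def)
  next
    case False then show ?thesis using *[of b a] by (simp add: abs_if max_def)
  qed
qed

section \<open>Curves with a shrinking radius of analyticity\<close>

text \<open>\<open>M * T < w0\<close> keeps the radius of analyticity positive up to the final time,
  with the uniform lower bound \<open>w_end\<close>.\<close>

locale shrinking_radius =
  fixes w0 M T :: real
  assumes M0: "M > 0" and T0: "T > 0" and MT: "M * T < w0"
begin

definition w :: "real \<Rightarrow> real" where "w t = w0 - M * t"

definition w_end :: real where "w_end = w T"

lemma w_end_pos: "w_end > 0" using MT by (simp add: w_end_def w_def)

lemma w_ge: "t \<in> {0..T} \<Longrightarrow> w_end \<le> w t" using M0 by (simp add: w_end_def w_def)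

lemma w_le: "t \<in> {0..T} \<Longrightarrow> w t \<le> w0" using M0 by (simp add: w_def)

lemma w_pos: "t \<in> {0..T} \<Longrightarrow> 0 < w t" using w_ge[of t] w_end_pos by linarith

text \<open>
  \<open>h t\<close> is a spectral density of \<open>u t\<close>. Only radii \<open>c\<close> strictly below the final one are controlled:
  the gap absorbs every power of \<open>\<xi>\<close>, which closes the class under \<open>x\<close>-derivatives and products.
\<close>

definition spectral_curve :: "(real \<Rightarrow> real \<Rightarrow> complex) \<Rightarrow> (real \<Rightarrow> real \<Rightarrow> complex) \<Rightarrow> bool" where
  "spectral_curve u h \<longleftrightarrow> (\<forall>t\<in>{0..T}. h t \<in> borel_measurable borel \<and> u t = fourier_int 1 (h t)) \<and>
     (\<forall>c\<in>{0..<w_end}. (\<forall>t\<in>{0..T}. wnorm c 0 (h t) < \<infinity>) \<and>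
        (\<forall>t\<in>{0..T}. ((\<lambda>s. wnorm c 0 (\<lambda>\<xi>. h s \<xi> - h t \<xi>)) \<longlongrightarrow> 0) (at t within {0..T})))"

lemma spectral_curve_meas: "spectral_curve u h \<Longrightarrow> t \<in> {0..T} \<Longrightarrow> h t \<in> borel_measurable borel"
  by (simp add: spectral_curve_def)

lemma spectral_curve_fourier_int: "spectral_curve u h \<Longrightarrow> t \<in> {0..T} \<Longrightarrow> u t = fourier_int 1 (h t)"
  by (simp add: spectral_curve_def)

text \<open>The intermediate radius is the midpoint of \<open>c\<close> and \<open>w_end\<close>: it
  stays below \<open>w_end\<close> and leaves a gap for \<open>wnorm_absorb\<close>.\<close>

lemma absorb_mid:
  assumes "c \<in> {0..<w_end}"
  obtains c' C where "c' \<in> {0..<w_end}" "\<And>h. h \<in> borel_measurable borel \<Longrightarrow> wnorm c m h \<le> ennreal C * wnorm c' 0 h"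
proof -
  have "c < (c + w_end) / 2" using assms by auto
  from wnorm_absorb[OF this, of m 0] obtain C where "\<And>h. h \<in> borel_measurable borel \<Longrightarrow> wnorm c m h \<le> ennreal C * wnorm ((c + w_end) / 2) 0 h"
    by auto
  then show ?thesis using assms by (intro that[of "(c + w_end) / 2" C]) auto
qed

lemma spectral_curve_finite:
  assumes u: "spectral_curve u h" and t: "t \<in> {0..T}" and c: "c \<in> {0..<w_end}"
  shows "wnorm c m (h t) < \<infinity>"
proof -
  obtain c' C where c': "c' \<in> {0..<w_end}" "\<And>h. h \<in> borel_measurable borel \<Longrightarrow> wnorm c m h \<le> ennreal C * wnorm c' 0 h"
    using absorb_mid[OF c, of m] by blast
  show ?thesis
    by (rule order.strict_trans1[OF c'(2)[OF spectral_curve_meas[OF u t]]]) (use u t c' in \<open>auto simp: spectral_curve_def ennreal_mult_less_top\<close>)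
qed

lemma spectral_curve_lim:
  assumes u: "spectral_curve u h" and t: "t \<in> {0..T}" and c: "c \<in> {0..<w_end}"
  shows "((\<lambda>s. wnorm c m (\<lambda>\<xi>. h s \<xi> - h t \<xi>)) \<longlongrightarrow> 0) (at t within {0..T})"
proof -
  obtain c' C where c': "c' \<in> {0..<w_end}" "\<And>h. h \<in> borel_measurable borel \<Longrightarrow> wnorm c m h \<le> ennreal C * wnorm c' 0 h"
    using absorb_mid[OF c, of m] by blast
  have [measurable]: "s \<in> {0..T} \<Longrightarrow> h s \<in> borel_measurable borel" for s by (rule spectral_curve_meas[OF u])
  show ?thesis
  proof (rule ennreal_tendsto_0_le)
    show "((\<lambda>s. wnorm c' 0 (\<lambda>\<xi>. h s \<xi> - h t \<xi>)) \<longlongrightarrow> 0) (at t within {0..T})"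
      using u t c' by (auto simp: spectral_curve_def)
    show "\<forall>\<^sub>F s in at t within {0..T}. wnorm c m (\<lambda>\<xi>. h s \<xi> - h t \<xi>) \<le> ennreal C * wnorm c' 0 (\<lambda>\<xi>. h s \<xi> - h t \<xi>)"
      unfolding eventually_at_filter
      by (intro always_eventually allI impI c') (use t in measurable)
  qed
qed

lemma spectral_curve_int: "spectral_curve u h \<Longrightarrow> t \<in> {0..T} \<Longrightarrow> integrable lborel (h t)"
  using spectral_curve_finite[of u h t 0 1] w_end_pos by (intro integrable_of_wnorm[of 1 0]) (auto simp: spectral_curve_meas)

lemma spectral_curve_sqi: "spectral_curve u h \<Longrightarrow> t \<in> {0..T} \<Longrightarrow> square_integrable (h t)"
  using spectral_curve_finite[of u h t 0 0] w_end_pos by (intro sqi_of_wnorm[of 0 0]) (auto simp: spectral_curve_meas)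

lemma fourier_int_measurable': "h \<in> borel_measurable borel \<Longrightarrow> fourier_int s h \<in> borel_measurable borel" by measurable

lemma spectral_curve_fourier:
  assumes "spectral_curve u h" "t \<in> {0..T}"
  shows "AE \<xi> in lborel. fourier (u t) \<xi> = h t \<xi>" "square_integrable (u t)"
  using fourier_fourier_int[OF spectral_curve_int[OF assms] spectral_curve_sqi[OF assms], of "u t"] spectral_curve_fourier_int[OF assms] fourier_int_measurable'[OF spectral_curve_meas[OF assms], of 1] by auto

lemma spectral_curve_Hnorm: "spectral_curve u h \<Longrightarrow> t \<in> {0..T} \<Longrightarrow> Hnorm_sq v m (u t) = wnorm v m (h t)"
  unfolding Hnorm_sq_eq_wnorm by (rule wnorm_cong_AE[OF spectral_curve_fourier(1)])

lemma spectral_curveI: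
  assumes "\<And>t. t \<in> {0..T} \<Longrightarrow> h t \<in> borel_measurable borel" "\<And>t x. t \<in> {0..T} \<Longrightarrow> u t x = fourier_int 1 (h t) x"
    and "\<And>c t. c \<in> {0..<w_end} \<Longrightarrow> t \<in> {0..T} \<Longrightarrow> wnorm c 0 (h t) < \<infinity>"
    and "\<And>c t. c \<in> {0..<w_end} \<Longrightarrow> t \<in> {0..T} \<Longrightarrow> ((\<lambda>s. wnorm c 0 (\<lambda>\<xi>. h s \<xi> - h t \<xi>)) \<longlongrightarrow> 0) (at t within {0..T})"
  shows "spectral_curve u h"
  unfolding spectral_curve_def using assms by (auto simp: fun_eq_iff)

lemma eventually_within_I: "(\<And>s. s \<in> S \<Longrightarrow> P s) \<Longrightarrow> eventually P (at t within S)"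
  unfolding eventually_at_filter by (intro always_eventually) auto

lemma tendsto_add_0: "(f \<longlongrightarrow> 0) F \<Longrightarrow> (g \<longlongrightarrow> 0) F \<Longrightarrow> ((\<lambda>s. f s + g s) \<longlongrightarrow> 0) F"
  for f g :: "_ \<Rightarrow> ennreal"
  using tendsto_add[of f 0 F g 0] by simp

section \<open>Closure of spectral curves under algebra and differentiation\<close>

lemma spectral_curve_add:
  assumes u: "spectral_curve u h" and v: "spectral_curve v k"
  shows "spectral_curve (\<lambda>t x. u t x + v t x) (\<lambda>t \<xi>. h t \<xi> + k t \<xi>)"
proof (rule spectral_curveI)
  have [measurable]: "s \<in> {0..T} \<Longrightarrow> h s \<in> borel_measurable borel" for s by (rule spectral_curve_meas[OF u])
  have [measurable]: "s \<in> {0..T} \<Longrightarrow> k s \<in> borel_measurable borel" for s by (rule spectral_curve_meas[OF v])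
  fix t assume t: "t \<in> {0..T}"
  show "(\<lambda>\<xi>. h t \<xi> + k t \<xi>) \<in> borel_measurable borel" using t by measurable
  show "u t x + v t x = fourier_int 1 (\<lambda>\<xi>. h t \<xi> + k t \<xi>) x" for x
    by (simp add: fourier_int_add spectral_curve_int[OF u t] spectral_curve_int[OF v t] spectral_curve_fourier_int[OF u t] spectral_curve_fourier_int[OF v t])
  fix c assume c: "c \<in> {0..<w_end}"
  show "wnorm c 0 (\<lambda>\<xi>. h t \<xi> + k t \<xi>) < \<infinity>"
    using wnorm_add[of "h t" "k t" c 0] spectral_curve_finite[OF u t c, of 0] spectral_curve_finite[OF v t c, of 0] t
    by (auto simp: ennreal_mult_less_top elim!: order.strict_trans1)
  show "((\<lambda>s. wnorm c 0 (\<lambda>\<xi>. (h s \<xi> + k s \<xi>) - (h t \<xi> + k t \<xi>))) \<longlongrightarrow> 0) (at t within {0..T})"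
  proof (rule ennreal_tendsto_0_le)
    show "((\<lambda>s. wnorm c 0 (\<lambda>\<xi>. h s \<xi> - h t \<xi>) + wnorm c 0 (\<lambda>\<xi>. k s \<xi> - k t \<xi>)) \<longlongrightarrow> 0) (at t within {0..T})"
      by (intro tendsto_add_0 spectral_curve_lim[OF u t c] spectral_curve_lim[OF v t c])
    show "\<forall>\<^sub>F s in at t within {0..T}. wnorm c 0 (\<lambda>\<xi>. (h s \<xi> + k s \<xi>) - (h t \<xi> + k t \<xi>)) \<le> ennreal 2 * (wnorm c 0 (\<lambda>\<xi>. h s \<xi> - h t \<xi>) + wnorm c 0 (\<lambda>\<xi>. k s \<xi> - k t \<xi>))"
    proof (rule eventually_within_I)
      fix s assume s: "s \<in> {0..T}"
      have "wnorm c 0 (\<lambda>\<xi>. (h s \<xi> - h t \<xi>) + (k s \<xi> - k t \<xi>)) \<le> 2 * wnorm c 0 (\<lambda>\<xi>. h s \<xi> - h t \<xi>) + 2 * wnorm c 0 (\<lambda>\<xi>. k s \<xi> - k t \<xi>)"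
        by (rule wnorm_add) (use s t in measurable)
      then show "wnorm c 0 (\<lambda>\<xi>. (h s \<xi> + k s \<xi>) - (h t \<xi> + k t \<xi>)) \<le> ennreal 2 * (wnorm c 0 (\<lambda>\<xi>. h s \<xi> - h t \<xi>) + wnorm c 0 (\<lambda>\<xi>. k s \<xi> - k t \<xi>))"
        by (simp add: distrib_left add_diff_add)
    qed
  qed
qed

lemma spectral_curve_cmult:
  assumes u: "spectral_curve u h"
  shows "spectral_curve (\<lambda>t x. z * u t x) (\<lambda>t \<xi>. z * h t \<xi>)"
proof (rule spectral_curveI)
  have [measurable]: "s \<in> {0..T} \<Longrightarrow> h s \<in> borel_measurable borel" for s by (rule spectral_curve_meas[OF u])
  fix t assume t: "t \<in> {0..T}"
  show "(\<lambda>\<xi>. z * h t \<xi>) \<in> borel_measurable borel" using t by measurable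
  show "z * u t x = fourier_int 1 (\<lambda>\<xi>. z * h t \<xi>) x" for x
    by (simp add: fourier_int_cmult spectral_curve_fourier_int[OF u t])
  fix c assume c: "c \<in> {0..<w_end}"
  show "wnorm c 0 (\<lambda>\<xi>. z * h t \<xi>) < \<infinity>"
    using spectral_curve_finite[OF u t c, of 0] t by (subst wnorm_cmult) (auto simp: ennreal_mult_less_top)
  show "((\<lambda>s. wnorm c 0 (\<lambda>\<xi>. z * h s \<xi> - z * h t \<xi>)) \<longlongrightarrow> 0) (at t within {0..T})"
  proof (rule ennreal_tendsto_0_le[OF spectral_curve_lim[OF u t c]], rule eventually_within_I)
    fix s assume s: "s \<in> {0..T}"
    show "wnorm c 0 (\<lambda>\<xi>. z * h s \<xi> - z * h t \<xi>) \<le> ennreal ((cmod z)\<^sup>2) * wnorm c 0 (\<lambda>\<xi>. h s \<xi> - h t \<xi>)"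
      unfolding right_diff_distrib[symmetric] by (subst wnorm_cmult) (use s t in auto)
  qed
qed

lemma spectral_curve_diff:
  assumes u: "spectral_curve u h" and v: "spectral_curve v k"
  shows "spectral_curve (\<lambda>t x. u t x - v t x) (\<lambda>t \<xi>. h t \<xi> - k t \<xi>)"
  using spectral_curve_add[OF u spectral_curve_cmult[OF v, of "-1"]] by simp

lemma spectral_curve_cnj:
  assumes u: "spectral_curve u h"
  shows "spectral_curve (\<lambda>t x. cnj (u t x)) (\<lambda>t \<xi>. cnj (h t (- \<xi>)))"
proof (rule spectral_curveI)
  have [measurable]: "s \<in> {0..T} \<Longrightarrow> h s \<in> borel_measurable borel" for s by (rule spectral_curve_meas[OF u])
  fix t assume t: "t \<in> {0..T}"
  show "(\<lambda>\<xi>. cnj (h t (- \<xi>))) \<in> borel_measurable borel" using t by measurable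
  show "cnj (u t x) = fourier_int 1 (\<lambda>\<xi>. cnj (h t (- \<xi>))) x" for x
    by (simp add: fourier_int_cnj_reflect spectral_curve_fourier_int[OF u t])
  fix c assume c: "c \<in> {0..<w_end}"
  show "wnorm c 0 (\<lambda>\<xi>. cnj (h t (- \<xi>))) < \<infinity>"
    using spectral_curve_finite[OF u t c, of 0] t by (subst wnorm_reflect) auto
  show "((\<lambda>s. wnorm c 0 (\<lambda>\<xi>. cnj (h s (- \<xi>)) - cnj (h t (- \<xi>)))) \<longlongrightarrow> 0) (at t within {0..T})"
  proof (rule ennreal_tendsto_0_le[OF spectral_curve_lim[OF u t c], where C=1], rule eventually_within_I)
    fix s assume s: "s \<in> {0..T}"
    show "wnorm c 0 (\<lambda>\<xi>. cnj (h s (- \<xi>)) - cnj (h t (- \<xi>))) \<le> ennreal 1 * wnorm c 0 (\<lambda>\<xi>. h s \<xi> - h t \<xi>)"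
      using wnorm_reflect[of "\<lambda>\<xi>. h s \<xi> - h t \<xi>" c 0] s t by simp
  qed
qed

lemma spectral_curve_mult:
  assumes u: "spectral_curve u h" and v: "spectral_curve v k"
  shows "spectral_curve (\<lambda>t x. u t x * v t x) (\<lambda>t. conv (h t) (k t))"
proof (rule spectral_curveI)
  have [measurable]: "s \<in> {0..T} \<Longrightarrow> h s \<in> borel_measurable borel" for s by (rule spectral_curve_meas[OF u])
  have [measurable]: "s \<in> {0..T} \<Longrightarrow> k s \<in> borel_measurable borel" for s by (rule spectral_curve_meas[OF v])
  fix t assume t: "t \<in> {0..T}"
  show "conv (h t) (k t) \<in> borel_measurable borel" using t by measurable
  show "u t x * v t x = fourier_int 1 (conv (h t) (k t)) x" for x
    by (simp add: conv_fourier_int(1)[OF spectral_curve_int[OF u t] spectral_curve_int[OF v t]] spectral_curve_fourier_int[OF u t] spectral_curve_fourier_int[OF v t])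
  fix c assume c: "c \<in> {0..<w_end}"
  then have c0: "c \<ge> 0" by simp
  \<comment> \<open>Order 1 exceeds 1/2, so there the tame estimate is an algebra estimate; raising
    the order from 0 to 1 is free for spectral curves.\<close>
  define K where "K = 2 * tame_const 1 1"
  have tame: "wnorm c 0 (conv a b) \<le> ennreal K * (wnorm c 1 a * wnorm c 1 b)" if "a \<in> borel_measurable borel" "b \<in> borel_measurable borel" for a b
    using order_trans[OF wnorm_mono[of c c 0 1] conv_tame_alg[OF _ c0 that, of 1]] unfolding K_def by simp
  show "wnorm c 0 (conv (h t) (k t)) < \<infinity>"
    using tame[of "h t" "k t"] spectral_curve_finite[OF u t c, of 1] spectral_curve_finite[OF v t c, of 1] t
    by (auto simp: ennreal_mult_less_top elim!: order.strict_trans1)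
  define p where "p s = wnorm c 1 (\<lambda>\<xi>. h s \<xi> - h t \<xi>)" for s
  define q where "q s = wnorm c 1 (\<lambda>\<xi>. k s \<xi> - k t \<xi>)" for s
  have pl: "(p \<longlongrightarrow> 0) (at t within {0..T})" and ql: "(q \<longlongrightarrow> 0) (at t within {0..T})"
    unfolding p_def q_def by (rule spectral_curve_lim[OF u t c], rule spectral_curve_lim[OF v t c])
  have "((\<lambda>s. wnorm c 1 (h t) * q s) \<longlongrightarrow> wnorm c 1 (h t) * 0) (at t within {0..T})"
    by (rule ennreal_tendsto_cmult[OF _ ql]) (use spectral_curve_finite[OF u t c, of 1] in simp)
  moreover have "((\<lambda>s. wnorm c 1 (k t) * p s) \<longlongrightarrow> wnorm c 1 (k t) * 0) (at t within {0..T})"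
    by (rule ennreal_tendsto_cmult[OF _ pl]) (use spectral_curve_finite[OF v t c, of 1] in simp)
  moreover have "((\<lambda>s. p s * q s) \<longlongrightarrow> 0 * 0) (at t within {0..T})"
    by (rule tendsto_mult_ennreal[OF pl ql]) simp
  ultimately have L: "((\<lambda>s. p s * q s + (wnorm c 1 (h t) * q s + wnorm c 1 (k t) * p s)) \<longlongrightarrow> 0) (at t within {0..T})"
    by (intro tendsto_add_0) auto
  show "((\<lambda>s. wnorm c 0 (\<lambda>\<xi>. conv (h s) (k s) \<xi> - conv (h t) (k t) \<xi>)) \<longlongrightarrow> 0) (at t within {0..T})"
  proof (rule ennreal_tendsto_0_le[OF L, where C="4 * K"], rule eventually_within_I)
    fix s assume s: "s \<in> {0..T}"
    have mm: "h s \<in> borel_measurable borel" "h t \<in> borel_measurable borel" "k s \<in> borel_measurable borel" "k t \<in> borel_measurable borel"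
      by (rule spectral_curve_meas[OF u s] spectral_curve_meas[OF u t] spectral_curve_meas[OF v s] spectral_curve_meas[OF v t])+
    define dh where "dh \<xi> = h s \<xi> - h t \<xi>" for \<xi>
    define dk where "dk \<xi> = k s \<xi> - k t \<xi>" for \<xi>
    have md: "dh \<in> borel_measurable borel" "dk \<in> borel_measurable borel"
      unfolding dh_def dk_def by (intro borel_measurable_diff mm)+
    have "wnorm c 0 (\<lambda>\<xi>. conv (h s) (k s) \<xi> - conv (h t) (k t) \<xi>) = wnorm c 0 (\<lambda>\<xi>. conv dh dk \<xi> + (conv (h t) dk \<xi> + conv dh (k t) \<xi>))"
      unfolding dh_def dk_def
      by (rule arg_cong[where f="wnorm c 0"], rule ext, rule conv_diff_diff) (rule spectral_curve_sqi[OF u s] spectral_curve_sqi[OF u t] spectral_curve_sqi[OF v s] spectral_curve_sqi[OF v t])+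
    also have "\<dots> \<le> 2 * wnorm c 0 (conv dh dk) + 2 * wnorm c 0 (\<lambda>\<xi>. conv (h t) dk \<xi> + conv dh (k t) \<xi>)"
      by (intro wnorm_add borel_measurable_add conv_measurable mm md)
    also have "\<dots> \<le> 2 * wnorm c 0 (conv dh dk) + 2 * (2 * wnorm c 0 (conv (h t) dk) + 2 * wnorm c 0 (conv dh (k t)))"
      by (intro add_mono mult_left_mono wnorm_add order_refl conv_measurable mm md) auto
    also have "\<dots> \<le> 4 * wnorm c 0 (conv dh dk) + (4 * wnorm c 0 (conv (h t) dk) + 4 * wnorm c 0 (conv dh (k t)))"
      by (intro add_mono mult_right_mono) (auto simp: distrib_left mult.assoc[symmetric])
    also have "\<dots> \<le> 4 * (ennreal K * (p s * q s)) + (4 * (ennreal K * (wnorm c 1 (h t) * q s)) + 4 * (ennreal K * (p s * wnorm c 1 (k t))))"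
      unfolding p_def q_def dh_def[symmetric, abs_def] dk_def[symmetric, abs_def]
      by (intro add_mono mult_left_mono tame mm md) auto
    also have "\<dots> = ennreal (4 * K) * (p s * q s + (wnorm c 1 (h t) * q s + wnorm c 1 (k t) * p s))"
    proof -
      have "ennreal (4 * K) = 4 * ennreal K" by (simp add: ennreal_mult')
      then show ?thesis by (simp only: distrib_left mult_ac)
    qed
    finally show "wnorm c 0 (\<lambda>\<xi>. conv (h s) (k s) \<xi> - conv (h t) (k t) \<xi>) \<le> ennreal (4 * K) * (p s * q s + (wnorm c 1 (h t) * q s + wnorm c 1 (k t) * p s))" .
  qed
qed

lemma spectral_curve_has_derivative:
  assumes u: "spectral_curve u h" and t: "t \<in> {0..T}"
  shows "(u t has_vector_derivative fourier_int 1 (\<lambda>\<xi>. \<i> * complex_of_real \<xi> * h t \<xi>) x) (at x)"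
proof -
  have [measurable]: "h t \<in> borel_measurable borel" by (rule spectral_curve_meas[OF u t])
  have c: "0 \<in> {0..<w_end}" using w_end_pos by simp
  have p: "integrable lborel (\<lambda>\<xi>. complex_of_real (\<xi> ^ n) * h t \<xi>)" for n
  proof (rule integrable_of_wnorm[of 1 0])
    show "wnorm 0 1 (\<lambda>\<xi>. complex_of_real (\<xi> ^ n) * h t \<xi>) < \<infinity>"
      by (rule order.strict_trans1[OF wnorm_power_le spectral_curve_finite[OF u t c]])
  qed auto
  have "(fourier_int 1 (h t) has_vector_derivative fourier_int 1 (\<lambda>\<xi>. \<i> * complex_of_real \<xi> * h t \<xi>) x) (at x)"
    using p[of 0] p[of 1] p[of 2] by (intro fourier_int_has_derivative) auto
  then show ?thesis by (simp add: spectral_curve_fourier_int[OF u t])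
qed

lemma spectral_curve_Dx:
  assumes u: "spectral_curve u h"
  shows "spectral_curve (Dx u) (\<lambda>t \<xi>. \<i> * complex_of_real \<xi> * h t \<xi>)"
proof (rule spectral_curveI)
  have [measurable]: "s \<in> {0..T} \<Longrightarrow> h s \<in> borel_measurable borel" for s by (rule spectral_curve_meas[OF u])
  fix t assume t: "t \<in> {0..T}"
  show "(\<lambda>\<xi>. \<i> * complex_of_real \<xi> * h t \<xi>) \<in> borel_measurable borel" using t by measurable
  show "Dx u t x = fourier_int 1 (\<lambda>\<xi>. \<i> * complex_of_real \<xi> * h t \<xi>) x" for x
    unfolding Dx_def by (rule vector_derivative_at[OF spectral_curve_has_derivative[OF u t]])
  fix c assume c: "c \<in> {0..<w_end}"
  show "wnorm c 0 (\<lambda>\<xi>. \<i> * complex_of_real \<xi> * h t \<xi>) < \<infinity>"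
    by (rule order.strict_trans1[OF wnorm_xi spectral_curve_finite[OF u t c]])
  show "((\<lambda>s. wnorm c 0 (\<lambda>\<xi>. \<i> * complex_of_real \<xi> * h s \<xi> - \<i> * complex_of_real \<xi> * h t \<xi>)) \<longlongrightarrow> 0) (at t within {0..T})"
  proof (rule ennreal_tendsto_0_le[OF spectral_curve_lim[OF u t c, of 1], where C=1], rule eventually_within_I)
    fix s assume s: "s \<in> {0..T}"
    show "wnorm c 0 (\<lambda>\<xi>. \<i> * complex_of_real \<xi> * h s \<xi> - \<i> * complex_of_real \<xi> * h t \<xi>) \<le> ennreal 1 * wnorm c 1 (\<lambda>\<xi>. h s \<xi> - h t \<xi>)"
      using wnorm_xi[of c 0 "\<lambda>\<xi>. h s \<xi> - h t \<xi>"] by (simp add: right_diff_distrib)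
  qed
qed

end

text \<open>
  The frequency cut-off makes the energy differentiable in time although the derivative of the full
  norm may be infinite.
\<close>

definition cut_weight :: "real \<Rightarrow> real \<Rightarrow> real \<Rightarrow> (real \<Rightarrow> complex) \<Rightarrow> real \<Rightarrow> complex" where
  "cut_weight R v m h = trunc R (\<lambda>\<xi>. complex_of_real (weight v m \<xi>) * h \<xi>)"

lemma cut_weight_measurable [measurable]: "h \<in> borel_measurable borel \<Longrightarrow> cut_weight R v m h \<in> borel_measurable borel"
  unfolding cut_weight_def by measurable

lemma cut_weight_eq: "cut_weight R v m h \<xi> = (if \<bar>\<xi>\<bar> \<le> R then complex_of_real (weight v m \<xi>) * h \<xi> else 0)"
  by (auto simp: cut_weight_def trunc_def indicator_def)

lemma L2sq_cut_weight_le: "L2sq (cut_weight R v m h) \<le> wnorm v m h"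
  unfolding wnorm_def cut_weight_def by (rule L2sq_mono[OF cmod_trunc])

text \<open>One inequality is Fatou's lemma, the other monotonicity. It transports to full norms
  both the bounds uniform in the cut-off and measurability in time.\<close>

lemma wnorm_liminf:
  assumes [measurable]: "h \<in> borel_measurable borel"
  shows "wnorm v m h = liminf (\<lambda>n. L2sq (cut_weight (real n) v m h))"
proof (rule antisym)
  show "wnorm v m h \<le> liminf (\<lambda>n. L2sq (cut_weight (real n) v m h))"
    unfolding wnorm_def
  proof (rule L2sq_Fatou)
    show "AE \<xi> in lborel. (\<lambda>n. cut_weight (real n) v m h \<xi>) \<longlonglongrightarrow> complex_of_real (weight v m \<xi>) * h \<xi>"
    proof (intro AE_I2 tendsto_eventually)
      fix \<xi> show "\<forall>\<^sub>F n in sequentially. cut_weight (real n) v m h \<xi> = complex_of_real (weight v m \<xi>) * h \<xi>"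
        using eventually_ge_at_top[of "nat \<lceil>\<bar>\<xi>\<bar>\<rceil>"]
      proof eventually_elim
        case (elim n)
        then have "\<bar>\<xi>\<bar> \<le> real n" by linarith
        then show ?case by (simp add: cut_weight_eq)
      qed
    qed
  qed measurable
  show "liminf (\<lambda>n. L2sq (cut_weight (real n) v m h)) \<le> wnorm v m h"
    by (rule Liminf_le) (auto intro: always_eventually L2sq_cut_weight_le)
qed

lemma exp_diff_bound2: "\<bar>exp a - exp b - (a - b) * exp b\<bar> \<le> (a - b)\<^sup>2 * exp (max a b)" for a b :: real
proof -
  have *: "\<bar>exp x - 1 - x\<bar> \<le> x\<^sup>2 * exp (max x 0)" for x :: real
  proof -
    have 0: "exp x - 1 - x \<ge> 0" using exp_ge_add_one_self[of x] by linarith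
    have "1 - x \<le> exp (- x)" using exp_ge_add_one_self[of "- x"] by linarith
    then have "exp x * (1 - x) \<le> exp x * exp (- x)" by simp
    then have "exp x - 1 - x \<le> x * (exp x - 1)" by (simp add: exp_add[symmetric] algebra_simps)
    also have "\<dots> \<le> \<bar>x\<bar> * \<bar>exp x - exp 0\<bar>" by (simp flip: abs_mult)
    also have "\<dots> \<le> \<bar>x\<bar> * (\<bar>x - 0\<bar> * exp (max x 0))" by (intro mult_left_mono exp_diff_bound) auto
    finally show ?thesis using 0 by (simp add: power2_eq_square mult.assoc[symmetric])
  qed
  have "exp a - exp b - (a - b) * exp b = exp b * (exp (a - b) - 1 - (a - b))"
  proof -
    have "exp a = exp b * exp (a - b)" by (simp add: exp_add[symmetric])
    then show ?thesis by (simp add: algebra_simps)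
  qed
  also have "\<bar>\<dots>\<bar> \<le> exp b * ((a - b)\<^sup>2 * exp (max (a - b) 0))"
    using mult_left_mono[OF *[of "a - b"], of "exp b"] by (simp add: abs_mult)
  also have "\<dots> = (a - b)\<^sup>2 * exp (max a b)"
    by (auto simp: max_def exp_add[symmetric])
  finally show ?thesis .
qed

section \<open>Differentiability of squared norms, and Riemann sums\<close>

text \<open>Chain rule for the squared norm. The hypothesis \<open>lim\<close> is differentiability
  at the single time \<open>t\<close> in the L2 sense, with the difference quotient squared.\<close>

lemma L2sqr_has_derivative:
  assumes y: "\<And>s. s \<in> S \<Longrightarrow> square_integrable (y s)" and z: "square_integrable z" and t: "t \<in> S"
    and lim: "((\<lambda>s. L2sqr (\<lambda>\<xi>. y s \<xi> - y t \<xi> - complex_of_real (s - t) * z \<xi>) / (s - t)\<^sup>2) \<longlongrightarrow> 0) (at t within S)"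
  shows "((\<lambda>s. L2sqr (y s)) has_vector_derivative 2 * Re (LINT \<xi>|lborel. cnj (y t \<xi>) * z \<xi>)) (at t within S)"
proof -
  let ?I = "Re (LINT \<xi>|lborel. cnj (y t \<xi>) * z \<xi>)"
  define q where "q s = L2sqr (\<lambda>\<xi>. y s \<xi> - y t \<xi> - complex_of_real (s - t) * z \<xi>) / (s - t)\<^sup>2" for s
  have ql: "(q \<longlongrightarrow> 0) (at t within S)" using lim unfolding q_def .
  let ?b = "\<lambda>s. 2 * (sqrt (L2sqr (y t)) * sqrt (q s)) + (2 * \<bar>s - t\<bar> * L2sqr z + 2 * q s * \<bar>s - t\<bar>)"
  have bl: "(?b \<longlongrightarrow> 2 * (sqrt (L2sqr (y t)) * sqrt 0) + (2 * \<bar>t - t\<bar> * L2sqr z + 2 * 0 * \<bar>t - t\<bar>)) (at t within S)"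
    by (intro tendsto_intros ql)
  have main: "\<bar>L2sqr (y s) - L2sqr (y t) - (s - t) * (2 * ?I)\<bar> \<le> ?b s * \<bar>s - t\<bar>" if s: "s \<in> S" "s \<noteq> t" for s
  proof -
    define r where "r \<xi> = y s \<xi> - y t \<xi> - complex_of_real (s - t) * z \<xi>" for \<xi>
    have sz: "square_integrable (\<lambda>\<xi>. complex_of_real (s - t) * z \<xi>)" by (rule sqi_cmult[OF z])
    have r: "square_integrable r" unfolding r_def by (intro sqi_diff sz y s t)
    have Nr: "L2sqr r = q s * (s - t)\<^sup>2" using s unfolding r_def q_def by simp
    have "(LINT \<xi>|lborel. cnj (y t \<xi>) * (y s \<xi> - y t \<xi>)) = (LINT \<xi>|lborel. cnj (y t \<xi>) * r \<xi> + cnj (y t \<xi>) * (complex_of_real (s - t) * z \<xi>))"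
      by (intro Bochner_Integration.integral_cong) (auto simp: r_def algebra_simps)
    also have "\<dots> = (LINT \<xi>|lborel. cnj (y t \<xi>) * r \<xi>) + (LINT \<xi>|lborel. cnj (y t \<xi>) * (complex_of_real (s - t) * z \<xi>))"
      by (rule Bochner_Integration.integral_add) (intro sqi_mult_integrable sqi_cnj y t r sz)+
    also have "(LINT \<xi>|lborel. cnj (y t \<xi>) * (complex_of_real (s - t) * z \<xi>)) = complex_of_real (s - t) * (LINT \<xi>|lborel. cnj (y t \<xi>) * z \<xi>)"
      by (subst integral_mult_right_zero[symmetric]) (simp only: mult.left_commute)
    finally have e1: "Re (LINT \<xi>|lborel. cnj (y t \<xi>) * (y s \<xi> - y t \<xi>)) = Re (LINT \<xi>|lborel. cnj (y t \<xi>) * r \<xi>) + (s - t) * ?I"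
      by simp
    have e2: "L2sqr (\<lambda>\<xi>. y s \<xi> - y t \<xi>) \<le> 2 * L2sqr r + 2 * ((s - t)\<^sup>2 * L2sqr z)"
    proof -
      have "L2sq (\<lambda>\<xi>. y s \<xi> - y t \<xi>) = L2sq (\<lambda>\<xi>. r \<xi> + complex_of_real (s - t) * z \<xi>)" by (simp add: r_def)
      also have "\<dots> \<le> 2 * L2sq r + 2 * L2sq (\<lambda>\<xi>. complex_of_real (s - t) * z \<xi>)" by (rule L2sq_add) (use r sz in auto)
      also have "\<dots> = ennreal (2 * L2sqr r + 2 * ((s - t)\<^sup>2 * L2sqr z))"
        using z by (subst L2sq_cmult) (auto simp: ennreal_plus ennreal_mult ennreal_L2sqr r simp flip: of_real_diff)
      finally show ?thesis unfolding L2sqr_def[of "\<lambda>\<xi>. y s \<xi> - y t \<xi>"] by (intro enn2real_leI) auto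
    qed
    have e3: "\<bar>Re (LINT \<xi>|lborel. cnj (y t \<xi>) * r \<xi>)\<bar> \<le> sqrt (L2sqr (y t)) * (sqrt (q s) * \<bar>s - t\<bar>)"
    proof -
      have "\<bar>Re (LINT \<xi>|lborel. cnj (y t \<xi>) * r \<xi>)\<bar> \<le> sqrt (L2sqr (y t)) * sqrt (L2sqr r)"
        using sqi_CS_real[OF sqi_cnj[OF y[OF t]] r] by (intro order_trans[OF abs_Re_le_cmod]) (simp add: L2sqr_cnj)
      then show ?thesis by (simp add: Nr real_sqrt_mult)
    qed
    have "L2sqr (y s) - L2sqr (y t) - (s - t) * (2 * ?I) = 2 * Re (LINT \<xi>|lborel. cnj (y t \<xi>) * r \<xi>) + L2sqr (\<lambda>\<xi>. y s \<xi> - y t \<xi>)"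
      unfolding L2sqr_diff[OF y[OF s(1)] y[OF t]] e1 by (simp add: algebra_simps)
    also have "\<bar>\<dots>\<bar> \<le> 2 * (sqrt (L2sqr (y t)) * (sqrt (q s) * \<bar>s - t\<bar>)) + (2 * L2sqr r + 2 * ((s - t)\<^sup>2 * L2sqr z))"
      using e2 e3 L2sqr_nonneg[of "\<lambda>\<xi>. y s \<xi> - y t \<xi>"] by linarith
    also have "\<dots> = ?b s * \<bar>s - t\<bar>"
    proof -
      have "(s - t)\<^sup>2 = \<bar>s - t\<bar> * \<bar>s - t\<bar>" by (simp add: power2_eq_square)
      then show ?thesis unfolding Nr by (simp only:) (simp add: algebra_simps)
    qed
    finally show ?thesis .
  qed
  show ?thesis
    unfolding has_vector_derivative_def has_derivative_iff_norm
  proof (intro conjI bounded_linear_scaleR_left)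
    show "((\<lambda>s. norm (L2sqr (y s) - L2sqr (y t) - (s - t) *\<^sub>R (2 * ?I)) / norm (s - t)) \<longlongrightarrow> 0) (at t within S)"
    proof (rule tendsto_sandwich[OF _ _ tendsto_const])
      show "(?b \<longlongrightarrow> 0) (at t within S)" using bl by simp
      show "\<forall>\<^sub>F s in at t within S. norm (L2sqr (y s) - L2sqr (y t) - (s - t) *\<^sub>R (2 * ?I)) / norm (s - t) \<le> ?b s"
        unfolding eventually_at_filter using main
        by (intro always_eventually allI impI) (simp only: real_norm_def real_scaleR_def, subst pos_divide_le_eq, auto)
    qed simp
  qed
qed

lemma affine_comb: "a + (b - a) * c = (1 - c) * a + c * b" for a b c :: real
  by (simp add: algebra_simps)

text \<open>Uniform continuity of \<open>f'\<close> bounds the linearisation error on each of the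
  \<open>Suc n\<close> pieces. The end points may come in either order, since increments in time can
  be negative.\<close>

lemma riemann_sums:
  fixes f f' :: "real \<Rightarrow> complex"
  assumes f: "\<And>x. x \<in> {p..r} \<Longrightarrow> (f has_vector_derivative f' x) (at x within {p..r})"
    and c: "continuous_on {p..r} f'" and ab: "a \<in> {p..r}" "b \<in> {p..r}"
  shows "(\<lambda>n. complex_of_real ((b - a) / real (Suc n)) * (\<Sum>i<Suc n. f' (a + (b - a) * (real i / real (Suc n))))) \<longlonglongrightarrow> f b - f a"
proof (rule LIMSEQ_I)
  fix e :: real assume e: "e > 0"
  define e' where "e' = e / (2 * (\<bar>b - a\<bar> + 1))"
  have e': "e' > 0" unfolding e'_def using e by (intro divide_pos_pos mult_pos_pos add_nonneg_pos) auto
  have "uniformly_continuous_on {p..r} f'" by (rule compact_uniformly_continuous[OF c]) simp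
  then obtain d where d: "d > 0" "\<And>x x'. x \<in> {p..r} \<Longrightarrow> x' \<in> {p..r} \<Longrightarrow> dist x' x < d \<Longrightarrow> dist (f' x') (f' x) < e'"
    using e' unfolding uniformly_continuous_on_def by meson
  obtain n0 :: nat where n0: "\<bar>b - a\<bar> / d < real n0" using reals_Archimedean2 by blast
  show "\<exists>n0. \<forall>n\<ge>n0. norm (complex_of_real ((b - a) / real (Suc n)) * (\<Sum>i<Suc n. f' (a + (b - a) * (real i / real (Suc n)))) - (f b - f a)) < e"
  proof (intro exI[of _ n0] allI impI)
    fix n assume n: "n \<ge> n0"
    define N where "N = real (Suc n)"
    have N: "N > 0" unfolding N_def by simp
    have Nd: "\<bar>b - a\<bar> / N < d"
    proof -
      have "\<bar>b - a\<bar> / d < N" using n0 n unfolding N_def by linarith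
      then show ?thesis using d N by (simp add: field_simps)
    qed
    define x where "x i = a + (b - a) * (real i / N)" for i :: nat
    have x0: "x 0 = a" and xn: "x (Suc n) = b" using N by (auto simp: x_def N_def)
    have xS: "x (Suc i) - x i = (b - a) / N" for i
      unfolding x_def by (simp add: add_divide_distrib distrib_left diff_divide_distrib algebra_simps)
    have xin: "x i \<in> closed_segment a b" if "i \<le> Suc n" for i
    proof -
      have "x i = (1 - real i / N) *\<^sub>R a + (real i / N) *\<^sub>R b"
        unfolding x_def real_scaleR_def by (rule affine_comb)
      moreover have "0 \<le> real i / N" "real i / N \<le> 1" using that N by (auto simp: N_def)
      ultimately show ?thesis unfolding closed_segment_def by blast
    qed
    have seg: "closed_segment a b \<subseteq> {p..r}" using ab by (auto simp: closed_segment_eq_real_ivl split: if_splits)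
    have piece: "norm (f (x (Suc i)) - f (x i) - (x (Suc i) - x i) *\<^sub>R f' (x i)) \<le> norm (x (Suc i) - x i) * e'" if "i < Suc n" for i
    proof (rule vector_differentiable_bound_linearization)
      let ?S = "closed_segment (x i) (x (Suc i))"
      have Ssub: "?S \<subseteq> {p..r}"
        using subset_trans[OF _ seg] xin[of i] xin[of "Suc i"] that by (simp add: closed_segment_subset convex_closed_segment)
      show "(f has_vector_derivative f' z) (at z within ?S)" if "z \<in> ?S" for z
        by (rule has_vector_derivative_within_subset[OF f Ssub]) (use Ssub that in blast)
      show "?S \<subseteq> ?S" "x i \<in> ?S" by auto
      show "norm (f' z - f' (x i)) \<le> e'" if z: "z \<in> ?S" for z
      proof -
        have "dist z (x i) \<le> dist (x (Suc i)) (x i)"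
          using z by (metis dist_commute dist_in_closed_segment)
        also have "\<dots> = \<bar>b - a\<bar> / N" using xS[of i] N by (simp add: dist_real_def)
        finally have "dist z (x i) < d" using Nd by simp
        moreover have "z \<in> {p..r}" "x i \<in> {p..r}" using z Ssub ends_in_segment(1)[of "x i" "x (Suc i)"] by blast+
        ultimately show ?thesis using d(2)[of "x i" z] by (simp add: dist_norm less_imp_le)
      qed
    qed
    have "f b - f a = (\<Sum>i<Suc n. f (x (Suc i)) - f (x i))"
      by (subst sum_lessThan_telescope) (simp add: x0 xn)
    then have "norm (complex_of_real ((b - a) / N) * (\<Sum>i<Suc n. f' (x i)) - (f b - f a)) =
        norm (\<Sum>i<Suc n. (f (x (Suc i)) - f (x i) - (x (Suc i) - x i) *\<^sub>R f' (x i)))"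
      by (subst norm_minus_commute) (simp only: sum_subtractf xS sum_distrib_left scaleR_conv_of_real)
    also have "\<dots> \<le> (\<Sum>i<Suc n. norm (x (Suc i) - x i) * e')"
      by (rule order_trans[OF norm_sum sum_mono]) (use piece in auto)
    also have "\<dots> = \<bar>b - a\<bar> * e'" using N unfolding xS by (simp add: N_def)
    also have "\<dots> < e"
    proof -
      have "\<bar>b - a\<bar> * e < 2 * (\<bar>b - a\<bar> + 1) * e" using e by (intro mult_strict_right_mono) auto
      moreover have "2 * (\<bar>b - a\<bar> + 1) > 0" by (intro mult_pos_pos add_nonneg_pos) auto
      ultimately show ?thesis unfolding e'_def times_divide_eq_right by (simp only: pos_divide_less_eq mult.commute[of e])
    qed
    finally show "norm (complex_of_real ((b - a) / real (Suc n)) * (\<Sum>i<Suc n. f' (a + (b - a) * (real i / real (Suc n)))) - (f b - f a)) < e"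
      unfolding x_def N_def .
  qed
qed

text \<open>Cauchy-Schwarz costs a factor \<open>n\<close> and there are \<open>n\<close> summands.
  For \<open>c\<close> of size \<open>1 / n\<close>, as in a Riemann sum, the bound no longer
  depends on \<open>n\<close>.\<close>

lemma L2sq_sum_le:
  assumes "\<And>i. i < n \<Longrightarrow> g i \<in> borel_measurable borel" "\<And>i. i < n \<Longrightarrow> L2sq (g i) \<le> B"
  shows "L2sq (\<lambda>x. c * (\<Sum>i<n. g i x)) \<le> ennreal ((cmod c)\<^sup>2 * (real n)\<^sup>2) * B"
proof -
  have [measurable]: "(\<lambda>x. \<Sum>i<n. g i x) \<in> borel_measurable borel"
    by (rule borel_measurable_sum) (use assms in auto)
  have "L2sq (\<lambda>x. \<Sum>i<n. g i x) \<le> (\<integral>\<^sup>+ x. (\<Sum>i<n. ennreal (real n) * ennreal ((cmod (g i x))\<^sup>2)) \<partial>lborel)"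
    unfolding L2sq_def
  proof (rule nn_integral_mono)
    fix x
    have "(cmod (\<Sum>i<n. g i x))\<^sup>2 \<le> (\<Sum>i<n. cmod (g i x))\<^sup>2" by (intro power_mono norm_sum) simp
    also have "\<dots> \<le> (\<Sum>i<n. real n * (cmod (g i x))\<^sup>2)"
      using sum_squared_le_sum_of_squares[of "\<lambda>i. cmod (g i x)" "{..<n}"] by (simp add: sum_distrib_left[symmetric] mult.commute)
    finally have "ennreal ((cmod (\<Sum>i<n. g i x))\<^sup>2) \<le> ennreal (\<Sum>i<n. real n * (cmod (g i x))\<^sup>2)" by (rule ennreal_leI)
    also have "\<dots> = (\<Sum>i<n. ennreal (real n) * ennreal ((cmod (g i x))\<^sup>2))"
      by (subst sum_ennreal[symmetric]) (auto simp: ennreal_mult)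
    finally show "ennreal ((cmod (\<Sum>i<n. g i x))\<^sup>2) \<le> (\<Sum>i<n. ennreal (real n) * ennreal ((cmod (g i x))\<^sup>2))" .
  qed
  also have "\<dots> = (\<Sum>i<n. ennreal (real n) * L2sq (g i))"
    unfolding L2sq_def using assms(1) by (subst nn_integral_sum) (auto intro!: sum.cong nn_integral_cmult)
  also have "\<dots> \<le> (\<Sum>i<n. ennreal (real n) * B)" using assms(2) by (intro sum_mono mult_left_mono) auto
  also have "\<dots> = ennreal ((real n)\<^sup>2) * B"
    by (simp add: power2_eq_square ennreal_mult ennreal_of_nat_eq_real_of_nat mult.assoc)
  finally have "ennreal ((cmod c)\<^sup>2) * L2sq (\<lambda>x. \<Sum>i<n. g i x) \<le> ennreal ((cmod c)\<^sup>2) * (ennreal ((real n)\<^sup>2) * B)"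
    by (rule mult_left_mono) simp
  then show ?thesis by (subst L2sq_cmult) (auto simp: ennreal_mult mult.assoc)
qed

context shrinking_radius
begin

text \<open>Below a fixed frequency the weight is smooth in time, uniformly in \<xi>. The three
  bounds are its size, a Lipschitz bound and a second-order Taylor bound; the plus sign in the last
  reflects that \<open>w\<close> decreases at rate \<open>M\<close>.\<close>

lemma weight_local:
  assumes R: "R \<ge> 0"
  obtains B where "B \<ge> 0" "\<And>s \<xi>. s \<in> {0..T} \<Longrightarrow> \<bar>\<xi>\<bar> \<le> R \<Longrightarrow> weight (w s) m \<xi> \<le> B"
    "\<And>s t \<xi>. s \<in> {0..T} \<Longrightarrow> t \<in> {0..T} \<Longrightarrow> \<bar>\<xi>\<bar> \<le> R \<Longrightarrow> \<bar>weight (w s) m \<xi> - weight (w t) m \<xi>\<bar> \<le> B * \<bar>s - t\<bar>"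
    "\<And>s t \<xi>. s \<in> {0..T} \<Longrightarrow> t \<in> {0..T} \<Longrightarrow> \<bar>\<xi>\<bar> \<le> R \<Longrightarrow>
       \<bar>weight (w s) m \<xi> - weight (w t) m \<xi> + (s - t) * M * japanese \<xi> * weight (w t) m \<xi>\<bar> \<le> B * (s - t)\<^sup>2"
proof -
  define P where "P = (1 + R) powr \<bar>m\<bar> * exp (w0 * (1 + R))"
  \<comment> \<open>One constant for all three bounds: \<open>P\<close> bounds the weight itself,
    and \<open>L\<close> dominates 1, the Lipschitz factor and its square.\<close>
  define L where "L = 1 + (M * (1 + R)) + (M * (1 + R))\<^sup>2"
  have w0: "w0 > 0" using MT M0 T0 by (smt (verit) mult_pos_pos)
  have P0: "P \<ge> 0" by (simp add: P_def)
  have L: "L \<ge> 1" "L \<ge> M * (1 + R)" "L \<ge> (M * (1 + R))\<^sup>2" using M0 R by (auto simp: L_def)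
  have j: "japanese \<xi> \<le> 1 + R" if "\<bar>\<xi>\<bar> \<le> R" for \<xi> using japanese_le[of \<xi>] that by linarith
  have jm: "japanese \<xi> powr m \<le> (1 + R) powr \<bar>m\<bar>" if "\<bar>\<xi>\<bar> \<le> R" for \<xi>
    using powr_mono[OF abs_ge_self[of m] japanese_ge_1[of \<xi>]] powr_mono2[of "\<bar>m\<bar>" "japanese \<xi>" "1 + R"] j[OF that] by auto
  have ex: "exp (w s * japanese \<xi>) \<le> exp (w0 * (1 + R))" if "s \<in> {0..T}" "\<bar>\<xi>\<bar> \<le> R" for s \<xi>
    using w_le[OF that(1)] w_pos[OF that(1)] j[OF that(2)] by (auto intro!: mult_mono)
  have ws: "w s * x - w t * x = - (M * (s - t) * x)" for s t x by (simp add: w_def algebra_simps)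
  have ja: "\<bar>M * (s - t) * japanese \<xi>\<bar> \<le> M * (1 + R) * \<bar>s - t\<bar>" if "\<bar>\<xi>\<bar> \<le> R" for s t \<xi>
  proof -
    have "\<bar>M * (s - t) * japanese \<xi>\<bar> = M * japanese \<xi> * \<bar>s - t\<bar>" using M0 by (simp add: abs_mult)
    also have "\<dots> \<le> M * (1 + R) * \<bar>s - t\<bar>" using j[OF that] M0 by (intro mult_right_mono mult_left_mono) auto
    finally show ?thesis .
  qed
  show ?thesis
  proof (rule that[of "P * L"])
    show "P * L \<ge> 0" using P0 L by simp
    fix s \<xi> assume s: "s \<in> {0..T}" and \<xi>: "\<bar>\<xi>\<bar> \<le> R"
    have "weight (w s) m \<xi> \<le> P * 1" unfolding weight_def P_def using jm[OF \<xi>] ex[OF s \<xi>] by (simp add: mult_mono)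
    also have "\<dots> \<le> P * L" using P0 L by (intro mult_left_mono) auto
    finally show "weight (w s) m \<xi> \<le> P * L" .
    fix t assume t: "t \<in> {0..T}"
    have mx: "exp (max (w s * japanese \<xi>) (w t * japanese \<xi>)) \<le> exp (w0 * (1 + R))"
      using ex[OF s \<xi>] ex[OF t \<xi>] by (simp add: max_def)
    have "\<bar>exp (w s * japanese \<xi>) - exp (w t * japanese \<xi>)\<bar> \<le> (M * (1 + R) * \<bar>s - t\<bar>) * exp (w0 * (1 + R))"
      using ja[OF \<xi>, of s t] by (intro order_trans[OF exp_diff_bound] mult_mono mx) (auto simp: ws)
    then have "japanese \<xi> powr m * \<bar>exp (w s * japanese \<xi>) - exp (w t * japanese \<xi>)\<bar> \<le> (1 + R) powr \<bar>m\<bar> * ((M * (1 + R) * \<bar>s - t\<bar>) * exp (w0 * (1 + R)))"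
      using jm[OF \<xi>] by (intro mult_mono) auto
    then have "\<bar>weight (w s) m \<xi> - weight (w t) m \<xi>\<bar> \<le> P * (M * (1 + R)) * \<bar>s - t\<bar>"
      unfolding weight_def P_def right_diff_distrib[symmetric] abs_mult by (simp add: mult_ac)
    also have "\<dots> \<le> P * L * \<bar>s - t\<bar>" using P0 L by (intro mult_right_mono mult_left_mono) auto
    finally show "\<bar>weight (w s) m \<xi> - weight (w t) m \<xi>\<bar> \<le> P * L * \<bar>s - t\<bar>" .
    have "\<bar>exp (w s * japanese \<xi>) - exp (w t * japanese \<xi>) - (w s * japanese \<xi> - w t * japanese \<xi>) * exp (w t * japanese \<xi>)\<bar> \<le> (M * (1 + R) * \<bar>s - t\<bar>)\<^sup>2 * exp (w0 * (1 + R))"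
      using power_mono[OF ja[OF \<xi>, of s t], of 2] by (intro order_trans[OF exp_diff_bound2] mult_mono mx) (auto simp: ws)
    then have "japanese \<xi> powr m * \<bar>exp (w s * japanese \<xi>) - exp (w t * japanese \<xi>) - (w s * japanese \<xi> - w t * japanese \<xi>) * exp (w t * japanese \<xi>)\<bar> \<le> (1 + R) powr \<bar>m\<bar> * ((M * (1 + R) * \<bar>s - t\<bar>)\<^sup>2 * exp (w0 * (1 + R)))"
      using jm[OF \<xi>] by (intro mult_mono) auto
    also have "\<dots> = P * (M * (1 + R))\<^sup>2 * (s - t)\<^sup>2" by (simp add: P_def power_mult_distrib mult_ac)
    also have "\<dots> \<le> P * L * (s - t)\<^sup>2" using P0 L by (intro mult_right_mono mult_left_mono) auto
    finally have "\<bar>japanese \<xi> powr m * (exp (w s * japanese \<xi>) - exp (w t * japanese \<xi>) - (w s * japanese \<xi> - w t * japanese \<xi>) * exp (w t * japanese \<xi>))\<bar> \<le> P * L * (s - t)\<^sup>2"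
      by (simp add: abs_mult)
    moreover have "japanese \<xi> powr m * (exp (w s * japanese \<xi>) - exp (w t * japanese \<xi>) - (w s * japanese \<xi> - w t * japanese \<xi>) * exp (w t * japanese \<xi>)) =
        weight (w s) m \<xi> - weight (w t) m \<xi> + (s - t) * M * japanese \<xi> * weight (w t) m \<xi>"
      unfolding weight_def ws by (simp add: algebra_simps)
    ultimately show "\<bar>weight (w s) m \<xi> - weight (w t) m \<xi> + (s - t) * M * japanese \<xi> * weight (w t) m \<xi>\<bar> \<le> P * L * (s - t)\<^sup>2" by simp
  qed
qed

end

section \<open>The energy estimate\<close>

context shrinking_radius
begin

section \<open>Cut-off energies: integrability, continuity and measurability in time\<close>

lemma cut_weight_sqi:
  assumes u: "spectral_curve u h" and t: "t \<in> {0..T}" and R: "R \<ge> 0"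
  shows "square_integrable (cut_weight R (w t) m (h t))"
proof -
  have [measurable]: "h t \<in> borel_measurable borel" by (rule spectral_curve_meas[OF u t])
  obtain B where B: "B \<ge> 0" "\<And>s \<xi>. s \<in> {0..T} \<Longrightarrow> \<bar>\<xi>\<bar> \<le> R \<Longrightarrow> weight (w s) m \<xi> \<le> B"
    using weight_local[OF R, of m] by metis
  have "L2sq (cut_weight R (w t) m (h t)) \<le> L2sq (\<lambda>\<xi>. complex_of_real B * h t \<xi>)"
    by (rule L2sq_mono) (use B t in \<open>auto simp: cut_weight_eq norm_mult intro!: mult_right_mono\<close>)
  also have "\<dots> < \<infinity>" using sqi_cmult[OF spectral_curve_sqi[OF u t]] by (simp add: sqi_iff)
  finally show ?thesis by (simp add: sqi_iff)
qed

lemma L2sq_le_combo: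
  assumes [measurable]: "f \<in> borel_measurable borel" "a \<in> borel_measurable borel" "b \<in> borel_measurable borel"
    and pw: "\<And>\<xi>. cmod (f \<xi>) \<le> p * cmod (a \<xi>) + q * cmod (b \<xi>)" and pq: "p \<ge> 0" "q \<ge> 0"
  shows "L2sq f \<le> ennreal (2 * p\<^sup>2) * L2sq a + ennreal (2 * q\<^sup>2) * L2sq b"
proof -
  have "L2sq f \<le> L2sq (\<lambda>\<xi>. complex_of_real (p * cmod (a \<xi>)) + complex_of_real (q * cmod (b \<xi>)))"
  proof (rule L2sq_mono)
    fix \<xi>
    have "cmod (complex_of_real (p * cmod (a \<xi>)) + complex_of_real (q * cmod (b \<xi>))) = p * cmod (a \<xi>) + q * cmod (b \<xi>)"
      unfolding of_real_add[symmetric] norm_of_real using pq by simp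
    then show "cmod (f \<xi>) \<le> cmod (complex_of_real (p * cmod (a \<xi>)) + complex_of_real (q * cmod (b \<xi>)))" using pw[of \<xi>] by simp
  qed
  also have "\<dots> \<le> 2 * L2sq (\<lambda>\<xi>. complex_of_real (p * cmod (a \<xi>))) + 2 * L2sq (\<lambda>\<xi>. complex_of_real (q * cmod (b \<xi>)))"
    by (rule L2sq_add) measurable
  also have "L2sq (\<lambda>\<xi>. complex_of_real (p * cmod (a \<xi>))) = ennreal (p\<^sup>2) * L2sq a"
    by (simp add: L2sq_def norm_mult power_mult_distrib ennreal_mult nn_integral_cmult)
  also have "L2sq (\<lambda>\<xi>. complex_of_real (q * cmod (b \<xi>))) = ennreal (q\<^sup>2) * L2sq b"
    by (simp add: L2sq_def norm_mult power_mult_distrib ennreal_mult nn_integral_cmult)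
  finally show ?thesis by (simp add: ennreal_mult mult.assoc)
qed

text \<open>The increment is split into the change of the density, which is continuous at radius 0,
  and the change of the weight, which is Lipschitz below the cut-off.\<close>

lemma cut_weight_lim:
  assumes u: "spectral_curve u h" and t: "t \<in> {0..T}" and R: "R \<ge> 0"
  shows "((\<lambda>s. L2sq (\<lambda>\<xi>. cut_weight R (w s) m (h s) \<xi> - cut_weight R (w t) m (h t) \<xi>)) \<longlongrightarrow> 0) (at t within {0..T})"
proof -
  obtain B where B: "B \<ge> 0" "\<And>s \<xi>. s \<in> {0..T} \<Longrightarrow> \<bar>\<xi>\<bar> \<le> R \<Longrightarrow> weight (w s) m \<xi> \<le> B"
    "\<And>s t \<xi>. s \<in> {0..T} \<Longrightarrow> t \<in> {0..T} \<Longrightarrow> \<bar>\<xi>\<bar> \<le> R \<Longrightarrow> \<bar>weight (w s) m \<xi> - weight (w t) m \<xi>\<bar> \<le> B * \<bar>s - t\<bar>"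
    using weight_local[OF R, of m] by metis
  have mt: "h t \<in> borel_measurable borel" by (rule spectral_curve_meas[OF u t])
  have c: "0 \<in> {0..<w_end}" using w_end_pos by simp
  have L: "((\<lambda>s. L2sq (\<lambda>\<xi>. h s \<xi> - h t \<xi>)) \<longlongrightarrow> 0) (at t within {0..T})"
    using spectral_curve_lim[OF u t c, of 0] by (simp add: wnorm_00)
  have ht: "L2sq (h t) = ennreal (L2sqr (h t))" by (rule ennreal_L2sqr[symmetric, OF spectral_curve_sqi[OF u t]])
  have "((\<lambda>s. ennreal ((s - t)\<^sup>2 * L2sqr (h t))) \<longlongrightarrow> ennreal ((t - t)\<^sup>2 * L2sqr (h t))) (at t within {0..T})"
    by (intro tendsto_intros)
  then have L2: "((\<lambda>s. ennreal ((s - t)\<^sup>2 * L2sqr (h t))) \<longlongrightarrow> 0) (at t within {0..T})" by simp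
  show ?thesis
  proof (rule ennreal_tendsto_0_le[OF tendsto_add_0[OF L L2], where C="2 * B\<^sup>2"], rule eventually_within_I)
    fix s assume s: "s \<in> {0..T}"
    have ms: "h s \<in> borel_measurable borel" by (rule spectral_curve_meas[OF u s])
    have "L2sq (\<lambda>\<xi>. cut_weight R (w s) m (h s) \<xi> - cut_weight R (w t) m (h t) \<xi>) \<le> ennreal (2 * B\<^sup>2) * L2sq (\<lambda>\<xi>. h s \<xi> - h t \<xi>) + ennreal (2 * (B * \<bar>s - t\<bar>)\<^sup>2) * L2sq (h t)"
    proof (rule L2sq_le_combo)
      fix \<xi>
      show "cmod (cut_weight R (w s) m (h s) \<xi> - cut_weight R (w t) m (h t) \<xi>) \<le> B * cmod (h s \<xi> - h t \<xi>) + (B * \<bar>s - t\<bar>) * cmod (h t \<xi>)"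
      proof (cases "\<bar>\<xi>\<bar> \<le> R")
        case True
        have "cut_weight R (w s) m (h s) \<xi> - cut_weight R (w t) m (h t) \<xi> = complex_of_real (weight (w s) m \<xi>) * (h s \<xi> - h t \<xi>) + complex_of_real (weight (w s) m \<xi> - weight (w t) m \<xi>) * h t \<xi>"
          using True by (simp add: cut_weight_eq algebra_simps)
        also have "cmod \<dots> \<le> weight (w s) m \<xi> * cmod (h s \<xi> - h t \<xi>) + \<bar>weight (w s) m \<xi> - weight (w t) m \<xi>\<bar> * cmod (h t \<xi>)"
          by (rule order_trans[OF norm_triangle_ineq]) (simp only: norm_mult norm_of_real, simp)
        also have "\<dots> \<le> B * cmod (h s \<xi> - h t \<xi>) + (B * \<bar>s - t\<bar>) * cmod (h t \<xi>)"
          by (intro add_mono mult_right_mono B s t True) auto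
        finally show ?thesis .
      qed (use B in \<open>auto simp: cut_weight_eq\<close>)
    qed (use B ms mt in \<open>auto intro!: borel_measurable_diff cut_weight_measurable\<close>)
    also have "\<dots> = ennreal (2 * B\<^sup>2) * (L2sq (\<lambda>\<xi>. h s \<xi> - h t \<xi>) + ennreal ((s - t)\<^sup>2 * L2sqr (h t)))"
    proof -
      have "ennreal (2 * (B * \<bar>s - t\<bar>)\<^sup>2) * ennreal (L2sqr (h t)) = ennreal (2 * B\<^sup>2) * ennreal ((s - t)\<^sup>2 * L2sqr (h t))"
        by (simp only: ennreal_mult[symmetric] zero_le_power2 L2sqr_nonneg mult_nonneg_nonneg zero_le_numeral) (simp add: power_mult_distrib mult_ac)
      then show ?thesis by (simp only: ht distrib_left)
    qed
    finally show "L2sq (\<lambda>\<xi>. cut_weight R (w s) m (h s) \<xi> - cut_weight R (w t) m (h t) \<xi>) \<le> ennreal (2 * B\<^sup>2) * (L2sq (\<lambda>\<xi>. h s \<xi> - h t \<xi>) + ennreal ((s - t)\<^sup>2 * L2sqr (h t)))" .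
  qed
qed

lemma cut_weight_continuous:
  assumes u: "spectral_curve u h" and R: "R \<ge> 0"
  shows "continuous_on {0..T} (\<lambda>s. L2sqr (cut_weight R (w s) m (h s)))"
  by (rule L2sqr_continuous) (use cut_weight_sqi[OF u _ R] cut_weight_lim[OF u _ R] in auto)

text \<open>The norm is an inferior limit of functions that are continuous in time. Measurability is
  what allows time integrals of norms to be added.\<close>

lemma spectral_curve_Hmeas:
  assumes u: "spectral_curve u h" and t: "t \<in> {0..T}"
  shows "(\<lambda>s. Hnorm_sq (w s) m (u s) * indicator {0..t} s) \<in> borel_measurable borel"
proof -
  have "Hnorm_sq (w s) m (u s) * indicator {0..t} s = liminf (\<lambda>n. ennreal (indicator {0..t} s *\<^sub>R L2sqr (cut_weight (real n) (w s) m (h s))))" for s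
  proof (cases "s \<in> {0..t}")
    case True
    then have s: "s \<in> {0..T}" using t by auto
    show ?thesis using True
      by (simp add: spectral_curve_Hnorm[OF u s] wnorm_liminf[OF spectral_curve_meas[OF u s]] ennreal_L2sqr[OF cut_weight_sqi[OF u s]])
  qed (simp add: Liminf_const)
  moreover have "(\<lambda>s. liminf (\<lambda>n. ennreal (indicator {0..t} s *\<^sub>R L2sqr (cut_weight (real n) (w s) m (h s))))) \<in> borel_measurable borel"
  proof (intro borel_measurable_liminf)
    fix n
    have "(\<lambda>s. indicator {0..t} s *\<^sub>R L2sqr (cut_weight (real n) (w s) m (h s))) \<in> borel_measurable borel"
      by (rule borel_measurable_continuous_on_indicator) (use t in \<open>auto intro!: continuous_on_subset[OF cut_weight_continuous[OF u]]\<close>)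
    then show "(\<lambda>s. ennreal (indicator {0..t} s *\<^sub>R L2sqr (cut_weight (real n) (w s) m (h s)))) \<in> borel_measurable borel" by measurable
  qed
  ultimately show ?thesis by presburger
qed

text \<open>
  The pointwise equation becomes one for spectral densities without any joint measurability in
  \<open>(t, \<xi>)\<close>: Riemann sums converge for each \<open>x\<close>, hence for the densities by Bessel and Fatou.
\<close>

lemma strong_deriv:
  assumes u: "spectral_curve u h" and N: "spectral_curve N k"
    and ode: "\<And>t x. t \<in> {0..T} \<Longrightarrow> ((\<lambda>s. u s x) has_vector_derivative N t x) (at t within {0..T})"
    and t: "t \<in> {0..T}" and t': "t' \<in> {0..T}"
    and b: "\<And>s. s \<in> closed_segment t t' \<Longrightarrow> L2sq (\<lambda>\<xi>. k s \<xi> - k t \<xi>) \<le> b"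
  shows "L2sq (\<lambda>\<xi>. h t' \<xi> - h t \<xi> - complex_of_real (t' - t) * k t \<xi>) \<le> ennreal (2 * (t' - t)\<^sup>2) * b"
proof -
  have c: "0 \<in> {0..<w_end}" using w_end_pos by simp
  have seg: "closed_segment t t' \<subseteq> {0..T}" using t t' by (auto simp: closed_segment_eq_real_ivl split: if_splits)
  have kint: "s \<in> {0..T} \<Longrightarrow> integrable lborel (k s)" for s by (rule spectral_curve_int[OF N])
  \<comment> \<open>The sup bound of order 1 turns continuity of the densities into continuity at
    each point \<open>x\<close>, as the Riemann sums require.\<close>
  have Ncont: "continuous_on {0..T} (\<lambda>s. N s x)" for x
    unfolding continuous_on_def
  proof
    fix r assume r: "r \<in> {0..T}"
    have "((\<lambda>s. ennreal ((cmod (N s x - N r x))\<^sup>2)) \<longlongrightarrow> 0) (at r within {0..T})"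
    proof (rule ennreal_tendsto_0_le[OF spectral_curve_lim[OF N r c, of 1], where C="japanese_int 1"], rule eventually_within_I)
      fix s assume s: "s \<in> {0..T}"
      have "N s x - N r x = fourier_int 1 (\<lambda>\<xi>. k s \<xi> - k r \<xi>) x"
        by (simp only: fourier_int_diff[OF kint[OF s] kint[OF r]] spectral_curve_fourier_int[OF N s] spectral_curve_fourier_int[OF N r])
      then show "ennreal ((cmod (N s x - N r x))\<^sup>2) \<le> ennreal (japanese_int 1) * wnorm 0 1 (\<lambda>\<xi>. k s \<xi> - k r \<xi>)"
        using fourier_int_sup_bound[of 1 "\<lambda>\<xi>. k s \<xi> - k r \<xi>" 1 x] spectral_curve_meas[OF N s] spectral_curve_meas[OF N r] by auto
    qed
    then have "((\<lambda>s. (cmod (N s x - N r x))\<^sup>2) \<longlongrightarrow> 0) (at r within {0..T})"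
      using tendsto_enn2real[of "\<lambda>s. ennreal ((cmod (N s x - N r x))\<^sup>2)" 0] by simp
    then have "((\<lambda>s. N s x - N r x) \<longlongrightarrow> 0) (at r within {0..T})"
      using tendsto_norm_zero_iff by (simp add: tendsto_norm_zero_iff)
    then show "((\<lambda>s. N s x) \<longlongrightarrow> N r x) (at r within {0..T})" by (simp add: LIM_zero_iff)
  qed
  define e where "e \<xi> = h t' \<xi> - h t \<xi> - complex_of_real (t' - t) * k t \<xi>" for \<xi>
  have es: "square_integrable e" unfolding e_def by (intro sqi_diff sqi_cmult spectral_curve_sqi[OF u] spectral_curve_sqi[OF N] t t')
  have ei: "integrable lborel e" unfolding e_def
    by (intro Bochner_Integration.integrable_diff integrable_mult_right spectral_curve_int[OF u] spectral_curve_int[OF N] t t')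
  define D where "D x = u t' x - u t x - complex_of_real (t' - t) * N t x" for x
  have DF: "D x = fourier_int 1 e x" for x
    unfolding D_def e_def
    by (simp only: fourier_int_diff[OF Bochner_Integration.integrable_diff[OF spectral_curve_int[OF u t'] spectral_curve_int[OF u t]] integrable_mult_right[OF spectral_curve_int[OF N t]]]
      fourier_int_diff[OF spectral_curve_int[OF u t'] spectral_curve_int[OF u t]] fourier_int_cmult spectral_curve_fourier_int[OF u t] spectral_curve_fourier_int[OF u t'] spectral_curve_fourier_int[OF N t])
  \<comment> \<open>Riemann sums of \<open>N\<close> with its value at \<open>t\<close> subtracted;
    they converge to the linearisation error \<open>D\<close>, and each summand is controlled by
    \<open>b\<close>.\<close>
  define S where "S n x = complex_of_real ((t' - t) / real (Suc n)) * (\<Sum>i<Suc n. N (t + (t' - t) * (real i / real (Suc n))) x - N t x)" for n x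
  have pin: "t + (t' - t) * (real i / real (Suc n)) \<in> closed_segment t t'" if "i < Suc n" for i n
  proof -
    have "t + (t' - t) * (real i / real (Suc n)) = (1 - real i / real (Suc n)) *\<^sub>R t + (real i / real (Suc n)) *\<^sub>R t'"
      unfolding real_scaleR_def by (rule affine_comb)
    moreover have "0 \<le> real i / real (Suc n)" "real i / real (Suc n) \<le> 1" using that by auto
    ultimately show ?thesis unfolding closed_segment_def by blast
  qed
  have Nm: "N s \<in> borel_measurable borel" if "s \<in> {0..T}" for s
    unfolding spectral_curve_fourier_int[OF N that] by (rule fourier_int_measurable'[OF spectral_curve_meas[OF N that]])
  have Sm: "S n \<in> borel_measurable borel" for n
    unfolding S_def by (intro borel_measurable_times borel_measurable_const borel_measurable_sum borel_measurable_diff Nm t subsetD[OF seg] pin) (simp only: lessThan_iff)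
  have Dm: "D \<in> borel_measurable borel" unfolding DF[abs_def] by (rule fourier_int_measurable') (use es in auto)
  have SD: "(\<lambda>n. S n x) \<longlonglongrightarrow> D x" for x
  proof -
    have "(\<lambda>n. complex_of_real ((t' - t) / real (Suc n)) * (\<Sum>i<Suc n. N (t + (t' - t) * (real i / real (Suc n))) x)) \<longlonglongrightarrow> u t' x - u t x"
      by (rule riemann_sums[OF ode Ncont t t'])
    then have "(\<lambda>n. complex_of_real ((t' - t) / real (Suc n)) * (\<Sum>i<Suc n. N (t + (t' - t) * (real i / real (Suc n))) x) - complex_of_real (t' - t) * N t x) \<longlonglongrightarrow> D x"
      unfolding D_def by (intro tendsto_diff tendsto_const)
    moreover have "complex_of_real ((t' - t) / real (Suc n)) * (\<Sum>i<Suc n. N (t + (t' - t) * (real i / real (Suc n))) x) - complex_of_real (t' - t) * N t x = S n x" for n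
    proof -
      have "complex_of_real ((t' - t) / real (Suc n)) * (\<Sum>i<Suc n. N t x) = complex_of_real (t' - t) * N t x"
        by (simp add: mult.assoc[symmetric] del: of_real_diff of_nat_Suc)
      then show ?thesis unfolding S_def sum_subtractf right_diff_distrib by simp
    qed
    ultimately show ?thesis by (simp only:)
  qed
  have Sb: "L2sq (S n) \<le> ennreal ((t' - t)\<^sup>2) * b" for n
  proof -
    have "L2sq (S n) \<le> ennreal ((cmod (complex_of_real ((t' - t) / real (Suc n))))\<^sup>2 * (real (Suc n))\<^sup>2) * b"
      unfolding S_def
    proof (rule L2sq_sum_le)
      fix i assume i: "i < Suc n"
      let ?s = "t + (t' - t) * (real i / real (Suc n))"
      have sS: "?s \<in> closed_segment t t'" by (rule pin[OF i])
      then have s: "?s \<in> {0..T}" using seg by auto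
      show "(\<lambda>x. N ?s x - N t x) \<in> borel_measurable borel" by (intro borel_measurable_diff Nm s t)
      have "(\<lambda>x. N ?s x - N t x) = fourier_int 1 (\<lambda>\<xi>. k ?s \<xi> - k t \<xi>)"
        by (intro ext) (simp only: fourier_int_diff[OF kint[OF s] kint[OF t]] spectral_curve_fourier_int[OF N s] spectral_curve_fourier_int[OF N t])
      then have "L2sq (\<lambda>x. N ?s x - N t x) \<le> L2sq (\<lambda>\<xi>. k ?s \<xi> - k t \<xi>)"
        using Bessel[OF Bochner_Integration.integrable_diff[OF kint[OF s] kint[OF t]], of 1] by simp
      also have "\<dots> \<le> b" by (rule b[OF sS])
      finally show "L2sq (\<lambda>x. N ?s x - N t x) \<le> b" .
    qed
    also have "(cmod (complex_of_real ((t' - t) / real (Suc n))))\<^sup>2 * (real (Suc n))\<^sup>2 = (t' - t)\<^sup>2"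
      unfolding norm_of_real by (simp add: power_divide)
    finally show ?thesis .
  qed
  have "L2sq D \<le> ennreal ((t' - t)\<^sup>2) * b"
    by (rule order_trans[OF L2sq_Fatou[of S D, OF Sm Dm] Liminf_le]) (use SD Sb in \<open>auto intro: always_eventually\<close>)
  \<comment> \<open>Back from the error to its density \<open>e\<close>; the 2 in the claim arises
    here, from \<open>plancherel_limit_L2sq_le\<close>.\<close>
  moreover have "L2sq e \<le> 2 * L2sq D"
  proof -
    have f: "AE \<xi> in lborel. fourier D \<xi> = e \<xi>" and Ds: "square_integrable D"
      using fourier_fourier_int[OF ei es, of D] Dm DF by auto
    have "L2sq e = L2sq (fourier D)" by (rule L2sq_cong_AE) (use f in auto)
    also have "\<dots> \<le> 2 * L2sq D" by (rule plancherel_limit_L2sq_le[OF Ds _ fourier_spec[OF Ds]]) simp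
    finally show ?thesis .
  qed
  ultimately have "L2sq e \<le> 2 * (ennreal ((t' - t)\<^sup>2) * b)"
    by (meson mult_left_mono order_trans zero_le)
  then show ?thesis unfolding e_def by (simp add: ennreal_mult mult.assoc)
qed

section \<open>Differentiation of the cut-off energy in time\<close>

lemma deriv_o:
  assumes u: "spectral_curve u h" and N: "spectral_curve N k"
    and ode: "\<And>t x. t \<in> {0..T} \<Longrightarrow> ((\<lambda>s. u s x) has_vector_derivative N t x) (at t within {0..T})"
    and t: "t \<in> {0..T}"
  shows "((\<lambda>s. L2sqr (\<lambda>\<xi>. h s \<xi> - h t \<xi> - complex_of_real (s - t) * k t \<xi>) / (s - t)\<^sup>2) \<longlongrightarrow> 0) (at t within {0..T})"
proof (rule tendstoI)
  fix e :: real assume e: "e > 0"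
  have c: "0 \<in> {0..<w_end}" using w_end_pos by simp
  have "eventually (\<lambda>s. L2sq (\<lambda>\<xi>. k s \<xi> - k t \<xi>) < ennreal (e / 4)) (at t within {0..T})"
    using spectral_curve_lim[OF N t c, of 0] e by (intro order_tendstoD) (auto simp: wnorm_00)
  then obtain d where d: "d > 0" "\<And>s. s \<in> {0..T} \<Longrightarrow> s \<noteq> t \<Longrightarrow> dist s t < d \<Longrightarrow> L2sq (\<lambda>\<xi>. k s \<xi> - k t \<xi>) < ennreal (e / 4)"
    unfolding eventually_at by auto
  show "\<forall>\<^sub>F s in at t within {0..T}. dist (L2sqr (\<lambda>\<xi>. h s \<xi> - h t \<xi> - complex_of_real (s - t) * k t \<xi>) / (s - t)\<^sup>2) 0 < e"
    unfolding eventually_at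
  proof (intro exI[of _ d] conjI ballI impI d(1))
    fix s assume s: "s \<in> {0..T}" and "s \<noteq> t \<and> dist s t < d"
    then have ne: "s \<noteq> t" and ds: "dist s t < d" by auto
    have "L2sq (\<lambda>\<xi>. h s \<xi> - h t \<xi> - complex_of_real (s - t) * k t \<xi>) \<le> ennreal (2 * (s - t)\<^sup>2) * ennreal (e / 4)"
    proof (rule strong_deriv[OF u N ode t s])
      fix r assume r: "r \<in> closed_segment t s"
      then have rT: "r \<in> {0..T}" using t s by (auto simp: closed_segment_eq_real_ivl split: if_splits)
      show "L2sq (\<lambda>\<xi>. k r \<xi> - k t \<xi>) \<le> ennreal (e / 4)"
      proof (cases "r = t")
        case True then show ?thesis by (simp add: L2sq_def)
      next
        case False
        have "dist r t \<le> dist s t" using r by (metis dist_commute dist_in_closed_segment)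
        then show ?thesis using d(2)[OF rT False] ds by simp
      qed
    qed
    also have "\<dots> = ennreal (2 * (s - t)\<^sup>2 * (e / 4))" using e by (subst ennreal_mult) auto
    finally have "L2sqr (\<lambda>\<xi>. h s \<xi> - h t \<xi> - complex_of_real (s - t) * k t \<xi>) \<le> 2 * (s - t)\<^sup>2 * (e / 4)"
      unfolding L2sqr_def using e by (intro enn2real_leI) auto
    then have "L2sqr (\<lambda>\<xi>. h s \<xi> - h t \<xi> - complex_of_real (s - t) * k t \<xi>) / (s - t)\<^sup>2 \<le> e / 2"
      using ne by (simp add: divide_le_eq mult_ac)
    moreover have "0 \<le> L2sqr (\<lambda>\<xi>. h s \<xi> - h t \<xi> - complex_of_real (s - t) * k t \<xi>) / (s - t)\<^sup>2" by simp
    ultimately have "\<bar>L2sqr (\<lambda>\<xi>. h s \<xi> - h t \<xi> - complex_of_real (s - t) * k t \<xi>) / (s - t)\<^sup>2\<bar> < e"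
      using e by linarith
    then show "dist (L2sqr (\<lambda>\<xi>. h s \<xi> - h t \<xi> - complex_of_real (s - t) * k t \<xi>) / (s - t)\<^sup>2) 0 < e"
      by (simp only: dist_real_def diff_0_right)
  qed
qed

text \<open>The function is the time derivative of \<open>cut_weight R (w s) m (h s)\<close>: its
  second term stems from the decrease of \<open>w\<close> at rate \<open>M\<close>.\<close>

lemma sqi_of_energy:
  assumes u: "spectral_curve u h" and N: "spectral_curve N k" and t: "t \<in> {0..T}" and R: "R \<ge> 0"
  shows "square_integrable (cut_weight R (w t) m (\<lambda>\<xi>. k t \<xi> - complex_of_real (M * japanese \<xi>) * h t \<xi>))"
proof -
  obtain B where B: "B \<ge> 0" "\<And>s \<xi>. s \<in> {0..T} \<Longrightarrow> \<bar>\<xi>\<bar> \<le> R \<Longrightarrow> weight (w s) m \<xi> \<le> B"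
    using weight_local[OF R, of m] by metis
  have ht: "h t \<in> borel_measurable borel" and kt: "k t \<in> borel_measurable borel" by (rule spectral_curve_meas[OF u t], rule spectral_curve_meas[OF N t])
  define z where "z = cut_weight R (w t) m (\<lambda>\<xi>. k t \<xi> - complex_of_real (M * japanese \<xi>) * h t \<xi>)"
  have zm: "z \<in> borel_measurable borel" unfolding z_def using ht kt by measurable
  have "L2sq z \<le> ennreal (2 * B\<^sup>2) * L2sq (k t) + ennreal (2 * (B * (M * (1 + R)))\<^sup>2) * L2sq (h t)"
  proof (rule L2sq_le_combo[OF zm kt ht])
    fix \<xi> show "cmod (z \<xi>) \<le> B * cmod (k t \<xi>) + B * (M * (1 + R)) * cmod (h t \<xi>)"
    proof (cases "\<bar>\<xi>\<bar> \<le> R")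
      case True
      have "cmod (k t \<xi> - complex_of_real (M * japanese \<xi>) * h t \<xi>) \<le> cmod (k t \<xi>) + (M * japanese \<xi>) * cmod (h t \<xi>)"
        by (rule order_trans[OF norm_triangle_ineq4]) (simp only: norm_mult norm_of_real, use M0 in simp)
      also have "\<dots> \<le> cmod (k t \<xi>) + M * (1 + R) * cmod (h t \<xi>)"
        using M0 True japanese_le[of \<xi>] by (intro add_mono mult_right_mono mult_left_mono) auto
      finally have "weight (w t) m \<xi> * cmod (k t \<xi> - complex_of_real (M * japanese \<xi>) * h t \<xi>) \<le> B * (cmod (k t \<xi>) + M * (1 + R) * cmod (h t \<xi>))"
        using B(1) B(2)[OF t True] by (intro mult_mono) auto
      moreover have "cmod (z \<xi>) = weight (w t) m \<xi> * cmod (k t \<xi> - complex_of_real (M * japanese \<xi>) * h t \<xi>)"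
        using True by (simp add: z_def cut_weight_eq norm_mult del: of_real_mult)
      moreover have "B * (cmod (k t \<xi>) + M * (1 + R) * cmod (h t \<xi>)) = B * cmod (k t \<xi>) + B * (M * (1 + R)) * cmod (h t \<xi>)"
        by (simp only: distrib_left[of B] mult.assoc)
      ultimately show ?thesis by simp
    qed (use B M0 R in \<open>auto simp: z_def cut_weight_eq\<close>)
  qed (use B M0 R in auto)
  also have "\<dots> < \<infinity>" using spectral_curve_sqi[OF u t] spectral_curve_sqi[OF N t] by (auto simp: sqi_iff ennreal_mult_less_top)
  finally have zs: "square_integrable z" using zm by (simp add: sqi_iff)
  then show ?thesis unfolding z_def .
qed

text \<open>Product rule for weight times density, with the Taylor bound of
  \<open>weight_local\<close> for the weight and \<open>deriv_o\<close> for the density.\<close>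

lemma energy_deriv:
  assumes u: "spectral_curve u h" and N: "spectral_curve N k"
    and ode: "\<And>t x. t \<in> {0..T} \<Longrightarrow> ((\<lambda>s. u s x) has_vector_derivative N t x) (at t within {0..T})"
    and t: "t \<in> {0..T}" and R: "R \<ge> 0"
  shows "((\<lambda>s. L2sqr (cut_weight R (w s) m (h s))) has_vector_derivative
    2 * Re (LINT \<xi>|lborel. cnj (cut_weight R (w t) m (h t) \<xi>) * cut_weight R (w t) m (\<lambda>\<xi>. k t \<xi> - complex_of_real (M * japanese \<xi>) * h t \<xi>) \<xi>)) (at t within {0..T})"
proof (rule L2sqr_has_derivative[OF cut_weight_sqi[OF u _ R] _ t])
  obtain B where B: "B \<ge> 0" "\<And>s \<xi>. s \<in> {0..T} \<Longrightarrow> \<bar>\<xi>\<bar> \<le> R \<Longrightarrow> weight (w s) m \<xi> \<le> B"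
    "\<And>s t \<xi>. s \<in> {0..T} \<Longrightarrow> t \<in> {0..T} \<Longrightarrow> \<bar>\<xi>\<bar> \<le> R \<Longrightarrow> \<bar>weight (w s) m \<xi> - weight (w t) m \<xi>\<bar> \<le> B * \<bar>s - t\<bar>"
    "\<And>s t \<xi>. s \<in> {0..T} \<Longrightarrow> t \<in> {0..T} \<Longrightarrow> \<bar>\<xi>\<bar> \<le> R \<Longrightarrow>
       \<bar>weight (w s) m \<xi> - weight (w t) m \<xi> + (s - t) * M * japanese \<xi> * weight (w t) m \<xi>\<bar> \<le> B * (s - t)\<^sup>2"
    using weight_local[OF R, of m] by metis
  have ht: "h t \<in> borel_measurable borel" and kt: "k t \<in> borel_measurable borel" by (rule spectral_curve_meas[OF u t], rule spectral_curve_meas[OF N t])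
  define z where "z = cut_weight R (w t) m (\<lambda>\<xi>. k t \<xi> - complex_of_real (M * japanese \<xi>) * h t \<xi>)"
  have zm: "z \<in> borel_measurable borel" unfolding z_def using ht kt by measurable
  have zs: "square_integrable z" unfolding z_def by (rule sqi_of_energy[OF u N t R])
  then show "square_integrable (cut_weight R (w t) m (\<lambda>\<xi>. k t \<xi> - complex_of_real (M * japanese \<xi>) * h t \<xi>))" unfolding z_def .
  define q where "q s = L2sqr (\<lambda>\<xi>. h s \<xi> - h t \<xi> - complex_of_real (s - t) * k t \<xi>) / (s - t)\<^sup>2" for s
  have ql: "(q \<longlongrightarrow> 0) (at t within {0..T})" unfolding q_def by (rule deriv_o[OF u N ode t])
  let ?b = "\<lambda>s. 2 * B\<^sup>2 * q s + 2 * B\<^sup>2 * (s - t)\<^sup>2 * (2 * L2sqr (k t) + 2 * L2sqr (h t))"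
  have bl: "(?b \<longlongrightarrow> 2 * B\<^sup>2 * 0 + 2 * B\<^sup>2 * (t - t)\<^sup>2 * (2 * L2sqr (k t) + 2 * L2sqr (h t))) (at t within {0..T})"
    by (intro tendsto_intros ql)
  show "((\<lambda>s. L2sqr (\<lambda>\<xi>. cut_weight R (w s) m (h s) \<xi> - cut_weight R (w t) m (h t) \<xi> - complex_of_real (s - t) * cut_weight R (w t) m (\<lambda>\<xi>. k t \<xi> - complex_of_real (M * japanese \<xi>) * h t \<xi>) \<xi>) / (s - t)\<^sup>2) \<longlongrightarrow> 0) (at t within {0..T})"
    unfolding z_def[symmetric]
  proof (rule tendsto_sandwich[OF _ _ tendsto_const])
    show "(?b \<longlongrightarrow> 0) (at t within {0..T})" using bl by simp
    show "\<forall>\<^sub>F s in at t within {0..T}. L2sqr (\<lambda>\<xi>. cut_weight R (w s) m (h s) \<xi> - cut_weight R (w t) m (h t) \<xi> - complex_of_real (s - t) * z \<xi>) / (s - t)\<^sup>2 \<le> ?b s"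
      unfolding eventually_at_filter
    proof (intro always_eventually allI impI)
      fix s assume ne: "s \<noteq> t" and s: "s \<in> {0..T}"
      have hs: "h s \<in> borel_measurable borel" by (rule spectral_curve_meas[OF u s])
      define r where "r \<xi> = h s \<xi> - h t \<xi> - complex_of_real (s - t) * k t \<xi>" for \<xi>
      define kh where "kh \<xi> = complex_of_real (cmod (k t \<xi>)) + complex_of_real (cmod (h t \<xi>))" for \<xi>
      have rs: "square_integrable r" unfolding r_def by (intro sqi_diff sqi_cmult spectral_curve_sqi[OF u] spectral_curve_sqi[OF N] s t)
      have "L2sq (\<lambda>\<xi>. cut_weight R (w s) m (h s) \<xi> - cut_weight R (w t) m (h t) \<xi> - complex_of_real (s - t) * z \<xi>) \<le>
         ennreal (2 * B\<^sup>2) * L2sq r + ennreal (2 * (B * (s - t)\<^sup>2)\<^sup>2) * L2sq kh"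
      proof (rule L2sq_le_combo)
        show "(\<lambda>\<xi>. cut_weight R (w s) m (h s) \<xi> - cut_weight R (w t) m (h t) \<xi> - complex_of_real (s - t) * z \<xi>) \<in> borel_measurable borel"
          using hs ht zm by measurable
        show "r \<in> borel_measurable borel" using rs by auto
        show "kh \<in> borel_measurable borel" unfolding kh_def using ht kt by measurable
        fix \<xi>
        have khc: "cmod (kh \<xi>) = cmod (k t \<xi>) + cmod (h t \<xi>)"
          unfolding kh_def of_real_add[symmetric] norm_of_real by simp
        show "cmod (cut_weight R (w s) m (h s) \<xi> - cut_weight R (w t) m (h t) \<xi> - complex_of_real (s - t) * z \<xi>) \<le> B * cmod (r \<xi>) + B * (s - t)\<^sup>2 * cmod (kh \<xi>)"
        proof (cases "\<bar>\<xi>\<bar> \<le> R")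
          case True
          define A1 where "A1 = weight (w s) m \<xi>"
          define A2 where "A2 = weight (w t) m \<xi>"
          \<comment> \<open>The error of the product rule splits into the error of the density, the
            product of two first-order increments, and the Taylor error of the weight.\<close>
          have "cut_weight R (w s) m (h s) \<xi> - cut_weight R (w t) m (h t) \<xi> - complex_of_real (s - t) * z \<xi> =
             complex_of_real A1 * r \<xi> + (complex_of_real ((s - t) * (A1 - A2)) * k t \<xi>
              + complex_of_real (A1 - A2 + (s - t) * M * japanese \<xi> * A2) * h t \<xi>)"
            using True by (simp add: cut_weight_eq z_def r_def A1_def[symmetric] A2_def[symmetric] algebra_simps)
          also have "cmod \<dots> \<le> A1 * cmod (r \<xi>) + (\<bar>(s - t) * (A1 - A2)\<bar> * cmod (k t \<xi>) + \<bar>A1 - A2 + (s - t) * M * japanese \<xi> * A2\<bar> * cmod (h t \<xi>))"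
            by (intro order_trans[OF norm_triangle_ineq] add_mono) (simp_all only: norm_mult norm_of_real, simp_all add: A1_def)
          also have "\<dots> \<le> B * cmod (r \<xi>) + ((B * (s - t)\<^sup>2) * cmod (k t \<xi>) + (B * (s - t)\<^sup>2) * cmod (h t \<xi>))"
          proof (intro add_mono mult_right_mono norm_ge_zero)
            show "A1 \<le> B" unfolding A1_def by (rule B(2)[OF s True])
            show "\<bar>A1 - A2 + (s - t) * M * japanese \<xi> * A2\<bar> \<le> B * (s - t)\<^sup>2" unfolding A1_def A2_def by (rule B(4)[OF s t True])
            have "\<bar>(s - t) * (A1 - A2)\<bar> \<le> \<bar>s - t\<bar> * (B * \<bar>s - t\<bar>)"
              unfolding abs_mult A1_def A2_def by (intro mult_left_mono B(3)[OF s t True]) simp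
            then show "\<bar>(s - t) * (A1 - A2)\<bar> \<le> B * (s - t)\<^sup>2" by (simp add: power2_eq_square mult_ac)
          qed
          finally show ?thesis unfolding khc by (simp add: distrib_left)
        qed (use B in \<open>auto simp: cut_weight_eq z_def\<close>)
      qed (use B in auto)
      also have "L2sq kh \<le> ennreal (2 * L2sqr (k t) + 2 * L2sqr (h t))"
      proof -
        have "L2sq kh \<le> 2 * L2sq (\<lambda>\<xi>. complex_of_real (cmod (k t \<xi>))) + 2 * L2sq (\<lambda>\<xi>. complex_of_real (cmod (h t \<xi>)))"
          unfolding kh_def by (rule L2sq_add) (use ht kt in measurable)
        also have "\<dots> = 2 * L2sq (k t) + 2 * L2sq (h t)" by (simp add: L2sq_def)
        also have "\<dots> = ennreal (2 * L2sqr (k t) + 2 * L2sqr (h t))"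
          using spectral_curve_sqi[OF u t] spectral_curve_sqi[OF N t] by (simp add: ennreal_plus ennreal_mult ennreal_L2sqr)
        finally show ?thesis .
      qed
      also have "L2sq r = ennreal (q s * (s - t)\<^sup>2)"
      proof -
        have "q s * (s - t)\<^sup>2 = L2sqr r" using ne unfolding q_def r_def by simp
        then show ?thesis by (simp only: ennreal_L2sqr[OF rs])
      qed
      finally have "L2sq (\<lambda>\<xi>. cut_weight R (w s) m (h s) \<xi> - cut_weight R (w t) m (h t) \<xi> - complex_of_real (s - t) * z \<xi>) \<le>
        ennreal (2 * B\<^sup>2) * ennreal (q s * (s - t)\<^sup>2) + ennreal (2 * (B * (s - t)\<^sup>2)\<^sup>2) * ennreal (2 * L2sqr (k t) + 2 * L2sqr (h t))"
        by (simp add: mult_left_mono add_left_mono)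
      also have "\<dots> = ennreal (2 * B\<^sup>2 * (q s * (s - t)\<^sup>2) + 2 * (B * (s - t)\<^sup>2)\<^sup>2 * (2 * L2sqr (k t) + 2 * L2sqr (h t)))"
        by (subst ennreal_plus) (auto simp: ennreal_mult q_def)
      finally have "L2sqr (\<lambda>\<xi>. cut_weight R (w s) m (h s) \<xi> - cut_weight R (w t) m (h t) \<xi> - complex_of_real (s - t) * z \<xi>) \<le> 2 * B\<^sup>2 * (q s * (s - t)\<^sup>2) + 2 * (B * (s - t)\<^sup>2)\<^sup>2 * (2 * L2sqr (k t) + 2 * L2sqr (h t))"
        unfolding L2sqr_def[of "\<lambda>\<xi>. _ \<xi> - _ \<xi>"] by (intro enn2real_leI) (auto simp: q_def)
      also have "\<dots> = ?b s * (s - t)\<^sup>2" by (simp add: power2_eq_square algebra_simps)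
      finally show "L2sqr (\<lambda>\<xi>. cut_weight R (w s) m (h s) \<xi> - cut_weight R (w t) m (h t) \<xi> - complex_of_real (s - t) * z \<xi>) / (s - t)\<^sup>2 \<le> ?b s"
        using ne by (subst pos_divide_le_eq) auto
    qed
  qed simp
qed

text \<open>The factor \<open>\<i> * q\<close> makes the dispersive contribution purely imaginary,
  and weighted Young's inequality handles \<open>p\<close>. For
  \<open>\<mu> = M * japanese \<xi>\<close> the two terms on the right turn into the weights of
  order \<open>m + 1/2\<close> and \<open>m - 1/2\<close>.\<close>

lemma energy_pointwise:
  fixes h p :: complex
  assumes mu: "\<mu> > 0"
  shows "2 * Re (cnj h * ((\<i> * complex_of_real q) * (\<i> * complex_of_real x * (\<i> * complex_of_real x * h)) + p - complex_of_real \<mu> * h))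
    \<le> - \<mu> * (cmod h)\<^sup>2 + (1 / \<mu>) * (cmod p)\<^sup>2"
proof -
  have "Re (cnj h * ((\<i> * complex_of_real q) * (\<i> * complex_of_real x * (\<i> * complex_of_real x * h)) + p - complex_of_real \<mu> * h))
      = Re (cnj h * p) - \<mu> * (cmod h)\<^sup>2"
    unfolding cmod_power2 by (simp add: power2_eq_square algebra_simps)
  moreover have "Re (cnj h * p) \<le> cmod h * cmod p"
    using complex_Re_le_cmod[of "cnj h * p"] by (simp add: norm_mult)
  moreover have "2 * (cmod h * cmod p) \<le> \<mu> * (cmod h)\<^sup>2 + (1 / \<mu>) * (cmod p)\<^sup>2"
  proof -
    have "0 \<le> (1 / \<mu>) * (\<mu> * cmod h - cmod p)\<^sup>2" using mu by simp
    also have "\<dots> = \<mu> * (cmod h)\<^sup>2 + (1 / \<mu>) * (cmod p)\<^sup>2 - 2 * (cmod h * cmod p)"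
      using mu by (simp add: power2_eq_square field_simps)
    finally show ?thesis by simp
  qed
  ultimately show ?thesis by linarith
qed

lemma weight_half_sq: "(weight v (m + 1/2) \<xi>)\<^sup>2 = (weight v m \<xi>)\<^sup>2 * japanese \<xi>" "(weight v (m - 1/2) \<xi>)\<^sup>2 = (weight v m \<xi>)\<^sup>2 / japanese \<xi>"
proof -
  have "japanese \<xi> powr (1/2) * japanese \<xi> powr (1/2) = japanese \<xi>"
    by (simp add: powr_add[symmetric])
  then have e: "(japanese \<xi> powr (1/2))\<^sup>2 = japanese \<xi>" by (simp add: power2_eq_square)
  show "(weight v (m + 1/2) \<xi>)\<^sup>2 = (weight v m \<xi>)\<^sup>2 * japanese \<xi>"
    unfolding weight_def powr_add power_mult_distrib e by (simp add: mult_ac)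
  show "(weight v (m - 1/2) \<xi>)\<^sup>2 = (weight v m \<xi>)\<^sup>2 / japanese \<xi>"
    unfolding weight_def powr_diff power_mult_distrib power_divide e by simp
qed

text \<open>
  The derivative of the weight contributes \<open>- 2 M\<close> times the squared norm of order \<open>m + 1/2\<close>, half of
  which absorbs the source \<open>P\<close>; the dispersive term is skew-adjoint.
\<close>

lemma energy_ineq:
  assumes u: "spectral_curve u h" and P: "spectral_curve P p"
    and ode: "\<And>t x. t \<in> {0..T} \<Longrightarrow> ((\<lambda>s. u s x) has_vector_derivative (\<i> * complex_of_real q * Dx (Dx u) t x + P t x)) (at t within {0..T})"
    and t: "t \<in> {0..T}" and R: "R \<ge> 0"
  shows "L2sqr (cut_weight R (w t) m (h t)) + M * integral {0..t} (\<lambda>s. L2sqr (cut_weight R (w s) (m + 1/2) (h s)))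
    \<le> L2sqr (cut_weight R (w 0) m (h 0)) + (1 / M) * integral {0..t} (\<lambda>s. L2sqr (cut_weight R (w s) (m - 1/2) (p s)))"
proof -
  define k where "k s \<xi> = (\<i> * complex_of_real q) * (\<i> * complex_of_real \<xi> * (\<i> * complex_of_real \<xi> * h s \<xi>)) + p s \<xi>" for s \<xi>
  have N: "spectral_curve (\<lambda>t x. \<i> * complex_of_real q * Dx (Dx u) t x + P t x) k"
    unfolding k_def by (intro spectral_curve_add spectral_curve_cmult spectral_curve_Dx u P)
  define F where "F s = L2sqr (cut_weight R (w s) (m + 1/2) (h s))" for s
  define G where "G s = L2sqr (cut_weight R (w s) (m - 1/2) (p s))" for s
  define E where "E s = L2sqr (cut_weight R (w s) m (h s))" for s
  define E' where "E' s = 2 * Re (LINT \<xi>|lborel. cnj (cut_weight R (w s) m (h s) \<xi>) * cut_weight R (w s) m (\<lambda>\<xi>. k s \<xi> - complex_of_real (M * japanese \<xi>) * h s \<xi>) \<xi>)" for s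
  have sub: "{0..t} \<subseteq> {0..T}" using t by auto
  have dE: "(E has_vector_derivative E' s) (at s within {0..t})" if "s \<in> {0..t}" for s
    unfolding E_def E'_def
    by (rule has_vector_derivative_within_subset[OF energy_deriv[OF u N ode _ R] sub]) (use that sub in auto)
  have I1: "(E' has_integral (E t - E 0)) {0..t}"
    by (rule fundamental_theorem_of_calculus) (use dE t in auto)
  have Fi: "F integrable_on {0..t}" and Gi: "G integrable_on {0..t}"
    unfolding F_def G_def
    by (rule integrable_continuous_interval continuous_on_subset[OF cut_weight_continuous[OF u R] sub] continuous_on_subset[OF cut_weight_continuous[OF P R] sub])+
  have I2: "((\<lambda>s. - M * F s + (1 / M) * G s) has_integral (- M * integral {0..t} F + (1 / M) * integral {0..t} G)) {0..t}"
    by (intro has_integral_add has_integral_mult_right integrable_integral Fi Gi)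
  have "E' s \<le> - M * F s + (1 / M) * G s" if s: "s \<in> {0..t}" for s
  proof -
    have sT: "s \<in> {0..T}" using s sub by auto
    define y where "y = cut_weight R (w s) m (h s)"
    define z where "z = cut_weight R (w s) m (\<lambda>\<xi>. k s \<xi> - complex_of_real (M * japanese \<xi>) * h s \<xi>)"
    define f where "f = cut_weight R (w s) (m + 1/2) (h s)"
    define g where "g = cut_weight R (w s) (m - 1/2) (p s)"
    have ys: "square_integrable y" and fs: "square_integrable f" and gs: "square_integrable g"
      unfolding y_def f_def g_def by (rule cut_weight_sqi[OF u sT R] cut_weight_sqi[OF P sT R])+
    have pw: "2 * Re (cnj (y \<xi>) * z \<xi>) \<le> - M * (cmod (f \<xi>))\<^sup>2 + (1 / M) * (cmod (g \<xi>))\<^sup>2" for \<xi>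
    proof (cases "\<bar>\<xi>\<bar> \<le> R")
      case True
      define W where "W = weight (w s) m \<xi>"
      define \<mu> where "\<mu> = M * japanese \<xi>"
      have mu: "\<mu> > 0" using M0 by (simp add: \<mu>_def)
      have "cnj (y \<xi>) * z \<xi> = complex_of_real (W\<^sup>2) * (cnj (h s \<xi>) * ((\<i> * complex_of_real q) * (\<i> * complex_of_real \<xi> * (\<i> * complex_of_real \<xi> * h s \<xi>)) + p s \<xi> - complex_of_real \<mu> * h s \<xi>))"
        using True by (simp add: y_def z_def cut_weight_eq k_def W_def \<mu>_def power2_eq_square mult_ac)
      then have "2 * Re (cnj (y \<xi>) * z \<xi>) = W\<^sup>2 * (2 * Re (cnj (h s \<xi>) * ((\<i> * complex_of_real q) * (\<i> * complex_of_real \<xi> * (\<i> * complex_of_real \<xi> * h s \<xi>)) + p s \<xi> - complex_of_real \<mu> * h s \<xi>)))"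
      proof -
        have "Re (complex_of_real r * v) = r * Re v" for r v by simp
        moreover have "2 * (W\<^sup>2 * v) = W\<^sup>2 * (2 * v)" for v by simp
        ultimately show ?thesis using \<open>cnj (y \<xi>) * z \<xi> = _\<close> by (simp only:)
      qed
      also have "\<dots> \<le> W\<^sup>2 * (- \<mu> * (cmod (h s \<xi>))\<^sup>2 + (1 / \<mu>) * (cmod (p s \<xi>))\<^sup>2)"
        by (intro mult_left_mono energy_pointwise mu) simp
      also have "\<dots> = - M * ((W\<^sup>2 * japanese \<xi>) * (cmod (h s \<xi>))\<^sup>2) + (1 / M) * ((W\<^sup>2 / japanese \<xi>) * (cmod (p s \<xi>))\<^sup>2)"
        using M0 by (simp add: \<mu>_def right_diff_distrib mult_ac)
      also have "(W\<^sup>2 * japanese \<xi>) * (cmod (h s \<xi>))\<^sup>2 = (cmod (f \<xi>))\<^sup>2"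
        using True by (simp add: f_def cut_weight_eq norm_mult power_mult_distrib weight_half_sq W_def)
      also have "(W\<^sup>2 / japanese \<xi>) * (cmod (p s \<xi>))\<^sup>2 = (cmod (g \<xi>))\<^sup>2"
        using True by (simp add: g_def cut_weight_eq norm_mult power_mult_distrib weight_half_sq W_def)
      finally show ?thesis .
    qed (simp add: y_def z_def f_def g_def cut_weight_eq)
    have zi: "integrable lborel (\<lambda>\<xi>. cnj (y \<xi>) * z \<xi>)"
      unfolding z_def by (intro sqi_mult_integrable sqi_cnj ys sqi_of_energy[OF u N sT R])
    show ?thesis
    proof -
      have "E' s = (LINT \<xi>|lborel. 2 * Re (cnj (y \<xi>) * z \<xi>))"
        unfolding E'_def y_def[symmetric] z_def[symmetric] by (simp only: integral_mult_right_zero integral_Re[OF zi])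
      also have "\<dots> \<le> (LINT \<xi>|lborel. - M * (cmod (f \<xi>))\<^sup>2 + (1 / M) * (cmod (g \<xi>))\<^sup>2)"
        by (intro integral_mono integrable_mult_right integrable_Re zi Bochner_Integration.integrable_add sqi_integrable fs gs pw)
      also have "\<dots> = - M * F s + (1 / M) * G s"
        unfolding F_def G_def f_def[symmetric] g_def[symmetric] L2sqr_eq[OF fs] L2sqr_eq[OF gs]
        by (subst Bochner_Integration.integral_add) (auto intro!: integrable_mult_right sqi_integrable fs gs simp del: integral_mult_right_zero simp: integral_mult_right_zero)
      finally show ?thesis .
    qed
  qed
  then have "E t - E 0 \<le> - M * integral {0..t} F + (1 / M) * integral {0..t} G"
    by (intro has_integral_le[OF I1 I2])
  then show ?thesis unfolding E_def F_def[abs_def] G_def[abs_def] by linarith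
qed

section \<open>From cut-off energies to full norms\<close>

text \<open>Fatou's lemma in the cut-off radius carries \<open>energy_ineq\<close> over to the full
  norms. The source enters divided by \<open>M\<close>: every later absorption rests on this
  smallness.\<close>

lemma energy_bound:
  assumes u: "spectral_curve u h" and P: "spectral_curve P p"
    and ode: "\<And>t x. t \<in> {0..T} \<Longrightarrow> ((\<lambda>s. u s x) has_vector_derivative (\<i> * complex_of_real q * Dx (Dx u) t x + P t x)) (at t within {0..T})"
    and t: "t \<in> {0..T}" and BD: "B \<ge> 0" "D \<ge> 0"
    and B: "Hnorm_sq w0 m (u 0) \<le> ennreal (B\<^sup>2)"
    and D: "ennreal (2 * M) * (\<integral>\<^sup>+ s\<in>{0..t}. Hnorm_sq (w s) (m - 1/2) (P s) \<partial>lborel) \<le> ennreal (D\<^sup>2)"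
  shows "s \<in> {0..t} \<Longrightarrow> Hnorm_sq (w s) m (u s) \<le> ennreal ((2 * B + D / M)\<^sup>2)"
    and "ennreal (2 * M) * (\<integral>\<^sup>+ s\<in>{0..t}. Hnorm_sq (w s) (m + 1/2) (u s) \<partial>lborel) \<le> ennreal ((2 * B + D / M)\<^sup>2)"
proof -
  \<comment> \<open>Both terms on the left of \<open>energy_ineq\<close> will be at most
    \<open>X\<close>. As \<open>D\<close> already contains the factor \<open>2 * M\<close>, the
    source contributes \<open>D\<^sup>2 / (2 * M\<^sup>2)\<close>; as the smoothing norm carries
    \<open>2 * M\<close> against the \<open>M\<close> of the energy, the conclusion needs
    \<open>2 * X\<close>.\<close>
  define X where "X = B\<^sup>2 + D\<^sup>2 / (2 * M\<^sup>2)"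
  have X0: "X \<ge> 0" by (simp add: X_def)
  have X2: "2 * X \<le> (2 * B + D / M)\<^sup>2"
  proof -
    have "(2 * B + D / M)\<^sup>2 = 4 * B\<^sup>2 + 4 * B * (D / M) + (D / M)\<^sup>2" by (simp add: power2_eq_square algebra_simps)
    moreover have "0 \<le> B * (D / M)" using BD M0 by simp
    moreover have "2 * X = 2 * B\<^sup>2 + (D / M)\<^sup>2" by (simp add: X_def power_divide)
    ultimately show ?thesis using zero_le_power2[of B] by linarith
  qed
  have set_nn: "ennreal (integral {0..s} f) = (\<integral>\<^sup>+ r. ennreal (f r) * indicator {0..s} r \<partial>lborel)"
    if "s \<in> {0..T}" "continuous_on {0..T} f" "\<And>r. f r \<ge> 0" for s f
    by (rule nn_integral_has_integral_lebesgue'[symmetric])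
       (use that in \<open>auto intro!: integrable_integral integrable_continuous_interval continuous_on_subset[OF that(2)]\<close>)
  \<comment> \<open>Uniform in the cut-off radius \<open>n\<close>. The two terms on the left of
    \<open>energy_ineq\<close> are nonnegative, so each separately is at most
    \<open>X\<close>.\<close>
  have main: "L2sqr (cut_weight (real n) (w s) m (h s)) \<le> X \<and> M * integral {0..s} (\<lambda>s. L2sqr (cut_weight (real n) (w s) (m + 1/2) (h s))) \<le> X"
    if s: "s \<in> {0..t}" for s n
  proof -
    have sT: "s \<in> {0..T}" using s t by auto
    have 0: "0 \<in> {0..T}" using T0 by simp
    define F where "F r = L2sqr (cut_weight (real n) (w r) (m + 1/2) (h r))" for r
    define G where "G r = L2sqr (cut_weight (real n) (w r) (m - 1/2) (p r))" for r
    have Gc: "continuous_on {0..T} G" unfolding G_def by (rule cut_weight_continuous[OF P]) simp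
    have Fc: "continuous_on {0..T} F" unfolding F_def by (rule cut_weight_continuous[OF u]) simp
    have E0: "L2sqr (cut_weight (real n) (w 0) m (h 0)) \<le> B\<^sup>2"
    proof -
      have "L2sq (cut_weight (real n) (w 0) m (h 0)) \<le> wnorm w0 m (h 0)" using L2sq_cut_weight_le[of "real n" "w 0" m "h 0"] by (simp add: w_def)
      also have "\<dots> \<le> ennreal (B\<^sup>2)" using B spectral_curve_Hnorm[OF u 0] by simp
      finally show ?thesis unfolding L2sqr_def by (intro enn2real_leI) auto
    qed
    have "ennreal (2 * M) * ennreal (integral {0..s} G) \<le> ennreal (D\<^sup>2)"
    proof -
      have "ennreal (integral {0..s} G) \<le> (\<integral>\<^sup>+ r\<in>{0..t}. Hnorm_sq (w r) (m - 1/2) (P r) \<partial>lborel)"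
        unfolding set_nn[OF sT Gc, unfolded G_def, simplified, folded G_def]
      proof (rule nn_integral_mono)
        fix r
        show "ennreal (G r) * indicator {0..s} r \<le> Hnorm_sq (w r) (m - 1/2) (P r) * indicator {0..t} r"
        proof (cases "r \<in> {0..s}")
          case True
          then have r: "r \<in> {0..T}" "r \<in> {0..t}" using s sT by auto
          have "ennreal (G r) \<le> Hnorm_sq (w r) (m - 1/2) (P r)"
            unfolding G_def spectral_curve_Hnorm[OF P r(1)] by (subst ennreal_L2sqr[OF cut_weight_sqi[OF P r(1)]]) (auto intro: L2sq_cut_weight_le)
          then show ?thesis using True r by simp
        qed simp
      qed
      then have "ennreal (2 * M) * ennreal (integral {0..s} G) \<le> ennreal (2 * M) * (\<integral>\<^sup>+ r\<in>{0..t}. Hnorm_sq (w r) (m - 1/2) (P r) \<partial>lborel)"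
        by (rule mult_left_mono) simp
      then show ?thesis using D by (rule order_trans)
    qed
    moreover have G0: "integral {0..s} G \<ge> 0"
      by (rule integral_nonneg[OF integrable_continuous_interval[OF continuous_on_subset[OF Gc]]]) (use sT in \<open>auto simp: G_def\<close>)
    ultimately have "2 * M * integral {0..s} G \<le> D\<^sup>2"
      using M0 by (simp add: ennreal_mult[symmetric])
    then have "(1 / M) * integral {0..s} G \<le> D\<^sup>2 / (2 * M\<^sup>2)"
      using M0 by (simp add: field_simps power2_eq_square)
    then have "L2sqr (cut_weight (real n) (w s) m (h s)) + M * integral {0..s} F \<le> X"
      using energy_ineq[OF u P ode sT, of "real n" m] E0 unfolding X_def F_def[abs_def] G_def[abs_def] by simp
    moreover have "integral {0..s} F \<ge> 0"
      by (rule integral_nonneg[OF integrable_continuous_interval[OF continuous_on_subset[OF Fc]]]) (use sT in \<open>auto simp: F_def\<close>)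
    then have "M * integral {0..s} F \<ge> 0" using M0 by simp
    ultimately show ?thesis unfolding F_def[abs_def] using L2sqr_nonneg[of "cut_weight (real n) (w s) m (h s)"] by linarith
  qed
  show "Hnorm_sq (w s) m (u s) \<le> ennreal ((2 * B + D / M)\<^sup>2)" if s: "s \<in> {0..t}"
  proof -
    have sT: "s \<in> {0..T}" using s t by auto
    have "Hnorm_sq (w s) m (u s) = liminf (\<lambda>n. L2sq (cut_weight (real n) (w s) m (h s)))"
      by (simp add: spectral_curve_Hnorm[OF u sT] wnorm_liminf[OF spectral_curve_meas[OF u sT]])
    also have "\<dots> \<le> ennreal X"
      using main[OF s] by (intro Liminf_le always_eventually allI) (auto simp: ennreal_L2sqr[OF cut_weight_sqi[OF u sT], symmetric] intro: ennreal_leI)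
    also have "\<dots> \<le> ennreal ((2 * B + D / M)\<^sup>2)" using X2 X0 by (intro ennreal_leI) linarith
    finally show ?thesis .
  qed
  have tt: "t \<in> {0..t}" using t by auto
  have "(\<integral>\<^sup>+ s\<in>{0..t}. Hnorm_sq (w s) (m + 1/2) (u s) \<partial>lborel) = (\<integral>\<^sup>+ s. liminf (\<lambda>n. ennreal (L2sqr (cut_weight (real n) (w s) (m + 1/2) (h s))) * indicator {0..t} s) \<partial>lborel)"
  proof (rule nn_integral_cong)
    fix s show "Hnorm_sq (w s) (m + 1/2) (u s) * indicator {0..t} s = liminf (\<lambda>n. ennreal (L2sqr (cut_weight (real n) (w s) (m + 1/2) (h s))) * indicator {0..t} s)"
    proof (cases "s \<in> {0..t}")
      case True
      then have s: "s \<in> {0..T}" using t by auto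
      show ?thesis using True by (simp add: spectral_curve_Hnorm[OF u s] wnorm_liminf[OF spectral_curve_meas[OF u s]] ennreal_L2sqr[OF cut_weight_sqi[OF u s]])
    qed (simp add: Liminf_const)
  qed
  also have "\<dots> \<le> liminf (\<lambda>n. \<integral>\<^sup>+ s. ennreal (L2sqr (cut_weight (real n) (w s) (m + 1/2) (h s))) * indicator {0..t} s \<partial>lborel)"
  proof (rule nn_integral_liminf)
    fix n
    have "(\<lambda>s. indicator {0..t} s *\<^sub>R L2sqr (cut_weight (real n) (w s) (m + 1/2) (h s))) \<in> borel_measurable borel"
      by (rule borel_measurable_continuous_on_indicator) (use t in \<open>auto intro!: continuous_on_subset[OF cut_weight_continuous[OF u]]\<close>)
    then have "(\<lambda>s. ennreal (indicator {0..t} s *\<^sub>R L2sqr (cut_weight (real n) (w s) (m + 1/2) (h s)))) \<in> borel_measurable lborel" by measurable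
    then show "(\<lambda>s. ennreal (L2sqr (cut_weight (real n) (w s) (m + 1/2) (h s))) * indicator {0..t} s) \<in> borel_measurable lborel"
      by (rule measurable_cong[THEN iffD1, rotated]) (auto simp: indicator_def)
  qed
  also have "\<dots> \<le> ennreal (X / M)"
  proof (intro Liminf_le always_eventually allI)
    fix n
    have "M * integral {0..t} (\<lambda>s. L2sqr (cut_weight (real n) (w s) (m + 1/2) (h s))) \<le> X" using main[OF tt] by blast
    then have "integral {0..t} (\<lambda>s. L2sqr (cut_weight (real n) (w s) (m + 1/2) (h s))) \<le> X / M"
      using M0 by (simp add: field_simps)
    then have "ennreal (integral {0..t} (\<lambda>s. L2sqr (cut_weight (real n) (w s) (m + 1/2) (h s)))) \<le> ennreal (X / M)" by (rule ennreal_leI)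
    moreover have "ennreal (integral {0..t} (\<lambda>s. L2sqr (cut_weight (real n) (w s) (m + 1/2) (h s)))) = (\<integral>\<^sup>+ s. ennreal (L2sqr (cut_weight (real n) (w s) (m + 1/2) (h s))) * indicator {0..t} s \<partial>lborel)"
      by (rule set_nn[OF t cut_weight_continuous[OF u]]) auto
    ultimately show "(\<integral>\<^sup>+ s. ennreal (L2sqr (cut_weight (real n) (w s) (m + 1/2) (h s))) * indicator {0..t} s \<partial>lborel) \<le> ennreal (X / M)" by simp
  qed simp
  finally have "ennreal (2 * M) * (\<integral>\<^sup>+ s\<in>{0..t}. Hnorm_sq (w s) (m + 1/2) (u s) \<partial>lborel) \<le> ennreal (2 * M) * ennreal (X / M)"
    by (rule mult_left_mono) simp
  also have "\<dots> = ennreal (2 * X)" using M0 X0 by (subst ennreal_mult[symmetric]) auto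
  also have "\<dots> \<le> ennreal ((2 * B + D / M)\<^sup>2)" by (rule ennreal_leI[OF X2])
  finally show "ennreal (2 * M) * (\<integral>\<^sup>+ s\<in>{0..t}. Hnorm_sq (w s) (m + 1/2) (u s) \<partial>lborel) \<le> ennreal ((2 * B + D / M)\<^sup>2)" .
qed

end

section \<open>Products and the transport estimate\<close>

text \<open>Dominates the three tame constants in use: at order \<open>l\<close>, half a derivative
  above for the smoothing norm, and half a derivative below for sources. The summand 1 makes it at
  most its own square.\<close>

definition alg_const :: "real \<Rightarrow> real" where
  "alg_const l = 1 + 2 * tame_const l l + 2 * tame_const (l + 1/2) l + 2 * tame_const (l - 1/2) (l - 1/2)"

lemma tame_const_nonneg [simp]: "tame_const m s \<ge> 0" by (simp add: tame_const_def)

lemma alg_const_ge_1: "alg_const l \<ge> 1" by (simp add: alg_const_def)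

lemma alg_const_sq: "2 * tame_const l l \<le> (alg_const l)\<^sup>2" "2 * tame_const (l + 1/2) l \<le> (alg_const l)\<^sup>2" "2 * tame_const (l - 1/2) (l - 1/2) \<le> (alg_const l)\<^sup>2"
proof -
  have "alg_const l * 1 \<le> alg_const l * alg_const l" using alg_const_ge_1[of l] by (intro mult_left_mono) auto
  moreover have "2 * tame_const l l \<le> alg_const l" "2 * tame_const (l + 1/2) l \<le> alg_const l" "2 * tame_const (l - 1/2) (l - 1/2) \<le> alg_const l"
    using tame_const_nonneg[of l l] tame_const_nonneg[of "l + 1/2" l] tame_const_nonneg[of "l - 1/2" "l - 1/2"] unfolding alg_const_def by linarith+
  ultimately show "2 * tame_const l l \<le> (alg_const l)\<^sup>2" "2 * tame_const (l + 1/2) l \<le> (alg_const l)\<^sup>2" "2 * tame_const (l - 1/2) (l - 1/2) \<le> (alg_const l)\<^sup>2"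
    unfolding power2_eq_square by linarith+
qed

context shrinking_radius
begin

section \<open>Analytic curves and their derivatives\<close>

text \<open>Hides the spectral density, which is determined only up to null sets; by
  \<open>spectral_curve_Hnorm\<close> the norms of \<open>u\<close> are the same for each
  choice.\<close>

definition analytic :: "(real \<Rightarrow> real \<Rightarrow> complex) \<Rightarrow> bool" where "analytic u \<longleftrightarrow> (\<exists>h. spectral_curve u h)"

lemma analytic_add: "analytic u \<Longrightarrow> analytic v \<Longrightarrow> analytic (\<lambda>t x. u t x + v t x)"
  unfolding analytic_def using spectral_curve_add by blast

lemma analytic_diff: "analytic u \<Longrightarrow> analytic v \<Longrightarrow> analytic (\<lambda>t x. u t x - v t x)"
  unfolding analytic_def using spectral_curve_diff by blast

lemma analytic_cmult: "analytic u \<Longrightarrow> analytic (\<lambda>t x. z * u t x)"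
  unfolding analytic_def using spectral_curve_cmult by blast

lemma analytic_uminus: "analytic u \<Longrightarrow> analytic (\<lambda>t x. - u t x)"
  using analytic_cmult[of u "-1"] by simp

lemma analytic_mult: "analytic u \<Longrightarrow> analytic v \<Longrightarrow> analytic (\<lambda>t x. u t x * v t x)"
  unfolding analytic_def using spectral_curve_mult by blast

lemma analytic_cnj: "analytic u \<Longrightarrow> analytic (\<lambda>t x. cnj (u t x))"
  unfolding analytic_def using spectral_curve_cnj by blast

lemma analytic_Dx: "analytic u \<Longrightarrow> analytic (Dx u)"
  unfolding analytic_def using spectral_curve_Dx by blast

lemma analytic_cong:
  assumes "\<And>t x. t \<in> {0..T} \<Longrightarrow> u t x = v t x" shows "analytic u \<longleftrightarrow> analytic v"
proof -
  have "u t = v t" if "t \<in> {0..T}" for t using assms[OF that] by auto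
  then have "(\<forall>t\<in>{0..T}. h t \<in> borel_measurable borel \<and> u t = fourier_int 1 (h t)) \<longleftrightarrow> (\<forall>t\<in>{0..T}. h t \<in> borel_measurable borel \<and> v t = fourier_int 1 (h t))" for h
    by (intro ball_cong refl) simp
  then show ?thesis unfolding analytic_def spectral_curve_def by (simp only:)
qed

lemmas analytic_intros = analytic_add analytic_diff analytic_cmult analytic_uminus analytic_mult analytic_cnj analytic_Dx

lemma analytic_deriv:
  assumes "analytic u" "t \<in> {0..T}"
  shows "(u t has_vector_derivative Dx u t x) (at x)"
proof -
  obtain h where h: "spectral_curve u h" using assms by (auto simp: analytic_def)
  show ?thesis
    using spectral_curve_has_derivative[OF h assms(2), of x] unfolding Dx_def by (metis vector_derivative_at)
qed

lemma Dx_eqI: "(v t has_vector_derivative d) (at x) \<Longrightarrow> Dx v t x = d"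
  unfolding Dx_def by (rule vector_derivative_at)

lemma Dx_add: "analytic u \<Longrightarrow> analytic v \<Longrightarrow> t \<in> {0..T} \<Longrightarrow> Dx (\<lambda>t x. u t x + v t x) t x = Dx u t x + Dx v t x"
  by (intro Dx_eqI has_vector_derivative_add analytic_deriv)

lemma Dx_diff: "analytic u \<Longrightarrow> analytic v \<Longrightarrow> t \<in> {0..T} \<Longrightarrow> Dx (\<lambda>t x. u t x - v t x) t x = Dx u t x - Dx v t x"
  by (intro Dx_eqI has_vector_derivative_diff analytic_deriv)

lemma Dx_cmult: "analytic u \<Longrightarrow> t \<in> {0..T} \<Longrightarrow> Dx (\<lambda>t x. z * u t x) t x = z * Dx u t x"
  by (intro Dx_eqI has_vector_derivative_mult_right analytic_deriv)

lemma Dx_cong: "(\<And>x. u t x = v t x) \<Longrightarrow> Dx u t x = Dx v t x"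
  unfolding Dx_def by (rule arg_cong[where f="\<lambda>f. vector_derivative f (at x)"]) (rule ext)

section \<open>Bounds in the triple norm and for source terms\<close>

text \<open>The second entry of the squared triple norm, here indexed by the order at which it is
  taken, so that it also measures sources.\<close>

definition smoothing :: "real \<Rightarrow> real \<Rightarrow> (real \<Rightarrow> real \<Rightarrow> complex) \<Rightarrow> ennreal" where
  "smoothing m t u = ennreal (2 * M) * (\<integral>\<^sup>+ s\<in>{0..t}. Hnorm_sq (w s) m (u s) \<partial>lborel)"

lemma Hmeas: "analytic u \<Longrightarrow> t \<in> {0..T} \<Longrightarrow> (\<lambda>s. Hnorm_sq (w s) m (u s) * indicator {0..t} s) \<in> borel_measurable borel"
  unfolding analytic_def using spectral_curve_Hmeas by blast

lemma smoothing_combo: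
  assumes t: "t \<in> {0..T}" and an: "analytic U" "analytic V"
    and le: "\<And>s. s \<in> {0..t} \<Longrightarrow> Hnorm_sq (w s) m (P s) \<le> ennreal c1 * Hnorm_sq (w s) m1 (U s) + ennreal c2 * Hnorm_sq (w s) m2 (V s)"
  shows "smoothing m t P \<le> ennreal c1 * smoothing m1 t U + ennreal c2 * smoothing m2 t V"
proof -
  note [measurable] = Hmeas[OF an(1) t] Hmeas[OF an(2) t]
  have "(\<integral>\<^sup>+ s\<in>{0..t}. Hnorm_sq (w s) m (P s) \<partial>lborel) \<le>
     (\<integral>\<^sup>+ s. ennreal c1 * (Hnorm_sq (w s) m1 (U s) * indicator {0..t} s) + ennreal c2 * (Hnorm_sq (w s) m2 (V s) * indicator {0..t} s) \<partial>lborel)"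
    using le by (intro nn_integral_mono) (auto simp: indicator_def)
  also have "\<dots> = ennreal c1 * (\<integral>\<^sup>+ s\<in>{0..t}. Hnorm_sq (w s) m1 (U s) \<partial>lborel) + ennreal c2 * (\<integral>\<^sup>+ s\<in>{0..t}. Hnorm_sq (w s) m2 (V s) \<partial>lborel)"
    by (subst nn_integral_add) (auto simp: nn_integral_cmult)
  finally have "smoothing m t P \<le> ennreal (2 * M) * (ennreal c1 * (\<integral>\<^sup>+ s\<in>{0..t}. Hnorm_sq (w s) m1 (U s) \<partial>lborel) + ennreal c2 * (\<integral>\<^sup>+ s\<in>{0..t}. Hnorm_sq (w s) m2 (V s) \<partial>lborel))"
    unfolding smoothing_def by (rule mult_left_mono) simp
  then show ?thesis unfolding smoothing_def by (simp add: distrib_left mult.left_commute)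
qed

lemma smoothing_le:
  assumes t: "t \<in> {0..T}" and an: "analytic U"
    and le: "\<And>s. s \<in> {0..t} \<Longrightarrow> Hnorm_sq (w s) m (P s) \<le> ennreal c * Hnorm_sq (w s) m1 (U s)"
  shows "smoothing m t P \<le> ennreal c * smoothing m1 t U"
  using smoothing_combo[OF t an an, of m P c m1 0 m1] le by simp

text \<open>\<open>A\<close> bounds the triple norm of order \<open>m\<close> up to time
  \<open>t\<close>. As a predicate it can be weakened and combined with real constants, without
  finiteness conditions.\<close>

definition Y_bound :: "real \<Rightarrow> real \<Rightarrow> real \<Rightarrow> (real \<Rightarrow> real \<Rightarrow> complex) \<Rightarrow> bool" where
  "Y_bound m t A u \<longleftrightarrow> analytic u \<and> 0 \<le> A \<and> (\<forall>s\<in>{0..t}. Hnorm_sq (w s) m (u s) \<le> ennreal (A\<^sup>2)) \<and> smoothing (m + 1/2) t u \<le> ennreal (A\<^sup>2)"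

text \<open>
  \<open>source_bound m t A u\<close> bounds \<open>u\<close> as a source term for the energy estimate at order \<open>m\<close>: integrated in time,
  half a derivative below \<open>m\<close>.
\<close>

definition source_bound :: "real \<Rightarrow> real \<Rightarrow> real \<Rightarrow> (real \<Rightarrow> real \<Rightarrow> complex) \<Rightarrow> bool" where
  "source_bound m t A u \<longleftrightarrow> analytic u \<and> 0 \<le> A \<and> smoothing (m - 1/2) t u \<le> ennreal (A\<^sup>2)"

lemma Y_boundD: "Y_bound m t A u \<Longrightarrow> analytic u" "Y_bound m t A u \<Longrightarrow> 0 \<le> A" "Y_bound m t A u \<Longrightarrow> s \<in> {0..t} \<Longrightarrow> Hnorm_sq (w s) m (u s) \<le> ennreal (A\<^sup>2)"
  "Y_bound m t A u \<Longrightarrow> smoothing (m + 1/2) t u \<le> ennreal (A\<^sup>2)"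
  by (auto simp: Y_bound_def)

lemma source_boundD: "source_bound m t A u \<Longrightarrow> analytic u" "source_bound m t A u \<Longrightarrow> 0 \<le> A" "source_bound m t A u \<Longrightarrow> smoothing (m - 1/2) t u \<le> ennreal (A\<^sup>2)"
  by (auto simp: source_bound_def)

lemma Y_bound_mono: "Y_bound m t A u \<Longrightarrow> A \<le> A' \<Longrightarrow> Y_bound m t A' u"
  unfolding Y_bound_def by (auto intro: order_trans[OF _ ennreal_leI] power_mono)

lemma source_bound_mono: "source_bound m t A u \<Longrightarrow> A \<le> A' \<Longrightarrow> source_bound m t A' u"
  unfolding source_bound_def by (auto intro: order_trans[OF _ ennreal_leI] power_mono)

lemma smoothing_cong:
  assumes "t \<in> {0..T}" "\<And>s x. s \<in> {0..T} \<Longrightarrow> u s x = v s x"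
  shows "smoothing m t u = smoothing m t v"
proof -
  have "u s = v s" if "s \<in> {0..t}" for s using assms that by (intro ext) auto
  then have "Hnorm_sq (w s) m (u s) * indicator {0..t} s = Hnorm_sq (w s) m (v s) * indicator {0..t} s" for s
    by (cases "s \<in> {0..t}") auto
  then show ?thesis unfolding smoothing_def by (simp only:)
qed

lemma source_bound_cong:
  assumes "source_bound m t A u" "t \<in> {0..T}" "\<And>s x. s \<in> {0..T} \<Longrightarrow> v s x = u s x"
  shows "source_bound m t A v"
  using assms(1) analytic_cong[of u v] smoothing_cong[OF assms(2), of u v] assms(3) unfolding source_bound_def by auto

lemma Y_bound_cong:
  assumes "Y_bound m t A u" "t \<in> {0..T}" "\<And>s x. s \<in> {0..T} \<Longrightarrow> v s x = u s x"
  shows "Y_bound m t A v"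
proof -
  have "v s = u s" if "s \<in> {0..t}" for s using assms that by (intro ext) auto
  then show ?thesis
    using assms(1) analytic_cong[of u v] smoothing_cong[OF assms(2), of u v] assms(3) unfolding Y_bound_def by auto
qed

lemma Hnorm_sq_add:
  assumes "analytic u" "analytic v" "s \<in> {0..T}"
  shows "Hnorm_sq c m (\<lambda>x. u s x + v s x) \<le> ennreal 2 * Hnorm_sq c m (u s) + ennreal 2 * Hnorm_sq c m (v s)"
proof -
  obtain h k where h: "spectral_curve u h" and k: "spectral_curve v k" using assms by (auto simp: analytic_def)
  show ?thesis
    using wnorm_add[OF spectral_curve_meas[OF h assms(3)] spectral_curve_meas[OF k assms(3)], of c m]
    by (simp add: spectral_curve_Hnorm[OF h assms(3)] spectral_curve_Hnorm[OF k assms(3)] spectral_curve_Hnorm[OF spectral_curve_add[OF h k] assms(3), unfolded fun_eq_iff, simplified])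
qed

lemma Hnorm_sq_cmult:
  assumes "analytic u" "s \<in> {0..T}"
  shows "Hnorm_sq c m (\<lambda>x. z * u s x) = ennreal ((cmod z)\<^sup>2) * Hnorm_sq c m (u s)"
proof -
  obtain h where h: "spectral_curve u h" using assms by (auto simp: analytic_def)
  show ?thesis
    using wnorm_cmult[OF spectral_curve_meas[OF h assms(2)], of c m z] spectral_curve_Hnorm[OF spectral_curve_cmult[OF h] assms(2), of c m z]
    by (simp add: spectral_curve_Hnorm[OF h assms(2)])
qed

lemma Hnorm_sq_cnj:
  assumes "analytic u" "s \<in> {0..T}"
  shows "Hnorm_sq c m (\<lambda>x. cnj (u s x)) = Hnorm_sq c m (u s)"
proof -
  obtain h where h: "spectral_curve u h" using assms by (auto simp: analytic_def)
  show ?thesis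
    using wnorm_reflect[OF spectral_curve_meas[OF h assms(2)], of c m] spectral_curve_Hnorm[OF spectral_curve_cnj[OF h] assms(2), of c m]
    by (simp add: spectral_curve_Hnorm[OF h assms(2)])
qed

lemma Hnorm_sq_Dx:
  assumes "analytic u" "s \<in> {0..T}"
  shows "Hnorm_sq c m (Dx u s) \<le> Hnorm_sq c (m + 1) (u s)"
proof -
  obtain h where h: "spectral_curve u h" using assms by (auto simp: analytic_def)
  show ?thesis
    using wnorm_xi[of c m "h s"] spectral_curve_Hnorm[OF spectral_curve_Dx[OF h] assms(2), of c m]
    by (simp add: spectral_curve_Hnorm[OF h assms(2)])
qed

lemma Hnorm_sq_mono: "a \<le> b \<Longrightarrow> Hnorm_sq c a f \<le> Hnorm_sq c b f"
  unfolding Hnorm_sq_eq_wnorm by (rule wnorm_mono) auto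

lemma Hnorm_sq_mult:
  assumes "analytic u" "analytic v" "s \<in> {0..T}" and m: "m \<ge> 0" "r > 1/2"
  shows "Hnorm_sq (w s) m (\<lambda>x. u s x * v s x) \<le> ennreal (tame_const m r) * (Hnorm_sq (w s) m (u s) * Hnorm_sq (w s) r (v s) + Hnorm_sq (w s) r (u s) * Hnorm_sq (w s) m (v s))"
proof -
  obtain h k where h: "spectral_curve u h" and k: "spectral_curve v k" using assms by (auto simp: analytic_def)
  show ?thesis
    using conv_tame[OF m less_imp_le[OF w_pos[OF assms(3)]] spectral_curve_meas[OF h assms(3)] spectral_curve_meas[OF k assms(3)]]
      spectral_curve_Hnorm[OF spectral_curve_mult[OF h k] assms(3), of "w s" m]
    by (simp add: spectral_curve_Hnorm[OF h assms(3)] spectral_curve_Hnorm[OF k assms(3)])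
qed

text \<open>The squared triangle inequality produces \<open>2 * a\<^sup>2 + 2 * b\<^sup>2\<close>;
  this majorant has a rational square root, at the price of doubling both constants in every
  sum.\<close>

lemma sq_sum_bound: "a \<ge> 0 \<Longrightarrow> b \<ge> 0 \<Longrightarrow> ennreal 2 * ennreal (a\<^sup>2) + ennreal 2 * ennreal (b\<^sup>2) \<le> ennreal ((2 * a + 2 * b)\<^sup>2)"
proof -
  assume ab: "a \<ge> 0" "b \<ge> 0"
  have "ennreal 2 * ennreal (a\<^sup>2) + ennreal 2 * ennreal (b\<^sup>2) = ennreal (2 * a\<^sup>2 + 2 * b\<^sup>2)"
    by (subst ennreal_plus) (auto simp: ennreal_mult)
  also have "\<dots> \<le> ennreal ((2 * a + 2 * b)\<^sup>2)"
    using mult_nonneg_nonneg[OF ab] by (intro ennreal_leI) (simp add: power2_eq_square algebra_simps)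
  finally show ?thesis .
qed

lemma Y_bound_add:
  assumes t: "t \<in> {0..T}" and u: "Y_bound m t A u" and v: "Y_bound m t B v"
  shows "Y_bound m t (2 * A + 2 * B) (\<lambda>t x. u t x + v t x)"
proof -
  note nu = Y_boundD(1)[OF u] and nv = Y_boundD(1)[OF v] and A = Y_boundD(2)[OF u] and B = Y_boundD(2)[OF v]
  have 1: "Hnorm_sq (w s) m (\<lambda>x. u s x + v s x) \<le> ennreal ((2 * A + 2 * B)\<^sup>2)" if "s \<in> {0..t}" for s
    by (rule order_trans[OF Hnorm_sq_add[OF nu nv] order_trans[OF add_mono[OF mult_left_mono mult_left_mono] sq_sum_bound[OF A B]]])
       (use that t Y_boundD(3)[OF u] Y_boundD(3)[OF v] in auto)
  have "smoothing (m + 1/2) t (\<lambda>t x. u t x + v t x) \<le> ennreal 2 * smoothing (m + 1/2) t u + ennreal 2 * smoothing (m + 1/2) t v"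
    by (rule smoothing_combo[OF t nu nv Hnorm_sq_add[OF nu nv]]) (use t in auto)
  also have "\<dots> \<le> ennreal ((2 * A + 2 * B)\<^sup>2)"
    by (rule order_trans[OF add_mono[OF mult_left_mono mult_left_mono] sq_sum_bound[OF A B]])
       (use Y_boundD(4)[OF u] Y_boundD(4)[OF v] in auto)
  finally show ?thesis unfolding Y_bound_def using 1 A B analytic_add[OF nu nv] by auto
qed

lemma source_bound_add:
  assumes t: "t \<in> {0..T}" and u: "source_bound m t A u" and v: "source_bound m t B v"
  shows "source_bound m t (2 * A + 2 * B) (\<lambda>t x. u t x + v t x)"
proof -
  note nu = source_boundD(1)[OF u] and nv = source_boundD(1)[OF v] and A = source_boundD(2)[OF u] and B = source_boundD(2)[OF v]
  have "smoothing (m - 1/2) t (\<lambda>t x. u t x + v t x) \<le> ennreal 2 * smoothing (m - 1/2) t u + ennreal 2 * smoothing (m - 1/2) t v"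
    by (rule smoothing_combo[OF t nu nv Hnorm_sq_add[OF nu nv]]) (use t in auto)
  also have "\<dots> \<le> ennreal ((2 * A + 2 * B)\<^sup>2)"
    by (rule order_trans[OF add_mono[OF mult_left_mono mult_left_mono] sq_sum_bound[OF A B]])
       (use source_boundD(3)[OF u] source_boundD(3)[OF v] in auto)
  finally show ?thesis unfolding source_bound_def using A B analytic_add[OF nu nv] by auto
qed

lemma ennreal_sq_mult: "ennreal (a\<^sup>2) * ennreal (b\<^sup>2) = ennreal ((a * b)\<^sup>2)"
  by (simp add: ennreal_mult[symmetric] power_mult_distrib)

lemma Y_bound_cmult:
  assumes t: "t \<in> {0..T}" and u: "Y_bound m t A u"
  shows "Y_bound m t (cmod z * A) (\<lambda>t x. z * u t x)"
proof -
  note nu = Y_boundD(1)[OF u] and A = Y_boundD(2)[OF u]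
  have 1: "Hnorm_sq (w s) m (\<lambda>x. z * u s x) \<le> ennreal ((cmod z * A)\<^sup>2)" if "s \<in> {0..t}" for s
    using that t Y_boundD(3)[OF u that] by (subst Hnorm_sq_cmult[OF nu]) (auto simp: ennreal_sq_mult[symmetric] intro: mult_left_mono)
  have "smoothing (m + 1/2) t (\<lambda>t x. z * u t x) \<le> ennreal ((cmod z)\<^sup>2) * smoothing (m + 1/2) t u"
    by (rule smoothing_le[OF t nu]) (use t in \<open>auto simp: Hnorm_sq_cmult[OF nu]\<close>)
  also have "\<dots> \<le> ennreal ((cmod z * A)\<^sup>2)"
    unfolding ennreal_sq_mult[symmetric] by (rule mult_left_mono[OF Y_boundD(4)[OF u]]) simp
  finally show ?thesis unfolding Y_bound_def using 1 A analytic_cmult[OF nu] by auto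
qed

lemma source_bound_cmult:
  assumes t: "t \<in> {0..T}" and u: "source_bound m t A u"
  shows "source_bound m t (cmod z * A) (\<lambda>t x. z * u t x)"
proof -
  note nu = source_boundD(1)[OF u] and A = source_boundD(2)[OF u]
  have "smoothing (m - 1/2) t (\<lambda>t x. z * u t x) \<le> ennreal ((cmod z)\<^sup>2) * smoothing (m - 1/2) t u"
    by (rule smoothing_le[OF t nu]) (use t in \<open>auto simp: Hnorm_sq_cmult[OF nu]\<close>)
  also have "\<dots> \<le> ennreal ((cmod z * A)\<^sup>2)"
    unfolding ennreal_sq_mult[symmetric] by (rule mult_left_mono[OF source_boundD(3)[OF u]]) simp
  finally show ?thesis unfolding source_bound_def using A analytic_cmult[OF nu] by auto
qed

lemma Y_bound_cnj:
  assumes t: "t \<in> {0..T}" and u: "Y_bound m t A u"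
  shows "Y_bound m t A (\<lambda>t x. cnj (u t x))"
proof -
  note nu = Y_boundD(1)[OF u] and A = Y_boundD(2)[OF u]
  have 1: "Hnorm_sq (w s) m (\<lambda>x. cnj (u s x)) \<le> ennreal (A\<^sup>2)" if "s \<in> {0..t}" for s
    using that t Y_boundD(3)[OF u that] by (subst Hnorm_sq_cnj[OF nu]) auto
  have "smoothing (m + 1/2) t (\<lambda>t x. cnj (u t x)) \<le> ennreal 1 * smoothing (m + 1/2) t u"
    by (rule smoothing_le[OF t nu]) (use t in \<open>auto simp: Hnorm_sq_cnj[OF nu]\<close>)
  then show ?thesis unfolding Y_bound_def using 1 A analytic_cnj[OF nu] Y_boundD(4)[OF u] by auto
qed

lemma Y_bound_Dx:
  assumes t: "t \<in> {0..T}" and u: "Y_bound (m + 1) t A u"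
  shows "Y_bound m t A (Dx u)"
proof -
  note nu = Y_boundD(1)[OF u] and A = Y_boundD(2)[OF u]
  have 1: "Hnorm_sq (w s) m (Dx u s) \<le> ennreal (A\<^sup>2)" if "s \<in> {0..t}" for s
    by (rule order_trans[OF Hnorm_sq_Dx[OF nu] Y_boundD(3)[OF u that]]) (use that t in auto)
  have "smoothing (m + 1/2) t (Dx u) \<le> ennreal 1 * smoothing (m + 1 + 1/2) t u"
  proof (rule smoothing_le[OF t nu])
    fix s assume s: "s \<in> {0..t}"
    have "Hnorm_sq (w s) (m + 1/2) (Dx u s) \<le> Hnorm_sq (w s) (m + 1/2 + 1) (u s)"
      by (rule Hnorm_sq_Dx[OF nu]) (use s t in auto)
    then show "Hnorm_sq (w s) (m + 1/2) (Dx u s) \<le> ennreal 1 * Hnorm_sq (w s) (m + 1 + 1/2) (u s)"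
      by (simp add: add_ac)
  qed
  then show ?thesis unfolding Y_bound_def using 1 A analytic_Dx[OF nu] Y_boundD(4)[OF u] by auto
qed

lemma half_shift: "(m::real) - 1/2 + 1 = m + 1/2" "(m::real) + 1 - 1/2 = m + 1/2"
  by simp_all

text \<open>The gain of regularity is spent here: \<open>m - 1/2 + 1 = m + 1/2\<close>, so the
  derivative of a curve of order \<open>m\<close> is an admissible source at that same
  order.\<close>

lemma source_bound_Dx:
  assumes t: "t \<in> {0..T}" and u: "Y_bound m t A u"
  shows "source_bound m t A (Dx u)"
proof -
  note nu = Y_boundD(1)[OF u] and A = Y_boundD(2)[OF u]
  have "smoothing (m - 1/2) t (Dx u) \<le> ennreal 1 * smoothing (m + 1/2) t u"
  proof (rule smoothing_le[OF t nu])
    fix s assume s: "s \<in> {0..t}"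
    have "Hnorm_sq (w s) (m - 1/2) (Dx u s) \<le> Hnorm_sq (w s) (m - 1/2 + 1) (u s)"
      by (rule Hnorm_sq_Dx[OF nu]) (use s t in auto)
    then show "Hnorm_sq (w s) (m - 1/2) (Dx u s) \<le> ennreal 1 * Hnorm_sq (w s) (m + 1/2) (u s)"
      unfolding half_shift by simp
  qed
  then show ?thesis unfolding source_bound_def using A analytic_Dx[OF nu] Y_boundD(4)[OF u] by auto
qed

text \<open>Without a derivative, the gain raises the order by one instead. It serves the phase
  equation, whose right-hand side is controlled at order \<open>l\<close> and whose unknown is
  wanted at order \<open>l + 1\<close>.\<close>

lemma source_bound_up: "Y_bound m t A u \<Longrightarrow> source_bound (m + 1) t A u"
  unfolding Y_bound_def source_bound_def half_shift by simp

lemma const_bound: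
  assumes "c \<le> k\<^sup>2" "c \<ge> 0" "k \<ge> 0"
  shows "ennreal c * (ennreal (a\<^sup>2) * ennreal (b\<^sup>2)) \<le> ennreal ((k * a * b)\<^sup>2)"
proof -
  have "ennreal c * (ennreal (a\<^sup>2) * ennreal (b\<^sup>2)) = ennreal (c * (a * b)\<^sup>2)"
    using assms by (simp only: ennreal_sq_mult) (subst ennreal_mult, auto)
  also have "\<dots> \<le> ennreal (k\<^sup>2 * (a * b)\<^sup>2)" using assms by (intro ennreal_leI mult_right_mono) auto
  finally show ?thesis by (simp add: power_mult_distrib mult.assoc)
qed

text \<open>At order \<open>l + 1/2\<close> the tame form is decisive: in each term the
  time-integrated norm falls on one factor, and the other is bounded at order \<open>l\<close>,
  uniformly in time.\<close>

lemma Y_bound_mult: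
  assumes t: "t \<in> {0..T}" and l: "l > 1/2" and u: "Y_bound l t A u" and v: "Y_bound l t B v"
  shows "Y_bound l t (alg_const l * A * B) (\<lambda>t x. u t x * v t x)"
proof -
  note nu = Y_boundD(1)[OF u] and nv = Y_boundD(1)[OF v] and A = Y_boundD(2)[OF u] and B = Y_boundD(2)[OF v]
  have k: "alg_const l \<ge> 0" using alg_const_ge_1[of l] by linarith
  have 1: "Hnorm_sq (w s) l (\<lambda>x. u s x * v s x) \<le> ennreal ((alg_const l * A * B)\<^sup>2)" if s: "s \<in> {0..t}" for s
  proof -
    have "Hnorm_sq (w s) l (\<lambda>x. u s x * v s x) \<le> ennreal (tame_const l l) * (Hnorm_sq (w s) l (u s) * Hnorm_sq (w s) l (v s) + Hnorm_sq (w s) l (u s) * Hnorm_sq (w s) l (v s))"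
      by (rule Hnorm_sq_mult[OF nu nv]) (use s t l in auto)
    also have "\<dots> \<le> ennreal (tame_const l l) * (ennreal (A\<^sup>2) * ennreal (B\<^sup>2) + ennreal (A\<^sup>2) * ennreal (B\<^sup>2))"
      by (intro mult_left_mono add_mono mult_mono Y_boundD(3)[OF u s] Y_boundD(3)[OF v s]) auto
    also have "\<dots> = ennreal (2 * tame_const l l) * (ennreal (A\<^sup>2) * ennreal (B\<^sup>2))"
      by (simp only: mult_2[symmetric] ennreal_mult[of 2 "tame_const l l"] zero_le_numeral tame_const_nonneg ennreal_numeral mult.left_commute mult.assoc)
    also have "\<dots> \<le> ennreal ((alg_const l * A * B)\<^sup>2)" by (rule const_bound) (use alg_const_sq k in auto)
    finally show ?thesis .
  qed
  have "smoothing (l + 1/2) t (\<lambda>t x. u t x * v t x) \<le> ennreal (tame_const (l + 1/2) l * B\<^sup>2) * smoothing (l + 1/2) t u + ennreal (tame_const (l + 1/2) l * A\<^sup>2) * smoothing (l + 1/2) t v"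
  proof (rule smoothing_combo[OF t nu nv])
    fix s assume s: "s \<in> {0..t}"
    have "Hnorm_sq (w s) (l + 1/2) (\<lambda>x. u s x * v s x) \<le> ennreal (tame_const (l + 1/2) l) * (Hnorm_sq (w s) (l + 1/2) (u s) * Hnorm_sq (w s) l (v s) + Hnorm_sq (w s) l (u s) * Hnorm_sq (w s) (l + 1/2) (v s))"
      by (rule Hnorm_sq_mult[OF nu nv]) (use s t l in auto)
    also have "\<dots> \<le> ennreal (tame_const (l + 1/2) l) * (Hnorm_sq (w s) (l + 1/2) (u s) * ennreal (B\<^sup>2) + ennreal (A\<^sup>2) * Hnorm_sq (w s) (l + 1/2) (v s))"
      by (intro mult_left_mono add_mono mult_mono Y_boundD(3)[OF u s] Y_boundD(3)[OF v s]) auto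
    finally show "Hnorm_sq (w s) (l + 1/2) (\<lambda>x. u s x * v s x) \<le> ennreal (tame_const (l + 1/2) l * B\<^sup>2) * Hnorm_sq (w s) (l + 1/2) (u s) + ennreal (tame_const (l + 1/2) l * A\<^sup>2) * Hnorm_sq (w s) (l + 1/2) (v s)"
      by (simp add: ennreal_mult distrib_left mult_ac)
  qed
  also have "\<dots> \<le> ennreal (tame_const (l + 1/2) l * B\<^sup>2) * ennreal (A\<^sup>2) + ennreal (tame_const (l + 1/2) l * A\<^sup>2) * ennreal (B\<^sup>2)"
    by (intro add_mono mult_left_mono Y_boundD(4)[OF u] Y_boundD(4)[OF v]) auto
  also have "\<dots> = ennreal (2 * tame_const (l + 1/2) l) * (ennreal (A\<^sup>2) * ennreal (B\<^sup>2))"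
    by (simp add: ennreal_mult[symmetric] ennreal_plus[symmetric] mult_ac del: ennreal_plus)
  also have "\<dots> \<le> ennreal ((alg_const l * A * B)\<^sup>2)" by (rule const_bound) (use alg_const_sq k in auto)
  finally show ?thesis unfolding Y_bound_def using 1 A B k analytic_mult[OF nu nv] by auto
qed

text \<open>Order \<open>l - 1/2\<close> is still above 1/2 because \<open>l > 1\<close>. The
  differentiated factor takes the time-integrated norm, the other one a bound uniform in
  time.\<close>

lemma source_bound_mult:
  assumes t: "t \<in> {0..T}" and l: "l > 1" and u: "Y_bound l t A u" and v: "Y_bound l t B v"
  shows "source_bound l t (alg_const l * A * B) (\<lambda>t x. u t x * Dx v t x)"
proof -
  note nu = Y_boundD(1)[OF u] and nv = Y_boundD(1)[OF v] and A = Y_boundD(2)[OF u] and B = Y_boundD(2)[OF v]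
  have k: "alg_const l \<ge> 0" using alg_const_ge_1[of l] by linarith
  let ?m = "l - 1/2"
  have "smoothing ?m t (\<lambda>t x. u t x * Dx v t x) \<le> ennreal (2 * tame_const ?m ?m * A\<^sup>2) * smoothing (l + 1/2) t v"
  proof (rule smoothing_le[OF t nv])
    fix s assume s: "s \<in> {0..t}"
    then have sT: "s \<in> {0..T}" using t by auto
    have "Hnorm_sq (w s) ?m (\<lambda>x. u s x * Dx v s x) \<le> ennreal (tame_const ?m ?m) * (Hnorm_sq (w s) ?m (u s) * Hnorm_sq (w s) ?m (Dx v s) + Hnorm_sq (w s) ?m (u s) * Hnorm_sq (w s) ?m (Dx v s))"
      by (rule Hnorm_sq_mult[OF nu analytic_Dx[OF nv] sT]) (use l in auto)
    also have "\<dots> \<le> ennreal (tame_const ?m ?m) * (ennreal (A\<^sup>2) * Hnorm_sq (w s) (l + 1/2) (v s) + ennreal (A\<^sup>2) * Hnorm_sq (w s) (l + 1/2) (v s))"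
    proof -
      have a: "Hnorm_sq (w s) ?m (u s) \<le> ennreal (A\<^sup>2)" by (rule order_trans[OF Hnorm_sq_mono Y_boundD(3)[OF u s]]) simp
      have b: "Hnorm_sq (w s) ?m (Dx v s) \<le> Hnorm_sq (w s) (l + 1/2) (v s)" using Hnorm_sq_Dx[OF nv sT, of "w s" ?m] unfolding half_shift .
      show ?thesis by (intro mult_left_mono add_mono mult_mono a b) auto
    qed
    also have "\<dots> = ennreal (2 * tame_const ?m ?m * A\<^sup>2) * Hnorm_sq (w s) (l + 1/2) (v s)"
    proof -
      have "ennreal (2 * tame_const ?m ?m * A\<^sup>2) = 2 * (ennreal (tame_const ?m ?m) * ennreal (A\<^sup>2))"
        by (simp add: ennreal_mult mult.assoc)
      then show ?thesis by (simp only: mult_2[symmetric] mult_ac)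
    qed
    finally show "Hnorm_sq (w s) ?m (\<lambda>x. u s x * Dx v s x) \<le> ennreal (2 * tame_const ?m ?m * A\<^sup>2) * Hnorm_sq (w s) (l + 1/2) (v s)" .
  qed
  also have "\<dots> \<le> ennreal (2 * tame_const ?m ?m * A\<^sup>2) * ennreal (B\<^sup>2)" by (intro mult_left_mono Y_boundD(4)[OF v]) simp
  also have "\<dots> = ennreal (2 * tame_const ?m ?m) * (ennreal (A\<^sup>2) * ennreal (B\<^sup>2))"
    by (simp add: ennreal_mult mult.assoc)
  also have "\<dots> \<le> ennreal ((alg_const l * A * B)\<^sup>2)" by (rule const_bound) (use alg_const_sq k in auto)
  finally show ?thesis unfolding source_bound_def using A B k analytic_mult[OF nu analytic_Dx[OF nv]] by auto
qed

text \<open>Serves the phase with \<open>q = 0\<close> and the amplitude with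
  \<open>q = \<epsilon> / 2\<close>. The constants do not involve \<open>q\<close>, which is the
  origin of all uniformity in \<epsilon>.\<close>

lemma linear_estimate:
  assumes t: "t \<in> {0..T}" and u: "analytic u" and P: "source_bound m t D P" and B: "B \<ge> 0" "Hnorm_sq w0 m (u 0) \<le> ennreal (B\<^sup>2)"
    and ode: "\<And>t x. t \<in> {0..T} \<Longrightarrow> ((\<lambda>s. u s x) has_vector_derivative (\<i> * complex_of_real q * Dx (Dx u) t x + P t x)) (at t within {0..T})"
  shows "Y_bound m t (2 * B + D / M) u"
proof -
  obtain h p where h: "spectral_curve u h" and p: "spectral_curve P p" using u source_boundD(1)[OF P] by (auto simp: analytic_def)
  note e = energy_bound[OF h p ode t B(1) source_boundD(2)[OF P] B(2) source_boundD(3)[OF P, unfolded smoothing_def]]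
  show ?thesis unfolding Y_bound_def smoothing_def using e(1) e(2) u B(1) source_boundD(2)[OF P] M0 by auto
qed

end

section \<open>Expansion of the nonlinearities\<close>

definition abs_sq :: "(real \<Rightarrow> real \<Rightarrow> complex) \<Rightarrow> real \<Rightarrow> real \<Rightarrow> complex" where
  "abs_sq a = (\<lambda>t x. a t x * cnj (a t x))"

text \<open>Here and below the suffix \<open>_lin\<close> marks a derivative of the preceding map,
  taken at the first arguments in the direction of the last ones.\<close>

definition abs_sq_lin :: "(real \<Rightarrow> real \<Rightarrow> complex) \<Rightarrow> (real \<Rightarrow> real \<Rightarrow> complex) \<Rightarrow> real \<Rightarrow> real \<Rightarrow> complex" where
  "abs_sq_lin a a1 = (\<lambda>t x. a1 t x * cnj (a t x) + a t x * cnj (a1 t x))"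

definition pow_fun :: "nat \<Rightarrow> (real \<Rightarrow> real \<Rightarrow> complex) \<Rightarrow> real \<Rightarrow> real \<Rightarrow> complex" where
  "pow_fun n s = (\<lambda>t x. s t x ^ n)"

definition pow_fun_lin :: "nat \<Rightarrow> (real \<Rightarrow> real \<Rightarrow> complex) \<Rightarrow> (real \<Rightarrow> real \<Rightarrow> complex) \<Rightarrow> real \<Rightarrow> real \<Rightarrow> complex" where
  "pow_fun_lin n s s1 = (\<lambda>t x. of_nat n * (s t x ^ (n - 1) * s1 t x))"

text \<open>\<open>p\<close> stands for the derivative of the phase. Written through
  \<open>a\<close> and \<open>cnj a\<close> the nonlinearity is a polynomial, and the bracketing
  follows the order in which the rules for jets are applied.\<close>

definition phase_rhs :: "real \<Rightarrow> real \<Rightarrow> nat \<Rightarrow> nat \<Rightarrow> (real \<Rightarrow> real \<Rightarrow> complex) \<Rightarrow> (real \<Rightarrow> real \<Rightarrow> complex) \<Rightarrow> real \<Rightarrow> real \<Rightarrow> complex" where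
  "phase_rhs \<alpha> lam \<gamma> \<sigma> p a = (\<lambda>t x. (-1) * ((1/2 * (p t x * p t x) + of_real (\<alpha>/2) * (pow_fun \<gamma> (abs_sq a) t x * p t x)) + of_real lam * pow_fun \<sigma> (abs_sq a) t x))"

definition phase_rhs_lin :: "real \<Rightarrow> real \<Rightarrow> nat \<Rightarrow> nat \<Rightarrow> (real \<Rightarrow> real \<Rightarrow> complex) \<Rightarrow> (real \<Rightarrow> real \<Rightarrow> complex) \<Rightarrow> (real \<Rightarrow> real \<Rightarrow> complex) \<Rightarrow> (real \<Rightarrow> real \<Rightarrow> complex) \<Rightarrow> real \<Rightarrow> real \<Rightarrow> complex" where
  "phase_rhs_lin \<alpha> lam \<gamma> \<sigma> p a p1 a1 = (\<lambda>t x. (-1) * ((1/2 * (p1 t x * p t x + p t x * p1 t x)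
     + of_real (\<alpha>/2) * (pow_fun_lin \<gamma> (abs_sq a) (abs_sq_lin a a1) t x * p t x + pow_fun \<gamma> (abs_sq a) t x * p1 t x)) + of_real lam * pow_fun_lin \<sigma> (abs_sq a) (abs_sq_lin a a1) t x))"

definition ampl_rhs :: "real \<Rightarrow> nat \<Rightarrow> (real \<Rightarrow> real \<Rightarrow> complex) \<Rightarrow> (real \<Rightarrow> real \<Rightarrow> complex) \<Rightarrow> real \<Rightarrow> real \<Rightarrow> complex" where
  "ampl_rhs \<alpha> \<gamma> p a = (\<lambda>t x. (-1) * ((p t x * Dx a t x + 1/2 * (a t x * Dx p t x)) + 1/2 * Dx (\<lambda>t x. of_real \<alpha> * (pow_fun \<gamma> (abs_sq a) t x * a t x)) t x))"

definition ampl_rhs_lin :: "real \<Rightarrow> nat \<Rightarrow> (real \<Rightarrow> real \<Rightarrow> complex) \<Rightarrow> (real \<Rightarrow> real \<Rightarrow> complex) \<Rightarrow> (real \<Rightarrow> real \<Rightarrow> complex) \<Rightarrow> (real \<Rightarrow> real \<Rightarrow> complex) \<Rightarrow> real \<Rightarrow> real \<Rightarrow> complex" where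
  "ampl_rhs_lin \<alpha> \<gamma> p a p1 a1 = (\<lambda>t x. (-1) * (((p1 t x * Dx a t x + p t x * Dx a1 t x) + 1/2 * (a1 t x * Dx p t x + a t x * Dx p1 t x))
     + 1/2 * Dx (\<lambda>t x. of_real \<alpha> * (pow_fun_lin \<gamma> (abs_sq a) (abs_sq_lin a a1) t x * a t x + pow_fun \<gamma> (abs_sq a) t x * a1 t x)) t x))"

text \<open>Each of the \<open>n - 1\<close> multiplications costs a factor
  \<open>10 * k * L\<close>; \<open>k\<close> will be \<open>alg_const l\<close>.\<close>

definition pow_bound :: "real \<Rightarrow> nat \<Rightarrow> real \<Rightarrow> real" where
  "pow_bound k n L = L * (10 * k * L) ^ (n - 1)"

text \<open>This constant and the next two collect, term by term, what the rules for jets return: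
  \<open>10 * k\<close> for a product and a doubling for a sum. They depend on \<open>L\<close>,
  \<open>k\<close> and the nonlinearities, but not on \<epsilon>, \<open>M\<close> or
  \<open>T\<close>.\<close>

definition abs_sq_bound :: "real \<Rightarrow> real \<Rightarrow> real" where
  "abs_sq_bound k L = 10 * k * L * L"

definition phase_const :: "real \<Rightarrow> real \<Rightarrow> real \<Rightarrow> nat \<Rightarrow> nat \<Rightarrow> real \<Rightarrow> real" where
  "phase_const k \<alpha> lam \<gamma> \<sigma> L = 2 * (2 * (1/2 * (10 * k * L * L)) + 2 * (\<bar>\<alpha>/2\<bar> * (10 * k * pow_bound k \<gamma> (abs_sq_bound k L) * L))) + 2 * (\<bar>lam\<bar> * pow_bound k \<sigma> (abs_sq_bound k L))"

definition ampl_const :: "real \<Rightarrow> real \<Rightarrow> nat \<Rightarrow> real \<Rightarrow> real" where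
  "ampl_const k \<alpha> \<gamma> L = 2 * (2 * (10 * k * L * L) + 2 * (1/2 * (10 * k * L * L))) + 2 * (1/2 * (\<bar>\<alpha>\<bar> * (10 * k * pow_bound k \<gamma> (abs_sq_bound k L) * L)))"

locale shrinking_radius_reg = shrinking_radius +
  fixes l :: real
  assumes l1: "l > 1"
begin

text \<open>
  \<open>d\<close> and \<open>n\<close> stand for the sizes of the first difference \<open>y - y0\<close> and of the remainder
  \<open>y - y0 - e y1\<close>; the term \<open>d\<^sup>2\<close> is the quadratic Taylor error created by products. The bound on the
  remainder carries over to products because \<open>y1\<close> only enters through \<open>e y1 = (y - y0) - (y - y0 - e y1)\<close>.
\<close>

definition jet :: "real \<Rightarrow> real \<Rightarrow> real \<Rightarrow> real \<Rightarrow> real \<Rightarrow> (real \<Rightarrow> real \<Rightarrow> complex) \<Rightarrow> (real \<Rightarrow> real \<Rightarrow> complex) \<Rightarrow> (real \<Rightarrow> real \<Rightarrow> complex) \<Rightarrow> bool" where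
  "jet t d n e L y y0 y1 \<longleftrightarrow> analytic y1 \<and> Y_bound l t L y \<and> Y_bound l t L y0 \<and> Y_bound l t (L * d) (\<lambda>t x. y t x - y0 t x) \<and>
     Y_bound l t (L * (n + d\<^sup>2)) (\<lambda>t x. y t x - y0 t x - of_real e * y1 t x)"

definition source_jet :: "real \<Rightarrow> real \<Rightarrow> real \<Rightarrow> real \<Rightarrow> real \<Rightarrow> real \<Rightarrow> (real \<Rightarrow> real \<Rightarrow> complex) \<Rightarrow> (real \<Rightarrow> real \<Rightarrow> complex) \<Rightarrow> (real \<Rightarrow> real \<Rightarrow> complex) \<Rightarrow> bool" where
  "source_jet t d n e m L y y0 y1 \<longleftrightarrow> analytic y1 \<and> source_bound m t L y \<and> source_bound m t L y0 \<and> source_bound m t (L * d) (\<lambda>t x. y t x - y0 t x) \<and>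
     source_bound m t (L * (n + d\<^sup>2)) (\<lambda>t x. y t x - y0 t x - of_real e * y1 t x)"

lemma kap0: "alg_const l \<ge> 0" using alg_const_ge_1[of l] by linarith

context
  fixes t d n e :: real
  assumes t: "t \<in> {0..T}" and d: "d \<ge> 0" and n: "n \<ge> 0"
begin

lemma jetD:
  assumes "jet t d n e L y y0 y1"
  shows "analytic y" "analytic y0" "analytic y1" "L \<ge> 0"
  using assms Y_boundD(1,2) unfolding jet_def by blast+

section \<open>Calculus of jets\<close>

text \<open>The constant 10 is dictated by the remainder of second order: its two linear pieces cost
  8 through nested sums, the product of two first differences costs 2. The other three bounds need
  less.\<close>

lemma jet_mult:
  assumes y: "jet t d n e L y y0 y1" and z: "jet t d n e L' z z0 z1"
  shows "jet t d n e (10 * alg_const l * L * L') (\<lambda>t x. y t x * z t x) (\<lambda>t x. y0 t x * z0 t x) (\<lambda>t x. y1 t x * z0 t x + y0 t x * z1 t x)"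
proof -
  have L: "L \<ge> 0" "L' \<ge> 0" using jetD(4)[OF y] jetD(4)[OF z] by auto
  have l2: "l > 1/2" using l1 by simp
  define X where "X = alg_const l * L * L'"
  have X0: "X \<ge> 0" using kap0 L by (simp add: X_def)
  have y': "Y_bound l t L y" "Y_bound l t L y0" "Y_bound l t (L * d) (\<lambda>t x. y t x - y0 t x)" "Y_bound l t (L * (n + d\<^sup>2)) (\<lambda>t x. y t x - y0 t x - of_real e * y1 t x)"
    and z': "Y_bound l t L' z" "Y_bound l t L' z0" "Y_bound l t (L' * d) (\<lambda>t x. z t x - z0 t x)" "Y_bound l t (L' * (n + d\<^sup>2)) (\<lambda>t x. z t x - z0 t x - of_real e * z1 t x)"
    using y z by (auto simp: jet_def)
  note mult = Y_bound_mult[OF t l2]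
  have 1: "Y_bound l t (10 * X) (\<lambda>t x. y t x * z t x)" "Y_bound l t (10 * X) (\<lambda>t x. y0 t x * z0 t x)"
    using mult[OF y'(1) z'(1)] mult[OF y'(2) z'(2)] X0 by (auto simp: X_def[symmetric] elim!: Y_bound_mono)
  have "Y_bound l t (2 * (alg_const l * (L * d) * L') + 2 * (alg_const l * L * (L' * d))) (\<lambda>t x. (y t x - y0 t x) * z t x + y0 t x * (z t x - z0 t x))"
    by (intro Y_bound_add[OF t] mult y' z')
  then have 2: "Y_bound l t (10 * X * d) (\<lambda>t x. y t x * z t x - y0 t x * z0 t x)"
  proof (rule Y_bound_cong[OF Y_bound_mono t])
    show "2 * (alg_const l * (L * d) * L') + 2 * (alg_const l * L * (L' * d)) \<le> 10 * X * d"
      using mult_nonneg_nonneg[OF X0 d] by (simp add: X_def mult_ac)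
  qed (simp add: algebra_simps)
  \<comment> \<open>Product rule with exact remainder: expand about the base point
    \<open>(y0, z0)\<close>; besides the remainders of both factors, the product of the two first
    differences is left, of size \<open>d\<^sup>2\<close>.\<close>
  have "Y_bound l t (2 * (2 * (alg_const l * (L * (n + d\<^sup>2)) * L') + 2 * (alg_const l * L * (L' * (n + d\<^sup>2)))) + 2 * (alg_const l * (L * d) * (L' * d)))
     (\<lambda>t x. ((y t x - y0 t x - of_real e * y1 t x) * z0 t x + y0 t x * (z t x - z0 t x - of_real e * z1 t x)) + (y t x - y0 t x) * (z t x - z0 t x))"
    by (intro Y_bound_add[OF t] mult y' z')
  then have 3: "Y_bound l t (10 * X * (n + d\<^sup>2)) (\<lambda>t x. y t x * z t x - y0 t x * z0 t x - of_real e * (y1 t x * z0 t x + y0 t x * z1 t x))"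
  proof (rule Y_bound_cong[OF Y_bound_mono t])
    have "2 * (2 * (alg_const l * (L * (n + d\<^sup>2)) * L') + 2 * (alg_const l * L * (L' * (n + d\<^sup>2)))) + 2 * (alg_const l * (L * d) * (L' * d)) = 8 * (X * (n + d\<^sup>2)) + 2 * (X * d\<^sup>2)"
      by (simp add: X_def power2_eq_square mult_ac)
    also have "\<dots> \<le> 10 * X * (n + d\<^sup>2)"
      using mult_nonneg_nonneg[OF X0 n] by (simp add: algebra_simps)
    finally show "2 * (2 * (alg_const l * (L * (n + d\<^sup>2)) * L') + 2 * (alg_const l * L * (L' * (n + d\<^sup>2)))) + 2 * (alg_const l * (L * d) * (L' * d)) \<le> 10 * X * (n + d\<^sup>2)" .
  qed (simp add: algebra_simps)
  have e: "10 * alg_const l * L * L' = 10 * X" by (simp add: X_def)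
  show ?thesis unfolding jet_def e using 1 2 3 jetD[OF y] jetD[OF z] by (auto intro!: analytic_intros)
qed

lemma jet_cmult:
  assumes y: "jet t d n e L y y0 y1"
  shows "jet t d n e (cmod c * L) (\<lambda>t x. c * y t x) (\<lambda>t x. c * y0 t x) (\<lambda>t x. c * y1 t x)"
proof -
  have y': "Y_bound l t L y" "Y_bound l t L y0" "Y_bound l t (L * d) (\<lambda>t x. y t x - y0 t x)" "Y_bound l t (L * (n + d\<^sup>2)) (\<lambda>t x. y t x - y0 t x - of_real e * y1 t x)" "analytic y1"
    using y by (auto simp: jet_def)
  show ?thesis unfolding jet_def
    using Y_bound_cmult[OF t y'(1), of c] Y_bound_cmult[OF t y'(2), of c] Y_bound_cmult[OF t y'(3), of c] Y_bound_cmult[OF t y'(4), of c] analytic_cmult[OF y'(5)]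
    by (simp add: right_diff_distrib mult.left_commute[of _ c] mult.assoc)
qed

lemma jet_add:
  assumes y: "jet t d n e L y y0 y1" and z: "jet t d n e L' z z0 z1"
  shows "jet t d n e (2 * L + 2 * L') (\<lambda>t x. y t x + z t x) (\<lambda>t x. y0 t x + z0 t x) (\<lambda>t x. y1 t x + z1 t x)"
proof -
  have y': "Y_bound l t L y" "Y_bound l t L y0" "Y_bound l t (L * d) (\<lambda>t x. y t x - y0 t x)" "Y_bound l t (L * (n + d\<^sup>2)) (\<lambda>t x. y t x - y0 t x - of_real e * y1 t x)" "analytic y1"
    and z': "Y_bound l t L' z" "Y_bound l t L' z0" "Y_bound l t (L' * d) (\<lambda>t x. z t x - z0 t x)" "Y_bound l t (L' * (n + d\<^sup>2)) (\<lambda>t x. z t x - z0 t x - of_real e * z1 t x)" "analytic z1"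
    using y z by (auto simp: jet_def)
  note a = Y_bound_add[OF t y'(1) z'(1)] Y_bound_add[OF t y'(2) z'(2)] Y_bound_add[OF t y'(3) z'(3)] Y_bound_add[OF t y'(4) z'(4)] analytic_add[OF y'(5) z'(5)]
  have "Y_bound l t ((2 * L + 2 * L') * d) (\<lambda>t x. y t x + z t x - (y0 t x + z0 t x))"
    by (rule Y_bound_cong[OF Y_bound_mono[OF a(3)] t]) (simp_all add: algebra_simps)
  moreover have "Y_bound l t ((2 * L + 2 * L') * (n + d\<^sup>2)) (\<lambda>t x. y t x + z t x - (y0 t x + z0 t x) - of_real e * (y1 t x + z1 t x))"
    by (rule Y_bound_cong[OF Y_bound_mono[OF a(4)] t]) (simp_all add: algebra_simps)
  ultimately show ?thesis unfolding jet_def using a(1,2,5) by blast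
qed

lemma jet_cnj:
  assumes y: "jet t d n e L y y0 y1"
  shows "jet t d n e L (\<lambda>t x. cnj (y t x)) (\<lambda>t x. cnj (y0 t x)) (\<lambda>t x. cnj (y1 t x))"
proof -
  have y': "Y_bound l t L y" "Y_bound l t L y0" "Y_bound l t (L * d) (\<lambda>t x. y t x - y0 t x)" "Y_bound l t (L * (n + d\<^sup>2)) (\<lambda>t x. y t x - y0 t x - of_real e * y1 t x)" "analytic y1"
    using y by (auto simp: jet_def)
  show ?thesis unfolding jet_def
    using Y_bound_cnj[OF t y'(1)] Y_bound_cnj[OF t y'(2)] Y_bound_cnj[OF t y'(3)] Y_bound_cnj[OF t y'(4)] analytic_cnj[OF y'(5)]
    by simp
qed

text \<open>The induction starts at exponent 1, because the constant function 1 is not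
  square-integrable and hence not an analytic curve. This is where positivity of the exponents
  \<gamma> and \<sigma> enters.\<close>

lemma jet_pw_Suc:
  assumes y: "jet t d n e L y y0 y1"
  shows "jet t d n e (L * (10 * alg_const l * L) ^ k) (pow_fun (Suc k) y) (pow_fun (Suc k) y0) (pow_fun_lin (Suc k) y0 y1)"
proof (induction k)
  case 0
  then show ?case using y by (simp add: pow_fun_def pow_fun_lin_def)
next
  case (Suc k)
  have "pow_fun (Suc (Suc k)) y = (\<lambda>t x. y t x * pow_fun (Suc k) y t x)" for y by (simp add: pow_fun_def)
  moreover have "pow_fun_lin (Suc (Suc k)) y0 y1 = (\<lambda>t x. y1 t x * pow_fun (Suc k) y0 t x + y0 t x * pow_fun_lin (Suc k) y0 y1 t x)"
    by (simp add: pow_fun_def pow_fun_lin_def fun_eq_iff algebra_simps)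
  moreover have "10 * alg_const l * L * (L * (10 * alg_const l * L) ^ k) = L * (10 * alg_const l * L) ^ Suc k" by simp
  ultimately show ?case using jet_mult[OF y Suc] by (simp only:)
qed

lemma jet_pw:
  assumes "jet t d n e L y y0 y1" "k > 0"
  shows "jet t d n e (pow_bound (alg_const l) k L) (pow_fun k y) (pow_fun k y0) (pow_fun_lin k y0 y1)"
  using jet_pw_Suc[OF assms(1), of "k - 1"] assms(2) by (simp add: pow_bound_def)

lemma jet_sq:
  assumes "jet t d n e L a a0 a1"
  shows "jet t d n e (abs_sq_bound (alg_const l) L) (abs_sq a) (abs_sq a0) (abs_sq_lin a0 a1)"
  using jet_mult[OF assms jet_cnj[OF assms]] unfolding abs_sq_bound_def abs_sq_def abs_sq_lin_def .

lemma source_jet_cmult: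
  assumes y: "source_jet t d n e m L y y0 y1"
  shows "source_jet t d n e m (cmod c * L) (\<lambda>t x. c * y t x) (\<lambda>t x. c * y0 t x) (\<lambda>t x. c * y1 t x)"
proof -
  have y': "source_bound m t L y" "source_bound m t L y0" "source_bound m t (L * d) (\<lambda>t x. y t x - y0 t x)" "source_bound m t (L * (n + d\<^sup>2)) (\<lambda>t x. y t x - y0 t x - of_real e * y1 t x)" "analytic y1"
    using y by (auto simp: source_jet_def)
  show ?thesis unfolding source_jet_def
    using source_bound_cmult[OF t y'(1), of c] source_bound_cmult[OF t y'(2), of c] source_bound_cmult[OF t y'(3), of c] source_bound_cmult[OF t y'(4), of c] analytic_cmult[OF y'(5)]
    by (simp add: right_diff_distrib mult.left_commute[of _ c] mult.assoc)
qed

lemma source_jet_add: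
  assumes y: "source_jet t d n e m L y y0 y1" and z: "source_jet t d n e m L' z z0 z1"
  shows "source_jet t d n e m (2 * L + 2 * L') (\<lambda>t x. y t x + z t x) (\<lambda>t x. y0 t x + z0 t x) (\<lambda>t x. y1 t x + z1 t x)"
proof -
  have y': "source_bound m t L y" "source_bound m t L y0" "source_bound m t (L * d) (\<lambda>t x. y t x - y0 t x)" "source_bound m t (L * (n + d\<^sup>2)) (\<lambda>t x. y t x - y0 t x - of_real e * y1 t x)" "analytic y1"
    and z': "source_bound m t L' z" "source_bound m t L' z0" "source_bound m t (L' * d) (\<lambda>t x. z t x - z0 t x)" "source_bound m t (L' * (n + d\<^sup>2)) (\<lambda>t x. z t x - z0 t x - of_real e * z1 t x)" "analytic z1"
    using y z by (auto simp: source_jet_def)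
  note a = source_bound_add[OF t y'(1) z'(1)] source_bound_add[OF t y'(2) z'(2)] source_bound_add[OF t y'(3) z'(3)] source_bound_add[OF t y'(4) z'(4)] analytic_add[OF y'(5) z'(5)]
  have "source_bound m t ((2 * L + 2 * L') * d) (\<lambda>t x. y t x + z t x - (y0 t x + z0 t x))"
    by (rule source_bound_cong[OF source_bound_mono[OF a(3)] t]) (simp_all add: algebra_simps)
  moreover have "source_bound m t ((2 * L + 2 * L') * (n + d\<^sup>2)) (\<lambda>t x. y t x + z t x - (y0 t x + z0 t x) - of_real e * (y1 t x + z1 t x))"
    by (rule source_bound_cong[OF source_bound_mono[OF a(4)] t]) (simp_all add: algebra_simps)
  ultimately show ?thesis unfolding source_jet_def using a(1,2,5) by blast
qed

lemma source_jet_up: "jet t d n e L y y0 y1 \<Longrightarrow> source_jet t d n e (l + 1) L y y0 y1"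
  unfolding jet_def source_jet_def using source_bound_up by blast

lemma source_jet_Dx:
  assumes y: "jet t d n e L y y0 y1"
  shows "source_jet t d n e l L (Dx y) (Dx y0) (Dx y1)"
proof -
  have y': "Y_bound l t L y" "Y_bound l t L y0" "Y_bound l t (L * d) (\<lambda>t x. y t x - y0 t x)" "Y_bound l t (L * (n + d\<^sup>2)) (\<lambda>t x. y t x - y0 t x - of_real e * y1 t x)"
    using y by (auto simp: jet_def)
  note N = jetD[OF y]
  have "source_bound l t (L * d) (\<lambda>t x. Dx y t x - Dx y0 t x)"
    by (rule source_bound_cong[OF source_bound_Dx[OF t y'(3)] t]) (simp add: Dx_diff N)
  moreover have "source_bound l t (L * (n + d\<^sup>2)) (\<lambda>t x. Dx y t x - Dx y0 t x - of_real e * Dx y1 t x)"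
    by (rule source_bound_cong[OF source_bound_Dx[OF t y'(4)] t]) (simp add: Dx_diff Dx_cmult analytic_diff analytic_cmult N)
  ultimately show ?thesis unfolding source_jet_def using source_bound_Dx[OF t y'(1)] source_bound_Dx[OF t y'(2)] analytic_Dx[OF N(3)] by blast
qed

text \<open>The algebra of \<open>jet_mult\<close>, with the derivative on the second factor and
  \<open>source_bound_mult\<close> in place of the product estimate.\<close>

lemma source_jet_mult:
  assumes y: "jet t d n e L y y0 y1" and z: "jet t d n e L' z z0 z1"
  shows "source_jet t d n e l (10 * alg_const l * L * L') (\<lambda>t x. y t x * Dx z t x) (\<lambda>t x. y0 t x * Dx z0 t x) (\<lambda>t x. y1 t x * Dx z0 t x + y0 t x * Dx z1 t x)"
proof -
  have L: "L \<ge> 0" "L' \<ge> 0" using jetD(4)[OF y] jetD(4)[OF z] by auto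
  define X where "X = alg_const l * L * L'"
  have X0: "X \<ge> 0" using kap0 L by (simp add: X_def)
  have y': "Y_bound l t L y" "Y_bound l t L y0" "Y_bound l t (L * d) (\<lambda>t x. y t x - y0 t x)" "Y_bound l t (L * (n + d\<^sup>2)) (\<lambda>t x. y t x - y0 t x - of_real e * y1 t x)"
    and z': "Y_bound l t L' z" "Y_bound l t L' z0" "Y_bound l t (L' * d) (\<lambda>t x. z t x - z0 t x)" "Y_bound l t (L' * (n + d\<^sup>2)) (\<lambda>t x. z t x - z0 t x - of_real e * z1 t x)"
    using y z by (auto simp: jet_def)
  note N = jetD[OF y] jetD[OF z]
  note mult = source_bound_mult[OF t l1]
  have 1: "source_bound l t (10 * X) (\<lambda>t x. y t x * Dx z t x)" "source_bound l t (10 * X) (\<lambda>t x. y0 t x * Dx z0 t x)"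
    using mult[OF y'(1) z'(1)] mult[OF y'(2) z'(2)] X0 by (auto simp: X_def[symmetric] elim!: source_bound_mono)
  have "source_bound l t (2 * (alg_const l * (L * d) * L') + 2 * (alg_const l * L * (L' * d))) (\<lambda>t x. (y t x - y0 t x) * Dx z t x + y0 t x * Dx (\<lambda>t x. z t x - z0 t x) t x)"
    by (intro source_bound_add[OF t] mult y' z')
  then have 2: "source_bound l t (10 * X * d) (\<lambda>t x. y t x * Dx z t x - y0 t x * Dx z0 t x)"
  proof (rule source_bound_cong[OF source_bound_mono t])
    show "2 * (alg_const l * (L * d) * L') + 2 * (alg_const l * L * (L' * d)) \<le> 10 * X * d"
      using mult_nonneg_nonneg[OF X0 d] by (simp add: X_def mult_ac)
  qed (simp add: algebra_simps Dx_diff N)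
  have "source_bound l t (2 * (2 * (alg_const l * (L * (n + d\<^sup>2)) * L') + 2 * (alg_const l * L * (L' * (n + d\<^sup>2)))) + 2 * (alg_const l * (L * d) * (L' * d)))
     (\<lambda>t x. ((y t x - y0 t x - of_real e * y1 t x) * Dx z0 t x + y0 t x * Dx (\<lambda>t x. z t x - z0 t x - of_real e * z1 t x) t x) + (y t x - y0 t x) * Dx (\<lambda>t x. z t x - z0 t x) t x)"
    by (intro source_bound_add[OF t] mult y' z')
  then have 3: "source_bound l t (10 * X * (n + d\<^sup>2)) (\<lambda>t x. y t x * Dx z t x - y0 t x * Dx z0 t x - of_real e * (y1 t x * Dx z0 t x + y0 t x * Dx z1 t x))"
  proof (rule source_bound_cong[OF source_bound_mono t])
    have "2 * (2 * (alg_const l * (L * (n + d\<^sup>2)) * L') + 2 * (alg_const l * L * (L' * (n + d\<^sup>2)))) + 2 * (alg_const l * (L * d) * (L' * d)) = 8 * (X * (n + d\<^sup>2)) + 2 * (X * d\<^sup>2)"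
      by (simp add: X_def power2_eq_square mult_ac)
    also have "\<dots> \<le> 10 * X * (n + d\<^sup>2)"
      using mult_nonneg_nonneg[OF X0 n] by (simp add: algebra_simps)
    finally show "2 * (2 * (alg_const l * (L * (n + d\<^sup>2)) * L') + 2 * (alg_const l * L * (L' * (n + d\<^sup>2)))) + 2 * (alg_const l * (L * d) * (L' * d)) \<le> 10 * X * (n + d\<^sup>2)" .
  next
    fix s x assume s: "s \<in> {0..T}"
    have "Dx (\<lambda>t x. z t x - z0 t x - of_real e * z1 t x) s x = Dx z s x - Dx z0 s x - of_real e * Dx z1 s x"
      using s by (simp add: Dx_diff Dx_cmult analytic_diff analytic_cmult N)
    moreover have "Dx (\<lambda>t x. z t x - z0 t x) s x = Dx z s x - Dx z0 s x" using s by (simp add: Dx_diff N)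
    ultimately show "y s x * Dx z s x - y0 s x * Dx z0 s x - of_real e * (y1 s x * Dx z0 s x + y0 s x * Dx z1 s x) =
      ((y s x - y0 s x - of_real e * y1 s x) * Dx z0 s x + y0 s x * Dx (\<lambda>t x. z t x - z0 t x - of_real e * z1 t x) s x) + (y s x - y0 s x) * Dx (\<lambda>t x. z t x - z0 t x) s x"
      by (simp only:) (simp add: algebra_simps)
  qed
  have e: "10 * alg_const l * L * L' = 10 * X" by (simp add: X_def)
  show ?thesis unfolding source_jet_def e using 1 2 3 N by (auto intro!: analytic_intros)
qed

section \<open>Jets of the two right-hand sides\<close>

text \<open>Neither \<open>p\<close> nor \<open>a\<close> is differentiated here, so the jet lives
  at order \<open>l\<close> and is raised to a source of order \<open>l + 1\<close> in the last
  step.\<close>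

lemma source_jet_phase_rhs:
  assumes p: "jet t d n e L p p0 p1" and a: "jet t d n e L a a0 a1" and g: "\<gamma> > 0" "\<sigma> > 0"
  shows "source_jet t d n e (l + 1) (phase_const (alg_const l) \<alpha> lam \<gamma> \<sigma> L) (phase_rhs \<alpha> lam \<gamma> \<sigma> p a) (phase_rhs \<alpha> lam \<gamma> \<sigma> p0 a0) (phase_rhs_lin \<alpha> lam \<gamma> \<sigma> p0 a0 p1 a1)"
proof -
  note s = jet_sq[OF a]
  note G = jet_mult[OF jet_pw[OF s g(1)] p]
  note c1 = jet_cmult[OF jet_mult[OF p p], of "1/2"]
  note c2 = jet_cmult[OF G, of "of_real (\<alpha>/2)"]
  note c3 = jet_cmult[OF jet_pw[OF s g(2)], of "of_real lam"]
  note R = jet_cmult[OF jet_add[OF jet_add[OF c1 c2] c3], of "-1"]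
  have m: "cmod (-1) = 1" "cmod (1/2) = 1/2" by simp_all
  show ?thesis using source_jet_up[OF R] unfolding phase_rhs_def phase_rhs_lin_def phase_const_def m norm_of_real mult_1 .
qed

text \<open>Each term contains exactly one derivative, of \<open>a\<close>, of \<open>p\<close> or
  of the flux, and the energy estimate recovers exactly one; hence the order stays
  \<open>l\<close>.\<close>

lemma source_jet_ampl_rhs:
  assumes p: "jet t d n e L p p0 p1" and a: "jet t d n e L a a0 a1" and g: "\<gamma> > 0"
  shows "source_jet t d n e l (ampl_const (alg_const l) \<alpha> \<gamma> L) (ampl_rhs \<alpha> \<gamma> p a) (ampl_rhs \<alpha> \<gamma> p0 a0) (ampl_rhs_lin \<alpha> \<gamma> p0 a0 p1 a1)"
proof -
  note s = jet_sq[OF a]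
  note c1 = source_jet_mult[OF p a]
  note c2 = source_jet_cmult[OF source_jet_mult[OF a p], of "1/2"]
  note c3 = source_jet_cmult[OF source_jet_Dx[OF jet_cmult[OF jet_mult[OF jet_pw[OF s g] a], of "of_real \<alpha>"]], of "1/2"]
  note R = source_jet_cmult[OF source_jet_add[OF source_jet_add[OF c1 c2] c3], of "-1"]
  have m: "cmod (-1) = 1" "cmod (1/2) = 1/2" by simp_all
  show ?thesis using R unfolding ampl_rhs_def ampl_rhs_lin_def ampl_const_def m norm_of_real mult_1 .
qed

end

end

section \<open>Spectral densities of elements of the solution spaces\<close>

context shrinking_radius
begin

text \<open>Continuity is given for the density multiplied by the moving exponential. Undoing this
  weight costs \<open>\<bar>s - t\<bar> * japanese \<xi>\<close>, which the gap between
  \<open>c\<close> and \<open>w_end\<close> absorbs. The hypothesis \<open>cont\<close> selects the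
  representative that equals its Fourier integral everywhere.\<close>

lemma spectral_curve_of_C_H:
  assumes C: "\<psi> \<in> C_H w T m" and m: "m > 1/2" and cont: "\<And>t. t \<in> {0..T} \<Longrightarrow> continuous_on UNIV (\<psi> t)"
  shows "spectral_curve \<psi> (\<lambda>t. fourier (\<psi> t))"
    and "t \<in> {0..T} \<Longrightarrow> Hnorm_sq (w t) m (\<psi> t) < \<infinity>"
    and "m' \<le> m \<Longrightarrow> continuous_on {0..T} (\<lambda>s. enn2real (Hnorm_sq (w s) m' (\<psi> s)))"
proof -
  define k where "k t \<xi> = complex_of_real (exp (w t * japanese \<xi>)) * fourier (\<psi> t) \<xi>" for t \<xi>
  have sqv: "square_integrable (\<psi> t)" and fin: "Hnorm_sq (w t) m (\<psi> t) < \<infinity>" if "t \<in> {0..T}" for t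
    using C that by (auto simp: C_H_def Hspace_def Hnorm_def ennsqrt_less_top[simplified])
  show "t \<in> {0..T} \<Longrightarrow> Hnorm_sq (w t) m (\<psi> t) < \<infinity>" by (rule fin)
  have P: "is_plancherel_limit (-1) (\<psi> t) (fourier (\<psi> t))" if "t \<in> {0..T}" for t by (rule fourier_spec[OF sqv[OF that]])
  then have fs: "square_integrable (fourier (\<psi> t))" if "t \<in> {0..T}" for t using that by (simp add: plancherel_limit_iff)
  have fm[measurable]: "fourier (\<psi> t) \<in> borel_measurable borel" if "t \<in> {0..T}" for t using fs[OF that] by auto
  have km: "k t \<in> borel_measurable borel" if "t \<in> {0..T}" for t
    using fm[OF that] unfolding k_def by measurable
  have wk: "wnorm 0 r (k t) = Hnorm_sq (w t) r (\<psi> t)" for r t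
    unfolding Hnorm_sq_eq_wnorm wnorm_alt k_def by (simp add: weight_def norm_mult mult.assoc)
  have kf: "wnorm 0 m (k t) < \<infinity>" if "t \<in> {0..T}" for t unfolding wk by (rule fin[OF that])
  have ki: "integrable lborel (k t)" if "t \<in> {0..T}" for t
    by (rule integrable_of_wnorm[OF m _ km[OF that] kf[OF that]]) simp
  have ks: "square_integrable (k t)" if "t \<in> {0..T}" for t
    by (rule sqi_of_wnorm[OF _ _ km[OF that] kf[OF that]]) (use m in auto)
  \<comment> \<open>Continuity is assumed after an inverse transform;
    \<open>fourier_fourier_int\<close> brings it back to the weighted densities
    \<open>k\<close>.\<close>
  have klim: "((\<lambda>s. wnorm 0 m (\<lambda>\<xi>. k s \<xi> - k t \<xi>)) \<longlongrightarrow> 0) (at t within {0..T})" if t: "t \<in> {0..T}" for t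
  proof -
    have H: "((\<lambda>s. Hnorm 0 m (\<lambda>x. inv_fourier (k s) x - inv_fourier (k t) x)) \<longlongrightarrow> 0) (at t within {0..T})"
      using C t unfolding C_H_def C_Sobolev_def k_def by auto
    have "((\<lambda>s. Hnorm 0 m (\<lambda>x. inv_fourier (k s) x - inv_fourier (k t) x) * Hnorm 0 m (\<lambda>x. inv_fourier (k s) x - inv_fourier (k t) x)) \<longlongrightarrow> 0 * 0) (at t within {0..T})"
      by (rule tendsto_mult_ennreal[OF H H]) simp
    then have H2: "((\<lambda>s. Hnorm_sq 0 m (\<lambda>x. inv_fourier (k s) x - inv_fourier (k t) x)) \<longlongrightarrow> 0) (at t within {0..T})"
      by (simp add: Hnorm_def ennsqrt_sq power2_eq_square[symmetric])
    show ?thesis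
    proof (rule ennreal_tendsto_0_le[OF H2, where C=1], rule eventually_within_I)
      fix s assume s: "s \<in> {0..T}"
      have "AE x in lborel. inv_fourier (k s) x - inv_fourier (k t) x = fourier_int 1 (\<lambda>\<xi>. k s \<xi> - k t \<xi>) x"
        using inv_fourier_fourier_int(1)[OF ki[OF s] ks[OF s]] inv_fourier_fourier_int(1)[OF ki[OF t] ks[OF t]]
        by eventually_elim (simp add: fourier_int_diff ki[OF s] ki[OF t])
      moreover have "(\<lambda>x. inv_fourier (k s) x - inv_fourier (k t) x) \<in> borel_measurable borel"
        by (intro borel_measurable_diff inv_fourier_fourier_int(2) ki ks s t)
      ultimately have "AE \<xi> in lborel. fourier (\<lambda>x. inv_fourier (k s) x - inv_fourier (k t) x) \<xi> = k s \<xi> - k t \<xi>"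
        by (intro fourier_fourier_int(1) Bochner_Integration.integrable_diff sqi_diff ki ks s t)
      then show "wnorm 0 m (\<lambda>\<xi>. k s \<xi> - k t \<xi>) \<le> ennreal 1 * Hnorm_sq 0 m (\<lambda>x. inv_fourier (k s) x - inv_fourier (k t) x)"
        unfolding Hnorm_sq_eq_wnorm by (subst wnorm_cong_AE) auto
    qed
  qed
  show "spectral_curve \<psi> (\<lambda>t. fourier (\<psi> t))"
  proof (rule spectral_curveI)
    fix t assume t: "t \<in> {0..T}"
    show "fourier (\<psi> t) \<in> borel_measurable borel" by (rule fm[OF t])
    have wf: "wnorm (w t) m (fourier (\<psi> t)) < \<infinity>" using fin[OF t] by (simp add: Hnorm_sq_eq_wnorm)
    have W: "wnorm 0 r (fourier (\<psi> t)) < \<infinity>" for r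
    proof -
      obtain K where "wnorm 0 r (fourier (\<psi> t)) \<le> ennreal K * wnorm (w t) m (fourier (\<psi> t))"
        using wnorm_absorb[OF w_pos[OF t], of r m] fm[OF t] by blast
      then show ?thesis by (rule order.strict_trans1) (use wf in \<open>auto simp: ennreal_mult_less_top\<close>)
    qed
    have fp: "integrable lborel (\<lambda>\<xi>. complex_of_real (\<xi> ^ n) * fourier (\<psi> t) \<xi>)" for n
    proof (rule integrable_of_wnorm[of 1 0])
      have "wnorm 0 1 (\<lambda>\<xi>. complex_of_real (\<xi> ^ n) * fourier (\<psi> t) \<xi>) \<le> wnorm 0 (1 + real n) (fourier (\<psi> t))"
        by (rule wnorm_power_le)
      then show "wnorm 0 1 (\<lambda>\<xi>. complex_of_real (\<xi> ^ n) * fourier (\<psi> t) \<xi>) < \<infinity>"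
        using W by (rule order.strict_trans1)
    qed (use fm[OF t] in auto)
    have fi: "integrable lborel (fourier (\<psi> t))" using fp[of 0] by simp
    have "AE x in lborel. \<psi> t x = fourier_int (- (- 1)) (fourier (\<psi> t)) x"
      by (rule plancherel_limit_inversion[OF sqv[OF t] _ P[OF t] fi]) simp
    then have "AE x in lborel. \<psi> t x = fourier_int 1 (fourier (\<psi> t)) x" by simp
    moreover have "continuous_on UNIV (fourier_int 1 (fourier (\<psi> t)))"
    proof -
      have "(fourier_int 1 (fourier (\<psi> t)) has_vector_derivative fourier_int 1 (\<lambda>\<xi>. \<i> * complex_of_real \<xi> * fourier (\<psi> t) \<xi>) x) (at x)" for x
        using fp[of 0] fp[of 1] fp[of 2] by (intro fourier_int_has_derivative) auto
      then show ?thesis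
        by (intro continuous_at_imp_continuous_on ballI) (rule has_vector_derivative_continuous)
    qed
    ultimately have "\<psi> t = fourier_int 1 (fourier (\<psi> t))" by (intro continuous_AE_eq cont[OF t])
    then show "\<psi> t x = fourier_int 1 (fourier (\<psi> t)) x" for x by (rule fun_cong)
    fix c assume c: "c \<in> {0..<w_end}"
    show "wnorm c 0 (fourier (\<psi> t)) < \<infinity>"
      by (rule order.strict_trans1[OF wnorm_mono wf]) (use c m w_ge[OF t] in auto)
    \<comment> \<open>\<open>Q\<close> pays for the single power of \<open>japanese \<xi>\<close>
      that a time increment of the exponential produces.\<close>
    obtain Q where Q: "Q > 0" "\<And>x. x \<ge> 1 \<Longrightarrow> x powr 1 \<le> Q * exp ((w_end - c) * x)"
      using powr_exp_bound[of "w_end - c" 1] c by auto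
    have "((\<lambda>s. ennreal ((s - t)\<^sup>2 * L2sqr (k t))) \<longlongrightarrow> ennreal ((t - t)\<^sup>2 * L2sqr (k t))) (at t within {0..T})"
      by (intro tendsto_intros)
    then have L2: "((\<lambda>s. ennreal ((s - t)\<^sup>2 * L2sqr (k t))) \<longlongrightarrow> 0) (at t within {0..T})" by simp
    define Q' where "Q' = 2 * (1 + (M * Q)\<^sup>2)"
    show "((\<lambda>s. wnorm c 0 (\<lambda>\<xi>. fourier (\<psi> s) \<xi> - fourier (\<psi> t) \<xi>)) \<longlongrightarrow> 0) (at t within {0..T})"
    proof (rule ennreal_tendsto_0_le[OF tendsto_add_0[OF klim[OF t] L2], where C=Q'], rule eventually_within_I)
      fix s assume s: "s \<in> {0..T}"
      have mm: "(\<lambda>\<xi>. complex_of_real (weight c 0 \<xi>) * (fourier (\<psi> s) \<xi> - fourier (\<psi> t) \<xi>)) \<in> borel_measurable borel"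
        using fm[OF s] fm[OF t] by measurable
      have md: "(\<lambda>\<xi>. k s \<xi> - k t \<xi>) \<in> borel_measurable borel" by (intro borel_measurable_diff km s t)
      have "wnorm c 0 (\<lambda>\<xi>. fourier (\<psi> s) \<xi> - fourier (\<psi> t) \<xi>) \<le> ennreal (2 * 1\<^sup>2) * L2sq (\<lambda>\<xi>. k s \<xi> - k t \<xi>) + ennreal (2 * (M * Q * \<bar>s - t\<bar>)\<^sup>2) * L2sq (k t)"
        unfolding wnorm_def
      proof (rule L2sq_le_combo[OF mm md km[OF t]])
        fix \<xi>
        define j where "j = japanese \<xi>"
        have j: "j \<ge> 1" by (simp add: j_def)
        have fk: "fourier (\<psi> r) \<xi> = complex_of_real (exp (- w r * j)) * k r \<xi>" for r
          by (simp add: k_def j_def exp_minus flip: of_real_mult mult.assoc)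
        have "fourier (\<psi> s) \<xi> - fourier (\<psi> t) \<xi> = complex_of_real (exp (- w s * j)) * (k s \<xi> - k t \<xi>) + complex_of_real (exp (- w s * j) - exp (- w t * j)) * k t \<xi>"
          unfolding fk by (simp add: algebra_simps)
        then have "cmod (fourier (\<psi> s) \<xi> - fourier (\<psi> t) \<xi>) \<le> exp (- w s * j) * cmod (k s \<xi> - k t \<xi>) + \<bar>exp (- w s * j) - exp (- w t * j)\<bar> * cmod (k t \<xi>)"
          by (simp only:) (rule order_trans[OF norm_triangle_ineq], simp only: norm_mult norm_of_real, simp)
        also have "\<dots> \<le> exp (- w_end * j) * cmod (k s \<xi> - k t \<xi>) + (M * \<bar>s - t\<bar> * j * exp (- w_end * j)) * cmod (k t \<xi>)"
        proof (intro add_mono mult_right_mono norm_ge_zero)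
          show e1: "exp (- w s * j) \<le> exp (- w_end * j)" using w_ge[OF s] j by simp
          have e2: "exp (- w t * j) \<le> exp (- w_end * j)" using w_ge[OF t] j by simp
          have "\<bar>exp (- w s * j) - exp (- w t * j)\<bar> \<le> \<bar>- w s * j - - w t * j\<bar> * exp (max (- w s * j) (- w t * j))" by (rule exp_diff_bound)
          also have "\<dots> \<le> (M * \<bar>s - t\<bar> * j) * exp (- w_end * j)"
          proof (rule mult_mono)
            have "- w s * j - - w t * j = M * (s - t) * j" by (simp add: w_def algebra_simps)
            then show "\<bar>- w s * j - - w t * j\<bar> \<le> M * \<bar>s - t\<bar> * j" using M0 j by (simp add: abs_mult)
            show "exp (max (- w s * j) (- w t * j)) \<le> exp (- w_end * j)" using e1 e2 by (simp add: max_def)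
          qed (use M0 j in auto)
          finally show "\<bar>exp (- w s * j) - exp (- w t * j)\<bar> \<le> M * \<bar>s - t\<bar> * j * exp (- w_end * j)" .
        qed
        finally have "exp (c * j) * cmod (fourier (\<psi> s) \<xi> - fourier (\<psi> t) \<xi>) \<le> exp (c * j) * (exp (- w_end * j) * cmod (k s \<xi> - k t \<xi>) + (M * \<bar>s - t\<bar> * j * exp (- w_end * j)) * cmod (k t \<xi>))"
          by (rule mult_left_mono) simp
        also have "\<dots> = exp (- (w_end - c) * j) * cmod (k s \<xi> - k t \<xi>) + (M * \<bar>s - t\<bar> * (j * exp (- (w_end - c) * j))) * cmod (k t \<xi>)"
        proof -
          have "exp (- (w_end - c) * j) = exp (c * j) * exp (- w_end * j)" by (simp add: exp_add[symmetric] algebra_simps)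
          then show ?thesis by (simp only:) (simp add: algebra_simps)
        qed
        also have "\<dots> \<le> 1 * cmod (k s \<xi> - k t \<xi>) + (M * \<bar>s - t\<bar> * Q) * cmod (k t \<xi>)"
        proof (intro add_mono mult_right_mono mult_left_mono norm_ge_zero)
          show "exp (- (w_end - c) * j) \<le> 1" using c j by (simp add: mult_nonpos_nonneg)
          have "j * exp (- (w_end - c) * j) \<le> (Q * exp ((w_end - c) * j)) * exp (- (w_end - c) * j)"
            using Q(2)[OF j] j by (intro mult_right_mono) auto
          also have "\<dots> = Q" by (simp add: mult.assoc exp_add[symmetric] left_diff_distrib)
          finally show "j * exp (- (w_end - c) * j) \<le> Q" .
        qed (use M0 in auto)
        finally show "cmod (complex_of_real (weight c 0 \<xi>) * (fourier (\<psi> s) \<xi> - fourier (\<psi> t) \<xi>)) \<le> 1 * cmod (k s \<xi> - k t \<xi>) + M * Q * \<bar>s - t\<bar> * cmod (k t \<xi>)"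
          by (simp add: weight_def norm_mult j_def mult_ac)
      qed (use M0 Q in auto)
      also have "\<dots> \<le> ennreal Q' * wnorm 0 m (\<lambda>\<xi>. k s \<xi> - k t \<xi>) + ennreal Q' * ennreal ((s - t)\<^sup>2 * L2sqr (k t))"
      proof (rule add_mono)
        show "ennreal (2 * 1\<^sup>2) * L2sq (\<lambda>\<xi>. k s \<xi> - k t \<xi>) \<le> ennreal Q' * wnorm 0 m (\<lambda>\<xi>. k s \<xi> - k t \<xi>)"
          unfolding wnorm_00[symmetric] using m by (intro mult_mono ennreal_leI wnorm_mono) (auto simp: Q'_def)
        have "ennreal (2 * (M * Q * \<bar>s - t\<bar>)\<^sup>2) * L2sq (k t) = ennreal (2 * (M * Q)\<^sup>2 * ((s - t)\<^sup>2 * L2sqr (k t)))"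
          unfolding ennreal_L2sqr[OF ks[OF t], symmetric] by (subst ennreal_mult[symmetric]) (auto simp: power_mult_distrib mult_ac)
        also have "\<dots> \<le> ennreal (Q' * ((s - t)\<^sup>2 * L2sqr (k t)))"
          by (intro ennreal_leI mult_right_mono) (auto simp: Q'_def)
        finally show "ennreal (2 * (M * Q * \<bar>s - t\<bar>)\<^sup>2) * L2sq (k t) \<le> ennreal Q' * ennreal ((s - t)\<^sup>2 * L2sqr (k t))"
          by (simp add: ennreal_mult'' )
      qed
      finally show "wnorm c 0 (\<lambda>\<xi>. fourier (\<psi> s) \<xi> - fourier (\<psi> t) \<xi>) \<le> ennreal Q' * (wnorm 0 m (\<lambda>\<xi>. k s \<xi> - k t \<xi>) + ennreal ((s - t)\<^sup>2 * L2sqr (k t)))"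
        by (simp only: distrib_left)
    qed
  qed
  show "continuous_on {0..T} (\<lambda>s. enn2real (Hnorm_sq (w s) m' (\<psi> s)))" if m': "m' \<le> m"
  proof -
    \<comment> \<open>The moving exponential is already contained in \<open>k\<close>; only the
      fixed polynomial weight of order \<open>m'\<close> has to be added.\<close>
    define y where "y s \<xi> = complex_of_real (weight 0 m' \<xi>) * k s \<xi>" for s \<xi>
    have yn: "L2sq (y s) = Hnorm_sq (w s) m' (\<psi> s)" for s unfolding wk[symmetric] wnorm_def y_def[abs_def] ..
    have "continuous_on {0..T} (\<lambda>s. L2sqr (y s))"
    proof (rule L2sqr_continuous)
      fix s assume s: "s \<in> {0..T}"
      have "L2sq (y s) < \<infinity>" unfolding yn by (rule order.strict_trans1[OF Hnorm_sq_mono[OF m'] fin[OF s]])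
      moreover have "y s \<in> borel_measurable borel" unfolding y_def using km[OF s] by measurable
      ultimately show "square_integrable (y s)" by (simp add: sqi_iff)
    next
      fix t assume t: "t \<in> {0..T}"
      show "((\<lambda>s. L2sq (\<lambda>x. y s x - y t x)) \<longlongrightarrow> 0) (at t within {0..T})"
      proof (rule ennreal_tendsto_0_le[OF klim[OF t], where C=1], rule eventually_within_I)
        fix s
        have "L2sq (\<lambda>x. y s x - y t x) = wnorm 0 m' (\<lambda>\<xi>. k s \<xi> - k t \<xi>)"
          unfolding wnorm_def y_def right_diff_distrib ..
        also have "\<dots> \<le> wnorm 0 m (\<lambda>\<xi>. k s \<xi> - k t \<xi>)" by (rule wnorm_mono[OF _ m']) simp
        finally show "L2sq (\<lambda>x. y s x - y t x) \<le> ennreal 1 * wnorm 0 m (\<lambda>\<xi>. k s \<xi> - k t \<xi>)" by simp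
      qed
    qed
    then show ?thesis unfolding L2sqr_def yn .
  qed
qed

end

section \<open>Uniform bounds by continuity\<close>

text \<open>At the first time where \<open>G\<close> equals \<open>A\<close> the hypothesis of
  \<open>step\<close> holds, and it would force \<open>G\<close> down to \<beta>, strictly below
  \<open>A\<close>.\<close>

lemma continuity_bootstrap:
  fixes G :: "real \<Rightarrow> real"
  assumes c: "continuous_on {0..T} G" and G0: "G 0 \<le> A" and bA: "\<beta> < A"
    and step: "\<And>t. t \<in> {0..T} \<Longrightarrow> (\<And>s. s \<in> {0..t} \<Longrightarrow> G s \<le> A) \<Longrightarrow> G t \<le> \<beta>"
    and t: "t \<in> {0..T}"
  shows "G t \<le> A"
proof (rule ccontr)
  assume "\<not> G t \<le> A"
  then have Gt: "A < G t" by simp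
  have ivt: "\<exists>x\<in>{0..s}. G x = A" if "s \<in> {0..T}" "A \<le> G s" for s
    using IVT'[of G 0 A s] G0 that continuous_on_subset[OF c, of "{0..s}"] by auto
  \<comment> \<open>A compact set of times, so that a first one exists.\<close>
  define S where "S = {x \<in> {0..t}. G x = A}"
  have ct: "continuous_on {0..t} G" by (rule continuous_on_subset[OF c]) (use t in auto)
  have "closed S" unfolding S_def by (rule continuous_closed_preimage_constant[OF ct]) simp
  then have "compact S" using compact_Int_closed[of "{0..t}" S] by (simp add: S_def Int_def conj_commute cong: conj_cong)
  moreover have "S \<noteq> {}" using ivt[OF t] Gt unfolding S_def by auto
  ultimately obtain t1 where t1: "t1 \<in> S" "\<And>x. x \<in> S \<Longrightarrow> t1 \<le> x" by (metis compact_attains_inf)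
  have t1T: "t1 \<in> {0..T}" "t1 \<le> t" "G t1 = A" using t1(1) t by (auto simp: S_def)
  have "G s \<le> A" if s: "s \<in> {0..t1}" for s
  proof (rule ccontr)
    assume "\<not> G s \<le> A"
    then have "A < G s" by simp
    with ivt[of s] s t1T obtain x where x: "x \<in> {0..s}" "G x = A" by auto
    then have "x \<in> S" using s t1T unfolding S_def by auto
    then have "s = t1" using t1(2)[of x] x s by auto
    then show False using \<open>A < G s\<close> t1T by simp
  qed
  from step[OF t1T(1) this] t1T(3) bA show False by simp
qed

context shrinking_radius
begin

section \<open>Qualitative regularity and optimal constants\<close>

text \<open>An indefinite integral is continuous in its upper limit. The norm of order
  \<open>m\<close> may be infinite on a null set of times, so the integrand is first replaced by its
  real-valued version \<open>g\<close>.\<close>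

lemma smoothing_continuous:
  assumes u: "analytic u" and fin: "smoothing m T u < \<infinity>"
  shows "continuous_on {0..T} (\<lambda>t. enn2real (smoothing m t u))"
    and "t \<in> {0..T} \<Longrightarrow> smoothing m t u < \<infinity>"
proof -
  have T: "T \<in> {0..T}" using T0 by simp
  define f where "f s = Hnorm_sq (w s) m (u s) * indicator {0..T} s" for s
  have fm[measurable]: "f \<in> borel_measurable borel" unfolding f_def by (rule Hmeas[OF u T])
  have ff: "(\<integral>\<^sup>+ s. f s \<partial>lborel) < \<infinity>"
    using fin M0 unfolding smoothing_def f_def by (auto simp: ennreal_mult_less_top)
  define g where "g s = enn2real (f s)" for s
  have gm[measurable]: "g \<in> borel_measurable borel" unfolding g_def by measurable
  have AEf: "AE s in lborel. f s = ennreal (g s)"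
  proof -
    have "AE s in lborel. f s \<noteq> \<infinity>" by (rule nn_integral_noteq_infinite) (use ff in auto)
    then show ?thesis by eventually_elim (simp add: g_def less_top)
  qed
  have gi: "integrable lborel g"
  proof (rule integrableI_bounded)
    have "(\<integral>\<^sup>+ s. ennreal (norm (g s)) \<partial>lborel) = (\<integral>\<^sup>+ s. f s \<partial>lborel)"
      by (rule nn_integral_cong_AE) (use AEf in \<open>auto simp: g_def\<close>)
    then show "(\<integral>\<^sup>+ s. ennreal (norm (g s)) \<partial>lborel) < \<infinity>" using ff by simp
  qed measurable
  have Jt: "smoothing m t u = ennreal (2 * M) * ennreal (integral {0..t} g)" if t: "t \<in> {0..T}" for t
  proof -
    have si: "set_integrable lborel {0..t} g" unfolding set_integrable_def by (rule integrable_mult_indicator) (use gi in auto)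
    have "(\<integral>\<^sup>+ s\<in>{0..t}. Hnorm_sq (w s) m (u s) \<partial>lborel) = (\<integral>\<^sup>+ s. ennreal (indicator {0..t} s *\<^sub>R g s) \<partial>lborel)"
    proof (rule nn_integral_cong_AE)
      show "AE s in lborel. Hnorm_sq (w s) m (u s) * indicator {0..t} s = ennreal (indicator {0..t} s *\<^sub>R g s)"
        using AEf by eventually_elim (use t in \<open>auto simp: f_def indicator_def split: if_splits\<close>)
    qed
    also have "\<dots> = ennreal (LINT s:{0..t}|lborel. g s)"
      unfolding set_lebesgue_integral_def
      by (rule nn_integral_eq_integral) (use si in \<open>auto simp: set_integrable_def g_def\<close>)
    also have "(LINT s:{0..t}|lborel. g s) = integral {0..t} g"
      by (rule set_borel_integral_eq_integral(2)[OF si])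
    finally show ?thesis by (simp add: smoothing_def)
  qed
  have g_on: "g integrable_on {0..T}"
  proof (rule set_borel_integral_eq_integral(1))
    show "set_integrable lborel {0..T} g" unfolding set_integrable_def by (rule integrable_mult_indicator[OF _ gi]) simp
  qed
  show "t \<in> {0..T} \<Longrightarrow> smoothing m t u < \<infinity>" by (simp add: Jt ennreal_mult_less_top)
  have "continuous_on {0..T} (\<lambda>t. 2 * M * integral {0..t} g)"
    by (intro continuous_intros indefinite_integral_continuous_1 g_on)
  then show "continuous_on {0..T} (\<lambda>t. enn2real (smoothing m t u))"
  proof (rule continuous_on_eq)
    fix t assume t: "t \<in> {0..T}"
    have "integral {0..t} g \<ge> 0"
      by (rule integral_nonneg) (use t integrable_on_subinterval[OF g_on, of 0 t] in \<open>auto simp: g_def\<close>)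
    then show "2 * M * integral {0..t} g = enn2real (smoothing m t u)"
      using M0 by (simp add: Jt[OF t] ennreal_mult[symmetric])
  qed
qed

lemma smoothing_0: "smoothing m 0 u = 0"
proof -
  have "(\<integral>\<^sup>+ s\<in>{0..0}. Hnorm_sq (w s) m (u s) \<partial>lborel) = (\<integral>\<^sup>+ s. 0 \<partial>(lborel :: real measure))"
    by (rule nn_integral_cong_AE) (use AE_lborel_singleton[of 0] in \<open>auto simp: indicator_def elim!: eventually_mono\<close>)
  then show ?thesis by (simp add: smoothing_def)
qed

lemma smoothing_mono_m: "a \<le> b \<Longrightarrow> smoothing a t u \<le> smoothing b t u"
  unfolding smoothing_def by (intro mult_left_mono nn_integral_mono mult_right_mono Hnorm_sq_mono) auto

text \<open>Finiteness and continuity without constants: what the bootstrap needs before any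
  quantitative bound is known.\<close>

definition regular_curve :: "real \<Rightarrow> (real \<Rightarrow> real \<Rightarrow> complex) \<Rightarrow> bool" where
  "regular_curve m u \<longleftrightarrow> analytic u \<and> continuous_on {0..T} (\<lambda>s. enn2real (Hnorm_sq (w s) m (u s))) \<and>
     (\<forall>s\<in>{0..T}. Hnorm_sq (w s) m (u s) < \<infinity>) \<and> smoothing (m + 1/2) T u < \<infinity>"

text \<open>The order \<open>m'\<close> may be lower than that of the space, since the limit
  solution and the corrector are used below the regularity they have.\<close>

lemma regular_curve_of_Y:
  assumes u: "u \<in> Y_space w T m" and m: "m > 1/2" and m': "m' \<le> m" and cont: "\<And>t. t \<in> {0..T} \<Longrightarrow> continuous_on UNIV (u t)"
  shows "regular_curve m' u"
proof -
  have C: "u \<in> C_H w T m" and L: "u \<in> L2_H w T (m + 1/2)" using u by (auto simp: Y_space_def)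
  note c = spectral_curve_of_C_H[OF C m cont]
  have "smoothing (m + 1/2) T u < \<infinity>" using L by (auto simp: L2_H_def smoothing_def ennreal_mult_less_top)
  then have "smoothing (m' + 1/2) T u < \<infinity>" using smoothing_mono_m[of "m' + 1/2" "m + 1/2" T u] m' by (auto elim: order.strict_trans1)
  moreover have "Hnorm_sq (w s) m' (u s) < \<infinity>" if "s \<in> {0..T}" for s
    by (rule order.strict_trans1[OF Hnorm_sq_mono[OF m'] c(2)[OF _ that]]) auto
  ultimately show ?thesis unfolding regular_curve_def analytic_def using c(1) c(3)[OF _ m'] by blast
qed

lemma regular_curve_Y_bound:
  assumes u: "regular_curve m u" shows "\<exists>A\<ge>0. Y_bound m T A u"
proof -
  have c: "continuous_on {0..T} (\<lambda>s. enn2real (Hnorm_sq (w s) m (u s)))" and f: "\<And>s. s \<in> {0..T} \<Longrightarrow> Hnorm_sq (w s) m (u s) < \<infinity>"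
    and sm: "smoothing (m + 1/2) T u < \<infinity>" and n: "analytic u" using u by (auto simp: regular_curve_def)
  obtain B where B: "\<And>s. s \<in> {0..T} \<Longrightarrow> enn2real (Hnorm_sq (w s) m (u s)) \<le> B"
  proof -
    have "{0..T} \<noteq> {}" using T0 by simp
    from continuous_attains_sup[OF compact_Icc this c] that show ?thesis by blast
  qed
  \<comment> \<open>The summand 1 gives \<open>A \<ge> 1\<close>, so that any quantity below
    \<open>A\<close> is also below \<open>A\<^sup>2\<close>.\<close>
  define A where "A = 1 + \<bar>B\<bar> + enn2real (smoothing (m + 1/2) T u)"
  have A: "A \<ge> 1" by (simp add: A_def)
  have AA: "x \<le> A \<Longrightarrow> x \<le> A\<^sup>2" for x
    using mult_left_mono[of 1 A A] A unfolding power2_eq_square by linarith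
  have "Y_bound m T A u" unfolding Y_bound_def
  proof (intro conjI ballI n)
    show "0 \<le> A" using A by simp
    fix s assume s: "s \<in> {0..T}"
    have "Hnorm_sq (w s) m (u s) = ennreal (enn2real (Hnorm_sq (w s) m (u s)))" using f[OF s] by (simp add: less_top)
    also have "\<dots> \<le> ennreal (A\<^sup>2)"
    proof (intro ennreal_leI AA)
      have "B \<le> \<bar>B\<bar>" "0 \<le> enn2real (smoothing (m + 1/2) T u)" by auto
      then show "enn2real (Hnorm_sq (w s) m (u s)) \<le> A" using B[OF s] unfolding A_def by linarith
    qed
    finally show "Hnorm_sq (w s) m (u s) \<le> ennreal (A\<^sup>2)" .
  next
    have "smoothing (m + 1/2) T u = ennreal (enn2real (smoothing (m + 1/2) T u))" using sm by (simp add: less_top)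
    also have "\<dots> \<le> ennreal (A\<^sup>2)" by (intro ennreal_leI AA) (simp add: A_def)
    finally show "smoothing (m + 1/2) T u \<le> ennreal (A\<^sup>2)" .
  qed
  then show ?thesis using A by (intro exI[of _ A]) auto
qed

lemma triple_le: "Y_bound m T A u \<Longrightarrow> triple_norm w M m T u \<le> ennreal A"
  unfolding triple_norm_def
  by (rule ennsqrt_le) (auto simp: Y_bound_def smoothing_def intro!: SUP_least)

text \<open>The triple norm is the least admissible constant in \<open>Y_bound\<close>. This
  minimality turns an estimate whose right-hand side contains the unknown size into a numerical
  inequality that can be absorbed.\<close>

lemma triple_Y_bound:
  assumes u: "Y_bound m T A0 u"
  shows "Y_bound m T (enn2real (triple_norm w M m T u)) u"
    and "Y_bound m T A u \<Longrightarrow> enn2real (triple_norm w M m T u) \<le> A"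
    and "triple_norm w M m T u = ennreal (enn2real (triple_norm w M m T u))"
proof -
  show eq: "triple_norm w M m T u = ennreal (enn2real (triple_norm w M m T u))"
  proof -
    have "triple_norm w M m T u < \<top>" using triple_le[OF u] by (rule le_less_trans) simp
    then show ?thesis by simp
  qed
  show "Y_bound m T A u \<Longrightarrow> enn2real (triple_norm w M m T u) \<le> A"
    using triple_le[of m A u] by (intro enn2real_leI) (auto simp: Y_bound_def)
  define d where "d = enn2real (triple_norm w M m T u)"
  have "max (SUP s\<in>{0..T}. Hnorm_sq (w s) m (u s)) (smoothing (m + 1/2) T u) \<le> ennreal (d\<^sup>2)"
    by (rule ennsqrt_leD) (use eq in \<open>auto simp: d_def triple_norm_def smoothing_def\<close>)
  then show "Y_bound m T (enn2real (triple_norm w M m T u)) u"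
    unfolding Y_bound_def d_def[symmetric] using Y_boundD(1)[OF u] by (auto simp: d_def SUP_le_iff)
qed

section \<open>The systems in complex polynomial form\<close>

text \<open>Phases are complexified so that both unknowns live in the same spaces and obey the same
  calculus.\<close>

definition cr :: "(real \<Rightarrow> real \<Rightarrow> real) \<Rightarrow> real \<Rightarrow> real \<Rightarrow> complex" where
  "cr \<phi> = (\<lambda>t x. complex_of_real (\<phi> t x))"

lemma has_vector_derivative_cr:
  "(f has_vector_derivative d) F \<Longrightarrow> ((\<lambda>x. complex_of_real (f x)) has_vector_derivative complex_of_real d) F"
  by (rule bounded_linear.has_vector_derivative[OF bounded_linear_of_real])

lemma Dx_deriv: "\<psi> t differentiable (at x) \<Longrightarrow> (\<psi> t has_vector_derivative Dx \<psi> t x) (at x)"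
  unfolding Dx_def using vector_derivative_works by blast

lemma Dx_cr: "\<phi> t differentiable (at x) \<Longrightarrow> Dx (cr \<phi>) t x = complex_of_real (Dx \<phi> t x)"
  unfolding cr_def by (rule Dx_eqI[OF has_vector_derivative_cr[OF Dx_deriv]])

lemma Dx_Dx_cr:
  assumes "twice_x_differentiable T \<phi>" "t \<in> {0..T}"
  shows "Dx (Dx (cr \<phi>)) t x = complex_of_real (Dx (Dx \<phi>) t x)"
proof -
  have "Dx (cr \<phi>) t = (\<lambda>x. complex_of_real (Dx \<phi> t x))"
    using assms by (intro ext Dx_cr) (auto simp: twice_x_differentiable_def)
  then show ?thesis
    using has_vector_derivative_cr[OF Dx_deriv[of "Dx \<phi>" t x]] assms
    by (intro Dx_eqI) (auto simp: twice_x_differentiable_def)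
qed

lemma cont_of_twice: "twice_x_differentiable T \<psi> \<Longrightarrow> t \<in> {0..T} \<Longrightarrow> continuous_on UNIV (\<psi> t)"
  unfolding twice_x_differentiable_def
  by (intro continuous_at_imp_continuous_on ballI differentiable_imp_continuous_within) auto

lemma cont_cr: "twice_x_differentiable T \<phi> \<Longrightarrow> t \<in> {0..T} \<Longrightarrow> continuous_on UNIV (cr \<phi> t)"
  unfolding cr_def by (intro continuous_intros cont_of_twice)

lemma of_real_pow_sq: "complex_of_real (c * ((cmod z)\<^sup>2) ^ n) = of_real c * (z * cnj z) ^ n"
  by (simp only: of_real_mult of_real_power[of _ n] complex_norm_square)

text \<open>The squared modulus becomes \<open>a * cnj a\<close>, which makes the right-hand sides
  polynomials covered by the jets; the coefficient \<open>q\<close> of the linear estimate is read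
  off as \<open>\<epsilon> / 2\<close>.\<close>

lemma solves_S_ode:
  assumes S: "solves_S (\<lambda>s. \<alpha> * s ^ \<gamma>) (\<lambda>s. lam * s ^ \<sigma>) \<epsilon> T \<phi>0 a0 \<phi> a" and t: "t \<in> {0..T}"
  shows "((\<lambda>s. cr \<phi> s x) has_vector_derivative phase_rhs \<alpha> lam \<gamma> \<sigma> (Dx (cr \<phi>)) a t x) (at t within {0..T})"
    and "((\<lambda>s. a s x) has_vector_derivative (\<i> * complex_of_real (\<epsilon> / 2) * Dx (Dx a) t x + ampl_rhs \<alpha> \<gamma> (Dx (cr \<phi>)) a t x)) (at t within {0..T})"
proof -
  have tw: "twice_x_differentiable T \<phi>" using S by (simp add: solves_S_def)
  have D1: "Dx (cr \<phi>) t x = complex_of_real (Dx \<phi> t x)" by (rule Dx_cr) (use tw t in \<open>auto simp: twice_x_differentiable_def\<close>)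
  have D2: "Dx (Dx (cr \<phi>)) t x = complex_of_real (Dx (Dx \<phi>) t x)" by (rule Dx_Dx_cr[OF tw t])
  have 1: "((\<lambda>s. \<phi> s x) has_vector_derivative
           - (1/2 * (Dx \<phi> t x)\<^sup>2 + 1/2 * (\<alpha> * ((cmod (a t x))\<^sup>2) ^ \<gamma>) * Dx \<phi> t x + lam * ((cmod (a t x))\<^sup>2) ^ \<sigma>)) (at t within {0..T})"
    and 2: "((\<lambda>s. a s x) has_vector_derivative
           (\<i> * complex_of_real \<epsilon> / 2 * Dx (Dx a) t x
            - (complex_of_real (Dx \<phi> t x) * Dx a t x
               + 1/2 * a t x * complex_of_real (Dx (Dx \<phi>) t x)
               + 1/2 * Dx (\<lambda>t x. complex_of_real (\<alpha> * ((cmod (a t x))\<^sup>2) ^ \<gamma>) * a t x) t x))) (at t within {0..T})"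
    using S t unfolding solves_S_def by blast+
  have "complex_of_real (- (1/2 * (Dx \<phi> t x)\<^sup>2 + 1/2 * (\<alpha> * ((cmod (a t x))\<^sup>2) ^ \<gamma>) * Dx \<phi> t x + lam * ((cmod (a t x))\<^sup>2) ^ \<sigma>)) = phase_rhs \<alpha> lam \<gamma> \<sigma> (Dx (cr \<phi>)) a t x"
    unfolding of_real_minus of_real_add of_real_mult[of "_ * _" "Dx \<phi> t x"] of_real_mult[of "1/2"] of_real_pow_sq
    by (simp add: phase_rhs_def pow_fun_def abs_sq_def D1 power2_eq_square algebra_simps)
  then show "((\<lambda>s. cr \<phi> s x) has_vector_derivative phase_rhs \<alpha> lam \<gamma> \<sigma> (Dx (cr \<phi>)) a t x) (at t within {0..T})"
    using has_vector_derivative_cr[OF 1] by (simp add: cr_def)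
  have "(\<lambda>t x. complex_of_real (\<alpha> * ((cmod (a t x))\<^sup>2) ^ \<gamma>) * a t x) = (\<lambda>t x. of_real \<alpha> * (pow_fun \<gamma> (abs_sq a) t x * a t x))"
    unfolding of_real_pow_sq by (simp add: pow_fun_def abs_sq_def mult.assoc)
  then have "\<i> * complex_of_real \<epsilon> / 2 * Dx (Dx a) t x
            - (complex_of_real (Dx \<phi> t x) * Dx a t x
               + 1/2 * a t x * complex_of_real (Dx (Dx \<phi>) t x)
               + 1/2 * Dx (\<lambda>t x. complex_of_real (\<alpha> * ((cmod (a t x))\<^sup>2) ^ \<gamma>) * a t x) t x) =
     \<i> * complex_of_real (\<epsilon> / 2) * Dx (Dx a) t x + ampl_rhs \<alpha> \<gamma> (Dx (cr \<phi>)) a t x"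
    by (simp only:) (simp add: ampl_rhs_def D1 D2 algebra_simps)
  then show "((\<lambda>s. a s x) has_vector_derivative (\<i> * complex_of_real (\<epsilon> / 2) * Dx (Dx a) t x + ampl_rhs \<alpha> \<gamma> (Dx (cr \<phi>)) a t x)) (at t within {0..T})"
    by (rule has_vector_derivative_eq_rhs[OF 2])
qed

lemma analytic_pw_Suc: "analytic s \<Longrightarrow> analytic (pow_fun (Suc k) s)"
proof (induction k)
  case 0 then show ?case by (simp add: pow_fun_def)
next
  case (Suc k)
  have "pow_fun (Suc (Suc k)) s = (\<lambda>t x. s t x * pow_fun (Suc k) s t x)" by (simp add: pow_fun_def)
  then show ?case using analytic_mult[OF Suc(2) Suc(1)[OF Suc(2)]] by simp
qed

lemma analytic_pw: "analytic s \<Longrightarrow> n > 0 \<Longrightarrow> analytic (pow_fun n s)"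
  using analytic_pw_Suc[of s "n - 1"] by simp

text \<open>For \<open>n \<le> 1\<close> the factor \<open>s ^ (n - 1)\<close> is the constant 1,
  which is not an analytic curve; it is dropped before products are formed.\<close>

lemma analytic_pw1: "analytic s \<Longrightarrow> analytic s1 \<Longrightarrow> analytic (pow_fun_lin n s s1)"
proof (cases "n - 1 = 0")
  case True
  assume "analytic s1"
  have "pow_fun_lin n s s1 = (\<lambda>t x. of_nat n * s1 t x)" using True by (simp add: pow_fun_lin_def)
  then show ?thesis using analytic_cmult[OF \<open>analytic s1\<close>] by simp
next
  case False
  assume "analytic s" "analytic s1"
  have "pow_fun_lin n s s1 = (\<lambda>t x. of_nat n * (pow_fun (n - 1) s t x * s1 t x))" by (simp add: pow_fun_lin_def pow_fun_def)
  then show ?thesis using analytic_cmult[OF analytic_mult[OF analytic_pw[OF \<open>analytic s\<close>] \<open>analytic s1\<close>]] False by simp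
qed

lemma analytic_sq: "analytic a \<Longrightarrow> analytic (abs_sq a)" unfolding abs_sq_def by (intro analytic_mult analytic_cnj)

lemma analytic_sq1: "analytic a \<Longrightarrow> analytic a1 \<Longrightarrow> analytic (abs_sq_lin a a1)" unfolding abs_sq_lin_def by (intro analytic_mult analytic_cnj analytic_add)

lemma deriv_mono: "deriv (\<lambda>s::real. c * s ^ n) s = c * (real n * s ^ (n - 1))"
  by (rule DERIV_imp_deriv) (auto intro!: derivative_eq_intros)

lemma sq1_Re: "abs_sq_lin a a1 t x = complex_of_real (2 * Re (cnj (a t x) * a1 t x))"
  by (simp add: abs_sq_lin_def complex_eq_iff)

text \<open>\<open>abs_sq_lin a a1\<close> is twice \<open>Re (cnj a * a1)\<close>, hence the
  coefficient \<open>c / 2\<close>.\<close>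

lemma pw1_of_real: "complex_of_real (c * (real n * ((cmod (a t x))\<^sup>2) ^ (n - 1)) * Re (cnj (a t x) * a1 t x)) = of_real (c / 2) * pow_fun_lin n (abs_sq a) (abs_sq_lin a a1) t x"
proof -
  have "complex_of_real (c * (real n * ((cmod (a t x))\<^sup>2) ^ (n - 1)) * Re (cnj (a t x) * a1 t x)) =
     complex_of_real (c * real n * ((cmod (a t x))\<^sup>2) ^ (n - 1)) * complex_of_real (Re (cnj (a t x) * a1 t x))"
    by (simp only: of_real_mult mult.assoc)
  also have "\<dots> = of_real (c / 2) * pow_fun_lin n (abs_sq a) (abs_sq_lin a a1) t x"
    unfolding of_real_pow_sq pow_fun_lin_def sq1_Re by (simp add: abs_sq_def)
  finally show ?thesis .
qed

lemma solves_lin_ode: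
  assumes S: "solves_linearized (\<lambda>s. \<alpha> * s ^ \<gamma>) (\<lambda>s. lam * s ^ \<sigma>) T \<phi> a \<phi>10 a10 \<phi>1 a1" and t: "t \<in> {0..T}"
    and tw: "twice_x_differentiable T \<phi>" and n: "analytic a" "analytic a1" and g: "\<gamma> > 0"
  shows "((\<lambda>s. cr \<phi>1 s x) has_vector_derivative phase_rhs_lin \<alpha> lam \<gamma> \<sigma> (Dx (cr \<phi>)) a (Dx (cr \<phi>1)) a1 t x) (at t within {0..T})"
    and "((\<lambda>s. a1 s x) has_vector_derivative (\<i> / 2 * Dx (Dx a) t x + ampl_rhs_lin \<alpha> \<gamma> (Dx (cr \<phi>)) a (Dx (cr \<phi>1)) a1 t x)) (at t within {0..T})"
proof -
  have tw1: "twice_x_differentiable T \<phi>1" using S by (simp add: solves_linearized_def)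
  have D1: "Dx (cr \<phi>) t x = complex_of_real (Dx \<phi> t x)" by (rule Dx_cr) (use tw t in \<open>auto simp: twice_x_differentiable_def\<close>)
  have D2: "Dx (Dx (cr \<phi>)) t x = complex_of_real (Dx (Dx \<phi>) t x)" by (rule Dx_Dx_cr[OF tw t])
  have D3: "Dx (cr \<phi>1) t x = complex_of_real (Dx \<phi>1 t x)" by (rule Dx_cr) (use tw1 t in \<open>auto simp: twice_x_differentiable_def\<close>)
  have D4: "Dx (Dx (cr \<phi>1)) t x = complex_of_real (Dx (Dx \<phi>1) t x)" by (rule Dx_Dx_cr[OF tw1 t])
  let ?s = "(cmod (a t x))\<^sup>2"
  have 1: "((\<lambda>s. \<phi>1 s x) has_vector_derivative
           - ((Dx \<phi> t x + 1/2 * (\<alpha> * ?s ^ \<gamma>)) * Dx \<phi>1 t x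
              + (deriv (\<lambda>s. \<alpha> * s ^ \<gamma>) ?s * Dx \<phi> t x + 2 * deriv (\<lambda>s. lam * s ^ \<sigma>) ?s)
                * Re (cnj (a t x) * a1 t x))) (at t within {0..T})"
    and 2: "((\<lambda>s. a1 s x) has_vector_derivative
           (\<i> / 2 * Dx (Dx a) t x
            - (complex_of_real (Dx \<phi> t x) * Dx a1 t x
               + 1/2 * a1 t x * complex_of_real (Dx (Dx \<phi>) t x)
               + Dx a t x * complex_of_real (Dx \<phi>1 t x)
               + 1/2 * a t x * complex_of_real (Dx (Dx \<phi>1) t x)
               + 1/2 * Dx (\<lambda>t x. complex_of_real (\<alpha> * ((cmod (a t x))\<^sup>2) ^ \<gamma>) * a1 t x) t x
               + 1/2 * Dx (\<lambda>t x. 2 * a t x * complex_of_real (deriv (\<lambda>s. \<alpha> * s ^ \<gamma>) ((cmod (a t x))\<^sup>2)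
                                  * Re (cnj (a t x) * a1 t x))) t x))) (at t within {0..T})"
    using S t unfolding solves_linearized_def by blast+
  let ?R = "Re (cnj (a t x) * a1 t x)"
  have "complex_of_real (- ((Dx \<phi> t x + 1/2 * (\<alpha> * ?s ^ \<gamma>)) * Dx \<phi>1 t x
              + (deriv (\<lambda>s. \<alpha> * s ^ \<gamma>) ?s * Dx \<phi> t x + 2 * deriv (\<lambda>s. lam * s ^ \<sigma>) ?s) * ?R))
     = - (complex_of_real (Dx \<phi> t x) * complex_of_real (Dx \<phi>1 t x) + 1/2 * complex_of_real (\<alpha> * ?s ^ \<gamma>) * complex_of_real (Dx \<phi>1 t x)
        + complex_of_real (\<alpha> * (real \<gamma> * ?s ^ (\<gamma> - 1)) * ?R) * complex_of_real (Dx \<phi> t x) + 2 * complex_of_real (lam * (real \<sigma> * ?s ^ (\<sigma> - 1)) * ?R))"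
    unfolding deriv_mono by (simp add: algebra_simps)
  also have "\<dots> = phase_rhs_lin \<alpha> lam \<gamma> \<sigma> (Dx (cr \<phi>)) a (Dx (cr \<phi>1)) a1 t x"
    unfolding pw1_of_real of_real_pow_sq by (simp add: phase_rhs_lin_def pow_fun_def abs_sq_def D1 D3 algebra_simps)
  finally show "((\<lambda>s. cr \<phi>1 s x) has_vector_derivative phase_rhs_lin \<alpha> lam \<gamma> \<sigma> (Dx (cr \<phi>)) a (Dx (cr \<phi>1)) a1 t x) (at t within {0..T})"
    using has_vector_derivative_cr[OF 1] by (simp add: cr_def)
  have e1: "(\<lambda>t x. complex_of_real (\<alpha> * ((cmod (a t x))\<^sup>2) ^ \<gamma>) * a1 t x) = (\<lambda>t x. of_real \<alpha> * (pow_fun \<gamma> (abs_sq a) t x * a1 t x))"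
    unfolding of_real_pow_sq by (simp add: pow_fun_def abs_sq_def mult.assoc)
  have e2: "(\<lambda>t x. 2 * a t x * complex_of_real (deriv (\<lambda>s. \<alpha> * s ^ \<gamma>) ((cmod (a t x))\<^sup>2) * Re (cnj (a t x) * a1 t x))) =
      (\<lambda>t x. of_real \<alpha> * (pow_fun_lin \<gamma> (abs_sq a) (abs_sq_lin a a1) t x * a t x))"
    unfolding deriv_mono pw1_of_real by (simp add: mult_ac)
  have np: "analytic (\<lambda>t x. of_real \<alpha> * (pow_fun \<gamma> (abs_sq a) t x * a1 t x))" "analytic (\<lambda>t x. of_real \<alpha> * (pow_fun_lin \<gamma> (abs_sq a) (abs_sq_lin a a1) t x * a t x))"
    by (intro analytic_cmult analytic_mult analytic_pw analytic_pw1 analytic_sq analytic_sq1 n g)+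
  have "(\<lambda>t x. of_real \<alpha> * (pow_fun_lin \<gamma> (abs_sq a) (abs_sq_lin a a1) t x * a t x + pow_fun \<gamma> (abs_sq a) t x * a1 t x)) = (\<lambda>t x. of_real \<alpha> * (pow_fun_lin \<gamma> (abs_sq a) (abs_sq_lin a a1) t x * a t x) + of_real \<alpha> * (pow_fun \<gamma> (abs_sq a) t x * a1 t x))"
    by (simp add: distrib_left)
  \<comment> \<open>The linearised system differentiates the two parts of the flux separately;
    analyticity makes both differentiable, so that their derivatives combine.\<close>
  then have e3: "Dx (\<lambda>t x. of_real \<alpha> * (pow_fun_lin \<gamma> (abs_sq a) (abs_sq_lin a a1) t x * a t x + pow_fun \<gamma> (abs_sq a) t x * a1 t x)) t x =
     Dx (\<lambda>t x. of_real \<alpha> * (pow_fun_lin \<gamma> (abs_sq a) (abs_sq_lin a a1) t x * a t x)) t x + Dx (\<lambda>t x. of_real \<alpha> * (pow_fun \<gamma> (abs_sq a) t x * a1 t x)) t x"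
    using Dx_add[OF np(2,1) t] by simp
  have "\<i> / 2 * Dx (Dx a) t x
            - (complex_of_real (Dx \<phi> t x) * Dx a1 t x
               + 1/2 * a1 t x * complex_of_real (Dx (Dx \<phi>) t x)
               + Dx a t x * complex_of_real (Dx \<phi>1 t x)
               + 1/2 * a t x * complex_of_real (Dx (Dx \<phi>1) t x)
               + 1/2 * Dx (\<lambda>t x. of_real \<alpha> * (pow_fun \<gamma> (abs_sq a) t x * a1 t x)) t x
               + 1/2 * Dx (\<lambda>t x. of_real \<alpha> * (pow_fun_lin \<gamma> (abs_sq a) (abs_sq_lin a a1) t x * a t x)) t x) =
     \<i> / 2 * Dx (Dx a) t x + ampl_rhs_lin \<alpha> \<gamma> (Dx (cr \<phi>)) a (Dx (cr \<phi>1)) a1 t x"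
    unfolding ampl_rhs_lin_def e3 D1 D2 D3 D4 by (simp add: algebra_simps)
  then show "((\<lambda>s. a1 s x) has_vector_derivative (\<i> / 2 * Dx (Dx a) t x + ampl_rhs_lin \<alpha> \<gamma> (Dx (cr \<phi>)) a (Dx (cr \<phi>1)) a1 t x)) (at t within {0..T})"
    by (rule has_vector_derivative_eq_rhs[OF 2[unfolded e1 e2]])
qed

end

context shrinking_radius_reg
begin

section \<open>The uniform bound\<close>

text \<open>A jet with both differences equal to 0. Through it the jet rules also deliver plain
  bounds for the nonlinear terms.\<close>

lemma jet_refl:
  assumes t: "t \<in> {0..T}" and y: "Y_bound l t L y"
  shows "jet t 0 0 0 L y y y"
proof -
  have z: "Y_bound l t 0 (\<lambda>t x. 0)" using Y_bound_cmult[OF t y, of 0] by simp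
  then show ?thesis unfolding jet_def using y Y_boundD(1)[OF y] by simp
qed

text \<open>The threshold for \<open>M\<close> is evaluated at the very size to be proved. As long
  as that size holds, the sources contribute at most 1 and each norm is at most
  \<open>2 * B + 1\<close>, which closes the bootstrap. Nothing depends on \<open>q\<close>, hence
  on \<epsilon>.\<close>

lemma uniform_bound:
  assumes \<phi>: "regular_curve (l + 1) \<phi>" and a: "regular_curve l a" and B: "B \<ge> 0"
    and i1: "Hnorm_sq w0 (l + 1) (\<phi> 0) \<le> ennreal (B\<^sup>2)" and i2: "Hnorm_sq w0 l (a 0) \<le> ennreal (B\<^sup>2)"
    and o1: "\<And>t x. t \<in> {0..T} \<Longrightarrow> ((\<lambda>s. \<phi> s x) has_vector_derivative phase_rhs \<alpha> lam \<gamma> \<sigma> (Dx \<phi>) a t x) (at t within {0..T})"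
    and o2: "\<And>t x. t \<in> {0..T} \<Longrightarrow> ((\<lambda>s. a s x) has_vector_derivative (\<i> * complex_of_real q * Dx (Dx a) t x + ampl_rhs \<alpha> \<gamma> (Dx \<phi>) a t x)) (at t within {0..T})"
    and g: "\<gamma> > 0" "\<sigma> > 0"
    and M: "M \<ge> phase_const (alg_const l) \<alpha> lam \<gamma> \<sigma> (4 * B + 3)" "M \<ge> ampl_const (alg_const l) \<alpha> \<gamma> (4 * B + 3)"
  shows "Y_bound (l + 1) T (4 * B + 3) \<phi>" and "Y_bound l T (4 * B + 3) a"
proof -
  \<comment> \<open>Four quantities of size \<open>(2 B + 1)\<^sup>2\<close> add up to \<open>(4 B + 2)\<^sup>2\<close>, strictly below \<open>(4 B + 3)\<^sup>2\<close>.\<close>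
  define L where "L = 4 * B + 3"
  have L0: "L \<ge> 0" using B by (simp add: L_def)
  define E1 where "E1 s = enn2real (Hnorm_sq (w s) (l + 1) (\<phi> s))" for s
  define E2 where "E2 s = enn2real (Hnorm_sq (w s) l (a s))" for s
  define I1 where "I1 s = enn2real (smoothing (l + 1 + 1/2) s \<phi>)" for s
  define I2 where "I2 s = enn2real (smoothing (l + 1/2) s a)" for s
  have n: "analytic \<phi>" "analytic a" using \<phi> a by (auto simp: regular_curve_def)
  have sm: "smoothing (l + 1 + 1/2) T \<phi> < \<infinity>" "smoothing (l + 1/2) T a < \<infinity>" using \<phi> a by (auto simp: regular_curve_def)
  note Jc1 = smoothing_continuous[OF n(1) sm(1)] and Jc2 = smoothing_continuous[OF n(2) sm(2)]
  have f1: "Hnorm_sq (w s) (l + 1) (\<phi> s) = ennreal (E1 s)" "Hnorm_sq (w s) l (a s) = ennreal (E2 s)" if "s \<in> {0..T}" for s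
    using \<phi> a that by (auto simp: regular_curve_def E1_def E2_def less_top)
  have f2: "smoothing (l + 1 + 1/2) s \<phi> = ennreal (I1 s)" "smoothing (l + 1/2) s a = ennreal (I2 s)" if "s \<in> {0..T}" for s
    using Jc1(2)[OF that] Jc2(2)[OF that] by (auto simp: I1_def I2_def less_top)
  have nn: "E1 s \<ge> 0" "E2 s \<ge> 0" "I1 s \<ge> 0" "I2 s \<ge> 0" for s by (auto simp: E1_def E2_def I1_def I2_def)
  \<comment> \<open>The sum of the four nonnegative quantities: one continuous function to
    bootstrap, and a bound on it bounds each summand.\<close>
  define G where "G s = E1 s + E2 s + I1 s + I2 s" for s
  have yb: "Y_bound (l + 1) t L \<phi> \<and> Y_bound l t L a" if t: "t \<in> {0..T}" and Gs: "\<And>s. s \<in> {0..t} \<Longrightarrow> G s \<le> L\<^sup>2" for t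
  proof -
    have "Hnorm_sq (w s) (l + 1) (\<phi> s) \<le> ennreal (L\<^sup>2)" "Hnorm_sq (w s) l (a s) \<le> ennreal (L\<^sup>2)" if s: "s \<in> {0..t}" for s
      using f1[of s] s t Gs[OF s] nn[of s] by (auto simp: G_def intro!: ennreal_leI)
    moreover have "smoothing (l + 1 + 1/2) t \<phi> \<le> ennreal (L\<^sup>2)" "smoothing (l + 1/2) t a \<le> ennreal (L\<^sup>2)"
      using f2[OF t] t Gs[of t] nn[of t] by (auto simp: G_def intro!: ennreal_leI)
    ultimately show ?thesis unfolding Y_bound_def using n L0 by auto
  qed
  have step: "G t \<le> (4 * B + 2)\<^sup>2" if t: "t \<in> {0..T}" and Gs: "\<And>s. s \<in> {0..t} \<Longrightarrow> G s \<le> L\<^sup>2" for t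
  proof -
    note y = yb[OF t Gs]
    have jp: "jet t 0 0 0 L (Dx \<phi>) (Dx \<phi>) (Dx \<phi>)" by (rule jet_refl[OF t Y_bound_Dx[OF t]]) (use y in auto)
    have ja: "jet t 0 0 0 L a a a" by (rule jet_refl[OF t]) (use y in auto)
    have d1: "source_bound (l + 1) t (phase_const (alg_const l) \<alpha> lam \<gamma> \<sigma> L) (phase_rhs \<alpha> lam \<gamma> \<sigma> (Dx \<phi>) a)"
      using source_jet_phase_rhs[OF t _ _ jp ja g] by (simp add: source_jet_def)
    have d2: "source_bound l t (ampl_const (alg_const l) \<alpha> \<gamma> L) (ampl_rhs \<alpha> \<gamma> (Dx \<phi>) a)"
      using source_jet_ampl_rhs[OF t _ _ jp ja g(1)] by (simp add: source_jet_def)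
    have e1: "Y_bound (l + 1) t (2 * B + phase_const (alg_const l) \<alpha> lam \<gamma> \<sigma> L / M) \<phi>"
      by (rule linear_estimate[OF t n(1) d1 B i1, of 0]) (use o1 in simp)
    have e2: "Y_bound l t (2 * B + ampl_const (alg_const l) \<alpha> \<gamma> L / M) a"
      by (rule linear_estimate[OF t n(2) d2 B i2 o2])
    have "phase_const (alg_const l) \<alpha> lam \<gamma> \<sigma> L / M \<le> 1" "ampl_const (alg_const l) \<alpha> \<gamma> L / M \<le> 1" using M M0 by (auto simp: L_def)
    then have e: "Y_bound (l + 1) t (2 * B + 1) \<phi>" "Y_bound l t (2 * B + 1) a" using Y_bound_mono[OF e1] Y_bound_mono[OF e2] by auto
    have tt: "t \<in> {0..t}" using t by auto
    have "ennreal (E1 t) \<le> ennreal ((2 * B + 1)\<^sup>2)" "ennreal (E2 t) \<le> ennreal ((2 * B + 1)\<^sup>2)"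
      "ennreal (I1 t) \<le> ennreal ((2 * B + 1)\<^sup>2)" "ennreal (I2 t) \<le> ennreal ((2 * B + 1)\<^sup>2)"
      using Y_boundD(3)[OF e(1) tt] Y_boundD(3)[OF e(2) tt] Y_boundD(4)[OF e(1)] Y_boundD(4)[OF e(2)] f1[OF t] f2[OF t] by auto
    then have "G t \<le> 4 * (2 * B + 1)\<^sup>2" unfolding G_def by (simp add: ennreal_le_iff)
    then show ?thesis by (simp add: power2_eq_square algebra_simps)
  qed
  have 0: "0 \<in> {0..T}" using T0 by simp
  have G0: "G 0 \<le> L\<^sup>2"
  proof -
    have w0: "w 0 = w0" by (simp add: w_def)
    have "ennreal (E1 0) \<le> ennreal (B\<^sup>2)" "ennreal (E2 0) \<le> ennreal (B\<^sup>2)" using i1 i2 f1[OF 0] by (auto simp: w0)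
    then have "G 0 \<le> 2 * B\<^sup>2" by (simp add: G_def I1_def I2_def smoothing_0 ennreal_le_iff)
    also have "\<dots> \<le> L\<^sup>2" unfolding L_def using B mult_nonneg_nonneg[OF B B] by (simp add: power2_eq_square algebra_simps)
    finally show ?thesis .
  qed
  have c: "continuous_on {0..T} G"
    unfolding G_def E1_def E2_def I1_def I2_def using \<phi> a Jc1(1) Jc2(1) by (intro continuous_intros) (auto simp: regular_curve_def)
  have lt: "(4 * B + 2)\<^sup>2 < L\<^sup>2" unfolding L_def using B by (intro power_strict_mono) auto
  have "G t \<le> L\<^sup>2" if "t \<in> {0..T}" for t
    by (rule continuity_bootstrap[OF c G0 lt step that])
  then show "Y_bound (l + 1) T (4 * B + 3) \<phi>" "Y_bound l T (4 * B + 3) a"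
    using yb[of T] T0 unfolding L_def by auto
qed

end

section \<open>First and second order differences\<close>

context shrinking_radius_reg
begin

text \<open>\<open>m \<ge> 8 * K\<close> makes the coefficient of \<open>d\<close> on the right at
  most 1/2, so that this term moves to the left.\<close>

lemma half_absorb:
  fixes d R K c m :: real
  assumes "d \<le> 2 * R + (4 * K * d + c) / m" "m > 0" "m \<ge> 8 * K" "d \<ge> 0"
  shows "d \<le> 4 * R + 2 * (c / m)"
proof -
  have "4 * K * d / m \<le> d / 2"
    using mult_right_mono[OF assms(3,4)] assms(2) by (simp add: field_simps)
  then show ?thesis using assms(1) by (simp add: add_divide_distrib)
qed

text \<open>The limit amplitude lacks the dispersive term, so the difference solves the dispersive
  equation with the extra source \<open>\<i> * (\<epsilon> / 2) * Dx (Dx a)\<close>. Bounding it as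
  a source of order \<open>l\<close> is why \<open>a\<close> is assumed at order
  \<open>l + 1\<close>.\<close>

lemma first_difference_bound:
  assumes y: "Y_bound (l + 1) T \<Lambda> \<phi>e" "Y_bound l T \<Lambda> ae" "Y_bound (l + 1) T \<Lambda> \<phi>" "Y_bound l T \<Lambda> a" and L: "\<Lambda> \<ge> 1"
    and oe: "\<And>t x. t \<in> {0..T} \<Longrightarrow> ((\<lambda>s. \<phi>e s x) has_vector_derivative phase_rhs \<alpha> lam \<gamma> \<sigma> (Dx \<phi>e) ae t x) (at t within {0..T})"
      "\<And>t x. t \<in> {0..T} \<Longrightarrow> ((\<lambda>s. ae s x) has_vector_derivative (\<i> * complex_of_real (\<epsilon> / 2) * Dx (Dx ae) t x + ampl_rhs \<alpha> \<gamma> (Dx \<phi>e) ae t x)) (at t within {0..T})"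
    and o0: "\<And>t x. t \<in> {0..T} \<Longrightarrow> ((\<lambda>s. \<phi> s x) has_vector_derivative phase_rhs \<alpha> lam \<gamma> \<sigma> (Dx \<phi>) a t x) (at t within {0..T})"
      "\<And>t x. t \<in> {0..T} \<Longrightarrow> ((\<lambda>s. a s x) has_vector_derivative ampl_rhs \<alpha> \<gamma> (Dx \<phi>) a t x) (at t within {0..T})"
    and C0: "Y_bound (l + 1) T C0 a" and R: "R \<ge> 0"
    and i: "Hnorm_sq w0 (l + 1) (\<lambda>x. \<phi>e 0 x - \<phi> 0 x) \<le> ennreal (R\<^sup>2)" "Hnorm_sq w0 l (\<lambda>x. ae 0 x - a 0 x) \<le> ennreal (R\<^sup>2)"
    and g: "\<gamma> > 0" "\<sigma> > 0" and e: "\<epsilon> \<ge> 0"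
    and M: "M \<ge> 8 * phase_const (alg_const l) \<alpha> lam \<gamma> \<sigma> \<Lambda>" "M \<ge> 8 * ampl_const (alg_const l) \<alpha> \<gamma> \<Lambda>"
  shows "Y_bound (l + 1) T (4 * R + 2 * (\<epsilon> * C0 / M)) (\<lambda>t x. \<phi>e t x - \<phi> t x)"
    and "Y_bound l T (4 * R + 2 * (\<epsilon> * C0 / M)) (\<lambda>t x. ae t x - a t x)"
proof -
  have T: "T \<in> {0..T}" using T0 by simp
  note n = Y_boundD(1)[OF y(1)] Y_boundD(1)[OF y(2)] Y_boundD(1)[OF y(3)] Y_boundD(1)[OF y(4)]
  let ?u = "\<lambda>t x. \<phi>e t x - \<phi> t x" and ?v = "\<lambda>t x. ae t x - a t x"
  define Kphi where "Kphi = phase_const (alg_const l) \<alpha> lam \<gamma> \<sigma> \<Lambda>"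
  define Kampl where "Kampl = ampl_const (alg_const l) \<alpha> \<gamma> \<Lambda>"
  have u0: "\<exists>A. Y_bound (l + 1) T A ?u"
    using Y_bound_add[OF T y(1) Y_bound_cmult[OF T y(3), of "-1"]] by (intro exI) simp
  have v0: "\<exists>A. Y_bound l T A ?v"
    using Y_bound_add[OF T y(2) Y_bound_cmult[OF T y(4), of "-1"]] by (intro exI) simp
  \<comment> \<open>The least constants. By \<open>umin\<close> and \<open>vmin\<close> every bound
    that is derived for the differences becomes an inequality for \<open>d\<close> itself.\<close>
  define d1 where "d1 = enn2real (triple_norm w M (l + 1) T ?u)"
  define d2 where "d2 = enn2real (triple_norm w M l T ?v)"
  define d where "d = max d1 d2"
  have u1: "Y_bound (l + 1) T d1 ?u" and umin: "\<And>A. Y_bound (l + 1) T A ?u \<Longrightarrow> d1 \<le> A"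
    using u0 triple_Y_bound unfolding d1_def by blast+
  have v1: "Y_bound l T d2 ?v" and vmin: "\<And>A. Y_bound l T A ?v \<Longrightarrow> d2 \<le> A"
    using v0 triple_Y_bound unfolding d2_def by blast+
  have ud: "Y_bound (l + 1) T d ?u" and vd: "Y_bound l T d ?v"
    using Y_bound_mono[OF u1] Y_bound_mono[OF v1] by (auto simp: d_def)
  have d0: "d \<ge> 0" by (rule Y_boundD(2)[OF ud])
  have dL: "d \<le> \<Lambda> * d" using mult_right_mono[OF L d0] by simp
  have d2': "\<Lambda> * d \<le> \<Lambda> * (d + d\<^sup>2)" using L by (intro mult_left_mono) auto
  \<comment> \<open>The jet has \<open>n = d\<close> and \<open>e = 0\<close>: only the first
    difference is of interest, and it also fills the slot of the remainder.\<close>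
  have jp: "jet T d d 0 \<Lambda> (Dx \<phi>e) (Dx \<phi>) (Dx \<phi>)"
  proof -
    have "Y_bound l T d (\<lambda>t x. Dx \<phi>e t x - Dx \<phi> t x)"
      by (rule Y_bound_cong[OF Y_bound_Dx[OF T ud] T]) (simp add: Dx_diff n)
    from Y_bound_mono[OF this dL] Y_bound_mono[OF this order_trans[OF dL d2']]
    show ?thesis unfolding jet_def using Y_bound_Dx[OF T y(1)] Y_bound_Dx[OF T y(3)] analytic_Dx[OF n(3)] by simp
  qed
  have ja: "jet T d d 0 \<Lambda> ae a a"
    unfolding jet_def using Y_bound_mono[OF vd dL] Y_bound_mono[OF vd order_trans[OF dL d2']] y n by simp
  have D1: "source_bound (l + 1) T (Kphi * d) (\<lambda>t x. phase_rhs \<alpha> lam \<gamma> \<sigma> (Dx \<phi>e) ae t x - phase_rhs \<alpha> lam \<gamma> \<sigma> (Dx \<phi>) a t x)"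
    using source_jet_phase_rhs[OF T d0 d0 jp ja g] unfolding source_jet_def Kphi_def by blast
  have D2: "source_bound l T (Kampl * d) (\<lambda>t x. ampl_rhs \<alpha> \<gamma> (Dx \<phi>e) ae t x - ampl_rhs \<alpha> \<gamma> (Dx \<phi>) a t x)"
    using source_jet_ampl_rhs[OF T d0 d0 jp ja g(1)] unfolding source_jet_def Kampl_def by blast
  have D3: "source_bound l T (\<epsilon> / 2 * C0) (\<lambda>t x. \<i> * complex_of_real (\<epsilon> / 2) * Dx (Dx a) t x)"
    using source_bound_cmult[OF T source_bound_Dx[OF T Y_bound_Dx[OF T C0]], of "\<i> * complex_of_real (\<epsilon> / 2)"] e by (simp add: norm_mult)
  note D4 = source_bound_add[OF T D2 D3]
  have e1: "Y_bound (l + 1) T (2 * R + Kphi * d / M) ?u"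
  proof (rule linear_estimate[OF T analytic_diff[OF n(1,3)] D1 R i(1), of 0])
    fix t x assume t: "t \<in> {0..T}"
    show "((\<lambda>s. \<phi>e s x - \<phi> s x) has_vector_derivative \<i> * complex_of_real 0 * Dx (Dx ?u) t x + (phase_rhs \<alpha> lam \<gamma> \<sigma> (Dx \<phi>e) ae t x - phase_rhs \<alpha> lam \<gamma> \<sigma> (Dx \<phi>) a t x)) (at t within {0..T})"
      using has_vector_derivative_diff[OF oe(1)[OF t] o0(1)[OF t]] by simp
  qed
  have e2: "Y_bound l T (2 * R + (2 * (Kampl * d) + 2 * (\<epsilon> / 2 * C0)) / M) ?v"
  proof (rule linear_estimate[OF T analytic_diff[OF n(2,4)] D4 R i(2), of "\<epsilon> / 2"])
    fix t x assume t: "t \<in> {0..T}"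
    have "Dx (Dx ?v) t x = Dx (\<lambda>t x. Dx ae t x - Dx a t x) t x"
      by (rule Dx_cong) (simp add: Dx_diff n t del: atLeastAtMost_iff)
    also have "\<dots> = Dx (Dx ae) t x - Dx (Dx a) t x" by (rule Dx_diff[OF analytic_Dx[OF n(2)] analytic_Dx[OF n(4)] t])
    finally have "\<i> * complex_of_real (\<epsilon> / 2) * Dx (Dx ae) t x + ampl_rhs \<alpha> \<gamma> (Dx \<phi>e) ae t x - ampl_rhs \<alpha> \<gamma> (Dx \<phi>) a t x =
       \<i> * complex_of_real (\<epsilon> / 2) * Dx (Dx ?v) t x + ((ampl_rhs \<alpha> \<gamma> (Dx \<phi>e) ae t x - ampl_rhs \<alpha> \<gamma> (Dx \<phi>) a t x) + \<i> * complex_of_real (\<epsilon> / 2) * Dx (Dx a) t x)"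
      by (simp only:) (simp add: algebra_simps)
    note eq = this
    have "((\<lambda>s. ae s x - a s x) has_vector_derivative (\<i> * complex_of_real (\<epsilon> / 2) * Dx (Dx ae) t x + ampl_rhs \<alpha> \<gamma> (Dx \<phi>e) ae t x - ampl_rhs \<alpha> \<gamma> (Dx \<phi>) a t x)) (at t within {0..T})"
      by (intro has_vector_derivative_diff oe o0 t)
    then show "((\<lambda>s. ae s x - a s x) has_vector_derivative \<i> * complex_of_real (\<epsilon> / 2) * Dx (Dx ?v) t x + ((ampl_rhs \<alpha> \<gamma> (Dx \<phi>e) ae t x - ampl_rhs \<alpha> \<gamma> (Dx \<phi>) a t x) + \<i> * complex_of_real (\<epsilon> / 2) * Dx (Dx a) t x)) (at t within {0..T})"
      unfolding eq .
  qed
  \<comment> \<open>One inequality for both equations: the larger constant is used, and the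
    coefficient 4 covers the doubling by \<open>source_bound_add\<close>.\<close>
  define Km where "Km = max Kphi Kampl"
  have Kd: "Kphi * d \<le> Km * d" "Kampl * d \<le> Km * d" "0 \<le> Kphi * d" "0 \<le> \<epsilon> / 2 * C0" "0 \<le> Kampl * d"
    using d0 source_boundD(2)[OF D1] source_boundD(2)[OF D2] source_boundD(2)[OF D3] by (auto simp: Km_def intro: mult_right_mono)
  have "d1 \<le> 2 * R + (4 * Km * d + \<epsilon> * C0) / M"
    by (rule order_trans[OF umin[OF e1]]) (use M0 Kd in \<open>auto intro!: divide_right_mono\<close>)
  moreover have "d2 \<le> 2 * R + (4 * Km * d + \<epsilon> * C0) / M"
    by (rule order_trans[OF vmin[OF e2]]) (use M0 Kd in \<open>auto intro!: divide_right_mono\<close>)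
  ultimately have "d \<le> 2 * R + (4 * Km * d + \<epsilon> * C0) / M" by (simp add: d_def)
  then have "d \<le> 4 * R + 2 * (\<epsilon> * C0 / M)"
    by (rule half_absorb) (use M0 M d0 in \<open>auto simp: Km_def Kphi_def Kampl_def max_def\<close>)
  then show "Y_bound (l + 1) T (4 * R + 2 * (\<epsilon> * C0 / M)) ?u" "Y_bound l T (4 * R + 2 * (\<epsilon> * C0 / M)) ?v"
    using Y_bound_mono[OF ud] Y_bound_mono[OF vd] by auto
qed

text \<open>The scheme of the first difference, with genuine jets in the direction
  \<open>(\<phi>1, a1)\<close>. The nonlinear sources are now bounded through the unknown
  \<open>m\<close> plus the square of the known first difference.\<close>

lemma second_difference_bound:
  assumes y: "Y_bound (l + 1) T \<Lambda> \<phi>e" "Y_bound l T \<Lambda> ae" "Y_bound (l + 1) T \<Lambda> \<phi>" "Y_bound l T \<Lambda> a" and L: "\<Lambda> \<ge> 1"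
    and y1: "Y_bound (l + 1) T C1 \<phi>1" "Y_bound l T C1 a1"
    and oe: "\<And>t x. t \<in> {0..T} \<Longrightarrow> ((\<lambda>s. \<phi>e s x) has_vector_derivative phase_rhs \<alpha> lam \<gamma> \<sigma> (Dx \<phi>e) ae t x) (at t within {0..T})"
      "\<And>t x. t \<in> {0..T} \<Longrightarrow> ((\<lambda>s. ae s x) has_vector_derivative (\<i> * complex_of_real (\<epsilon> / 2) * Dx (Dx ae) t x + ampl_rhs \<alpha> \<gamma> (Dx \<phi>e) ae t x)) (at t within {0..T})"
    and o0: "\<And>t x. t \<in> {0..T} \<Longrightarrow> ((\<lambda>s. \<phi> s x) has_vector_derivative phase_rhs \<alpha> lam \<gamma> \<sigma> (Dx \<phi>) a t x) (at t within {0..T})"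
      "\<And>t x. t \<in> {0..T} \<Longrightarrow> ((\<lambda>s. a s x) has_vector_derivative ampl_rhs \<alpha> \<gamma> (Dx \<phi>) a t x) (at t within {0..T})"
    and o1: "\<And>t x. t \<in> {0..T} \<Longrightarrow> ((\<lambda>s. \<phi>1 s x) has_vector_derivative phase_rhs_lin \<alpha> lam \<gamma> \<sigma> (Dx \<phi>) a (Dx \<phi>1) a1 t x) (at t within {0..T})"
      "\<And>t x. t \<in> {0..T} \<Longrightarrow> ((\<lambda>s. a1 s x) has_vector_derivative (\<i> / 2 * Dx (Dx a) t x + ampl_rhs_lin \<alpha> \<gamma> (Dx \<phi>) a (Dx \<phi>1) a1 t x)) (at t within {0..T})"
    and C0: "Y_bound (l + 1) T C2 a1" and R: "R \<ge> 0"
    and i: "Hnorm_sq w0 (l + 1) (\<lambda>x. \<phi>e 0 x - \<phi> 0 x - of_real \<epsilon> * \<phi>1 0 x) \<le> ennreal (R\<^sup>2)" "Hnorm_sq w0 l (\<lambda>x. ae 0 x - a 0 x - of_real \<epsilon> * a1 0 x) \<le> ennreal (R\<^sup>2)"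
    and g: "\<gamma> > 0" "\<sigma> > 0" and e: "\<epsilon> \<ge> 0"
    and M: "M \<ge> 8 * phase_const (alg_const l) \<alpha> lam \<gamma> \<sigma> \<Lambda>" "M \<ge> 8 * ampl_const (alg_const l) \<alpha> \<gamma> \<Lambda>"
    and ud: "Y_bound (l + 1) T d (\<lambda>t x. \<phi>e t x - \<phi> t x)" and vd: "Y_bound l T d (\<lambda>t x. ae t x - a t x)"
  shows "Y_bound (l + 1) T (4 * R + d\<^sup>2 + 2 * (\<epsilon>\<^sup>2 * C2 / M)) (\<lambda>t x. \<phi>e t x - \<phi> t x - of_real \<epsilon> * \<phi>1 t x)"
    and "Y_bound l T (4 * R + d\<^sup>2 + 2 * (\<epsilon>\<^sup>2 * C2 / M)) (\<lambda>t x. ae t x - a t x - of_real \<epsilon> * a1 t x)"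
proof -
  have T: "T \<in> {0..T}" using T0 by simp
  note n = Y_boundD(1)[OF y(1)] Y_boundD(1)[OF y(2)] Y_boundD(1)[OF y(3)] Y_boundD(1)[OF y(4)]
  note n1 = Y_boundD(1)[OF y1(1)] Y_boundD(1)[OF y1(2)]
  let ?u = "\<lambda>t x. \<phi>e t x - \<phi> t x - of_real \<epsilon> * \<phi>1 t x" and ?v = "\<lambda>t x. ae t x - a t x - of_real \<epsilon> * a1 t x"
  define Kphi where "Kphi = phase_const (alg_const l) \<alpha> lam \<gamma> \<sigma> \<Lambda>"
  define Kampl where "Kampl = ampl_const (alg_const l) \<alpha> \<gamma> \<Lambda>"
  have u0: "\<exists>A. Y_bound (l + 1) T A ?u"
    using Y_bound_add[OF T ud Y_bound_cmult[OF T y1(1), of "- of_real \<epsilon>"]] by (intro exI) simp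
  have v0: "\<exists>A. Y_bound l T A ?v"
    using Y_bound_add[OF T vd Y_bound_cmult[OF T y1(2), of "- of_real \<epsilon>"]] by (intro exI) simp
  define d1 where "d1 = enn2real (triple_norm w M (l + 1) T ?u)"
  define d2 where "d2 = enn2real (triple_norm w M l T ?v)"
  define m where "m = max d1 d2"
  have u1: "Y_bound (l + 1) T d1 ?u" and umin: "\<And>A. Y_bound (l + 1) T A ?u \<Longrightarrow> d1 \<le> A"
    using u0 triple_Y_bound unfolding d1_def by blast+
  have v1: "Y_bound l T d2 ?v" and vmin: "\<And>A. Y_bound l T A ?v \<Longrightarrow> d2 \<le> A"
    using v0 triple_Y_bound unfolding d2_def by blast+
  have um: "Y_bound (l + 1) T m ?u" and vm: "Y_bound l T m ?v"
    using Y_bound_mono[OF u1] Y_bound_mono[OF v1] by (auto simp: m_def)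
  have m0: "m \<ge> 0" by (rule Y_boundD(2)[OF um])
  have d0: "d \<ge> 0" by (rule Y_boundD(2)[OF ud])
  have dL: "d \<le> \<Lambda> * d" using mult_right_mono[OF L d0] by simp
  have mL: "m \<le> \<Lambda> * (m + d\<^sup>2)"
  proof -
    have "m \<le> m + d\<^sup>2" by simp
    also have "\<dots> \<le> \<Lambda> * (m + d\<^sup>2)" using mult_right_mono[OF L, of "m + d\<^sup>2"] m0 by simp
    finally show ?thesis .
  qed
  have jp: "jet T d m \<epsilon> \<Lambda> (Dx \<phi>e) (Dx \<phi>) (Dx \<phi>1)"
  proof -
    have "Y_bound l T d (\<lambda>t x. Dx \<phi>e t x - Dx \<phi> t x)"
      by (rule Y_bound_cong[OF Y_bound_Dx[OF T ud] T]) (simp add: Dx_diff n)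
    note 1 = Y_bound_mono[OF this dL]
    have "Y_bound l T m (\<lambda>t x. Dx \<phi>e t x - Dx \<phi> t x - of_real \<epsilon> * Dx \<phi>1 t x)"
      by (rule Y_bound_cong[OF Y_bound_Dx[OF T um] T]) (simp add: Dx_diff Dx_cmult analytic_diff analytic_cmult n n1)
    note 2 = Y_bound_mono[OF this mL]
    show ?thesis unfolding jet_def using 1 2 Y_bound_Dx[OF T y(1)] Y_bound_Dx[OF T y(3)] analytic_Dx[OF n1(1)] by simp
  qed
  have ja: "jet T d m \<epsilon> \<Lambda> ae a a1"
    unfolding jet_def using Y_bound_mono[OF vd dL] Y_bound_mono[OF vm mL] y n1 by simp
  \<comment> \<open>The unknown \<open>m\<close> occurs on the right only together with
    \<open>d\<^sup>2\<close>, so the absorption is carried out for their sum.\<close>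
  define X where "X = m + d\<^sup>2"
  have D1: "source_bound (l + 1) T (Kphi * X) (\<lambda>t x. phase_rhs \<alpha> lam \<gamma> \<sigma> (Dx \<phi>e) ae t x - phase_rhs \<alpha> lam \<gamma> \<sigma> (Dx \<phi>) a t x - of_real \<epsilon> * phase_rhs_lin \<alpha> lam \<gamma> \<sigma> (Dx \<phi>) a (Dx \<phi>1) a1 t x)"
    using source_jet_phase_rhs[OF T d0 m0 jp ja g] unfolding source_jet_def Kphi_def X_def by blast
  have D2: "source_bound l T (Kampl * X) (\<lambda>t x. ampl_rhs \<alpha> \<gamma> (Dx \<phi>e) ae t x - ampl_rhs \<alpha> \<gamma> (Dx \<phi>) a t x - of_real \<epsilon> * ampl_rhs_lin \<alpha> \<gamma> (Dx \<phi>) a (Dx \<phi>1) a1 t x)"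
    using source_jet_ampl_rhs[OF T d0 m0 jp ja g(1)] unfolding source_jet_def Kampl_def X_def by blast
  have D3: "source_bound l T (\<epsilon>\<^sup>2 / 2 * C2) (\<lambda>t x. \<i> * complex_of_real (\<epsilon>\<^sup>2 / 2) * Dx (Dx a1) t x)"
    using source_bound_cmult[OF T source_bound_Dx[OF T Y_bound_Dx[OF T C0]], of "\<i> * complex_of_real (\<epsilon>\<^sup>2 / 2)"] e by (simp add: norm_mult norm_power)
  note D4 = source_bound_add[OF T D2 D3]
  have e1: "Y_bound (l + 1) T (2 * R + Kphi * X / M) ?u"
  proof (rule linear_estimate[OF T analytic_diff[OF analytic_diff[OF n(1,3)] analytic_cmult[OF n1(1)]] D1 R i(1), of 0])
    fix t x assume t: "t \<in> {0..T}"
    have "((\<lambda>s. \<phi>e s x - \<phi> s x - of_real \<epsilon> * \<phi>1 s x) has_vector_derivative (phase_rhs \<alpha> lam \<gamma> \<sigma> (Dx \<phi>e) ae t x - phase_rhs \<alpha> lam \<gamma> \<sigma> (Dx \<phi>) a t x - of_real \<epsilon> * phase_rhs_lin \<alpha> lam \<gamma> \<sigma> (Dx \<phi>) a (Dx \<phi>1) a1 t x)) (at t within {0..T})"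
      by (intro has_vector_derivative_diff has_vector_derivative_mult_right oe o0 o1 t)
    then show "((\<lambda>s. \<phi>e s x - \<phi> s x - of_real \<epsilon> * \<phi>1 s x) has_vector_derivative \<i> * complex_of_real 0 * Dx (Dx ?u) t x + (phase_rhs \<alpha> lam \<gamma> \<sigma> (Dx \<phi>e) ae t x - phase_rhs \<alpha> lam \<gamma> \<sigma> (Dx \<phi>) a t x - of_real \<epsilon> * phase_rhs_lin \<alpha> lam \<gamma> \<sigma> (Dx \<phi>) a (Dx \<phi>1) a1 t x)) (at t within {0..T})"
      by simp
  qed
  have e2: "Y_bound l T (2 * R + (2 * (Kampl * X) + 2 * (\<epsilon>\<^sup>2 / 2 * C2)) / M) ?v"
  proof (rule linear_estimate[OF T analytic_diff[OF analytic_diff[OF n(2,4)] analytic_cmult[OF n1(2)]] D4 R i(2), of "\<epsilon> / 2"])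
    fix t x assume t: "t \<in> {0..T}"
    have "Dx (Dx ?v) t x = Dx (\<lambda>t x. Dx ae t x - Dx a t x - of_real \<epsilon> * Dx a1 t x) t x"
      by (rule Dx_cong) (simp add: Dx_diff Dx_cmult analytic_diff analytic_cmult n n1 t del: atLeastAtMost_iff)
    also have "\<dots> = Dx (Dx ae) t x - Dx (Dx a) t x - of_real \<epsilon> * Dx (Dx a1) t x"
      by (simp add: Dx_diff Dx_cmult analytic_diff analytic_cmult analytic_Dx n n1 t del: atLeastAtMost_iff)
    \<comment> \<open>The source \<open>\<i> / 2 * Dx (Dx a)\<close> of the corrector, multiplied by
      \<epsilon>, cancels the first-order source. What remains is the dispersive term of the
      remainder and \<open>Dx (Dx a1)\<close> with the factor
      \<open>\<epsilon>\<^sup>2 / 2\<close>.\<close>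
    finally have eq: "\<i> * complex_of_real (\<epsilon> / 2) * Dx (Dx ae) t x + ampl_rhs \<alpha> \<gamma> (Dx \<phi>e) ae t x - ampl_rhs \<alpha> \<gamma> (Dx \<phi>) a t x - of_real \<epsilon> * (\<i> / 2 * Dx (Dx a) t x + ampl_rhs_lin \<alpha> \<gamma> (Dx \<phi>) a (Dx \<phi>1) a1 t x) =
       \<i> * complex_of_real (\<epsilon> / 2) * Dx (Dx ?v) t x + ((ampl_rhs \<alpha> \<gamma> (Dx \<phi>e) ae t x - ampl_rhs \<alpha> \<gamma> (Dx \<phi>) a t x - of_real \<epsilon> * ampl_rhs_lin \<alpha> \<gamma> (Dx \<phi>) a (Dx \<phi>1) a1 t x) + \<i> * complex_of_real (\<epsilon>\<^sup>2 / 2) * Dx (Dx a1) t x)"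
      by (simp only:) (simp add: algebra_simps power2_eq_square)
    have "((\<lambda>s. ae s x - a s x - of_real \<epsilon> * a1 s x) has_vector_derivative (\<i> * complex_of_real (\<epsilon> / 2) * Dx (Dx ae) t x + ampl_rhs \<alpha> \<gamma> (Dx \<phi>e) ae t x - ampl_rhs \<alpha> \<gamma> (Dx \<phi>) a t x - of_real \<epsilon> * (\<i> / 2 * Dx (Dx a) t x + ampl_rhs_lin \<alpha> \<gamma> (Dx \<phi>) a (Dx \<phi>1) a1 t x))) (at t within {0..T})"
      by (intro has_vector_derivative_diff has_vector_derivative_mult_right oe o0 o1 t)
    then show "((\<lambda>s. ae s x - a s x - of_real \<epsilon> * a1 s x) has_vector_derivative \<i> * complex_of_real (\<epsilon> / 2) * Dx (Dx ?v) t x + ((ampl_rhs \<alpha> \<gamma> (Dx \<phi>e) ae t x - ampl_rhs \<alpha> \<gamma> (Dx \<phi>) a t x - of_real \<epsilon> * ampl_rhs_lin \<alpha> \<gamma> (Dx \<phi>) a (Dx \<phi>1) a1 t x) + \<i> * complex_of_real (\<epsilon>\<^sup>2 / 2) * Dx (Dx a1) t x)) (at t within {0..T})"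
      unfolding eq .
  qed
  define Km where "Km = max Kphi Kampl"
  have X0: "X \<ge> 0" using m0 by (simp add: X_def)
  have Kd: "Kphi * X \<le> Km * X" "Kampl * X \<le> Km * X" "0 \<le> Kphi * X" "0 \<le> \<epsilon>\<^sup>2 / 2 * C2" "0 \<le> Kampl * X"
    using X0 source_boundD(2)[OF D1] source_boundD(2)[OF D2] source_boundD(2)[OF D3] by (auto simp: Km_def intro: mult_right_mono)
  have "d1 \<le> 2 * R + (4 * Km * X + \<epsilon>\<^sup>2 * C2) / M"
    by (rule order_trans[OF umin[OF e1]]) (use M0 Kd in \<open>auto intro!: divide_right_mono\<close>)
  moreover have "d2 \<le> 2 * R + (4 * Km * X + \<epsilon>\<^sup>2 * C2) / M"
    by (rule order_trans[OF vmin[OF e2]]) (use M0 Kd in \<open>auto intro!: divide_right_mono\<close>)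
  ultimately have "m \<le> 2 * R + (4 * Km * X + \<epsilon>\<^sup>2 * C2) / M" by (simp add: m_def)
  \<comment> \<open>Adding \<open>d\<^sup>2\<close> on both sides makes \<open>X\<close> the
    unknown; inside the factor 2 it appears as \<open>d\<^sup>2 / 2\<close>.\<close>
  then have "X \<le> 2 * (R + d\<^sup>2 / 2) + (4 * Km * X + \<epsilon>\<^sup>2 * C2) / M" by (simp add: X_def)
  then have "X \<le> 4 * (R + d\<^sup>2 / 2) + 2 * (\<epsilon>\<^sup>2 * C2 / M)"
    by (rule half_absorb) (use M0 M X0 in \<open>auto simp: Km_def Kphi_def Kampl_def max_def\<close>)
  then have "m \<le> 4 * R + d\<^sup>2 + 2 * (\<epsilon>\<^sup>2 * C2 / M)" by (simp add: X_def)
  then show "Y_bound (l + 1) T (4 * R + d\<^sup>2 + 2 * (\<epsilon>\<^sup>2 * C2 / M)) ?u" "Y_bound l T (4 * R + d\<^sup>2 + 2 * (\<epsilon>\<^sup>2 * C2 / M)) ?v"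
    using Y_bound_mono[OF um] Y_bound_mono[OF vm] by auto
qed

end

section \<open>Curves in \<open>L\<^sup>2 \<inter> L\<^sup>\<infinity>\<close>\<close>

context shrinking_radius
begin

lemma analytic_L2sq_le:
  assumes u: "analytic u" and t: "t \<in> {0..T}" and m: "m \<ge> 0"
  shows "L2sq (u t) \<le> Hnorm_sq (w t) m (u t)" and "u t \<in> borel_measurable borel"
proof -
  obtain h where h: "spectral_curve u h" using u by (auto simp: analytic_def)
  have "L2sq (u t) \<le> L2sq (h t)" unfolding spectral_curve_fourier_int[OF h t] by (rule Bessel[OF spectral_curve_int[OF h t]]) simp
  also have "\<dots> \<le> wnorm (w t) m (h t)" unfolding wnorm_00[symmetric] using w_pos[OF t] m by (intro wnorm_mono) auto
  finally show "L2sq (u t) \<le> Hnorm_sq (w t) m (u t)" by (simp add: spectral_curve_Hnorm[OF h t])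
  show "u t \<in> borel_measurable borel" unfolding spectral_curve_fourier_int[OF h t] by (rule fourier_int_measurable'[OF spectral_curve_meas[OF h t]])
qed

lemma analytic_sup_le:
  assumes u: "analytic u" and t: "t \<in> {0..T}" and m: "m > 1/2" and A: "Hnorm_sq (w t) m (u t) \<le> ennreal (A\<^sup>2)" "A \<ge> 0"
  shows "cmod (u t x) \<le> sqrt (japanese_int m) * A"
proof -
  obtain h where h: "spectral_curve u h" using u by (auto simp: analytic_def)
  have "ennreal ((cmod (u t x))\<^sup>2) \<le> ennreal (japanese_int m) * wnorm 0 m (h t)"
    unfolding spectral_curve_fourier_int[OF h t] by (rule fourier_int_sup_bound[OF m spectral_curve_meas[OF h t]])
  also have "\<dots> \<le> ennreal (japanese_int m) * ennreal (A\<^sup>2)"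
  proof (rule mult_left_mono)
    have "wnorm 0 m (h t) \<le> wnorm (w t) m (h t)" using w_pos[OF t] by (intro wnorm_mono) auto
    then show "wnorm 0 m (h t) \<le> ennreal (A\<^sup>2)" using A(1) by (simp add: spectral_curve_Hnorm[OF h t])
  qed simp
  also have "\<dots> = ennreal ((sqrt (japanese_int m) * A)\<^sup>2)" by (simp add: ennreal_mult[symmetric] power_mult_distrib)
  finally have "(cmod (u t x))\<^sup>2 \<le> (sqrt (japanese_int m) * A)\<^sup>2" by (simp add: ennreal_le_iff)
  then show ?thesis by (rule power2_le_imp_le) (use A in simp)
qed

text \<open>Continuous curves with values in the intersection of L2 and the bounded functions, in
  the uniform norm. The class is visibly stable under oscillating factors, and it supplies the
  measurability in time that estimates of the essential supremum require.\<close>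

definition L2_Linf :: "(real \<Rightarrow> real \<Rightarrow> complex) \<Rightarrow> bool" where
  "L2_Linf v \<longleftrightarrow> (\<forall>t\<in>{0..T}. square_integrable (v t) \<and> (\<exists>K\<ge>0. \<forall>x. cmod (v t x) \<le> K) \<and>
     ((\<lambda>s. L2sq (\<lambda>x. v s x - v t x)) \<longlongrightarrow> 0) (at t within {0..T}) \<and>
     (\<exists>S. (S \<longlongrightarrow> (0::real)) (at t within {0..T}) \<and> (\<forall>s\<in>{0..T}. \<forall>x. cmod (v s x - v t x) \<le> S s)))"

lemma L2_LinfD:
  assumes "L2_Linf v" "t \<in> {0..T}"
  shows "square_integrable (v t)" "\<exists>K\<ge>0. \<forall>x. cmod (v t x) \<le> K" "((\<lambda>s. L2sq (\<lambda>x. v s x - v t x)) \<longlongrightarrow> 0) (at t within {0..T})"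
    "\<exists>S. (S \<longlongrightarrow> (0::real)) (at t within {0..T}) \<and> (\<forall>s\<in>{0..T}. \<forall>x. cmod (v s x - v t x) \<le> S s)"
  using assms unfolding L2_Linf_def by fast+

lemma L2_Linf_analytic: assumes u: "analytic u" shows "L2_Linf u"
  unfolding L2_Linf_def
proof (intro ballI conjI)
  fix t assume t: "t \<in> {0..T}"
  obtain h where h: "spectral_curve u h" using u by (auto simp: analytic_def)
  have c: "0 \<in> {0..<w_end}" using w_end_pos by simp
  show "square_integrable (u t)" by (rule spectral_curve_fourier(2)[OF h t])
  have f: "wnorm 0 1 (h t) < \<infinity>" by (rule spectral_curve_finite[OF h t c])
  show "\<exists>K\<ge>0. \<forall>x. cmod (u t x) \<le> K"
    using fourier_int_bound[OF spectral_curve_int[OF h t], of 1] spectral_curve_fourier_int[OF h t]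
    by (intro exI[of _ "1 / sqrt (2 * pi) * (LINT x|lborel. cmod (h t x))"] conjI) (auto intro!: mult_nonneg_nonneg integral_nonneg_AE)
  have d: "u s x - u t x = fourier_int 1 (\<lambda>\<xi>. h s \<xi> - h t \<xi>) x" if s: "s \<in> {0..T}" for s x
    by (simp only: fourier_int_diff[OF spectral_curve_int[OF h s] spectral_curve_int[OF h t]] spectral_curve_fourier_int[OF h s] spectral_curve_fourier_int[OF h t])
  have L0: "((\<lambda>s. L2sq (\<lambda>\<xi>. h s \<xi> - h t \<xi>)) \<longlongrightarrow> 0) (at t within {0..T})"
    using spectral_curve_lim[OF h t c, of 0] by (simp add: wnorm_00)
  show "((\<lambda>s. L2sq (\<lambda>x. u s x - u t x)) \<longlongrightarrow> 0) (at t within {0..T})"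
  proof (rule ennreal_tendsto_0_le[OF L0, where C=1], rule eventually_within_I)
    fix s assume s: "s \<in> {0..T}"
    have "L2sq (\<lambda>x. u s x - u t x) \<le> L2sq (\<lambda>\<xi>. h s \<xi> - h t \<xi>)"
      unfolding d[OF s] by (rule Bessel[OF Bochner_Integration.integrable_diff[OF spectral_curve_int[OF h s] spectral_curve_int[OF h t]]]) simp
    then show "L2sq (\<lambda>x. u s x - u t x) \<le> ennreal 1 * L2sq (\<lambda>\<xi>. h s \<xi> - h t \<xi>)" by simp
  qed
  define S where "S s = sqrt (japanese_int 1 * enn2real (wnorm 0 1 (\<lambda>\<xi>. h s \<xi> - h t \<xi>)))" for s
  have "((\<lambda>s. sqrt (japanese_int 1 * enn2real (wnorm 0 1 (\<lambda>\<xi>. h s \<xi> - h t \<xi>)))) \<longlongrightarrow> sqrt (japanese_int 1 * enn2real (ennreal 0))) (at t within {0..T})"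
    using spectral_curve_lim[OF h t c, of 1] by (intro tendsto_intros tendsto_enn2real) auto
  then have "(S \<longlongrightarrow> 0) (at t within {0..T})" unfolding S_def by simp
  moreover have "cmod (u s x - u t x) \<le> S s" if s: "s \<in> {0..T}" for s x
  proof -
    have m: "(\<lambda>\<xi>. h s \<xi> - h t \<xi>) \<in> borel_measurable borel" by (intro borel_measurable_diff spectral_curve_meas[OF h] s t)
    have fin: "wnorm 0 1 (\<lambda>\<xi>. h s \<xi> - h t \<xi>) < \<infinity>"
      using wnorm_diff[OF spectral_curve_meas[OF h s] spectral_curve_meas[OF h t], of 0 1] spectral_curve_finite[OF h s c, of 1] f
      by (auto simp: ennreal_mult_less_top elim!: order.strict_trans1)
    have "ennreal ((cmod (u s x - u t x))\<^sup>2) \<le> ennreal (japanese_int 1) * wnorm 0 1 (\<lambda>\<xi>. h s \<xi> - h t \<xi>)"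
      unfolding d[OF s] by (rule fourier_int_sup_bound[OF _ m]) simp
    also have "\<dots> = ennreal ((S s)\<^sup>2)"
      using fin by (simp add: S_def ennreal_mult less_top)
    finally have "(cmod (u s x - u t x))\<^sup>2 \<le> (S s)\<^sup>2" by (simp add: ennreal_le_iff)
    then show ?thesis by (rule power2_le_imp_le) (simp add: S_def)
  qed
  ultimately show "\<exists>S. (S \<longlongrightarrow> (0::real)) (at t within {0..T}) \<and> (\<forall>s\<in>{0..T}. \<forall>x. cmod (u s x - u t x) \<le> S s)" by blast
qed

lemma L2_Linf_diff: assumes u: "L2_Linf u" and v: "L2_Linf v" shows "L2_Linf (\<lambda>t x. u t x - v t x)"
  unfolding L2_Linf_def
proof (intro ballI conjI)
  fix t assume t: "t \<in> {0..T}"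
  have mu: "u s \<in> borel_measurable borel" and mv: "v s \<in> borel_measurable borel" if "s \<in> {0..T}" for s
    using u v that by (auto simp: L2_Linf_def)
  show "square_integrable (\<lambda>x. u t x - v t x)" using u v t by (auto simp: L2_Linf_def intro: sqi_diff)
  obtain K K' where K: "K \<ge> 0" "\<And>x. cmod (u t x) \<le> K" "K' \<ge> 0" "\<And>x. cmod (v t x) \<le> K'" using u v t unfolding L2_Linf_def by blast
  have "cmod (u t x - v t x) \<le> K + K'" for x by (rule order_trans[OF norm_triangle_ineq4 add_mono[OF K(2) K(4)]])
  then show "\<exists>K\<ge>0. \<forall>x. cmod (u t x - v t x) \<le> K" using K by (intro exI[of _ "K + K'"]) auto
  obtain S where S1: "(S \<longlongrightarrow> 0) (at t within {0..T})" "\<And>s x. s \<in> {0..T} \<Longrightarrow> cmod (u s x - u t x) \<le> S s" using L2_LinfD(4)[OF u t] by blast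
  obtain S' where S2: "(S' \<longlongrightarrow> 0) (at t within {0..T})" "\<And>s x. s \<in> {0..T} \<Longrightarrow> cmod (v s x - v t x) \<le> S' s" using L2_LinfD(4)[OF v t] by blast
  note S = S1 S2
  have "cmod (u s x - v s x - (u t x - v t x)) \<le> S s + S' s" if "s \<in> {0..T}" for s x
  proof -
    have "u s x - v s x - (u t x - v t x) = (u s x - u t x) - (v s x - v t x)" by simp
    then show ?thesis
      by (simp only:) (rule order_trans[OF norm_triangle_ineq4 add_mono[OF S(2)[OF that] S(4)[OF that]]])
  qed
  moreover have "((\<lambda>s. S s + S' s) \<longlongrightarrow> 0) (at t within {0..T})" using tendsto_add[OF S(1,3)] by simp
  ultimately show "\<exists>S. (S \<longlongrightarrow> (0::real)) (at t within {0..T}) \<and> (\<forall>s\<in>{0..T}. \<forall>x. cmod (u s x - v s x - (u t x - v t x)) \<le> S s)" by blast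
  have L: "((\<lambda>s. L2sq (\<lambda>x. u s x - u t x) + L2sq (\<lambda>x. v s x - v t x)) \<longlongrightarrow> 0) (at t within {0..T})"
    using u v t by (intro tendsto_add_0) (auto simp: L2_Linf_def)
  show "((\<lambda>s. L2sq (\<lambda>x. u s x - v s x - (u t x - v t x))) \<longlongrightarrow> 0) (at t within {0..T})"
  proof (rule ennreal_tendsto_0_le[OF L, where C=2], rule eventually_within_I)
    fix s assume s: "s \<in> {0..T}"
    have "L2sq (\<lambda>x. (u s x - u t x) - (v s x - v t x)) \<le> 2 * L2sq (\<lambda>x. u s x - u t x) + 2 * L2sq (\<lambda>x. v s x - v t x)"
      by (intro L2sq_diff borel_measurable_diff mu mv s t)
    then show "L2sq (\<lambda>x. u s x - v s x - (u t x - v t x)) \<le> ennreal 2 * (L2sq (\<lambda>x. u s x - u t x) + L2sq (\<lambda>x. v s x - v t x))"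
      by (simp add: distrib_left algebra_simps)
  qed
qed

lemma iexp_Lipschitz: "cmod (iexp a - iexp b) \<le> \<bar>a - b\<bar>"
proof -
  have "iexp a - iexp b = iexp b * (iexp (a - b) - 1)" by (simp add: exp_add[symmetric] algebra_simps)
  then have "cmod (iexp a - iexp b) = cmod (iexp (a - b) - 1)" by (simp add: norm_mult)
  also have "\<dots> \<le> \<bar>a - b\<bar>" using iexp_approx1[of "a - b" 0] by simp
  finally show ?thesis .
qed

text \<open>The exponential is 1-Lipschitz in the phase and \<open>u\<close> is bounded at the base
  time, so a small change of phase gives a small change of the product in both norms.\<close>

lemma L2_Linf_phase:
  assumes u: "L2_Linf u" and th: "L2_Linf (cr \<theta>)" shows "L2_Linf (\<lambda>t x. u t x * iexp (\<theta> t x))"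
  unfolding L2_Linf_def
proof (intro ballI conjI)
  fix t assume t: "t \<in> {0..T}"
  have mu: "u s \<in> borel_measurable borel" if "s \<in> {0..T}" for s using u that by (auto simp: L2_Linf_def)
  have mt: "(\<lambda>x. complex_of_real (\<theta> s x)) \<in> borel_measurable borel" if "s \<in> {0..T}" for s using th that by (auto simp: L2_Linf_def cr_def)
  have me: "(\<lambda>x. iexp (\<theta> s x)) \<in> borel_measurable borel" if "s \<in> {0..T}" for s using mt[OF that] by measurable
  have n: "L2sq (\<lambda>x. u t x * iexp (\<theta> t x)) = L2sq (u t)" by (simp add: L2sq_def norm_mult)
  show "square_integrable (\<lambda>x. u t x * iexp (\<theta> t x))" unfolding sqi_iff n using L2_LinfD(1)[OF u t] borel_measurable_times[OF mu[OF t] me[OF t]] by (simp add: sqi_iff)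
  obtain K where K: "K \<ge> 0" "\<And>x. cmod (u t x) \<le> K" using u t unfolding L2_Linf_def by blast
  show "\<exists>K\<ge>0. \<forall>x. cmod (u t x * iexp (\<theta> t x)) \<le> K" using K by (intro exI[of _ K]) (simp add: norm_mult)
  have pw: "cmod (u s x * iexp (\<theta> s x) - u t x * iexp (\<theta> t x)) \<le> 1 * cmod (u s x - u t x) + K * cmod (cr \<theta> s x - cr \<theta> t x)" for s x
  proof -
    have "u s x * iexp (\<theta> s x) - u t x * iexp (\<theta> t x) = (u s x - u t x) * iexp (\<theta> s x) + u t x * (iexp (\<theta> s x) - iexp (\<theta> t x))"
      by (simp add: algebra_simps)
    also have "cmod \<dots> \<le> cmod (u s x - u t x) + cmod (u t x) * cmod (iexp (\<theta> s x) - iexp (\<theta> t x))"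
      by (rule order_trans[OF norm_triangle_ineq]) (simp add: norm_mult)
    also have "\<dots> \<le> 1 * cmod (u s x - u t x) + K * cmod (cr \<theta> s x - cr \<theta> t x)"
    proof -
      have "cmod (cr \<theta> s x - cr \<theta> t x) = \<bar>\<theta> s x - \<theta> t x\<bar>" unfolding cr_def of_real_diff[symmetric] norm_of_real ..
      then have "cmod (u t x) * cmod (iexp (\<theta> s x) - iexp (\<theta> t x)) \<le> K * cmod (cr \<theta> s x - cr \<theta> t x)"
        using K iexp_Lipschitz[of "\<theta> s x" "\<theta> t x"] by (intro mult_mono) auto
      then show ?thesis by simp
    qed
    finally show ?thesis .
  qed
  obtain S where S1: "(S \<longlongrightarrow> 0) (at t within {0..T})" "\<And>s x. s \<in> {0..T} \<Longrightarrow> cmod (u s x - u t x) \<le> S s" using L2_LinfD(4)[OF u t] by blast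
  obtain S' where S2: "(S' \<longlongrightarrow> 0) (at t within {0..T})" "\<And>s x. s \<in> {0..T} \<Longrightarrow> cmod (cr \<theta> s x - cr \<theta> t x) \<le> S' s" using L2_LinfD(4)[OF th t] by blast
  note S = S1 S2
  have "cmod (u s x * iexp (\<theta> s x) - u t x * iexp (\<theta> t x)) \<le> S s + K * S' s" if "s \<in> {0..T}" for s x
    using pw[of s x] S(2)[OF that, of x] mult_left_mono[OF S(4)[OF that, of x] K(1)] by linarith
  moreover have "((\<lambda>s. S s + K * S' s) \<longlongrightarrow> 0 + K * 0) (at t within {0..T})" by (intro tendsto_intros S)
  ultimately show "\<exists>S. (S \<longlongrightarrow> (0::real)) (at t within {0..T}) \<and> (\<forall>s\<in>{0..T}. \<forall>x. cmod (u s x * iexp (\<theta> s x) - u t x * iexp (\<theta> t x)) \<le> S s)"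
    by (intro exI[of _ "\<lambda>s. S s + K * S' s"]) simp
  have L: "((\<lambda>s. L2sq (\<lambda>x. u s x - u t x) + L2sq (\<lambda>x. cr \<theta> s x - cr \<theta> t x)) \<longlongrightarrow> 0) (at t within {0..T})"
    using u th t by (intro tendsto_add_0) (auto simp: L2_Linf_def)
  show "((\<lambda>s. L2sq (\<lambda>x. u s x * iexp (\<theta> s x) - u t x * iexp (\<theta> t x))) \<longlongrightarrow> 0) (at t within {0..T})"
  proof (rule ennreal_tendsto_0_le[OF L, where C="2 + 2 * K\<^sup>2"], rule eventually_within_I)
    fix s assume s: "s \<in> {0..T}"
    have "L2sq (\<lambda>x. u s x * iexp (\<theta> s x) - u t x * iexp (\<theta> t x)) \<le> ennreal (2 * 1\<^sup>2) * L2sq (\<lambda>x. u s x - u t x) + ennreal (2 * K\<^sup>2) * L2sq (\<lambda>x. cr \<theta> s x - cr \<theta> t x)"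
    proof (rule L2sq_le_combo[OF _ _ _ pw])
      show "(\<lambda>x. u s x * iexp (\<theta> s x) - u t x * iexp (\<theta> t x)) \<in> borel_measurable borel"
        by (intro borel_measurable_diff borel_measurable_times mu me s t)
      show "(\<lambda>x. u s x - u t x) \<in> borel_measurable borel" by (intro borel_measurable_diff mu s t)
      show "(\<lambda>x. cr \<theta> s x - cr \<theta> t x) \<in> borel_measurable borel" unfolding cr_def by (intro borel_measurable_diff mt s t)
    qed (use K in auto)
    also have "\<dots> \<le> ennreal (2 + 2 * K\<^sup>2) * L2sq (\<lambda>x. u s x - u t x) + ennreal (2 + 2 * K\<^sup>2) * L2sq (\<lambda>x. cr \<theta> s x - cr \<theta> t x)"
      by (intro add_mono mult_right_mono ennreal_leI) auto
    finally show "L2sq (\<lambda>x. u s x * iexp (\<theta> s x) - u t x * iexp (\<theta> t x)) \<le> ennreal (2 + 2 * K\<^sup>2) * (L2sq (\<lambda>x. u s x - u t x) + L2sq (\<lambda>x. cr \<theta> s x - cr \<theta> t x))"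
      by (simp only: distrib_left)
  qed
qed

text \<open>Both parts of the norm are continuous in time: the L2 part by
  \<open>L2sqr_continuous\<close>, the essential supremum because it is 1-Lipschitz in the uniform
  distance.\<close>

lemma L2_Linf_measurable:
  assumes v: "L2_Linf v"
  shows "(\<lambda>t. L2_Linf_norm (v t)) \<in> borel_measurable (restrict_space lborel {0..T})"
proof -
  have sqv: "square_integrable (v t)" if "t \<in> {0..T}" for t using v that by (simp add: L2_Linf_def)
  have vm: "v t \<in> borel_measurable borel" if "t \<in> {0..T}" for t using sqv[OF that] by auto
  have c1: "continuous_on {0..T} (\<lambda>t. L2sqr (v t))"
    by (rule L2sqr_continuous) (use v in \<open>auto simp: L2_Linf_def\<close>)
  define e where "e t = enn2real (esssup lborel (\<lambda>x. ennreal (cmod (v t x))))" for t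
  have fin: "esssup lborel (\<lambda>x. ennreal (cmod (v t x))) = ennreal (e t)" if t: "t \<in> {0..T}" for t
  proof -
    obtain K where "K \<ge> 0" "\<And>x. cmod (v t x) \<le> K" using v t unfolding L2_Linf_def by blast
    then have "esssup lborel (\<lambda>x. ennreal (cmod (v t x))) \<le> ennreal K"
      using vm[OF t] by (intro esssup_I) (auto intro: ennreal_leI)
    then have "esssup lborel (\<lambda>x. ennreal (cmod (v t x))) < \<top>" by (rule le_less_trans) simp
    then show ?thesis by (simp add: e_def)
  qed
  have e0: "e t \<ge> 0" for t by (simp add: e_def)
  have le: "e s \<le> e t + D" if st: "s \<in> {0..T}" "t \<in> {0..T}" and D: "D \<ge> 0" "\<And>x. cmod (v s x - v t x) \<le> D" for s t D
  proof -
    have "esssup lborel (\<lambda>x. ennreal (cmod (v s x))) \<le> ennreal (e t + D)"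
    proof (rule esssup_I)
      show "(\<lambda>x. ennreal (cmod (v s x))) \<in> borel_measurable lborel" using vm[OF st(1)] by auto
      have "AE x in lborel. ennreal (cmod (v t x)) \<le> ennreal (e t)" unfolding fin[OF st(2), symmetric] by (rule esssup_AE)
      then show "AE x in lborel. ennreal (cmod (v s x)) \<le> ennreal (e t + D)"
      proof eventually_elim
        case (elim x)
        then have "cmod (v t x) \<le> e t" by (simp add: ennreal_le_iff e0)
        moreover have "cmod (v s x) \<le> cmod (v t x) + cmod (v s x - v t x)" using norm_triangle_ineq[of "v t x" "v s x - v t x"] by simp
        ultimately show ?case using D(2)[of x] by (intro ennreal_leI) linarith
      qed
    qed
    then show ?thesis unfolding fin[OF st(1)] using e0[of t] D(1) by (subst (asm) ennreal_le_iff) auto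
  qed
  have c2: "continuous_on {0..T} e"
    unfolding continuous_on_def
  proof
    fix t assume t: "t \<in> {0..T}"
    obtain S where S: "(S \<longlongrightarrow> (0::real)) (at t within {0..T})" "\<And>s x. s \<in> {0..T} \<Longrightarrow> cmod (v s x - v t x) \<le> S s" using v t unfolding L2_Linf_def by blast
    have "((\<lambda>s. e s - e t) \<longlongrightarrow> 0) (at t within {0..T})"
    proof (rule Lim_null_comparison[OF _ S(1)], rule eventually_within_I)
      fix s assume s: "s \<in> {0..T}"
      have S0: "S s \<ge> 0" using order_trans[OF norm_ge_zero S(2)[OF s]] .
      show "norm (e s - e t) \<le> S s"
        using le[OF s t S0 S(2)[OF s]] le[OF t s S0] S(2)[OF s] by (auto simp: norm_minus_commute abs_le_iff)
    qed
    then show "(e \<longlongrightarrow> e t) (at t within {0..T})" by (simp add: LIM_zero_iff)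
  qed
  have "(\<lambda>t. indicator {0..T} t *\<^sub>R (sqrt (L2sqr (v t)) + e t)) \<in> borel_measurable borel"
    by (rule borel_measurable_continuous_on_indicator) (auto intro!: continuous_intros c1 c2)
  then have "(\<lambda>t. ennreal (indicator {0..T} t *\<^sub>R (sqrt (L2sqr (v t)) + e t))) \<in> borel_measurable lborel" by measurable
  then have "(\<lambda>t. ennreal (indicator {0..T} t *\<^sub>R (sqrt (L2sqr (v t)) + e t))) \<in> borel_measurable (restrict_space lborel {0..T})"
    by (rule measurable_restrict_space1)
  then show ?thesis
  proof (rule measurable_cong[THEN iffD1, rotated])
    fix t assume "t \<in> space (restrict_space lborel {0..T})"
    then have t: "t \<in> {0..T}" by (simp add: space_restrict_space)
    have "ennsqrt (\<integral>\<^sup>+ x. ennreal ((cmod (v t x))\<^sup>2) \<partial>lborel) = ennreal (sqrt (L2sqr (v t)))"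
      unfolding L2sq_def[symmetric] using sqv[OF t] by (auto simp: ennsqrt_def L2sqr_def sqi_iff)
    then show "ennreal (indicator {0..T} t *\<^sub>R (sqrt (L2sqr (v t)) + e t)) = L2_Linf_norm (v t)"
      unfolding L2_Linf_norm_def fin[OF t] using t e0[of t] by (simp add: ennreal_plus)
  qed
qed

lemma Linf_L2_Linf_le:
  assumes v: "L2_Linf v" and A: "A \<ge> 0" "B \<ge> 0"
    and n: "\<And>t. t \<in> {0..T} \<Longrightarrow> L2sq (v t) \<le> ennreal (A\<^sup>2)" and s: "\<And>t x. t \<in> {0..T} \<Longrightarrow> cmod (v t x) \<le> B"
  shows "Linf_L2_Linf_norm T v \<le> ennreal (A + B)"
  unfolding Linf_L2_Linf_norm_def
proof (rule esssup_I[OF L2_Linf_measurable[OF v]], rule AE_I2)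
  fix t assume "t \<in> space (restrict_space lborel {0..T})"
  then have t: "t \<in> {0..T}" by (simp add: space_restrict_space)
  have "ennsqrt (\<integral>\<^sup>+ x. ennreal ((cmod (v t x))\<^sup>2) \<partial>lborel) \<le> ennreal A"
    unfolding L2sq_def[symmetric] by (rule ennsqrt_le[OF n[OF t] A(1)])
  moreover have "esssup lborel (\<lambda>x. ennreal (cmod (v t x))) \<le> ennreal B"
  proof (intro esssup_I AE_I2 ennreal_leI s[OF t])
    have "v t \<in> borel_measurable borel" using L2_LinfD(1)[OF v t] by auto
    then show "(\<lambda>x. ennreal (cmod (v t x))) \<in> borel_measurable lborel" by simp
  qed
  ultimately show "L2_Linf_norm (v t) \<le> ennreal (A + B)"
    unfolding L2_Linf_norm_def using A by (simp add: add_mono)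
qed

end

section \<open>The expansion and the WKB approximation\<close>

context shrinking_radius_reg
begin

section \<open>Combination of the two difference estimates\<close>

text \<open>The first difference has size \<open>8 * R + \<epsilon> * D\<close> and enters squared.
  In \<open>C\<close>, the number 132 is \<open>4 + 2 * 8\<^sup>2\<close>, the two middle terms
  belong to \<open>\<epsilon>\<^sup>2\<close>, and the last bracket is the crude bound for large
  \<open>R\<close>.\<close>

lemma second_order_bound:
  assumes y: "Y_bound (l + 1) T \<Lambda> \<phi>e" "Y_bound l T \<Lambda> ae" "Y_bound (l + 1) T \<Lambda> \<phi>" "Y_bound l T \<Lambda> a" and L: "\<Lambda> \<ge> 1"
    and y1: "Y_bound (l + 1) T C1 \<phi>1" "Y_bound l T C1 a1"
    and oe: "\<And>t x. t \<in> {0..T} \<Longrightarrow> ((\<lambda>s. \<phi>e s x) has_vector_derivative phase_rhs \<alpha> lam \<gamma> \<sigma> (Dx \<phi>e) ae t x) (at t within {0..T})"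
      "\<And>t x. t \<in> {0..T} \<Longrightarrow> ((\<lambda>s. ae s x) has_vector_derivative (\<i> * complex_of_real (\<epsilon> / 2) * Dx (Dx ae) t x + ampl_rhs \<alpha> \<gamma> (Dx \<phi>e) ae t x)) (at t within {0..T})"
    and o0: "\<And>t x. t \<in> {0..T} \<Longrightarrow> ((\<lambda>s. \<phi> s x) has_vector_derivative phase_rhs \<alpha> lam \<gamma> \<sigma> (Dx \<phi>) a t x) (at t within {0..T})"
      "\<And>t x. t \<in> {0..T} \<Longrightarrow> ((\<lambda>s. a s x) has_vector_derivative ampl_rhs \<alpha> \<gamma> (Dx \<phi>) a t x) (at t within {0..T})"
    and o1: "\<And>t x. t \<in> {0..T} \<Longrightarrow> ((\<lambda>s. \<phi>1 s x) has_vector_derivative phase_rhs_lin \<alpha> lam \<gamma> \<sigma> (Dx \<phi>) a (Dx \<phi>1) a1 t x) (at t within {0..T})"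
      "\<And>t x. t \<in> {0..T} \<Longrightarrow> ((\<lambda>s. a1 s x) has_vector_derivative (\<i> / 2 * Dx (Dx a) t x + ampl_rhs_lin \<alpha> \<gamma> (Dx \<phi>) a (Dx \<phi>1) a1 t x)) (at t within {0..T})"
    and C0: "Y_bound (l + 1) T C0 a" and C2: "Y_bound (l + 1) T C2 a1" and R: "R \<ge> 0"
    and i: "Hnorm_sq w0 (l + 1) (\<lambda>x. \<phi>e 0 x - \<phi> 0 x - of_real \<epsilon> * \<phi>1 0 x) \<le> ennreal (R\<^sup>2)" "Hnorm_sq w0 l (\<lambda>x. ae 0 x - a 0 x - of_real \<epsilon> * a1 0 x) \<le> ennreal (R\<^sup>2)"
    and g: "\<gamma> > 0" "\<sigma> > 0" and e: "\<epsilon> \<ge> 0" "\<epsilon> \<le> 1"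
    and M: "M \<ge> 8 * phase_const (alg_const l) \<alpha> lam \<gamma> \<sigma> \<Lambda>" "M \<ge> 8 * ampl_const (alg_const l) \<alpha> \<gamma> \<Lambda>"
    and C: "C = 132 + 2 * (8 * C1 + 2 * (C0 / M))\<^sup>2 + 2 * (C2 / M) + (8 * \<Lambda> + 2 * C1)"
  shows "Y_bound (l + 1) T (C * (R + \<epsilon>\<^sup>2)) (\<lambda>t x. \<phi>e t x - \<phi> t x - of_real \<epsilon> * \<phi>1 t x)"
    and "Y_bound l T (C * (R + \<epsilon>\<^sup>2)) (\<lambda>t x. ae t x - a t x - of_real \<epsilon> * a1 t x)"
proof -
  have T: "T \<in> {0..T}" and Z: "0 \<in> {0..T}" using T0 by auto
  let ?u = "\<lambda>t x. \<phi>e t x - \<phi> t x - of_real \<epsilon> * \<phi>1 t x" and ?v = "\<lambda>t x. ae t x - a t x - of_real \<epsilon> * a1 t x"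
  note n = Y_boundD(1)[OF y(1)] Y_boundD(1)[OF y(2)] Y_boundD(1)[OF y(3)] Y_boundD(1)[OF y(4)]
  note n1 = Y_boundD(1)[OF y1(1)] Y_boundD(1)[OF y1(2)]
  have nu: "analytic ?u" and nv: "analytic ?v" by (intro analytic_diff analytic_cmult n n1)+
  have Cn: "C0 \<ge> 0" "C1 \<ge> 0" "C2 \<ge> 0" using Y_boundD(2)[OF C0] Y_boundD(2)[OF y1(1)] Y_boundD(2)[OF C2] by auto
  have w0: "w 0 = w0" by (simp add: w_def)
  have cm: "cmod (of_real \<epsilon>) = \<epsilon>" using e by simp
  define D where "D = 8 * C1 + 2 * (C0 / M)"
  \<comment> \<open>The initial first difference is the initial remainder plus \<epsilon> times the
    corrector, whence a part of order \<epsilon> even for \<open>R = 0\<close>.\<close>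
  define R' where "R' = 2 * R + 2 * (\<epsilon> * C1)"
  have R'0: "R' \<ge> 0" using R e Cn by (simp add: R'_def)
  have i1: "Hnorm_sq w0 (l + 1) (\<lambda>x. \<phi>e 0 x - \<phi> 0 x) \<le> ennreal (R'\<^sup>2)"
  proof -
    have "Hnorm_sq w0 (l + 1) (\<lambda>x. ?u 0 x + of_real \<epsilon> * \<phi>1 0 x) \<le> ennreal 2 * Hnorm_sq w0 (l + 1) (?u 0) + ennreal 2 * Hnorm_sq w0 (l + 1) (\<lambda>x. of_real \<epsilon> * \<phi>1 0 x)"
      by (rule Hnorm_sq_add[OF nu analytic_cmult[OF n1(1)] Z])
    also have "\<dots> \<le> ennreal 2 * ennreal (R\<^sup>2) + ennreal 2 * ennreal ((\<epsilon> * C1)\<^sup>2)"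
      using i(1) Y_boundD(3)[OF Y_bound_cmult[OF T y1(1), of "of_real \<epsilon>"] Z] unfolding w0 cm by (intro add_mono mult_left_mono) auto
    also have "\<dots> \<le> ennreal (R'\<^sup>2)" unfolding R'_def by (rule sq_sum_bound) (use R e Cn in auto)
    finally show ?thesis by simp
  qed
  have i2: "Hnorm_sq w0 l (\<lambda>x. ae 0 x - a 0 x) \<le> ennreal (R'\<^sup>2)"
  proof -
    have "Hnorm_sq w0 l (\<lambda>x. ?v 0 x + of_real \<epsilon> * a1 0 x) \<le> ennreal 2 * Hnorm_sq w0 l (?v 0) + ennreal 2 * Hnorm_sq w0 l (\<lambda>x. of_real \<epsilon> * a1 0 x)"
      by (rule Hnorm_sq_add[OF nv analytic_cmult[OF n1(2)] Z])
    also have "\<dots> \<le> ennreal 2 * ennreal (R\<^sup>2) + ennreal 2 * ennreal ((\<epsilon> * C1)\<^sup>2)"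
      using i(2) Y_boundD(3)[OF Y_bound_cmult[OF T y1(2), of "of_real \<epsilon>"] Z] unfolding w0 cm by (intro add_mono mult_left_mono) auto
    also have "\<dots> \<le> ennreal (R'\<^sup>2)" unfolding R'_def by (rule sq_sum_bound) (use R e Cn in auto)
    finally show ?thesis by simp
  qed
  define d where "d = 4 * R' + 2 * (\<epsilon> * C0 / M)"
  have d1: "Y_bound (l + 1) T d (\<lambda>t x. \<phi>e t x - \<phi> t x)" and d2: "Y_bound l T d (\<lambda>t x. ae t x - a t x)"
    unfolding d_def by (rule first_difference_bound[OF y L oe o0 C0 R'0 i1 i2 g e(1) M]; assumption)+
  define m where "m = 4 * R + d\<^sup>2 + 2 * (\<epsilon>\<^sup>2 * C2 / M)"
  have m1: "Y_bound (l + 1) T m ?u" and m2: "Y_bound l T m ?v"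
    unfolding m_def by (rule second_difference_bound[OF y L y1 oe o0 o1 C2 R i g e(1) M d1 d2]; assumption)+
  \<comment> \<open>Bound by size alone: four times \<open>\<Lambda>\<close> for each of the two
    solutions and twice \<open>C1\<close> for the corrector.\<close>
  define C3 where "C3 = 8 * \<Lambda> + 2 * C1"
  have eC: "\<epsilon> * C1 \<le> C1" using mult_right_mono[OF e(2) Cn(2)] by simp
  have c1: "Y_bound (l + 1) T C3 ?u"
  proof (rule Y_bound_cong[OF Y_bound_mono T])
    show "Y_bound (l + 1) T (2 * (2 * \<Lambda> + 2 * (cmod (-1) * \<Lambda>)) + 2 * (cmod (- of_real \<epsilon>) * C1)) (\<lambda>t x. (\<phi>e t x + (-1) * \<phi> t x) + (- of_real \<epsilon>) * \<phi>1 t x)"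
      by (intro Y_bound_add[OF T] Y_bound_cmult[OF T] y y1)
    show "2 * (2 * \<Lambda> + 2 * (cmod (-1) * \<Lambda>)) + 2 * (cmod (- of_real \<epsilon>) * C1) \<le> C3" using e eC by (simp add: C3_def)
  qed simp
  have c2: "Y_bound l T C3 ?v"
  proof (rule Y_bound_cong[OF Y_bound_mono T])
    show "Y_bound l T (2 * (2 * \<Lambda> + 2 * (cmod (-1) * \<Lambda>)) + 2 * (cmod (- of_real \<epsilon>) * C1)) (\<lambda>t x. (ae t x + (-1) * a t x) + (- of_real \<epsilon>) * a1 t x)"
      by (intro Y_bound_add[OF T] Y_bound_cmult[OF T] y y1)
    show "2 * (2 * \<Lambda> + 2 * (cmod (-1) * \<Lambda>)) + 2 * (cmod (- of_real \<epsilon>) * C1) \<le> C3" using e eC by (simp add: C3_def)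
  qed simp
  have CC: "C = 132 + 2 * D\<^sup>2 + 2 * (C2 / M) + C3" using C by (simp add: D_def C3_def)
  have C30: "C3 \<ge> 0" "C2 / M \<ge> 0" using L Cn M0 by (auto simp: C3_def)
  \<comment> \<open>For \<open>R \<le> 1\<close> the quadratic term is linear in disguise, as
    \<open>R\<^sup>2 \<le> R\<close>. For larger \<open>R\<close> the claim exceeds
    \<open>C3\<close>, and the crude bound suffices.\<close>
  have "m \<le> C * (R + \<epsilon>\<^sup>2) \<or> C3 \<le> C * (R + \<epsilon>\<^sup>2)"
  proof (cases "R \<le> 1")
    case True
    have "d = 8 * R + \<epsilon> * D" by (simp add: d_def R'_def D_def algebra_simps)
    then have "d\<^sup>2 = (8 * R + \<epsilon> * D)\<^sup>2" by simp
    also have "\<dots> \<le> 128 * R\<^sup>2 + 2 * (D\<^sup>2 * \<epsilon>\<^sup>2)"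
      using zero_le_power2[of "8 * R - \<epsilon> * D"] by (simp add: power2_eq_square algebra_simps)
    also have "R\<^sup>2 \<le> R" using mult_left_mono[OF True R] by (simp add: power2_eq_square)
    finally have "m \<le> 132 * R + (2 * D\<^sup>2 + 2 * (C2 / M)) * \<epsilon>\<^sup>2" by (simp add: m_def algebra_simps)
    also have "\<dots> \<le> C * R + C * \<epsilon>\<^sup>2"
      using C30 R by (intro add_mono mult_right_mono) (auto simp: CC)
    finally show ?thesis by (simp add: distrib_left)
  next
    case False
    have "C3 * 1 \<le> C * (R + \<epsilon>\<^sup>2)"
    proof (rule mult_mono)
      show "C3 \<le> C" using C30 by (simp add: CC)
      show "1 \<le> R + \<epsilon>\<^sup>2" using False zero_le_power2[of \<epsilon>] by linarith
      show "0 \<le> C" using C30 by (simp add: CC)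
    qed simp
    then show ?thesis by simp
  qed
  then show "Y_bound (l + 1) T (C * (R + \<epsilon>\<^sup>2)) ?u" "Y_bound l T (C * (R + \<epsilon>\<^sup>2)) ?v"
    using Y_bound_mono[OF m1] Y_bound_mono[OF m2] Y_bound_mono[OF c1] Y_bound_mono[OF c2] by blast+
qed

section \<open>Passage to the wave function\<close>

text \<open>The error splits into one of amplitude and one of phase, and the phase error is divided
  by \<epsilon>. This is why the phase has to be known to second order: the corrector
  \<open>\<epsilon> * \<phi>1\<close> survives the division as the factor
  \<open>iexp \<phi>1\<close>, and only the remainder \<open>n\<close> is lost.\<close>

lemma wkb_bound:
  assumes W: "Y_bound (l + 1) T n (\<lambda>t x. cr \<phi>e t x - cr \<phi> t x - of_real \<epsilon> * cr \<phi>1 t x)"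
    and b: "Y_bound l T n (\<lambda>t x. ae t x - a t x - of_real \<epsilon> * a1 t x)"
    and a: "Y_bound l T \<Lambda> a" and a1: "Y_bound l T C1 a1"
    and an: "analytic (cr \<phi>e)" "analytic (cr \<phi>)" "analytic (cr \<phi>1)" "analytic ae" and e: "0 < \<epsilon>" "\<epsilon> \<le> 1"
    and K: "K = (2 + sqrt (japanese_int l)) * (2 + 2 * C1) + 2 * sqrt (japanese_int l) * \<Lambda> + japanese_int l * \<Lambda>"
  shows "Linf_L2_Linf_norm T (\<lambda>t x. ae t x * iexp (\<phi>e t x / \<epsilon>) - a t x * iexp (\<phi>1 t x) * iexp (\<phi> t x / \<epsilon>)) \<le> ennreal (K * (n / \<epsilon> + \<epsilon>))"
proof -
  have T: "T \<in> {0..T}" using T0 by simp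
  have l2: "l > 1/2" using l1 by simp
  define v where "v = (\<lambda>t x. ae t x * iexp (\<phi>e t x / \<epsilon>) - a t x * iexp (\<phi>1 t x) * iexp (\<phi> t x / \<epsilon>))"
  define W' where "W' = (\<lambda>t x. cr \<phi>e t x - cr \<phi> t x - of_real \<epsilon> * cr \<phi>1 t x)"
  \<comment> \<open>This is \<open>ae - a\<close>, written as remainder plus corrector so that the
    available bounds add up to a size of order \<open>n + \<epsilon>\<close>.\<close>
  define \<beta> where "\<beta> = (\<lambda>t x. (ae t x - a t x - of_real \<epsilon> * a1 t x) + of_real \<epsilon> * a1 t x)"
  define q where "q = sqrt (japanese_int l)"
  have q: "q \<ge> 0" "q * q = japanese_int l" by (auto simp: q_def)
  have n0: "n \<ge> 0" and L0: "\<Lambda> \<ge> 0" and C10: "C1 \<ge> 0" using Y_boundD(2)[OF W] Y_boundD(2)[OF a] Y_boundD(2)[OF a1] by auto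
  define p where "p = 2 * n + 2 * (\<epsilon> * C1)"
  have p0: "p \<ge> 0" using n0 e C10 by (simp add: p_def)
  have \<beta>: "Y_bound l T p \<beta>"
    unfolding \<beta>_def p_def using Y_bound_add[OF T b Y_bound_cmult[OF T a1, of "of_real \<epsilon>"]] e by simp
  have W': "Y_bound (l + 1) T n W'" using W unfolding W'_def .
  have scr: "cr (\<lambda>t x. \<theta> t x / \<epsilon>) = (\<lambda>t x. of_real (1 / \<epsilon>) * cr \<theta> t x)" for \<theta> by (simp add: cr_def)
  have v_L2_Linf: "L2_Linf v"
    unfolding v_def
    by (intro L2_Linf_diff L2_Linf_phase L2_Linf_analytic an Y_boundD(1)[OF a]) (simp_all add: scr analytic_cmult[OF an(1), of "of_real (1 / \<epsilon>)", simplified] analytic_cmult[OF an(2), of "of_real (1 / \<epsilon>)", simplified])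
  have asup: "cmod (a t x) \<le> q * \<Lambda>" if "t \<in> {0..T}" for t x
    unfolding q_def by (rule analytic_sup_le[OF Y_boundD(1)[OF a] that l2 Y_boundD(3)[OF a that] L0])
  have pw: "cmod (v t x) \<le> 1 * cmod (\<beta> t x) + (q * \<Lambda> / \<epsilon>) * cmod (W' t x)" if t: "t \<in> {0..T}" for t x
  proof -
    \<comment> \<open>The exact and the approximate phase, both already divided by \<epsilon>; their
      difference is \<open>W' / \<epsilon>\<close>.\<close>
    let ?A = "\<phi>e t x / \<epsilon>" and ?B = "\<phi>1 t x + \<phi> t x / \<epsilon>"
    have "v t x = \<beta> t x * iexp ?A + a t x * (iexp ?A - iexp ?B)"
      by (simp add: v_def \<beta>_def exp_add distrib_left algebra_simps)
    also have "cmod \<dots> \<le> cmod (\<beta> t x) + cmod (a t x) * cmod (iexp ?A - iexp ?B)"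
      by (rule order_trans[OF norm_triangle_ineq]) (simp add: norm_mult)
    also have "\<dots> \<le> 1 * cmod (\<beta> t x) + (q * \<Lambda>) * (cmod (W' t x) / \<epsilon>)"
    proof -
      have "W' t x = complex_of_real (\<epsilon> * (?A - ?B))" using e by (simp add: W'_def cr_def field_simps)
      then have "cmod (W' t x) = \<epsilon> * \<bar>?A - ?B\<bar>" using e(1) by (simp only: norm_of_real abs_mult abs_of_pos)
      then have "cmod (iexp ?A - iexp ?B) \<le> cmod (W' t x) / \<epsilon>" using iexp_Lipschitz[of ?A ?B] e by simp
      then have "cmod (a t x) * cmod (iexp ?A - iexp ?B) \<le> (q * \<Lambda>) * (cmod (W' t x) / \<epsilon>)"
        using asup[OF t, of x] q L0 by (intro mult_mono) auto
      then show ?thesis by simp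
    qed
    finally show ?thesis by simp
  qed
  define A where "A = 2 * p + 2 * (q * \<Lambda> / \<epsilon> * n)"
  define B where "B = q * p + q * \<Lambda> / \<epsilon> * (q * n)"
  have z: "q * \<Lambda> / \<epsilon> \<ge> 0" using q L0 e by simp
  have "Linf_L2_Linf_norm T v \<le> ennreal (A + B)"
  proof (rule Linf_L2_Linf_le[OF v_L2_Linf])
    show "A \<ge> 0" unfolding A_def by (intro add_nonneg_nonneg mult_nonneg_nonneg p0 n0 z) simp_all
    show "B \<ge> 0" unfolding B_def by (intro add_nonneg_nonneg mult_nonneg_nonneg p0 n0 z q)
    fix t assume t: "t \<in> {0..T}"
    have vm: "v t \<in> borel_measurable borel" using L2_LinfD(1)[OF v_L2_Linf t] by auto
    have "L2sq (v t) \<le> ennreal (2 * 1\<^sup>2) * L2sq (\<beta> t) + ennreal (2 * (q * \<Lambda> / \<epsilon>)\<^sup>2) * L2sq (W' t)"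
      by (rule L2sq_le_combo[OF vm analytic_L2sq_le(2)[OF Y_boundD(1)[OF \<beta>] t] analytic_L2sq_le(2)[OF Y_boundD(1)[OF W'] t] pw[OF t]]) (use z l1 in auto)
    also have "\<dots> \<le> ennreal (2 * 1\<^sup>2) * ennreal (p\<^sup>2) + ennreal (2 * (q * \<Lambda> / \<epsilon>)\<^sup>2) * ennreal (n\<^sup>2)"
      by (intro add_mono mult_left_mono order_trans[OF analytic_L2sq_le(1)[OF Y_boundD(1)[OF \<beta>] t] Y_boundD(3)[OF \<beta> t]] order_trans[OF analytic_L2sq_le(1)[OF Y_boundD(1)[OF W'] t] Y_boundD(3)[OF W' t]])
         (use l1 in auto)
    also have "\<dots> = ennreal 2 * ennreal (p\<^sup>2) + ennreal 2 * ennreal ((q * \<Lambda> / \<epsilon> * n)\<^sup>2)"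
      by (subst power_mult_distrib[of _ n]) (simp add: ennreal_mult mult.assoc del: power_mult_distrib times_divide_eq_left times_divide_eq_right)
    also have "\<dots> \<le> ennreal (A\<^sup>2)" unfolding A_def by (rule sq_sum_bound[OF p0 mult_nonneg_nonneg[OF z n0]])
    finally show "L2sq (v t) \<le> ennreal (A\<^sup>2)" .
    fix x
    have "cmod (\<beta> t x) \<le> q * p" unfolding q_def by (rule analytic_sup_le[OF Y_boundD(1)[OF \<beta>] t l2 Y_boundD(3)[OF \<beta> t] p0])
    moreover have "cmod (W' t x) \<le> q * n" unfolding q_def
      by (rule analytic_sup_le[OF Y_boundD(1)[OF W'] t l2 _ n0], rule order_trans[OF Hnorm_sq_mono Y_boundD(3)[OF W' t]]) simp
    ultimately have "1 * cmod (\<beta> t x) + (q * \<Lambda> / \<epsilon>) * cmod (W' t x) \<le> 1 * (q * p) + (q * \<Lambda> / \<epsilon>) * (q * n)"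
      using z by (intro add_mono mult_left_mono) auto
    then show "cmod (v t x) \<le> B" using pw[OF t, of x] by (simp add: B_def)
  qed
  also have "\<dots> \<le> ennreal (K * (n / \<epsilon> + \<epsilon>))"
  proof (rule ennreal_leI)
    \<comment> \<open>As \<open>\<epsilon> \<le> 1\<close>, the amplitude error \<open>n\<close> is
      dominated by the phase error \<open>n / \<epsilon>\<close>.\<close>
    define r where "r = n / \<epsilon>"
    have r0: "r \<ge> 0" using n0 e by (simp add: r_def)
    have nr: "n \<le> r" using e n0 by (simp add: r_def pos_le_divide_eq mult_left_le)
    have "p \<le> (2 + 2 * C1) * (r + \<epsilon>)"
    proof -
      have "0 \<le> C1 * r" "0 \<le> \<epsilon>" using C10 r0 e by auto
      then show ?thesis using nr by (simp add: p_def algebra_simps)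
    qed
    then have "(2 + q) * p \<le> (2 + q) * ((2 + 2 * C1) * (r + \<epsilon>))" using q by (intro mult_left_mono) auto
    moreover have "A + B = (2 + q) * p + (2 * q * \<Lambda> + japanese_int l * \<Lambda>) * r"
      unfolding A_def B_def r_def q(2)[symmetric] by (simp add: algebra_simps)
    moreover have "(2 * q * \<Lambda> + japanese_int l * \<Lambda>) * r \<le> (2 * q * \<Lambda> + japanese_int l * \<Lambda>) * (r + \<epsilon>)"
      using q L0 e by (intro mult_left_mono) auto
    ultimately have "A + B \<le> ((2 + q) * (2 + 2 * C1) + (2 * q * \<Lambda> + japanese_int l * \<Lambda>)) * (r + \<epsilon>)" by (simp add: distrib_right mult.assoc)
    then show "A + B \<le> K * (n / \<epsilon> + \<epsilon>)" unfolding K q_def[symmetric] r_def by (simp add: add.assoc)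
  qed
  finally show ?thesis unfolding v_def .
qed

end

context shrinking_radius
begin

section \<open>Initial data and the choice of constants\<close>

text \<open>Functions that agree almost everywhere have the same Plancherel limits, so
  \<open>SOME\<close> picks literally the same transform and the norms of the initial data carry
  over.\<close>

lemma Hnorm_initial:
  assumes u: "analytic u" and f: "square_integrable f" and ae: "AE x in lborel. u 0 x = f x"
  shows "fourier (u 0) = fourier f"
proof -
  have Z: "0 \<in> {0..T}" using T0 by simp
  show ?thesis by (rule fourier_cong_AE(1)[OF ae analytic_L2sq_le(2)[OF u Z order_refl]]) (use f in auto)
qed

end

theorem theorem1p4:
  fixes \<alpha> lam w0 l :: real and \<gamma> \<sigma> :: nat
    and g f :: "real \<Rightarrow> real"
    and \<phi>0 \<phi>10 :: "real \<Rightarrow> real" and a0 a10 :: "real \<Rightarrow> complex"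
    and \<phi>0e :: "real \<Rightarrow> real \<Rightarrow> real" and a0e :: "real \<Rightarrow> real \<Rightarrow> complex"
    and r1 :: "real \<Rightarrow> real"
  assumes "\<gamma> > 0" and "\<sigma> > 0"
    and g_eq: "g = (\<lambda>s. \<alpha> * s ^ \<gamma>)"
    and f_eq: "f = (\<lambda>s. lam * s ^ \<sigma>)"
    and "w0 > 0" and "l > 1"
    and "(\<lambda>x. complex_of_real (\<phi>0 x)) \<in> Hspace w0 (l + 3)" and "a0 \<in> Hspace w0 (l + 2)"
    and "(\<lambda>x. complex_of_real (\<phi>10 x)) \<in> Hspace w0 (l + 2)" and "a10 \<in> Hspace w0 (l + 1)"
    and "\<forall>\<epsilon>\<in>{0<..1}. (\<lambda>x. complex_of_real (\<phi>0e \<epsilon> x)) \<in> Hspace w0 (l + 1) \<and> a0e \<epsilon> \<in> Hspace w0 l"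
    and "\<exists>B::real. \<forall>\<epsilon>\<in>{0<..1}. Hnorm w0 (l + 1) (\<lambda>x. complex_of_real (\<phi>0e \<epsilon> x)) \<le> ennreal B
                        \<and> Hnorm w0 l (a0e \<epsilon>) \<le> ennreal B"
    and r1_eq: "r1 = (\<lambda>\<epsilon>. enn2real
           (Hnorm w0 (l + 1) (\<lambda>x. complex_of_real (\<phi>0e \<epsilon> x - \<phi>0 x - \<epsilon> * \<phi>10 x))
            + Hnorm w0 l (\<lambda>x. a0e \<epsilon> x - a0 x - complex_of_real \<epsilon> * a10 x)))"
    and "r1 \<in> o[at_right 0](\<lambda>\<epsilon>. \<epsilon>)"
  shows "\<exists>M0>0. \<forall>M\<ge>M0. \<forall>T. 0 < T \<and> T < w0 / M \<longrightarrow>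
    (let w = (\<lambda>t. w0 - M * t) in
     \<forall>\<phi>e ae \<phi> a \<phi>1 a1.
       (\<forall>\<epsilon>\<in>{0<..1}. (\<lambda>t x. complex_of_real (\<phi>e \<epsilon> t x), ae \<epsilon>) \<in> X_space w T l
                    \<and> solves_S g f \<epsilon> T (\<phi>0e \<epsilon>) (a0e \<epsilon>) (\<phi>e \<epsilon>) (ae \<epsilon>)) \<longrightarrow>
       (\<lambda>t x. complex_of_real (\<phi> t x), a) \<in> X_space w T (l + 2) \<longrightarrow>
       solves_S g f 0 T \<phi>0 a0 \<phi> a \<longrightarrow>
       (\<lambda>t x. complex_of_real (\<phi>1 t x), a1) \<in> X_space w T (l + 1) \<longrightarrow>
       solves_linearized g f T \<phi> a \<phi>10 a10 \<phi>1 a1 \<longrightarrow>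
       (\<exists>C>0. \<forall>\<epsilon>\<in>{0<..1}.
          triple_norm w M (l + 1) T (\<lambda>t x. complex_of_real (\<phi>e \<epsilon> t x - \<phi> t x - \<epsilon> * \<phi>1 t x))
          + triple_norm w M l T (\<lambda>t x. ae \<epsilon> t x - a t x - complex_of_real \<epsilon> * a1 t x)
          \<le> ennreal (C * (r1 \<epsilon> + \<epsilon>\<^sup>2))) \<and>
       (let err = (\<lambda>\<epsilon>. Linf_L2_Linf_norm T (\<lambda>t x.
              ae \<epsilon> t x * exp (\<i> * complex_of_real (\<phi>e \<epsilon> t x / \<epsilon>))
              - a t x * exp (\<i> * complex_of_real (\<phi>1 t x)) * exp (\<i> * complex_of_real (\<phi> t x / \<epsilon>))))
        in (\<exists>C>0. \<forall>\<^sub>F \<epsilon> in at_right 0. err \<epsilon> \<le> ennreal (C * (r1 \<epsilon> / \<epsilon> + \<epsilon>)))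
           \<and> (err \<longlongrightarrow> 0) (at_right 0)))"
proof -
  let ?c = complex_of_real
  obtain Be where Be: "\<And>\<epsilon>. \<epsilon> \<in> {0<..1} \<Longrightarrow> Hnorm w0 (l + 1) (\<lambda>x. ?c (\<phi>0e \<epsilon> x)) \<le> ennreal Be \<and> Hnorm w0 l (a0e \<epsilon>) \<le> ennreal Be"
    using assms(12) by blast
  have mono: "Hnorm w0 r u < \<infinity>" if "u \<in> Hspace w0 s" "r \<le> s" for r s u
  proof -
    have "Hnorm_sq w0 r u \<le> Hnorm_sq w0 s u" unfolding Hnorm_sq_eq_wnorm by (rule wnorm_mono) (use that in auto)
    then have "Hnorm w0 r u \<le> Hnorm w0 s u" unfolding Hnorm_def by (rule ennsqrt_mono)
    also have "\<dots> < \<infinity>" using that by (simp add: Hspace_def)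
    finally show ?thesis .
  qed
  \<comment> \<open>One bound for the perturbed and the limit data, so that all solutions get the
    same size \<open>\<Lambda>\<close> and the same threshold for \<open>M\<close>.\<close>
  define B where "B = \<bar>Be\<bar> + enn2real (Hnorm w0 (l + 1) (\<lambda>x. ?c (\<phi>0 x))) + enn2real (Hnorm w0 l a0)"
  have B0: "B \<ge> 0" by (simp add: B_def)
  have Bsq: "Hnorm_sq w0 r u \<le> ennreal (B\<^sup>2)" if "Hnorm w0 r u \<le> ennreal B" for r u
    using ennsqrt_leD[of "Hnorm_sq w0 r u" B] that B0 by (simp add: Hnorm_def)
  have BeB: "ennreal Be \<le> ennreal B" unfolding B_def by (intro ennreal_leI) (smt (verit) enn2real_nonneg)
  have B1: "Hnorm_sq w0 (l + 1) (\<lambda>x. ?c (\<phi>0 x)) \<le> ennreal (B\<^sup>2)"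
  proof (rule Bsq)
    have "Hnorm w0 (l + 1) (\<lambda>x. ?c (\<phi>0 x)) = ennreal (enn2real (Hnorm w0 (l + 1) (\<lambda>x. ?c (\<phi>0 x))))"
      using mono[OF assms(7), of "l + 1"] by (simp add: less_top)
    also have "\<dots> \<le> ennreal B" unfolding B_def by (intro ennreal_leI) (smt (verit) enn2real_nonneg)
    finally show "Hnorm w0 (l + 1) (\<lambda>x. ?c (\<phi>0 x)) \<le> ennreal B" .
  qed
  have B2: "Hnorm_sq w0 l a0 \<le> ennreal (B\<^sup>2)"
  proof (rule Bsq)
    have "Hnorm w0 l a0 = ennreal (enn2real (Hnorm w0 l a0))"
      using mono[OF assms(8), of l] by (simp add: less_top)
    also have "\<dots> \<le> ennreal B" unfolding B_def by (intro ennreal_leI) (smt (verit) enn2real_nonneg)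
    finally show "Hnorm w0 l a0 \<le> ennreal B" .
  qed
  define \<Lambda> where "\<Lambda> = 4 * B + 3"
  define Kphi where "Kphi = phase_const (alg_const l) \<alpha> lam \<gamma> \<sigma> \<Lambda>"
  define Kampl where "Kampl = ampl_const (alg_const l) \<alpha> \<gamma> \<Lambda>"
  \<comment> \<open>Absolute values spare a discussion of signs; the factor 8 is the one of
    \<open>half_absorb\<close>, and the 1 makes the threshold positive.\<close>
  define M0 where "M0 = 1 + 8 * \<bar>Kphi\<bar> + 8 * \<bar>Kampl\<bar>"
  show ?thesis
  proof (intro exI[of _ M0] conjI allI impI)
    show "M0 > 0" by (simp add: M0_def)
    fix M T assume M: "M \<ge> M0" and T: "0 < T \<and> T < w0 / M"
    have Mpos: "M > 0" using M by (simp add: M0_def)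
    have MT: "M * T < w0" using T Mpos by (simp add: field_simps)
    interpret E: shrinking_radius_reg w0 M T l
      by unfold_locales (use Mpos T MT assms(6) in auto)
    have MK: "M \<ge> 8 * phase_const (alg_const l) \<alpha> lam \<gamma> \<sigma> \<Lambda>" "M \<ge> 8 * ampl_const (alg_const l) \<alpha> \<gamma> \<Lambda>"
      using M abs_ge_self[of Kphi] abs_ge_self[of Kampl] abs_ge_zero[of Kphi] abs_ge_zero[of Kampl]
      unfolding M0_def Kphi_def Kampl_def by linarith+
    have MK1: "M \<ge> phase_const (alg_const l) \<alpha> lam \<gamma> \<sigma> (4 * B + 3)" "M \<ge> ampl_const (alg_const l) \<alpha> \<gamma> (4 * B + 3)"
      using M abs_ge_self[of Kphi] abs_ge_self[of Kampl] abs_ge_zero[of Kphi] abs_ge_zero[of Kampl]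
      unfolding M0_def Kphi_def Kampl_def \<Lambda>_def by linarith+
    have wE: "(\<lambda>t. w0 - M * t) = E.w" by (simp add: E.w_def fun_eq_iff)
    have w0E: "E.w 0 = w0" by (simp add: E.w_def)
    have TT: "T \<in> {0..T}" and ZZ: "0 \<in> {0..T}" using T by auto
    show "let w = \<lambda>t. w0 - M * t in
     \<forall>\<phi>e ae \<phi> a \<phi>1 a1.
       (\<forall>\<epsilon>\<in>{0<..1}. (\<lambda>t x. ?c (\<phi>e \<epsilon> t x), ae \<epsilon>) \<in> X_space w T l
                    \<and> solves_S g f \<epsilon> T (\<phi>0e \<epsilon>) (a0e \<epsilon>) (\<phi>e \<epsilon>) (ae \<epsilon>)) \<longrightarrow>
       (\<lambda>t x. ?c (\<phi> t x), a) \<in> X_space w T (l + 2) \<longrightarrow>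
       solves_S g f 0 T \<phi>0 a0 \<phi> a \<longrightarrow>
       (\<lambda>t x. ?c (\<phi>1 t x), a1) \<in> X_space w T (l + 1) \<longrightarrow>
       solves_linearized g f T \<phi> a \<phi>10 a10 \<phi>1 a1 \<longrightarrow>
       (\<exists>C>0. \<forall>\<epsilon>\<in>{0<..1}.
          triple_norm w M (l + 1) T (\<lambda>t x. ?c (\<phi>e \<epsilon> t x - \<phi> t x - \<epsilon> * \<phi>1 t x))
          + triple_norm w M l T (\<lambda>t x. ae \<epsilon> t x - a t x - ?c \<epsilon> * a1 t x)
          \<le> ennreal (C * (r1 \<epsilon> + \<epsilon>\<^sup>2))) \<and>
       (let err = (\<lambda>\<epsilon>. Linf_L2_Linf_norm T (\<lambda>t x.
              ae \<epsilon> t x * exp (\<i> * ?c (\<phi>e \<epsilon> t x / \<epsilon>))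
              - a t x * exp (\<i> * ?c (\<phi>1 t x)) * exp (\<i> * ?c (\<phi> t x / \<epsilon>))))
        in (\<exists>C>0. \<forall>\<^sub>F \<epsilon> in at_right 0. err \<epsilon> \<le> ennreal (C * (r1 \<epsilon> / \<epsilon> + \<epsilon>)))
           \<and> (err \<longlongrightarrow> 0) (at_right 0))"
      unfolding Let_def wE
    proof (intro allI impI)
      fix \<phi>e ae \<phi> a \<phi>1 a1
      assume He: "\<forall>\<epsilon>\<in>{0<..1}. (\<lambda>t x. ?c (\<phi>e \<epsilon> t x), ae \<epsilon>) \<in> X_space E.w T l \<and> solves_S g f \<epsilon> T (\<phi>0e \<epsilon>) (a0e \<epsilon>) (\<phi>e \<epsilon>) (ae \<epsilon>)"
        and X0: "(\<lambda>t x. ?c (\<phi> t x), a) \<in> X_space E.w T (l + 2)" and S0: "solves_S g f 0 T \<phi>0 a0 \<phi> a"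
        and X1: "(\<lambda>t x. ?c (\<phi>1 t x), a1) \<in> X_space E.w T (l + 1)" and S1: "solves_linearized g f T \<phi> a \<phi>10 a10 \<phi>1 a1"
      note sq7 = assms(7-10)[unfolded Hspace_def, simplified]
      have tw0: "twice_x_differentiable T \<phi>" "twice_x_differentiable T a" using S0 by (auto simp: solves_S_def)
      have tw1: "twice_x_differentiable T \<phi>1" "twice_x_differentiable T a1" using S1 by (auto simp: solves_linearized_def)
      have Y0: "E.cr \<phi> \<in> Y_space E.w T (l + 3)" "a \<in> Y_space E.w T (l + 2)"
        using X0 by (auto simp: X_space_def E.cr_def add.assoc)
      have Y1: "E.cr \<phi>1 \<in> Y_space E.w T (l + 2)" "a1 \<in> Y_space E.w T (l + 1)"
        using X1 by (auto simp: X_space_def E.cr_def add.assoc)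
      have l1: "l > 1" by (rule assms(6))
      have G0: "E.regular_curve (l + 1) (E.cr \<phi>)" "E.regular_curve l a" "E.regular_curve (l + 1) a"
        by (rule E.regular_curve_of_Y[OF Y0(1)] E.regular_curve_of_Y[OF Y0(2)]; use l1 tw0 in \<open>auto intro: E.cont_cr E.cont_of_twice\<close>)+
      have G1: "E.regular_curve (l + 1) (E.cr \<phi>1)" "E.regular_curve l a1" "E.regular_curve (l + 1) a1"
        by (rule E.regular_curve_of_Y[OF Y1(1)] E.regular_curve_of_Y[OF Y1(2)]; use l1 tw1 in \<open>auto intro: E.cont_cr E.cont_of_twice\<close>)+
      have n0: "E.analytic (E.cr \<phi>)" "E.analytic a" "E.analytic (E.cr \<phi>1)" "E.analytic a1" using G0 G1 by (auto simp: E.regular_curve_def)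
      \<comment> \<open>The amplitudes \<open>a\<close> and \<open>a1\<close> are taken at order
        \<open>l + 1\<close>, since their second derivatives appear as sources of order
        \<open>l\<close>.\<close>
      obtain C0 where C0: "E.Y_bound (l + 1) T C0 a" using E.regular_curve_Y_bound[OF G0(3)] by blast
      obtain C2 where C2: "E.Y_bound (l + 1) T C2 a1" using E.regular_curve_Y_bound[OF G1(3)] by blast
      obtain C1a where C1a: "E.Y_bound (l + 1) T C1a (E.cr \<phi>1)" using E.regular_curve_Y_bound[OF G1(1)] by blast
      obtain C1b where C1b: "E.Y_bound l T C1b a1" using E.regular_curve_Y_bound[OF G1(2)] by blast
      define C1 where "C1 = max C1a C1b"
      have C1: "E.Y_bound (l + 1) T C1 (E.cr \<phi>1)" "E.Y_bound l T C1 a1"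
        using E.Y_bound_mono[OF C1a] E.Y_bound_mono[OF C1b] by (auto simp: C1_def)
      note ode0 = E.solves_S_ode[OF S0[unfolded g_eq f_eq]]
      note ode1 = E.solves_lin_ode[OF S1[unfolded g_eq f_eq] _ tw0(1) n0(2,4) assms(1)]
      have AE0: "AE x in lborel. E.cr \<phi> 0 x = ?c (\<phi>0 x)" "AE x in lborel. a 0 x = a0 x"
        using S0 by (auto simp: solves_S_def E.cr_def elim: eventually_mono)
      have AE1: "AE x in lborel. E.cr \<phi>1 0 x = ?c (\<phi>10 x)" "AE x in lborel. a1 0 x = a10 x"
        using S1 by (auto simp: solves_linearized_def E.cr_def elim: eventually_mono)
      have bt0: "E.Y_bound (l + 1) T \<Lambda> (E.cr \<phi>)" "E.Y_bound l T \<Lambda> a"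
      proof -
        have i: "Hnorm_sq w0 (l + 1) (E.cr \<phi> 0) \<le> ennreal (B\<^sup>2)" "Hnorm_sq w0 l (a 0) \<le> ennreal (B\<^sup>2)"
          using B1 B2 E.Hnorm_initial[OF n0(1) _ AE0(1)] E.Hnorm_initial[OF n0(2) _ AE0(2)] sq7 by (auto simp: Hnorm_sq_def)
        show "E.Y_bound (l + 1) T \<Lambda> (E.cr \<phi>)" "E.Y_bound l T \<Lambda> a"
          unfolding \<Lambda>_def by (rule E.uniform_bound[OF G0(1,2) B0 i ode0 assms(1,2) MK1]; assumption)+
      qed
      \<comment> \<open>At \<open>\<epsilon> = 0\<close> the dispersive term disappears.\<close>
      have o0: "((\<lambda>s. a s x) has_vector_derivative ampl_rhs \<alpha> \<gamma> (Dx (E.cr \<phi>)) a t x) (at t within {0..T})" if "t \<in> {0..T}" for t x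
        using ode0(2)[OF that, of x] by simp
      have L1: "\<Lambda> \<ge> 1" using B0 by (simp add: \<Lambda>_def)
      define C where "C = 132 + 2 * (8 * C1 + 2 * (C0 / M))\<^sup>2 + 2 * (C2 / M) + (8 * \<Lambda> + 2 * C1)"
      have Cn: "C1 \<ge> 0" "C2 \<ge> 0" using E.Y_boundD(2)[OF C1(1)] E.Y_boundD(2)[OF C2] by auto
      have C132: "C \<ge> 132"
      proof -
        have "0 \<le> C2 / M" using Cn Mpos by simp
        then show ?thesis unfolding C_def using Cn L1 zero_le_power2[of "8 * C1 + 2 * (C0 / M)"] by linarith
      qed
      have main: "0 \<le> r1 \<epsilon> \<and> E.analytic (E.cr (\<phi>e \<epsilon>)) \<and> E.analytic (ae \<epsilon>) \<and>
          E.Y_bound (l + 1) T (C * (r1 \<epsilon> + \<epsilon>\<^sup>2)) (\<lambda>t x. E.cr (\<phi>e \<epsilon>) t x - E.cr \<phi> t x - ?c \<epsilon> * E.cr \<phi>1 t x) \<and>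
          E.Y_bound l T (C * (r1 \<epsilon> + \<epsilon>\<^sup>2)) (\<lambda>t x. ae \<epsilon> t x - a t x - ?c \<epsilon> * a1 t x)" if e: "\<epsilon> \<in> {0<..1}" for \<epsilon>
      proof -
        have Xe: "(\<lambda>t x. ?c (\<phi>e \<epsilon> t x), ae \<epsilon>) \<in> X_space E.w T l" and Se: "solves_S g f \<epsilon> T (\<phi>0e \<epsilon>) (a0e \<epsilon>) (\<phi>e \<epsilon>) (ae \<epsilon>)"
          using He e by auto
        have twe: "twice_x_differentiable T (\<phi>e \<epsilon>)" "twice_x_differentiable T (ae \<epsilon>)" using Se by (auto simp: solves_S_def)
        have Ye: "E.cr (\<phi>e \<epsilon>) \<in> Y_space E.w T (l + 1)" "ae \<epsilon> \<in> Y_space E.w T l"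
          using Xe by (auto simp: X_space_def E.cr_def)
        have Ge: "E.regular_curve (l + 1) (E.cr (\<phi>e \<epsilon>))" "E.regular_curve l (ae \<epsilon>)"
          by (rule E.regular_curve_of_Y[OF Ye(1)] E.regular_curve_of_Y[OF Ye(2)]; use l1 twe in \<open>auto intro: E.cont_cr E.cont_of_twice\<close>)+
        have ne: "E.analytic (E.cr (\<phi>e \<epsilon>))" "E.analytic (ae \<epsilon>)" using Ge by (auto simp: E.regular_curve_def)
        have AEe: "AE x in lborel. E.cr (\<phi>e \<epsilon>) 0 x = ?c (\<phi>0e \<epsilon> x)" "AE x in lborel. ae \<epsilon> 0 x = a0e \<epsilon> x"
          using Se by (auto simp: solves_S_def E.cr_def elim: eventually_mono)
        have sqe: "square_integrable (\<lambda>x. ?c (\<phi>0e \<epsilon> x))" "square_integrable (a0e \<epsilon>)"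
          using assms(11) e by (auto simp: Hspace_def)
        note odee = E.solves_S_ode[OF Se[unfolded g_eq f_eq]]
        have ie: "Hnorm_sq w0 (l + 1) (E.cr (\<phi>e \<epsilon>) 0) \<le> ennreal (B\<^sup>2)" "Hnorm_sq w0 l (ae \<epsilon> 0) \<le> ennreal (B\<^sup>2)"
          using Bsq[OF order_trans[OF conjunct1[OF Be[OF e]] BeB]] Bsq[OF order_trans[OF conjunct2[OF Be[OF e]] BeB]]
            E.Hnorm_initial[OF ne(1) sqe(1) AEe(1)] E.Hnorm_initial[OF ne(2) sqe(2) AEe(2)] by (auto simp: Hnorm_sq_def)
        have bte: "E.Y_bound (l + 1) T \<Lambda> (E.cr (\<phi>e \<epsilon>))" "E.Y_bound l T \<Lambda> (ae \<epsilon>)"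
          unfolding \<Lambda>_def by (rule E.uniform_bound[OF Ge B0 ie odee assms(1,2) MK1]; assumption)+
        let ?u = "\<lambda>t x. E.cr (\<phi>e \<epsilon>) t x - E.cr \<phi> t x - ?c \<epsilon> * E.cr \<phi>1 t x" and ?v = "\<lambda>t x. ae \<epsilon> t x - a t x - ?c \<epsilon> * a1 t x"
        have nu: "E.analytic ?u" "E.analytic ?v" by (intro E.analytic_diff E.analytic_cmult ne n0)+
        have su: "square_integrable (\<lambda>x. ?c (\<phi>0e \<epsilon> x - \<phi>0 x - \<epsilon> * \<phi>10 x))"
          using sqi_diff[OF sqi_diff[OF sqe(1)] sqi_cmult, of "\<lambda>x. ?c (\<phi>0 x)" "\<lambda>x. ?c (\<phi>10 x)" "?c \<epsilon>"] sq7 by simp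
        have sv: "square_integrable (\<lambda>x. a0e \<epsilon> x - a0 x - ?c \<epsilon> * a10 x)"
          by (intro sqi_diff sqi_cmult sqe) (use sq7 in auto)
        have fu: "fourier (?u 0) = fourier (\<lambda>x. ?c (\<phi>0e \<epsilon> x - \<phi>0 x - \<epsilon> * \<phi>10 x))"
          by (rule E.Hnorm_initial[OF nu(1) su]) (use AEe(1) AE0(1) AE1(1) in \<open>eventually_elim, simp\<close>)
        have fv: "fourier (?v 0) = fourier (\<lambda>x. a0e \<epsilon> x - a0 x - ?c \<epsilon> * a10 x)"
          by (rule E.Hnorm_initial[OF nu(2) sv]) (use AEe(2) AE0(2) AE1(2) in \<open>eventually_elim, simp\<close>)
        define H1 where "H1 = Hnorm w0 (l + 1) (\<lambda>x. ?c (\<phi>0e \<epsilon> x - \<phi>0 x - \<epsilon> * \<phi>10 x))"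
        define H2 where "H2 = Hnorm w0 l (\<lambda>x. a0e \<epsilon> x - a0 x - ?c \<epsilon> * a10 x)"
        have H1e: "H1 = ennsqrt (Hnorm_sq w0 (l + 1) (?u 0))" and H2e: "H2 = ennsqrt (Hnorm_sq w0 l (?v 0))"
          unfolding H1_def H2_def Hnorm_def Hnorm_sq_def fu fv by simp_all
        obtain Au where Au: "E.Y_bound (l + 1) T Au ?u"
          using E.Y_bound_add[OF TT E.Y_bound_add[OF TT bte(1) E.Y_bound_cmult[OF TT bt0(1), of "-1"]] E.Y_bound_cmult[OF TT C1(1), of "- ?c \<epsilon>"]] by auto
        obtain Av where Av: "E.Y_bound l T Av ?v"
          using E.Y_bound_add[OF TT E.Y_bound_add[OF TT bte(2) E.Y_bound_cmult[OF TT bt0(2), of "-1"]] E.Y_bound_cmult[OF TT C1(2), of "- ?c \<epsilon>"]] by auto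
        have "H1 \<le> ennreal Au" "H2 \<le> ennreal Av"
          unfolding H1e H2e
          using E.Y_boundD(2)[OF Au] E.Y_boundD(3)[OF Au ZZ] E.Y_boundD(2)[OF Av] E.Y_boundD(3)[OF Av ZZ] unfolding w0E by (blast intro: ennsqrt_le)+
        \<comment> \<open>\<open>r1\<close> is defined through \<open>enn2real\<close>, which would
          send an infinite norm to 0; finiteness therefore has to be known before \<open>r1\<close>
          can bound the data.\<close>
        then have fin: "H1 + H2 < \<top>" by (auto simp: le_less_trans[OF _ ennreal_less_top])
        have r1e: "ennreal (r1 \<epsilon>) = H1 + H2" unfolding r1_eq H1_def[symmetric] H2_def[symmetric] using fin by simp
        have r10: "r1 \<epsilon> \<ge> 0" by (simp add: r1_eq)
        have iu: "Hnorm_sq w0 (l + 1) (?u 0) \<le> ennreal ((r1 \<epsilon>)\<^sup>2)"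
          by (rule ennsqrt_leD[OF _ r10]) (simp add: H1e[symmetric] r1e)
        have iv: "Hnorm_sq w0 l (?v 0) \<le> ennreal ((r1 \<epsilon>)\<^sup>2)"
          by (rule ennsqrt_leD[OF _ r10]) (simp add: H2e[symmetric] r1e)
        have ee: "\<epsilon> \<ge> 0" "\<epsilon> \<le> 1" using e by auto
        have res: "E.Y_bound (l + 1) T (C * (r1 \<epsilon> + \<epsilon>\<^sup>2)) ?u" "E.Y_bound l T (C * (r1 \<epsilon> + \<epsilon>\<^sup>2)) ?v"
          by (rule E.second_order_bound[OF bte bt0 L1 C1 odee ode0(1) o0 ode1 C0 C2 r10 iu iv assms(1,2) ee MK C_def]; assumption)+
        show ?thesis using r10 ne res by blast
      qed
      have first: "triple_norm E.w M (l + 1) T (\<lambda>t x. ?c (\<phi>e \<epsilon> t x - \<phi> t x - \<epsilon> * \<phi>1 t x))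
          + triple_norm E.w M l T (\<lambda>t x. ae \<epsilon> t x - a t x - ?c \<epsilon> * a1 t x) \<le> ennreal (2 * C * (r1 \<epsilon> + \<epsilon>\<^sup>2))" if e: "\<epsilon> \<in> {0<..1}" for \<epsilon>
      proof -
        let ?X = "C * (r1 \<epsilon> + \<epsilon>\<^sup>2)"
        have X: "?X \<ge> 0" using main[OF e] C132 by simp
        have "triple_norm E.w M (l + 1) T (\<lambda>t x. ?c (\<phi>e \<epsilon> t x - \<phi> t x - \<epsilon> * \<phi>1 t x)) \<le> ennreal ?X"
          using E.triple_le[of "l + 1" ?X "\<lambda>t x. E.cr (\<phi>e \<epsilon>) t x - E.cr \<phi> t x - ?c \<epsilon> * E.cr \<phi>1 t x"] main[OF e] by (simp add: E.cr_def)
        moreover have "triple_norm E.w M l T (\<lambda>t x. ae \<epsilon> t x - a t x - ?c \<epsilon> * a1 t x) \<le> ennreal ?X"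
          using E.triple_le main[OF e] by blast
        ultimately have "triple_norm E.w M (l + 1) T (\<lambda>t x. ?c (\<phi>e \<epsilon> t x - \<phi> t x - \<epsilon> * \<phi>1 t x))
          + triple_norm E.w M l T (\<lambda>t x. ae \<epsilon> t x - a t x - ?c \<epsilon> * a1 t x) \<le> ennreal ?X + ennreal ?X" by (rule add_mono)
        also have "\<dots> = ennreal (2 * C * (r1 \<epsilon> + \<epsilon>\<^sup>2))" using X by (subst ennreal_plus[symmetric]) auto
        finally show ?thesis .
      qed
      define err where "err \<epsilon> = Linf_L2_Linf_norm T (\<lambda>t x. ae \<epsilon> t x * exp (\<i> * ?c (\<phi>e \<epsilon> t x / \<epsilon>))
              - a t x * exp (\<i> * ?c (\<phi>1 t x)) * exp (\<i> * ?c (\<phi> t x / \<epsilon>)))" for \<epsilon>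
      define K where "K = (2 + sqrt (japanese_int l)) * (2 + 2 * C1) + 2 * sqrt (japanese_int l) * \<Lambda> + japanese_int l * \<Lambda>"
      have K4: "K \<ge> 4"
      proof -
        have "2 * 2 \<le> (2 + sqrt (japanese_int l)) * (2 + 2 * C1)" using Cn by (intro mult_mono) auto
        moreover have "0 \<le> sqrt (japanese_int l) * \<Lambda>" "0 \<le> japanese_int l * \<Lambda>" using L1 by auto
        ultimately show ?thesis unfolding K_def by linarith
      qed
      have errb: "err \<epsilon> \<le> ennreal (K * (C + 1) * (r1 \<epsilon> / \<epsilon> + \<epsilon>))" if e: "\<epsilon> \<in> {0<..1}" for \<epsilon>
      proof -
        have "err \<epsilon> \<le> ennreal (K * (C * (r1 \<epsilon> + \<epsilon>\<^sup>2) / \<epsilon> + \<epsilon>))"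
          unfolding err_def by (rule E.wkb_bound[OF _ _ bt0(2) C1(2) _ n0(1,3) _ _ _ K_def]) (use main[OF e] e in auto)
        also have "\<dots> \<le> ennreal (K * (C + 1) * (r1 \<epsilon> / \<epsilon> + \<epsilon>))"
        proof (rule ennreal_leI)
          have q: "0 \<le> r1 \<epsilon> / \<epsilon>" using main[OF e] e by simp
          have "C * (r1 \<epsilon> + \<epsilon>\<^sup>2) / \<epsilon> = C * (r1 \<epsilon> / \<epsilon> + \<epsilon>)" using e by (simp add: power2_eq_square field_simps)
          also have "\<dots> + \<epsilon> \<le> (C + 1) * (r1 \<epsilon> / \<epsilon> + \<epsilon>)" unfolding distrib_right[of C 1] mult_1 by (rule add_left_mono) (use q in simp)
          finally show "K * (C * (r1 \<epsilon> + \<epsilon>\<^sup>2) / \<epsilon> + \<epsilon>) \<le> K * (C + 1) * (r1 \<epsilon> / \<epsilon> + \<epsilon>)"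
            using K4 by (simp add: mult.assoc mult_left_mono)
        qed
        finally show ?thesis .
      qed
      have ev: "\<forall>\<^sub>F \<epsilon> in at_right 0. err \<epsilon> \<le> ennreal (K * (C + 1) * (r1 \<epsilon> / \<epsilon> + \<epsilon>))"
        by (rule eventually_at_rightI[of 0 1]) (auto intro: errb)
      \<comment> \<open>Here the assumption that \<open>r1\<close> is of smaller order than
        \<epsilon> enters: the division by \<epsilon> in the phase still leaves a quantity tending
        to 0.\<close>
      have "((\<lambda>\<epsilon>. r1 \<epsilon> / \<epsilon>) \<longlongrightarrow> 0) (at_right 0)" using assms(14) by (rule smalloD_tendsto)
      then have "((\<lambda>\<epsilon>. ennreal (K * (C + 1) * (r1 \<epsilon> / \<epsilon> + \<epsilon>))) \<longlongrightarrow> ennreal (K * (C + 1) * (0 + 0))) (at_right 0)"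
        by (intro tendsto_intros)
      then have "((\<lambda>\<epsilon>. ennreal (K * (C + 1) * (r1 \<epsilon> / \<epsilon> + \<epsilon>))) \<longlongrightarrow> 0) (at_right 0)" by simp
      from tendsto_sandwich[OF _ ev tendsto_const this] have lim: "(err \<longlongrightarrow> 0) (at_right 0)" by simp
      have p1: "\<exists>C>0. \<forall>\<epsilon>\<in>{0<..1}. triple_norm E.w M (l + 1) T (\<lambda>t x. ?c (\<phi>e \<epsilon> t x - \<phi> t x - \<epsilon> * \<phi>1 t x))
          + triple_norm E.w M l T (\<lambda>t x. ae \<epsilon> t x - a t x - ?c \<epsilon> * a1 t x) \<le> ennreal (C * (r1 \<epsilon> + \<epsilon>\<^sup>2))"
        using first C132 by (intro exI[of _ "2 * C"]) auto
      have p2: "\<exists>C>0. \<forall>\<^sub>F \<epsilon> in at_right 0. err \<epsilon> \<le> ennreal (C * (r1 \<epsilon> / \<epsilon> + \<epsilon>))"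
        using ev K4 C132 by (intro exI[of _ "K * (C + 1)"]) auto
      show "(\<exists>C>0. \<forall>\<epsilon>\<in>{0<..1}. triple_norm E.w M (l + 1) T (\<lambda>t x. ?c (\<phi>e \<epsilon> t x - \<phi> t x - \<epsilon> * \<phi>1 t x))
          + triple_norm E.w M l T (\<lambda>t x. ae \<epsilon> t x - a t x - ?c \<epsilon> * a1 t x) \<le> ennreal (C * (r1 \<epsilon> + \<epsilon>\<^sup>2))) \<and>
        (\<exists>C>0. \<forall>\<^sub>F \<epsilon> in at_right 0. Linf_L2_Linf_norm T (\<lambda>t x. ae \<epsilon> t x * exp (\<i> * ?c (\<phi>e \<epsilon> t x / \<epsilon>))
              - a t x * exp (\<i> * ?c (\<phi>1 t x)) * exp (\<i> * ?c (\<phi> t x / \<epsilon>))) \<le> ennreal (C * (r1 \<epsilon> / \<epsilon> + \<epsilon>))) \<and>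
        ((\<lambda>\<epsilon>. Linf_L2_Linf_norm T (\<lambda>t x. ae \<epsilon> t x * exp (\<i> * ?c (\<phi>e \<epsilon> t x / \<epsilon>))
              - a t x * exp (\<i> * ?c (\<phi>1 t x)) * exp (\<i> * ?c (\<phi> t x / \<epsilon>)))) \<longlongrightarrow> 0) (at_right 0)"
        using p1 p2 lim unfolding err_def[abs_def] by blast
    qed
  qed
qed

end
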